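(* Let $k$ be a perfect field of characteristic $p>0$, and let $f:X\to B$ be a proper morphism with $\mathcal{O}_B=f_*(\mathcal{O}_X)$ between integral normal $k$-schemes of finite type. Let $\eta\in B$ be the generic point, let $X_\eta$ be the generic fiber (a scheme over the function field $\kappa(\eta)=\mathcal{O}_{B,\eta}$), and suppose $\dim(B)>0$. Then the geometric generic embedding dimension of $X_\eta$ is strictly smaller than $\dim(B)$.
   Context: The embedding dimension $\operatorname{edim}(R)$ of a local Noetherian ring $R$ is the smallest number of generators of its maximal ideal. For an integral proper scheme $Y$ over a field $K$ of characteristic $p>0$ with $K=H^0(Y,\mathcal{O}_Y)$ and function field $F$, the geometric generic embedding dimension of $Y$ is $\operatorname{edim}(F\otimes_K K^{1/p})$, where $F\otimes_K K^{1/p}$ is a local Artin ring. Here this is applied with $K=\kappa(\eta)$ and $Y=X_\eta$. *)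

theory Defs
  imports "HOL-Algebra.Algebra" "HOL-Analysis.Abstract_Topology" "HOL-Library.Extended_Nat"
    "HOL-Library.Poly_Mapping"
begin

no_notation var (\<open>X\<index>\<close>)  \<comment> \<open>so that \<open>X\<close> can be used as a variable\<close>

section \<open>Commutative algebra\<close>

definition local_ring :: "'r ring \<Rightarrow> bool" where
  "local_ring R \<longleftrightarrow> cring R \<and> (\<exists>!M. maximalideal M R)"

definition max_ideal :: "'r ring \<Rightarrow> 'r set" where
  "max_ideal R = (THE M. maximalideal M R)"

text \<open>
  The value is \<open>\<infinity>\<close> if the maximal ideal is not finitely generated.
\<close>
definition edim :: "'r ring \<Rightarrow> enat" where
  "edim R = (INF S \<in> {S. S \<subseteq> carrier R \<and> finite S \<and> Idl\<^bsub>R\<^esub> S = max_ideal R}. enat (card S))"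

text \<open>
  Fractions are equivalence classes of pairs (numerator, denominator). In what follows \<open>S\<close> is
  always multiplicatively closed and contains \<open>\<one>\<close>.
\<close>
definition fraction :: "'r ring \<Rightarrow> 'r set \<Rightarrow> 'r \<Rightarrow> 'r \<Rightarrow> ('r \<times> 'r) set" where
  "fraction R S a s = {(b, t). b \<in> carrier R \<and> t \<in> S \<and>
     (\<exists>u\<in>S. u \<otimes>\<^bsub>R\<^esub> (t \<otimes>\<^bsub>R\<^esub> a \<ominus>\<^bsub>R\<^esub> s \<otimes>\<^bsub>R\<^esub> b) = \<zero>\<^bsub>R\<^esub>)}"

definition localization :: "'r ring \<Rightarrow> 'r set \<Rightarrow> ('r \<times> 'r) set ring" where
  "localization R S = \<lparr>
     carrier = {fraction R S a s | a s. a \<in> carrier R \<and> s \<in> S},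
     monoid.mult = (\<lambda>x y. THE z. \<exists>a s b t. (a, s) \<in> x \<and> (b, t) \<in> y \<and>
        z = fraction R S (a \<otimes>\<^bsub>R\<^esub> b) (s \<otimes>\<^bsub>R\<^esub> t)),
     monoid.one = fraction R S \<one>\<^bsub>R\<^esub> \<one>\<^bsub>R\<^esub>,
     ring.zero = fraction R S \<zero>\<^bsub>R\<^esub> \<one>\<^bsub>R\<^esub>,
     ring.add = (\<lambda>x y. THE z. \<exists>a s b t. (a, s) \<in> x \<and> (b, t) \<in> y \<and>
        z = fraction R S (t \<otimes>\<^bsub>R\<^esub> a \<oplus>\<^bsub>R\<^esub> s \<otimes>\<^bsub>R\<^esub> b) (s \<otimes>\<^bsub>R\<^esub> t))\<rparr>"

definition fraction_field :: "'r ring \<Rightarrow> ('r \<times> 'r) set ring" where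
  "fraction_field R = localization R (carrier R - {\<zero>\<^bsub>R\<^esub>})"

definition to_fraction_field :: "'r ring \<Rightarrow> 'r \<Rightarrow> ('r \<times> 'r) set" where
  "to_fraction_field R a = fraction R (carrier R - {\<zero>\<^bsub>R\<^esub>}) a \<one>\<^bsub>R\<^esub>"

definition normal_domain :: "'r ring \<Rightarrow> bool" where
  "normal_domain R \<longleftrightarrow> domain R \<and>
     (\<forall>z \<in> carrier (fraction_field R).
        (\<exists>n::nat. \<exists>c \<in> {..<n} \<rightarrow> carrier R.
           z [^]\<^bsub>fraction_field R\<^esub> n \<oplus>\<^bsub>fraction_field R\<^esub>
             (\<Oplus>\<^bsub>fraction_field R\<^esub> i\<in>{..<n}.
                to_fraction_field R (c i) \<otimes>\<^bsub>fraction_field R\<^esub> z [^]\<^bsub>fraction_field R\<^esub> i)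
           = \<zero>\<^bsub>fraction_field R\<^esub>)
        \<longrightarrow> z \<in> to_fraction_field R ` carrier R)"

definition finitely_generated_algebra :: "'r ring \<Rightarrow> 's ring \<Rightarrow> ('r \<Rightarrow> 's) \<Rightarrow> bool" where
  "finitely_generated_algebra R A h \<longleftrightarrow>
     (\<exists>S. finite S \<and> S \<subseteq> carrier A \<and> generate_ring A (h ` carrier R \<union> S) = carrier A)"

text \<open>
  The tensor product \<open>A \<otimes>\<^bsub>C\<^esub> B\<close> of the \<open>C\<close>-algebras \<open>\<phi>: C \<rightarrow> A\<close> and \<open>\<psi>: C \<rightarrow> B\<close> is the free abelian
  group on \<open>A \<times> B\<close>, multiplied by \<open>(a, b)(a', b') = (aa', bb')\<close>, modulo the bilinear and
  \<open>C\<close>-balanced relations.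
\<close>
definition free_product_ring :: "'a ring \<Rightarrow> 'b ring \<Rightarrow> ('a \<times> 'b \<Rightarrow>\<^sub>0 int) ring" where
  "free_product_ring A B = \<lparr>
     carrier = {t. Poly_Mapping.keys t \<subseteq> carrier A \<times> carrier B},
     monoid.mult = (\<lambda>s t. frag_extend (\<lambda>(a, b).
        frag_extend (\<lambda>(a', b'). frag_of (a \<otimes>\<^bsub>A\<^esub> a', b \<otimes>\<^bsub>B\<^esub> b')) t) s),
     monoid.one = frag_of (\<one>\<^bsub>A\<^esub>, \<one>\<^bsub>B\<^esub>),
     ring.zero = 0,
     ring.add = (+)\<rparr>"

definition tensor_relations ::
  "'c ring \<Rightarrow> 'a ring \<Rightarrow> ('c \<Rightarrow> 'a) \<Rightarrow> 'b ring \<Rightarrow> ('c \<Rightarrow> 'b) \<Rightarrow> ('a \<times> 'b \<Rightarrow>\<^sub>0 int) set" where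
  "tensor_relations C A \<phi> B \<psi> =
     {frag_of (a \<oplus>\<^bsub>A\<^esub> a', b) - frag_of (a, b) - frag_of (a', b) | a a' b.
        a \<in> carrier A \<and> a' \<in> carrier A \<and> b \<in> carrier B} \<union>
     {frag_of (a, b \<oplus>\<^bsub>B\<^esub> b') - frag_of (a, b) - frag_of (a, b') | a b b'.
        a \<in> carrier A \<and> b \<in> carrier B \<and> b' \<in> carrier B} \<union>
     {frag_of (\<phi> c \<otimes>\<^bsub>A\<^esub> a, b) - frag_of (a, \<psi> c \<otimes>\<^bsub>B\<^esub> b) | c a b.
        c \<in> carrier C \<and> a \<in> carrier A \<and> b \<in> carrier B}"

definition tensor_class ::
  "'c ring \<Rightarrow> 'a ring \<Rightarrow> ('c \<Rightarrow> 'a) \<Rightarrow> 'b ring \<Rightarrow> ('c \<Rightarrow> 'b) \<Rightarrow>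
   ('a \<times> 'b \<Rightarrow>\<^sub>0 int) \<Rightarrow> ('a \<times> 'b \<Rightarrow>\<^sub>0 int) set" where
  "tensor_class C A \<phi> B \<psi> t =
     (Idl\<^bsub>free_product_ring A B\<^esub> (tensor_relations C A \<phi> B \<psi>)) +>\<^bsub>free_product_ring A B\<^esub> t"

definition tensor_ring ::
  "'c ring \<Rightarrow> 'a ring \<Rightarrow> ('c \<Rightarrow> 'a) \<Rightarrow> 'b ring \<Rightarrow> ('c \<Rightarrow> 'b) \<Rightarrow> ('a \<times> 'b \<Rightarrow>\<^sub>0 int) set ring" where
  "tensor_ring C A \<phi> B \<psi> =
     free_product_ring A B Quot (Idl\<^bsub>free_product_ring A B\<^esub> (tensor_relations C A \<phi> B \<psi>))"

text \<open>
  \<open>K\<^sup>1\<^sup>/\<^sup>p\<close> inside the algebraic closure of \<open>K\<close>; the embedding of \<open>K\<close> is \<open>ring.indexed_const K\<close>.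
\<close>
definition p_root_field ::
  "nat \<Rightarrow> 'r ring \<Rightarrow> (('r list \<times> nat) multiset \<Rightarrow> 'r) ring" where
  "p_root_field p K = (field.alg_closure K)
     \<lparr>carrier := {x \<in> carrier (field.alg_closure K).
        x [^]\<^bsub>field.alg_closure K\<^esub> p \<in> ring.indexed_const K ` carrier K}\<rparr>"

section \<open>Topology\<close>

definition irreducible_closed :: "'p topology \<Rightarrow> 'p set \<Rightarrow> bool" where
  "irreducible_closed T Z \<longleftrightarrow> closedin T Z \<and> Z \<noteq> {} \<and>
     (\<forall>Z1 Z2. closedin T Z1 \<and> closedin T Z2 \<and> Z \<subseteq> Z1 \<union> Z2 \<longrightarrow> Z \<subseteq> Z1 \<or> Z \<subseteq> Z2)"

definition krull_dim :: "'p topology \<Rightarrow> enat" where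
  "krull_dim T = (SUP n \<in> {n. \<exists>Z. (\<forall>i\<le>n. irreducible_closed T (Z i)) \<and>
     (\<forall>i<n. Z i \<subset> Z (Suc i))}. enat n)"

definition is_generic_point :: "'p topology \<Rightarrow> 'p \<Rightarrow> bool" where
  "is_generic_point T x \<longleftrightarrow> x \<in> topspace T \<and> T closure_of {x} = topspace T"

section \<open>Locally ringed spaces\<close>

record ('p, 'r) ringed_space =
  space_top :: "'p topology"
  sections :: "'p set \<Rightarrow> 'r ring"
  restr :: "'p set \<Rightarrow> 'p set \<Rightarrow> 'r \<Rightarrow> 'r"

abbreviation points :: "('p, 'r) ringed_space \<Rightarrow> 'p set" where
  "points X \<equiv> topspace (space_top X)"

abbreviation is_open :: "('p, 'r) ringed_space \<Rightarrow> 'p set \<Rightarrow> bool" where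
  "is_open X U \<equiv> openin (space_top X) U"

text \<open>
  The map \<open>restr X U V\<close> goes from the sections over \<open>U\<close> to those over \<open>V \<subseteq> U\<close>.
\<close>
definition is_ringed_space :: "('p, 'r) ringed_space \<Rightarrow> bool" where
  "is_ringed_space X \<longleftrightarrow>
     (\<forall>U. is_open X U \<longrightarrow> cring (sections X U)) \<and>
     (\<forall>U V. is_open X U \<and> is_open X V \<and> V \<subseteq> U \<longrightarrow>
        restr X U V \<in> ring_hom (sections X U) (sections X V)) \<and>
     (\<forall>U. is_open X U \<longrightarrow> (\<forall>s \<in> carrier (sections X U). restr X U U s = s)) \<and>
     (\<forall>U V W. is_open X U \<and> is_open X V \<and> is_open X W \<and> W \<subseteq> V \<and> V \<subseteq> U \<longrightarrow>
        (\<forall>s \<in> carrier (sections X U). restr X V W (restr X U V s) = restr X U W s)) \<and>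
     (\<forall>\<U>. (\<forall>V\<in>\<U>. is_open X V) \<longrightarrow>
        (\<forall>\<sigma>. (\<forall>V\<in>\<U>. \<sigma> V \<in> carrier (sections X V)) \<and>
              (\<forall>V\<in>\<U>. \<forall>W\<in>\<U>. restr X V (V \<inter> W) (\<sigma> V) = restr X W (V \<inter> W) (\<sigma> W)) \<longrightarrow>
           (\<exists>!s. s \<in> carrier (sections X (\<Union>\<U>)) \<and> (\<forall>V\<in>\<U>. restr X (\<Union>\<U>) V s = \<sigma> V))))"

definition germ :: "('p, 'r) ringed_space \<Rightarrow> 'p \<Rightarrow> 'p set \<Rightarrow> 'r \<Rightarrow> ('p set \<times> 'r) set" where
  "germ X x U s = {(V, t). is_open X V \<and> x \<in> V \<and> t \<in> carrier (sections X V) \<and>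
     (\<exists>W. is_open X W \<and> x \<in> W \<and> W \<subseteq> U \<inter> V \<and> restr X U W s = restr X V W t)}"

definition stalk :: "('p, 'r) ringed_space \<Rightarrow> 'p \<Rightarrow> ('p set \<times> 'r) set ring" where
  "stalk X x = \<lparr>
     carrier = {germ X x U s | U s. is_open X U \<and> x \<in> U \<and> s \<in> carrier (sections X U)},
     monoid.mult = (\<lambda>a b. THE c. \<exists>U s t. (U, s) \<in> a \<and> (U, t) \<in> b \<and>
        c = germ X x U (s \<otimes>\<^bsub>sections X U\<^esub> t)),
     monoid.one = germ X x (points X) \<one>\<^bsub>sections X (points X)\<^esub>,
     ring.zero = germ X x (points X) \<zero>\<^bsub>sections X (points X)\<^esub>,
     ring.add = (\<lambda>a b. THE c. \<exists>U s t. (U, s) \<in> a \<and> (U, t) \<in> b \<and>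
        c = germ X x U (s \<oplus>\<^bsub>sections X U\<^esub> t))\<rparr>"

definition locally_ringed_space :: "('p, 'r) ringed_space \<Rightarrow> bool" where
  "locally_ringed_space X \<longleftrightarrow> is_ringed_space X \<and> (\<forall>x \<in> points X. local_ring (stalk X x))"

definition open_subspace :: "('p, 'r) ringed_space \<Rightarrow> 'p set \<Rightarrow> ('p, 'r) ringed_space" where
  "open_subspace X U = X\<lparr>space_top := subtopology (space_top X) U\<rparr>"

text \<open>
  A morphism \<open>X \<rightarrow> Y\<close>, where \<open>X\<close> has points in \<open>'p\<close> and sections in \<open>'r\<close>, and \<open>Y\<close> has points in
  \<open>'q\<close> and sections in \<open>'s\<close>. The map \<open>sec_map f V\<close> goes from the sections of \<open>Y\<close> over \<open>V\<close> to the
  sections of \<open>X\<close> over the preimage of \<open>V\<close>.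
\<close>
record ('p, 'r, 'q, 's) lrs_map =
  pt_map :: "'p \<Rightarrow> 'q"
  sec_map :: "'q set \<Rightarrow> 's \<Rightarrow> 'r"

definition preimage ::
  "('p, 'r) ringed_space \<Rightarrow> ('p, 'r, 'q, 's) lrs_map \<Rightarrow> 'q set \<Rightarrow> 'p set" where
  "preimage X f V = {x \<in> points X. pt_map f x \<in> V}"

definition stalk_map ::
  "('p, 'r) ringed_space \<Rightarrow> ('q, 's) ringed_space \<Rightarrow> ('p, 'r, 'q, 's) lrs_map \<Rightarrow> 'p \<Rightarrow>
   ('q set \<times> 's) set \<Rightarrow> ('p set \<times> 'r) set" where
  "stalk_map X Y f x a =
     (THE b. \<exists>V s. (V, s) \<in> a \<and> b = germ X x (preimage X f V) (sec_map f V s))"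

definition is_morphism ::
  "('p, 'r) ringed_space \<Rightarrow> ('q, 's) ringed_space \<Rightarrow> ('p, 'r, 'q, 's) lrs_map \<Rightarrow> bool" where
  "is_morphism X Y f \<longleftrightarrow>
     locally_ringed_space X \<and> locally_ringed_space Y \<and>
     continuous_map (space_top X) (space_top Y) (pt_map f) \<and>
     (\<forall>V. is_open Y V \<longrightarrow>
        sec_map f V \<in> ring_hom (sections Y V) (sections X (preimage X f V))) \<and>
     (\<forall>V W. is_open Y V \<and> is_open Y W \<and> W \<subseteq> V \<longrightarrow> (\<forall>s \<in> carrier (sections Y V).
        sec_map f W (restr Y V W s) =
          restr X (preimage X f V) (preimage X f W) (sec_map f V s))) \<and>
     (\<forall>x \<in> points X.
        stalk_map X Y f x ` max_ideal (stalk Y (pt_map f x)) \<subseteq> max_ideal (stalk X x))"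

definition mor_eq ::
  "('p, 'r) ringed_space \<Rightarrow> ('q, 's) ringed_space \<Rightarrow>
   ('p, 'r, 'q, 's) lrs_map \<Rightarrow> ('p, 'r, 'q, 's) lrs_map \<Rightarrow> bool" where
  "mor_eq X Y f g \<longleftrightarrow> (\<forall>x \<in> points X. pt_map f x = pt_map g x) \<and>
     (\<forall>V. is_open Y V \<longrightarrow> (\<forall>s \<in> carrier (sections Y V). sec_map f V s = sec_map g V s))"

definition id_mor :: "('p, 'r, 'p, 'r) lrs_map" where
  "id_mor = \<lparr>pt_map = (\<lambda>x. x), sec_map = (\<lambda>V s. s)\<rparr>"

text \<open>
  \<open>comp_mor Y g f\<close> is \<open>g \<circ> f\<close> for \<open>f: X \<rightarrow> Y\<close> and \<open>g: Y \<rightarrow> Z\<close>.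
\<close>
definition comp_mor ::
  "('q, 's) ringed_space \<Rightarrow> ('q, 's, 'z, 't) lrs_map \<Rightarrow> ('p, 'r, 'q, 's) lrs_map \<Rightarrow>
   ('p, 'r, 'z, 't) lrs_map" where
  "comp_mor Y g f = \<lparr>pt_map = (\<lambda>x. pt_map g (pt_map f x)),
     sec_map = (\<lambda>W s. sec_map f (preimage Y g W) (sec_map g W s))\<rparr>"

definition isomorphic ::
  "('p, 'r) ringed_space \<Rightarrow> ('q, 's) ringed_space \<Rightarrow> bool" where
  "isomorphic X Y \<longleftrightarrow> (\<exists>f g. is_morphism X Y f \<and> is_morphism Y X g \<and>
     mor_eq X X (comp_mor Y g f) id_mor \<and> mor_eq Y Y (comp_mor X f g) id_mor)"

text \<open>
  The ringed space whose sections are the functions with values in the rings \<open>R x\<close> that are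
  locally of a prescribed form: \<open>adm V s\<close> says that \<open>s\<close> has this form on \<open>V\<close>.
\<close>
definition function_space ::
  "'p topology \<Rightarrow> ('p \<Rightarrow> 'r ring) \<Rightarrow> ('p set \<Rightarrow> ('p \<Rightarrow> 'r) \<Rightarrow> bool) \<Rightarrow>
   ('p, 'p \<Rightarrow> 'r) ringed_space" where
  "function_space T R adm = \<lparr>
     space_top = T,
     sections = (\<lambda>U. \<lparr>
        carrier = {s \<in> (\<Pi>\<^sub>E x\<in>U. carrier (R x)).
           \<forall>x\<in>U. \<exists>V. openin T V \<and> x \<in> V \<and> V \<subseteq> U \<and> adm V s},
        monoid.mult = (\<lambda>s t. \<lambda>x\<in>U. s x \<otimes>\<^bsub>R x\<^esub> t x),
        monoid.one = (\<lambda>x\<in>U. \<one>\<^bsub>R x\<^esub>),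
        ring.zero = (\<lambda>x\<in>U. \<zero>\<^bsub>R x\<^esub>),
        ring.add = (\<lambda>s t. \<lambda>x\<in>U. s x \<oplus>\<^bsub>R x\<^esub> t x)\<rparr>),
     restr = (\<lambda>U V s. restrict s V)\<rparr>"

section \<open>Schemes\<close>

definition zariski_topology :: "'r ring \<Rightarrow> 'r set topology" where
  "zariski_topology R =
     topology (\<lambda>U. \<exists>E \<subseteq> carrier R. U = {P. primeideal P R \<and> \<not> E \<subseteq> P})"

type_synonym 'r spec_section = "'r set \<Rightarrow> ('r \<times> 'r) set"

definition Spec :: "'r ring \<Rightarrow> ('r set, 'r spec_section) ringed_space" where
  "Spec R = function_space (zariski_topology R) (\<lambda>P. localization R (carrier R - P))
     (\<lambda>V s. \<exists>a \<in> carrier R. \<exists>b \<in> carrier R.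
        \<forall>P\<in>V. b \<notin> P \<and> s P = fraction R (carrier R - P) a b)"

definition const_section :: "'r ring \<Rightarrow> 'r \<Rightarrow> 'r spec_section" where
  "const_section R a = (\<lambda>P \<in> points (Spec R). fraction R (carrier R - P) a \<one>\<^bsub>R\<^esub>)"

text \<open>
  Taking \<open>R\<close> of the type of the sections of \<open>X\<close> is no restriction: if the open subspace \<open>U\<close> is
  isomorphic to the spectrum of some ring, then that ring is isomorphic to \<open>sections X U\<close>.
\<close>
definition affine_open :: "('p, 'r) ringed_space \<Rightarrow> 'p set \<Rightarrow> bool" where
  "affine_open X U \<longleftrightarrow> is_open X U \<and>
     (\<exists>R :: 'r ring. cring R \<and> isomorphic (open_subspace X U) (Spec R))"

definition is_scheme :: "('p, 'r) ringed_space \<Rightarrow> bool" where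
  "is_scheme X \<longleftrightarrow> locally_ringed_space X \<and> (\<forall>x \<in> points X. \<exists>U. x \<in> U \<and> affine_open X U)"

definition integral_scheme :: "('p, 'r) ringed_space \<Rightarrow> bool" where
  "integral_scheme X \<longleftrightarrow> is_scheme X \<and> points X \<noteq> {} \<and>
     (\<forall>U. is_open X U \<and> U \<noteq> {} \<longrightarrow> domain (sections X U))"

definition normal_scheme :: "('p, 'r) ringed_space \<Rightarrow> bool" where
  "normal_scheme X \<longleftrightarrow> is_scheme X \<and> (\<forall>x \<in> points X. normal_domain (stalk X x))"

definition generic_pt :: "('p, 'r) ringed_space \<Rightarrow> 'p" where
  "generic_pt X = (THE x. is_generic_point (space_top X) x)"

section \<open>Fibre products\<close>

text \<open>
  The fibre product of locally ringed spaces over \<open>f: X \<rightarrow> Z\<close> and \<open>g: Y \<rightarrow> Z\<close> (W. D. Gillam,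
  Localization of ringed spaces), which for schemes is the fibre product of schemes. Its points
  are the triples \<open>(x, y, P)\<close> with \<open>f x = g y = z\<close> and \<open>P\<close> a prime ideal of the tensor product of
  the stalks at \<open>x\<close> and \<open>y\<close> over the stalk at \<open>z\<close> that lies over both maximal ideals. The stalk at
  \<open>(x, y, P)\<close> is the localization of this tensor product at \<open>P\<close>.
\<close>
definition fp_ring ::
  "('a, 'b) ringed_space \<Rightarrow> ('c, 'd) ringed_space \<Rightarrow> ('z, 't) ringed_space \<Rightarrow>
   ('a, 'b, 'z, 't) lrs_map \<Rightarrow> ('c, 'd, 'z, 't) lrs_map \<Rightarrow> 'a \<Rightarrow> 'c \<Rightarrow>
   (('a set \<times> 'b) set \<times> ('c set \<times> 'd) set \<Rightarrow>\<^sub>0 int) set ring" where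
  "fp_ring X Y Z f g x y =
     tensor_ring (stalk Z (pt_map f x)) (stalk X x) (stalk_map X Z f x)
       (stalk Y y) (stalk_map Y Z g y)"

definition fp_class ::
  "('a, 'b) ringed_space \<Rightarrow> ('c, 'd) ringed_space \<Rightarrow> ('z, 't) ringed_space \<Rightarrow>
   ('a, 'b, 'z, 't) lrs_map \<Rightarrow> ('c, 'd, 'z, 't) lrs_map \<Rightarrow> 'a \<Rightarrow> 'c \<Rightarrow>
   (('a set \<times> 'b) set \<times> ('c set \<times> 'd) set \<Rightarrow>\<^sub>0 int) \<Rightarrow>
   (('a set \<times> 'b) set \<times> ('c set \<times> 'd) set \<Rightarrow>\<^sub>0 int) set" where
  "fp_class X Y Z f g x y =
     tensor_class (stalk Z (pt_map f x)) (stalk X x) (stalk_map X Z f x)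
       (stalk Y y) (stalk_map Y Z g y)"

type_synonym ('a, 'b, 'c, 'd) fp_point =
  "'a \<times> 'c \<times> (('a set \<times> 'b) set \<times> ('c set \<times> 'd) set \<Rightarrow>\<^sub>0 int) set set"

type_synonym ('a, 'b, 'c, 'd) fp_section =
  "('a, 'b, 'c, 'd) fp_point \<Rightarrow>
   ((('a set \<times> 'b) set \<times> ('c set \<times> 'd) set \<Rightarrow>\<^sub>0 int) set \<times>
    (('a set \<times> 'b) set \<times> ('c set \<times> 'd) set \<Rightarrow>\<^sub>0 int) set) set"

definition fp_points ::
  "('a, 'b) ringed_space \<Rightarrow> ('c, 'd) ringed_space \<Rightarrow> ('z, 't) ringed_space \<Rightarrow>
   ('a, 'b, 'z, 't) lrs_map \<Rightarrow> ('c, 'd, 'z, 't) lrs_map \<Rightarrow> ('a, 'b, 'c, 'd) fp_point set" where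
  "fp_points X Y Z f g = {(x, y, P). x \<in> points X \<and> y \<in> points Y \<and> pt_map f x = pt_map g y \<and>
     primeideal P (fp_ring X Y Z f g x y) \<and>
     {a \<in> carrier (stalk X x). fp_class X Y Z f g x y (frag_of (a, \<one>\<^bsub>stalk Y y\<^esub>)) \<in> P}
       = max_ideal (stalk X x) \<and>
     {b \<in> carrier (stalk Y y). fp_class X Y Z f g x y (frag_of (\<one>\<^bsub>stalk X x\<^esub>, b)) \<in> P}
       = max_ideal (stalk Y y)}"

text \<open>
  For a formal sum \<open>t\<close> of pairs (section of \<open>X\<close> over \<open>U\<close>, section of \<open>Y\<close> over \<open>V\<close>), its class in
  the tensor product of the stalks at \<open>x \<in> U\<close> and \<open>y \<in> V\<close>.
\<close>
definition fp_germ ::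
  "('a, 'b) ringed_space \<Rightarrow> ('c, 'd) ringed_space \<Rightarrow> ('z, 't) ringed_space \<Rightarrow>
   ('a, 'b, 'z, 't) lrs_map \<Rightarrow> ('c, 'd, 'z, 't) lrs_map \<Rightarrow> 'a set \<Rightarrow> 'c set \<Rightarrow>
   ('b \<times> 'd \<Rightarrow>\<^sub>0 int) \<Rightarrow> 'a \<Rightarrow> 'c \<Rightarrow>
   (('a set \<times> 'b) set \<times> ('c set \<times> 'd) set \<Rightarrow>\<^sub>0 int) set" where
  "fp_germ X Y Z f g U V t x y = fp_class X Y Z f g x y
     (frag_extend (\<lambda>(u, v). frag_of (germ X x U u, germ Y y V v)) t)"

definition fp_topology ::
  "('a, 'b) ringed_space \<Rightarrow> ('c, 'd) ringed_space \<Rightarrow> ('z, 't) ringed_space \<Rightarrow>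
   ('a, 'b, 'z, 't) lrs_map \<Rightarrow> ('c, 'd, 'z, 't) lrs_map \<Rightarrow>
   ('a, 'b, 'c, 'd) fp_point topology" where
  "fp_topology X Y Z f g = topology_generated_by
     {{(x, y, P) \<in> fp_points X Y Z f g. x \<in> U \<and> y \<in> V \<and> fp_germ X Y Z f g U V t x y \<notin> P} | U V t.
        is_open X U \<and> is_open Y V \<and>
        t \<in> carrier (free_product_ring (sections X U) (sections Y V))}"

definition fibre_product ::
  "('a, 'b) ringed_space \<Rightarrow> ('c, 'd) ringed_space \<Rightarrow> ('z, 't) ringed_space \<Rightarrow>
   ('a, 'b, 'z, 't) lrs_map \<Rightarrow> ('c, 'd, 'z, 't) lrs_map \<Rightarrow>
   (('a, 'b, 'c, 'd) fp_point, ('a, 'b, 'c, 'd) fp_section) ringed_space" where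
  "fibre_product X Y Z f g = function_space (fp_topology X Y Z f g)
     (\<lambda>(x, y, P). localization (fp_ring X Y Z f g x y) (carrier (fp_ring X Y Z f g x y) - P))
     (\<lambda>W s. \<exists>U V a b. is_open X U \<and> is_open Y V \<and>
        a \<in> carrier (free_product_ring (sections X U) (sections Y V)) \<and>
        b \<in> carrier (free_product_ring (sections X U) (sections Y V)) \<and>
        (\<forall>(x, y, P) \<in> W. x \<in> U \<and> y \<in> V \<and> fp_germ X Y Z f g U V b x y \<notin> P \<and>
           s (x, y, P) = fraction (fp_ring X Y Z f g x y) (carrier (fp_ring X Y Z f g x y) - P)
             (fp_germ X Y Z f g U V a x y) (fp_germ X Y Z f g U V b x y)))"

definition fp_fst ::
  "('a, 'b) ringed_space \<Rightarrow> ('c, 'd) ringed_space \<Rightarrow> ('z, 't) ringed_space \<Rightarrow>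
   ('a, 'b, 'z, 't) lrs_map \<Rightarrow> ('c, 'd, 'z, 't) lrs_map \<Rightarrow>
   (('a, 'b, 'c, 'd) fp_point, ('a, 'b, 'c, 'd) fp_section, 'a, 'b) lrs_map" where
  "fp_fst X Y Z f g = \<lparr>
     pt_map = (\<lambda>(x, y, P). x),
     sec_map = (\<lambda>U s. \<lambda>(x, y, P) \<in> {(x, y, P) \<in> fp_points X Y Z f g. x \<in> U}.
        fraction (fp_ring X Y Z f g x y) (carrier (fp_ring X Y Z f g x y) - P)
          (fp_class X Y Z f g x y (frag_of (germ X x U s, \<one>\<^bsub>stalk Y y\<^esub>)))
          \<one>\<^bsub>fp_ring X Y Z f g x y\<^esub>)\<rparr>"

definition fp_snd ::
  "('a, 'b) ringed_space \<Rightarrow> ('c, 'd) ringed_space \<Rightarrow> ('z, 't) ringed_space \<Rightarrow>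
   ('a, 'b, 'z, 't) lrs_map \<Rightarrow> ('c, 'd, 'z, 't) lrs_map \<Rightarrow>
   (('a, 'b, 'c, 'd) fp_point, ('a, 'b, 'c, 'd) fp_section, 'c, 'd) lrs_map" where
  "fp_snd X Y Z f g = \<lparr>
     pt_map = (\<lambda>(x, y, P). y),
     sec_map = (\<lambda>V s. \<lambda>(x, y, P) \<in> {(x, y, P) \<in> fp_points X Y Z f g. y \<in> V}.
        fraction (fp_ring X Y Z f g x y) (carrier (fp_ring X Y Z f g x y) - P)
          (fp_class X Y Z f g x y (frag_of (\<one>\<^bsub>stalk X x\<^esub>, germ Y y V s)))
          \<one>\<^bsub>fp_ring X Y Z f g x y\<^esub>)\<rparr>"

section \<open>Proper morphisms\<close>

definition finite_type ::
  "('p, 'r) ringed_space \<Rightarrow> ('q, 's) ringed_space \<Rightarrow> ('p, 'r, 'q, 's) lrs_map \<Rightarrow> bool" where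
  "finite_type X Y f \<longleftrightarrow> is_morphism X Y f \<and>
     (\<forall>y \<in> points Y. \<exists>V. y \<in> V \<and> affine_open Y V \<and>
        (\<exists>\<U>. finite \<U> \<and> \<Union>\<U> = preimage X f V \<and>
           (\<forall>U\<in>\<U>. affine_open X U \<and>
              finitely_generated_algebra (sections Y V) (sections X U)
                (\<lambda>s. restr X (preimage X f V) U (sec_map f V s)))))"

definition closed_immersion ::
  "('p, 'r) ringed_space \<Rightarrow> ('q, 's) ringed_space \<Rightarrow> ('p, 'r, 'q, 's) lrs_map \<Rightarrow> bool" where
  "closed_immersion X Y i \<longleftrightarrow> is_morphism X Y i \<and>
     closedin (space_top Y) (pt_map i ` points X) \<and>
     embedding_map (space_top X) (space_top Y) (pt_map i) \<and>
     (\<forall>V s. is_open Y V \<and> s \<in> carrier (sections X (preimage X i V)) \<longrightarrow>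
        (\<forall>y\<in>V. \<exists>W t. is_open Y W \<and> y \<in> W \<and> W \<subseteq> V \<and> t \<in> carrier (sections Y W) \<and>
           sec_map i W t = restr X (preimage X i V) (preimage X i W) s))"

definition separated ::
  "('p, 'r) ringed_space \<Rightarrow> ('q, 's) ringed_space \<Rightarrow> ('p, 'r, 'q, 's) lrs_map \<Rightarrow> bool" where
  "separated X Y f \<longleftrightarrow> is_morphism X Y f \<and>
     (\<exists>\<Delta>. closed_immersion X (fibre_product X X Y f f) \<Delta> \<and>
        mor_eq X X (comp_mor (fibre_product X X Y f f) (fp_fst X X Y f f) \<Delta>) id_mor \<and>
        mor_eq X X (comp_mor (fibre_product X X Y f f) (fp_snd X X Y f f) \<Delta>) id_mor)"

text \<open>
  HOL cannot quantify over all types, so the base changes \<open>g: Y' \<rightarrow> Y\<close> range over all schemes \<open>Y'\<close>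
  of the type of \<open>Spec R\<close> for rings \<open>R\<close> with elements in \<open>'s list\<close>. For quasi-compact \<open>f\<close>, in
  particular in the definition of a proper morphism, this is no restriction: it suffices to test
  the affine spaces over the affine open subschemes of \<open>Y\<close> (Stacks Project, Tag 05JX), and
  a polynomial ring in finitely many variables over a ring with elements in \<open>'s\<close> can be realized
  on a subset of \<open>'s list\<close>.
\<close>
definition universally_closed ::
  "('p, 'r) ringed_space \<Rightarrow> ('q, 's) ringed_space \<Rightarrow> ('p, 'r, 'q, 's) lrs_map \<Rightarrow> bool" where
  "universally_closed X Y f \<longleftrightarrow> is_morphism X Y f \<and>
     (\<forall>(Y' :: ('s list set, 's list spec_section) ringed_space) g.
        is_scheme Y' \<and> is_morphism Y' Y g \<longrightarrow>
        closed_map (space_top (fibre_product X Y' Y f g)) (space_top Y')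
          (pt_map (fp_snd X Y' Y f g)))"

definition proper_morphism ::
  "('p, 'r) ringed_space \<Rightarrow> ('q, 's) ringed_space \<Rightarrow> ('p, 'r, 'q, 's) lrs_map \<Rightarrow> bool" where
  "proper_morphism X Y f \<longleftrightarrow> finite_type X Y f \<and> separated X Y f \<and> universally_closed X Y f"

section \<open>Generic fibres and the geometric generic embedding dimension\<close>

text \<open>
  The following definitions are for integral \<open>B\<close> with generic point \<open>\<eta>\<close>. Then the stalk at \<open>\<eta>\<close> is
  a field and hence equal to the residue field \<open>\<kappa>(\<eta>)\<close>, and \<open>generic_inclusion B \<eta>\<close> is the canonical
  morphism \<open>Spec \<kappa>(\<eta>) \<rightarrow> B\<close>.
\<close>
definition generic_inclusion ::
  "('q, 's) ringed_space \<Rightarrow> 'q \<Rightarrow>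
   (('q set \<times> 's) set set, ('q set \<times> 's) set spec_section, 'q, 's) lrs_map" where
  "generic_inclusion B \<eta> = \<lparr>
     pt_map = (\<lambda>P. \<eta>),
     sec_map = (\<lambda>V s. \<lambda>P \<in> {P \<in> points (Spec (stalk B \<eta>)). \<eta> \<in> V}.
        fraction (stalk B \<eta>) (carrier (stalk B \<eta>) - P) (germ B \<eta> V s) \<one>\<^bsub>stalk B \<eta>\<^esub>)\<rparr>"

abbreviation generic_fibre ::
  "('p, 'r) ringed_space \<Rightarrow> ('q, 's) ringed_space \<Rightarrow> ('p, 'r, 'q, 's) lrs_map \<Rightarrow> 'q \<Rightarrow>
   (('p, 'r, ('q set \<times> 's) set set, ('q set \<times> 's) set spec_section) fp_point,
    ('p, 'r, ('q set \<times> 's) set set, ('q set \<times> 's) set spec_section) fp_section) ringed_space"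
  where
  "generic_fibre X B f \<eta> \<equiv>
     fibre_product X (Spec (stalk B \<eta>)) B f (generic_inclusion B \<eta>)"

abbreviation generic_fibre_mor ::
  "('p, 'r) ringed_space \<Rightarrow> ('q, 's) ringed_space \<Rightarrow> ('p, 'r, 'q, 's) lrs_map \<Rightarrow> 'q \<Rightarrow>
   (('p, 'r, ('q set \<times> 's) set set, ('q set \<times> 's) set spec_section) fp_point,
    ('p, 'r, ('q set \<times> 's) set set, ('q set \<times> 's) set spec_section) fp_section,
    ('q set \<times> 's) set set, ('q set \<times> 's) set spec_section) lrs_map" where
  "generic_fibre_mor X B f \<eta> \<equiv> fp_snd X (Spec (stalk B \<eta>)) B f (generic_inclusion B \<eta>)"

text \<open>
  For a scheme \<open>q: Y \<rightarrow> Spec K\<close>, the structure map from \<open>K\<close> to the stalk at \<open>y\<close>.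
\<close>
definition field_to_stalk ::
  "'r ring \<Rightarrow> ('p, 's) ringed_space \<Rightarrow> ('p, 's, 'r set, 'r spec_section) lrs_map \<Rightarrow> 'p \<Rightarrow>
   'r \<Rightarrow> ('p set \<times> 's) set" where
  "field_to_stalk K Y q y a = germ Y y (preimage Y q (points (Spec K)))
     (sec_map q (points (Spec K)) (const_section K a))"

definition geometric_generic_edim ::
  "nat \<Rightarrow> 'r ring \<Rightarrow> ('p, 's) ringed_space \<Rightarrow> ('p, 's, 'r set, 'r spec_section) lrs_map \<Rightarrow> enat"
  where
  "geometric_generic_edim p K Y q =
     edim (tensor_ring K (stalk Y (generic_pt Y)) (field_to_stalk K Y q (generic_pt Y))
       (p_root_field p K) (ring.indexed_const K))"

end

theory Submission imports Defs begin

text \<open>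
 Let \<open>K = \<kappa>(\<eta>)\<close>, let \<open>\<xi>\<close> be the generic point of \<open>X\<close>, and let \<open>T\<close> be the local ring of \<open>X\<^sub>\<eta>\<close> at its generic
 point. The ring \<open>M = T \<otimes>\<^bsub>K\<^esub> K\<^sup>1\<^sup>/\<^sup>p\<close> is compared with \<open>dim B\<close> through a \<open>p\<close>-basis \<open>t\<^sub>1, \<dots>, t\<^sub>e\<close> of \<open>K\<close>.

 Its length is at most \<open>dim B\<close> (\<open>p_basis_length_le_krull_dim\<close>). Indeed, let \<open>xs\<close> be a maximal tower of
 transcendental elements among the generators of the coordinate ring \<open>R\<close> of an affine open subset of \<open>B\<close>.
 Since \<open>k\<close> is perfect and \<open>K\<close> is finite over \<open>k(xs)\<close>, the degree of \<open>K\<close> over \<open>K\<^sup>p\<close> is at most that of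
 \<open>k(xs)\<close> over \<open>k(xs)\<^sup>p\<close>, so \<open>e\<close> is at most the length of \<open>xs\<close>
 (\<open>p_basis_length_le_transcendental_tower\<close>). Conversely each element of \<open>xs\<close> can be used to enlarge a
 prime ideal of \<open>R\<close>, which yields a chain of prime ideals as long as \<open>xs\<close> (\<open>exists_prime_chain\<close>).

 The field \<open>K\<close> contains the \<open>p\<close>-th roots that its elements have in \<open>T\<close> (\<open>root_descends\<close>). Such a root
 is integral over the local rings of the normal scheme \<open>X\<close>, so it is a function on \<open>f\<^sup>-\<^sup>1(V)\<close> for an open
 neighbourhood \<open>V\<close> of \<open>\<eta>\<close>, and \<open>f\<^sub>*(\<O>\<^sub>X) = \<O>\<^sub>B\<close> shows that it comes from \<open>V\<close>. Here \<open>T\<close> is the local ring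
 of \<open>X\<close> at \<open>\<xi>\<close>, because a tensor over \<open>K\<close> is a single function on \<open>X\<close> (\<open>fp_germ_section\<close>).

 Finally \<open>M\<close> is obtained from the field \<open>T\<close> by adjoining \<open>p\<close>-th roots \<open>\<tau>\<^sub>1, \<dots>, \<tau>\<^sub>e\<close> of the \<open>t\<^sub>i\<close>. All
 \<open>p\<close>-th powers in \<open>M\<close> lie in \<open>T\<close>, so \<open>M\<close> is local and its maximal ideal consists of the nilpotent
 elements. Each \<open>\<tau>\<^sub>i\<close> contributes at most one generator to this ideal, namely a nilpotent polynomial
 expression in \<open>\<tau>\<^sub>i\<close> of least degree. The first one contributes none: \<open>t\<^sub>1\<close> is not a \<open>p\<close>-th power in \<open>K\<close>,
 hence not in \<open>T\<close>, and \<open>T[\<tau>\<^sub>1]\<close> is a field. Therefore \<open>edim M < e\<close> (\<open>edim_tensor_p_root_field\<close>) if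
 \<open>e > 0\<close>, and \<open>edim M = 0\<close> if \<open>e = 0\<close>.
\<close>

section \<open>Fields of positive characteristic\<close>

lemma (in cring) binomial_expansion:
 assumes x: "x \<in> carrier R" and y: "y \<in> carrier R"
 shows "(x \<oplus> y) [^] n = (\<Oplus>i\<in>{..n::nat}. [(n choose i)] \<cdot>\<^bsub>R\<^esub> (x [^] i \<otimes> y [^] (n - i)))"
proof (induction n)
 case 0
 show ?case using x y by (simp add: add.nat_pow_Suc)
next
 case (Suc n)
 let ?t = "\<lambda>i. x [^] i \<otimes> y [^] (n - i)"
 let ?u = "\<lambda>i. x [^] i \<otimes> y [^] (Suc n - i)"
 let ?S = "\<Oplus>i\<in>{..n}. [(n choose i)] \<cdot>\<^bsub>R\<^esub> ?t i"
 have xS: "x \<otimes> ?S = (\<Oplus>i\<in>{..n}. [(n choose i)] \<cdot>\<^bsub>R\<^esub> ?u (Suc i))"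
 proof -
  have "x \<otimes> ?S = (\<Oplus>i\<in>{..n}. x \<otimes> ([(n choose i)] \<cdot>\<^bsub>R\<^esub> ?t i))"
   using x y by (intro finsum_rdistr) auto
  also have "\<dots> = (\<Oplus>i\<in>{..n}. [(n choose i)] \<cdot>\<^bsub>R\<^esub> ?u (Suc i))"
   using x y by (intro finsum_cong') (auto simp: add_pow_rdistr m_assoc m_lcomm nat_pow_Suc2 m_comm)
  finally show ?thesis .
 qed
 have yS: "y \<otimes> ?S = (\<Oplus>i\<in>{..Suc n}. [(n choose i)] \<cdot>\<^bsub>R\<^esub> ?u i)"
 proof -
  have "y \<otimes> ?S = (\<Oplus>i\<in>{..n}. y \<otimes> ([(n choose i)] \<cdot>\<^bsub>R\<^esub> ?t i))"
   using x y by (intro finsum_rdistr) auto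
  also have "\<dots> = (\<Oplus>i\<in>{..n}. [(n choose i)] \<cdot>\<^bsub>R\<^esub> ?u i)"
  proof (intro finsum_cong')
   show "y \<otimes> ([(n choose i)] \<cdot>\<^bsub>R\<^esub> ?t i) = [(n choose i)] \<cdot>\<^bsub>R\<^esub> ?u i" if "i \<in> {..n}" for i
   proof -
    from that have "Suc n - i = Suc (n - i)" by auto
    then show ?thesis using x y by (simp add: add_pow_rdistr m_assoc m_lcomm m_comm)
   qed
  qed (use x y in auto)
  also have "\<dots> = (\<Oplus>i\<in>{..Suc n}. [(n choose i)] \<cdot>\<^bsub>R\<^esub> ?u i)"
   using x y by (subst finsum_Suc) (auto simp: binomial_eq_0)
  finally show ?thesis .
 qed
 have S: "?S \<in> carrier R" using x y by (intro finsum_closed) auto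
 have "(x \<oplus> y) [^] Suc n = (x \<oplus> y) \<otimes> ?S"
  using x y Suc by (metis add.m_closed nat_pow_Suc2)
 also have "\<dots> = x \<otimes> ?S \<oplus> y \<otimes> ?S" using x y S l_distr by blast
 also have "y \<otimes> ?S = (\<Oplus>i\<in>{..n}. [(n choose Suc i)] \<cdot>\<^bsub>R\<^esub> ?u (Suc i)) \<oplus> [(n choose 0)] \<cdot>\<^bsub>R\<^esub> ?u 0"
  unfolding yS using x y by (subst finsum_Suc2) auto
 also have "x \<otimes> ?S = (\<Oplus>i\<in>{..n}. [(n choose i)] \<cdot>\<^bsub>R\<^esub> ?u (Suc i))" by (fact xS)
 also have "(\<Oplus>i\<in>{..n}. [(n choose i)] \<cdot>\<^bsub>R\<^esub> ?u (Suc i)) \<oplus>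
   ((\<Oplus>i\<in>{..n}. [(n choose Suc i)] \<cdot>\<^bsub>R\<^esub> ?u (Suc i)) \<oplus> [(n choose 0)] \<cdot>\<^bsub>R\<^esub> ?u 0)
  = (\<Oplus>i\<in>{..n}. [(Suc n choose Suc i)] \<cdot>\<^bsub>R\<^esub> ?u (Suc i)) \<oplus> [(Suc n choose 0)] \<cdot>\<^bsub>R\<^esub> ?u 0"
 proof -
  have "(\<Oplus>i\<in>{..n}. [(n choose i)] \<cdot>\<^bsub>R\<^esub> ?u (Suc i)) \<oplus> (\<Oplus>i\<in>{..n}. [(n choose Suc i)] \<cdot>\<^bsub>R\<^esub> ?u (Suc i))
    = (\<Oplus>i\<in>{..n}. [(n choose i)] \<cdot>\<^bsub>R\<^esub> ?u (Suc i) \<oplus> [(n choose Suc i)] \<cdot>\<^bsub>R\<^esub> ?u (Suc i))"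
   using x y by (intro finsum_addf [symmetric]) auto
  also have "\<dots> = (\<Oplus>i\<in>{..n}. [(Suc n choose Suc i)] \<cdot>\<^bsub>R\<^esub> ?u (Suc i))"
   using x y by (intro finsum_cong') (auto simp: add.nat_pow_mult)
  finally show ?thesis using x y by (simp flip: a_assoc)
 qed
 also have "\<dots> = (\<Oplus>i\<in>{..Suc n}. [(Suc n choose i)] \<cdot>\<^bsub>R\<^esub> ?u i)"
  using x y by (subst finsum_Suc2) auto
 finally show ?case .
qed

locale char_p_cring = cring +
 fixes p :: nat
 assumes prime_p: "Factorial_Ring.prime p" and char_p: "[p] \<cdot>\<^bsub>R\<^esub> \<one> = \<zero>"
begin

lemma p_gt_1: "p > 1"
 using prime_p prime_gt_1_nat by blast

lemma add_pow_multiple_p: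
 assumes "x \<in> carrier R" and "p dvd m"
 shows "[m] \<cdot>\<^bsub>R\<^esub> x = \<zero>"
proof -
 obtain j where j: "m = p * j" using assms(2) by blast
 have "[m] \<cdot>\<^bsub>R\<^esub> x = [j] \<cdot>\<^bsub>R\<^esub> ([p] \<cdot>\<^bsub>R\<^esub> x)"
  using assms(1) unfolding j by (simp add: add.nat_pow_pow mult.commute)
 also have "[p] \<cdot>\<^bsub>R\<^esub> x = ([p] \<cdot>\<^bsub>R\<^esub> \<one>) \<otimes> x"
  using assms(1) by (simp add: add_pow_ldistr)
 finally show ?thesis using assms(1) char_p by simp
qed

lemma power_p_add:
 assumes x: "x \<in> carrier R" and y: "y \<in> carrier R"
 shows "(x \<oplus> y) [^] p = x [^] p \<oplus> y [^] p"
proof -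
 obtain m where m: "p = Suc m" using p_gt_1 by (cases p) auto
 have m0: "m > 0" using p_gt_1 m by simp
 let ?f = "\<lambda>i. [(p choose i)] \<cdot>\<^bsub>R\<^esub> (x [^] i \<otimes> y [^] (p - i))"
 have "(x \<oplus> y) [^] p = (\<Oplus>i\<in>{..Suc m}. ?f i)"
  using binomial_expansion[OF x y, of p] m by simp
 also have "\<dots> = (\<Oplus>i\<in>{0, p}. ?f i)"
 proof (rule add.finprod_mono_neutral_cong_right)
  show "?f i = \<zero>" if "i \<in> {..Suc m} - {0, p}" for i
  proof (rule add_pow_multiple_p)
   from that m have "0 < i" "i < p" by auto
   then show "p dvd (p choose i)" using dvd_choose_prime[of i p] prime_p by auto
  qed (use x y in auto)
 qed (use m x y in auto)
 also have "\<dots> = x [^] p \<oplus> y [^] p" using x y p_gt_1 by (simp add: a_comm)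
 finally show ?thesis .
qed

lemma power_p_hom: "(\<lambda>x. x [^] p) \<in> ring_hom R R"
 using nat_pow_distrib power_p_add by (intro ring_hom_memI) auto

lemma power_p_ring_hom: "ring_hom_ring R R (\<lambda>x. x [^] p)"
 using power_p_hom ring_hom_ringI2 ring_axioms by blast

lemma power_p_minus:
 assumes x: "x \<in> carrier R"
 shows "(\<ominus> x) [^] p = \<ominus> (x [^] p)"
proof -
 interpret F: ring_hom_ring R R "\<lambda>x. x [^] p" by (rule power_p_ring_hom)
 show ?thesis using F.hom_a_inv x by simp
qed

end

locale char_p_field = char_p_cring + field
begin

lemma nat_pow_eq_zero:
 assumes "x \<in> carrier R" and "x [^] (n::nat) = \<zero>"
 shows "x = \<zero>" using assms(2)
proof (induction n)
 case (Suc n)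
 then show ?case using assms(1) integral[of "x [^] n" x] by auto
qed simp

lemma power_p_inj:
 assumes "x \<in> carrier R" "y \<in> carrier R" "x [^] p = y [^] p"
 shows "x = y"
proof -
 have "(x \<ominus> y) [^] p = \<zero>"
  using assms unfolding a_minus_def by (simp add: power_p_add power_p_minus r_neg)
 then have "x \<ominus> y = \<zero>" using assms nat_pow_eq_zero[of "x \<ominus> y"] by blast
 then show ?thesis using assms by simp
qed

lemma power_p_inj_on: "inj_on (\<lambda>x. x [^] p) (carrier R)"
 using power_p_inj by (auto intro: inj_onI)

lemma power_p_image_subfield:
 assumes "subfield E R"
 shows "subfield ((\<lambda>x. x [^] p) ` E) R"
 using ring_hom_ring.img_is_subfield(2)[OF power_p_ring_hom assms] one_not_zero by blast

end

lemma (in domain) eval_divisor_of_linear_power: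
 assumes t: "t \<in> carrier R"
  and "f \<in> carrier (poly_ring R)" "g \<in> carrier (poly_ring R)"
  and "f \<otimes>\<^bsub>poly_ring R\<^esub> g = [\<one>, \<ominus> t] [^]\<^bsub>poly_ring R\<^esub> (n::nat)"
  and x: "x \<in> carrier R"
 shows "f \<noteq> [] \<and> eval f x = lead_coeff f \<otimes> (x \<ominus> t) [^] (degree f)"
 using assms(2-4)
proof (induction n arbitrary: f g)
 case 0
 interpret P: domain "poly_ring R" using univ_poly_is_domain[OF carrier_is_subring] .
 have "f \<in> Units (poly_ring R)"
  using 0 P.m_comm[of f g] unfolding Units_def by (auto intro!: bexI[of _ g])
 then obtain k where "f = [k]" "k \<in> carrier R" "k \<noteq> \<zero>"
  using univ_poly_units_incl[OF carrier_is_subring] by auto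
 then show ?case using x by simp
next
 case (Suc n)
 interpret P: domain "poly_ring R" using univ_poly_is_domain[OF carrier_is_subring] .
 let ?\<pi> = "[\<one>, \<ominus> t]"
 have \<pi>: "?\<pi> \<in> carrier (poly_ring R)"
  using t unfolding sym[OF univ_poly_carrier] polynomial_def by simp
 have \<pi>0: "?\<pi> \<noteq> \<zero>\<^bsub>poly_ring R\<^esub>" by (simp add: univ_poly_zero)
 note hom = ring_hom_memE[OF eval_is_hom[OF carrier_is_subring t]]
 note homx = ring_hom_memE[OF eval_is_hom[OF carrier_is_subring x]]
 have e\<pi>: "eval ?\<pi> y = y \<ominus> t" if "y \<in> carrier R" for y
  using t that by (simp add: a_minus_def)
 have root: "\<exists>q\<in>carrier (poly_ring R). h = ?\<pi> \<otimes>\<^bsub>poly_ring R\<^esub> q"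
  if "h \<in> carrier (poly_ring R)" "eval h t = \<zero>" for h
 proof (cases "h = []")
  case True
  then show ?thesis using \<pi> P.r_null[OF \<pi>] P.zero_closed by (metis univ_poly_zero)
 next
  case False
  then have "?\<pi> pdivides h"
   using is_root_imp_pdivides[OF that(1)] that t unfolding is_root_def by blast
  then show ?thesis unfolding pdivides_def factor_def by auto
 qed
 have "eval (f \<otimes>\<^bsub>poly_ring R\<^esub> g) t = \<zero>"
 proof -
  have "eval ?\<pi> t = \<zero>" using e\<pi>[OF t] r_right_minus_eq[OF t t] by (simp del: eval.simps)
  then show ?thesis
   unfolding Suc.prems(3) using \<pi> hom(2)[of "?\<pi> [^]\<^bsub>poly_ring R\<^esub> n" ?\<pi>]
    hom(1)[of "?\<pi> [^]\<^bsub>poly_ring R\<^esub> n"] by (simp del: eval.simps)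
 qed
 then have "eval f t \<otimes> eval g t = \<zero>" using hom(2)[OF Suc.prems(1,2)] by metis
 then consider "eval f t = \<zero>" | "eval g t = \<zero>" using integral hom(1) Suc.prems by blast
 then show ?case
 proof cases
  case 1
  obtain q where q: "q \<in> carrier (poly_ring R)" "f = ?\<pi> \<otimes>\<^bsub>poly_ring R\<^esub> q"
   using root[OF Suc.prems(1) 1] by blast
  have "?\<pi> \<otimes>\<^bsub>poly_ring R\<^esub> (q \<otimes>\<^bsub>poly_ring R\<^esub> g) = ?\<pi> \<otimes>\<^bsub>poly_ring R\<^esub> ?\<pi> [^]\<^bsub>poly_ring R\<^esub> n"
   using Suc.prems(2,3) q \<pi> P.m_comm[OF P.nat_pow_closed[OF \<pi>] \<pi>, of n] by (simp add: P.m_assoc)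
  then have "q \<otimes>\<^bsub>poly_ring R\<^esub> g = ?\<pi> [^]\<^bsub>poly_ring R\<^esub> n"
   using P.m_lcancel[OF \<pi>0 \<pi>] q Suc.prems(2) \<pi> by simp
  then have IH: "q \<noteq> []" "eval q x = lead_coeff q \<otimes> (x \<ominus> t) [^] (degree q)"
   using Suc.IH[OF q(1) Suc.prems(2)] by auto
  have pol: "polynomial (carrier R) ?\<pi>" "polynomial (carrier R) q"
   using \<pi> q univ_poly_carrier by blast+
  have deg: "degree f = Suc (degree q)"
   using poly_mult_degree_eq[OF carrier_is_subring pol] IH(1) q(2) by (simp add: univ_poly_mult)
  have lq: "lead_coeff q \<in> carrier R"
   using pol(2) IH(1) lead_coeff_in_carrier[OF carrier_is_subring] by (cases q) auto
  have lead: "lead_coeff f = lead_coeff q"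
   using poly_mult_lead_coeff[OF carrier_is_subring pol _ IH(1)] q(2) lq by (simp add: univ_poly_mult)
  have "f \<noteq> []" using deg by auto
  moreover have "eval f x = (x \<ominus> t) \<otimes> eval q x"
   using homx(2)[OF \<pi> q(1)] q(2) e\<pi>[OF x] by simp
  ultimately show ?thesis unfolding IH(2) deg lead using x t lq by (simp add: m_lcomm m_comm)
 next
  case 2
  obtain q where q: "q \<in> carrier (poly_ring R)" "g = ?\<pi> \<otimes>\<^bsub>poly_ring R\<^esub> q"
   using root[OF Suc.prems(2) 2] by blast
  have "?\<pi> \<otimes>\<^bsub>poly_ring R\<^esub> (f \<otimes>\<^bsub>poly_ring R\<^esub> q) = ?\<pi> \<otimes>\<^bsub>poly_ring R\<^esub> ?\<pi> [^]\<^bsub>poly_ring R\<^esub> n"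
   using Suc.prems(1,3) q \<pi> P.m_comm[OF P.nat_pow_closed[OF \<pi>] \<pi>, of n] by (simp add: P.m_lcomm)
  then have "f \<otimes>\<^bsub>poly_ring R\<^esub> q = ?\<pi> [^]\<^bsub>poly_ring R\<^esub> n"
   using P.m_lcancel[OF \<pi>0 \<pi>] q Suc.prems(1) \<pi> by simp
  then show ?thesis using Suc.IH[OF Suc.prems(1) q(1)] by simp
 qed
qed

context char_p_field
begin

lemma poly_ring_char_p: "char_p_cring (poly_ring R) p"
proof -
 interpret P: domain "poly_ring R" using univ_poly_is_domain[OF carrier_is_subring] .
 have *: "[n] \<cdot>\<^bsub>poly_ring R\<^esub> \<one>\<^bsub>poly_ring R\<^esub> = (if [n] \<cdot>\<^bsub>R\<^esub> \<one> = \<zero> then [] else [[n] \<cdot>\<^bsub>R\<^esub> \<one>])" for n :: nat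
 proof (induction n)
  case (Suc n)
  then show ?case by (auto simp: univ_poly_add univ_poly_one univ_poly_zero)
 qed (simp add: univ_poly_zero)
 show ?thesis by unfold_locales (use prime_p char_p * in \<open>auto simp: univ_poly_zero\<close>)
qed

text \<open>
 Over the ambient field the polynomial \<open>X\<^sup>p - t\<^sup>p\<close> is \<open>(X - t)\<^sup>p\<close>, so the minimal polynomial of
 \<open>t\<close> over \<open>S\<close> is \<open>(X - t)\<^sup>d\<close>. Its value at \<open>0\<close> puts \<open>t\<^sup>d\<close> into \<open>S\<close>. For \<open>0 < d < p\<close> the exponents
 \<open>d\<close> and \<open>p\<close> are coprime, and \<open>t\<close> itself would lie in \<open>S\<close>.
\<close>
lemma degree_Irr_p_root:
 assumes S: "subfield S R" and t: "t \<in> carrier R" "t [^] p \<in> S"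
 shows "(algebraic over S) t" and "degree (Irr S t) \<le> p"
  and "t \<notin> S \<Longrightarrow> degree (Irr S t) = p"
proof -
 interpret P: domain "poly_ring R" using univ_poly_is_domain[OF carrier_is_subring] .
 interpret PS: domain "S[X]" using univ_poly_is_domain[OF subfieldE(1)[OF S]] .
 interpret PP: char_p_cring "poly_ring R" p by (rule poly_ring_char_p)
 note SE = subringE[OF subfieldE(1)[OF S]]
 obtain m where m: "p = Suc m" using p_gt_1 by (cases p) auto
 define q where "q = \<one> # replicate m \<zero> @ [\<ominus> (t [^] p)]"
 have q: "q \<in> carrier (S[X])"
  unfolding sym[OF univ_poly_carrier] polynomial_def q_def using SE t by auto
 have ev: "eval q x = x [^] p \<ominus> t [^] p" if "x \<in> carrier R" for x
  unfolding q_def using that t m by (simp add: eval_replicate a_minus_def)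
 have q0: "q \<noteq> []" "degree q = p" unfolding q_def m by auto
 have evt: "eval q t = \<zero>" using ev[of t] t by simp
 show alg: "(algebraic over S) t" using algebraicI[OF q q0(1) evt] .
 note I = IrrE[OF S t(1) alg]
 have div: "Irr S t pdivides q" using Irr_minimal[OF S t(1) alg q evt] .
 show le: "degree (Irr S t) \<le> p"
  using pdivides_imp_degree_le[OF subfieldE(1)[OF S] I(1) q q0(1) div] q0(2) by simp
 have IR: "Irr S t \<in> carrier (poly_ring R)" and qR: "q \<in> carrier (poly_ring R)"
  using carrier_polynomial_shell[OF subfieldE(1)[OF S]] I(1) q by auto
 obtain g where g: "g \<in> carrier (poly_ring R)" "q = Irr S t \<otimes>\<^bsub>poly_ring R\<^esub> g"
  using div unfolding pdivides_def factor_def by auto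
 have lin: "[\<one>, \<ominus> t] [^]\<^bsub>poly_ring R\<^esub> p = q"
 proof -
  have X: "[\<one>, \<zero>] \<in> carrier (poly_ring R)"
   unfolding sym[OF univ_poly_carrier] polynomial_def by simp
  have c: "poly_of_const a \<in> carrier (poly_ring R)" if "a \<in> carrier R" for a
   using that unfolding sym[OF univ_poly_carrier] polynomial_def poly_of_const_def by auto
  have Xn: "[\<one>, \<zero>] [^]\<^bsub>poly_ring R\<^esub> n = \<one> # replicate n \<zero>" for n :: nat
  proof (induction n)
   case (Suc n)
   have "[\<one>, \<zero>] [^]\<^bsub>poly_ring R\<^esub> Suc n = poly_mult (monom \<one> 1) (\<one> # replicate n \<zero>)"
    unfolding P.nat_pow_Suc2[OF X] Suc by (simp add: univ_poly_mult monom_def)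
   also have "\<dots> = \<one> # replicate (Suc n) \<zero>"
    by (subst poly_mult_monom') (auto simp: replicate_append_same)
   finally show ?case .
  qed (simp add: univ_poly_one)
  have hom: "poly_of_const \<in> ring_hom R (poly_ring R)"
   using canonical_embedding_is_hom[OF carrier_is_subring] by simp
  have "[\<one>, \<ominus> t] = [\<one>, \<zero>] \<oplus>\<^bsub>poly_ring R\<^esub> poly_of_const (\<ominus> t)"
   using t by (auto simp: univ_poly_add poly_of_const_def)
  then have "[\<one>, \<ominus> t] [^]\<^bsub>poly_ring R\<^esub> p
    = [\<one>, \<zero>] [^]\<^bsub>poly_ring R\<^esub> p \<oplus>\<^bsub>poly_ring R\<^esub> (poly_of_const (\<ominus> t)) [^]\<^bsub>poly_ring R\<^esub> p"
   using PP.power_p_add[OF X c] t by simp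
  also have "(poly_of_const (\<ominus> t)) [^]\<^bsub>poly_ring R\<^esub> p = poly_of_const ((\<ominus> t) [^] p)"
  proof -
   interpret h: ring_hom_ring R "poly_ring R" poly_of_const
    using hom ring_hom_ringI2 ring_axioms P.ring_axioms by blast
   show ?thesis using h.hom_nat_pow t by simp
  qed
  also have "[\<one>, \<zero>] [^]\<^bsub>poly_ring R\<^esub> p \<oplus>\<^bsub>poly_ring R\<^esub> poly_of_const ((\<ominus> t) [^] p) = q"
  proof -
   have "poly_add (\<one> # replicate m \<zero> @ [\<zero>]) (normalize [a]) = \<one> # replicate m \<zero> @ [a]"
    if a: "a \<in> carrier R" for a
   proof -
    have "poly_add (\<one> # replicate m \<zero> @ [\<zero>]) (normalize [a])
      = poly_add (\<one> # replicate m \<zero> @ [\<zero>]) [a]"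
     using a by (intro poly_add_normalize(2)[symmetric]) auto
    also have "\<dots> = poly_add ((\<one> # replicate m \<zero>) @ replicate (length [a]) \<zero>) [a]"
     by (simp only: length_Cons list.size(3) replicate_Suc replicate_0 append_Cons)
    also have "\<dots> = normalize ((\<one> # replicate m \<zero>) @ [a])"
     using a by (intro poly_add_append_replicate) auto
    finally show ?thesis by simp
   qed
   from this[of "\<ominus> (t [^] p)"] show ?thesis
    unfolding Xn univ_poly_add poly_of_const_def power_p_minus[OF t(1)] q_def
    using t m by (simp add: replicate_append_same)
  qed
  finally show ?thesis .
 qed
 have pw: "eval (Irr S t) \<zero> = (\<ominus> t) [^] degree (Irr S t)"
  using eval_divisor_of_linear_power[OF t(1) IR g(1), of p \<zero>] g(2) lin I(3) t
  by (simp add: a_minus_def)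
 have S0: "eval (Irr S t) \<zero> \<in> S"
 proof -
  have *: "eval l \<zero> \<in> S" if "set l \<subseteq> S" for l using that
  proof (induction l)
   case (Cons a l)
   have "a \<in> carrier R" using Cons SE(1) by auto
   then have "a \<otimes> \<zero> [^] n \<in> S" for n :: nat
    by (cases n) (use Cons.prems SE in auto)
   then show ?case using Cons SE(7) by simp
  qed (use SE in auto)
  show ?thesis
   by (rule *) (use I(1) in \<open>auto simp: sym[OF univ_poly_carrier] polynomial_def\<close>)
 qed
 show "degree (Irr S t) = p" if tS: "t \<notin> S"
 proof (rule ccontr)
  let ?d = "degree (Irr S t)"
  assume ne: "?d \<noteq> p"
  have d0: "?d > 0"
  proof (rule ccontr)
   assume "\<not> ?d > 0"
   then have "Irr S t = [\<one>]" using I(3) IR pirreducible_degree[OF S I(1,2)] by simp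
   then show False using I(4) t by simp
  qed
  then have cop: "coprime ?d p"
   using prime_p le ne by (metis coprime_commute dvd_imp_le le_antisym prime_imp_coprime_nat)
  obtain a b where ab: "a * ?d = b * p + 1"
   using bezout_nat[of ?d p] d0 cop by (auto simp: mult.commute)
  have powS: "x [^] (n::nat) \<in> S" if "x \<in> S" for x n by (induction n) (use that SE in auto)
  let ?s = "\<ominus> t"
  have s: "?s \<in> carrier R" "?s [^] p \<in> S" "?s \<noteq> \<zero>"
   using t power_p_minus SE(5) tS SE(2) by auto
  have "(?s [^] ?d) [^] a \<in> S" using powS S0 pw by simp
  then have "(?s [^] p) [^] b \<otimes> ?s \<in> S"
   using ab s by (simp add: nat_pow_pow mult.commute)
  moreover have "(?s [^] p) [^] b \<in> S - {\<zero>}"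
   using powS[OF s(2), of b] nat_pow_eq_zero[of "?s [^] p" b] nat_pow_eq_zero[of ?s p] s by blast
  ultimately have "?s \<in> S" using subfield_m_inv_simprule[OF S] s by blast
  then have "\<ominus> ?s \<in> S" using SE(5) by blast
  then show False using tS t by simp
 qed
qed

end

primrec (in ring) strict_tower :: "'a set \<Rightarrow> 'a list \<Rightarrow> bool" where
 "strict_tower F [] \<longleftrightarrow> True"
| "strict_tower F (x # xs) \<longleftrightarrow> strict_tower F xs \<and> x \<notin> finite_extension F xs"

primrec (in ring) transcendental_tower :: "'a set \<Rightarrow> 'a list \<Rightarrow> bool" where
 "transcendental_tower F [] \<longleftrightarrow> True"
| "transcendental_tower F (x # xs) \<longleftrightarrow>
   transcendental_tower F xs \<and> (transcendental over (finite_extension F xs)) x"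

lemma (in ring) finite_extension_Cons:
 "finite_extension F (x # xs) = simple_extension (finite_extension F xs) x" by simp

lemma (in ring) simple_extension_of_member:
 assumes "subring E R" and "x \<in> E"
 shows "simple_extension E x = E"
 using simple_extension_subring_incl[OF assms(1) subset_refl assms(2)]
  simple_extension_incl[OF subringE(1)[OF assms(1)]] subringE(1)[OF assms(1)] assms(2) by blast

lemma (in domain) exists_transcendental_tower:
 assumes F: "subring F R" and ys: "set ys \<subseteq> carrier R"
 shows "\<exists>xs. set xs \<subseteq> set ys \<and> transcendental_tower F xs \<and>
  (\<forall>y\<in>set ys. (algebraic over (finite_extension F xs)) y)" using ys
proof (induction ys)
 case Nil
 then show ?case by (intro exI[of _ "[]"]) simp
next
 case (Cons y ys)
 then obtain xs where xs: "set xs \<subseteq> set ys" "transcendental_tower F xs"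
   "\<forall>y\<in>set ys. (algebraic over (finite_extension F xs)) y" by auto
 have sub: "subring (finite_extension F xs) R"
  using finite_extension_is_subring[OF F] xs(1) Cons.prems by auto
 show ?case
 proof (cases "(algebraic over (finite_extension F xs)) y")
  case True
  then show ?thesis using xs by (intro exI[of _ xs]) auto
 next
  case False
  have y: "y \<in> carrier R" using Cons.prems by simp
  have le: "finite_extension F xs \<subseteq> finite_extension F (y # xs)"
   unfolding finite_extension_Cons using simple_extension_incl[OF subringE(1)[OF sub] y] .
  have sub': "subring (finite_extension F (y # xs)) R"
   unfolding finite_extension_Cons using simple_extension_is_subring[OF sub y] .
  have "y \<in> finite_extension F (y # xs)"
   unfolding finite_extension_Cons using simple_extension_mem[OF sub y] .
  then have "(algebraic over (finite_extension F (y # xs))) y"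
   using algebraic_self[OF sub'] by blast
  moreover have "(algebraic over (finite_extension F (y # xs))) z" if "z \<in> set ys" for z
   using xs(3) that algebraic_mono[OF le] by blast
  ultimately show ?thesis using xs(1,2) False
   by (intro exI[of _ "y # xs"]) (auto simp: over_def simp del: finite_extension.simps)
 qed
qed

context char_p_field
begin

lemma p_root_tower_subfield:
 assumes F: "subfield F R" and ts: "set ts \<subseteq> carrier R" "\<forall>t\<in>set ts. t [^] p \<in> F"
 shows "subfield (finite_extension F ts) R"
 using finite_extension_is_subfield[OF F ts(1)] degree_Irr_p_root(1)[OF F] ts by blast

lemma p_root_tower_dimension:
 assumes F: "subfield F R" and "set ts \<subseteq> carrier R" "\<forall>t\<in>set ts. t [^] p \<in> F"
 shows "\<exists>m \<le> p ^ length ts. dimension m F (finite_extension F ts) \<and>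
  (strict_tower F ts \<longrightarrow> m = p ^ length ts)" using assms(2,3)
proof (induction ts)
 case Nil
 show ?case using dimension_one[OF F] by auto
next
 case (Cons t ts)
 let ?E = "finite_extension F ts"
 have E: "subfield ?E R" using p_root_tower_subfield[OF F] Cons.prems by simp
 have FE: "F \<subseteq> ?E" using finite_extension_incl[OF subfieldE(3)[OF F]] Cons.prems by simp
 have t: "t \<in> carrier R" "t [^] p \<in> ?E" using Cons.prems FE by auto
 obtain m where m: "m \<le> p ^ length ts" "dimension m F ?E"
   "strict_tower F ts \<longrightarrow> m = p ^ length ts"
  using Cons by (auto simp del: finite_extension.simps)
 let ?d = "degree (Irr ?E t)"
 have "dimension (m * ?d) F (finite_extension F (t # ts))" unfolding finite_extension_Cons
  using telescopic_base[OF F E m(2) dimension_simple_extension[OF E t(1) degree_Irr_p_root(1)[OF E t]]] .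
 moreover have "m * ?d \<le> p ^ length (t # ts)"
  using mult_le_mono[OF m(1) degree_Irr_p_root(2)[OF E t]] by (simp add: mult.commute)
 moreover have "strict_tower F (t # ts) \<longrightarrow> m * ?d = p ^ length (t # ts)"
  using m(3) degree_Irr_p_root(3)[OF E t] by (simp add: mult.commute)
 ultimately show ?case by blast
qed

lemma exists_strict_tower:
 assumes F: "subfield F R" and "set ys \<subseteq> carrier R" "\<forall>t\<in>set ys. t [^] p \<in> F"
 shows "\<exists>ts. set ts \<subseteq> set ys \<and> strict_tower F ts \<and> finite_extension F ts = finite_extension F ys"
 using assms(2,3)
proof (induction ys)
 case Nil
 then show ?case by (intro exI[of _ "[]"]) simp
next
 case (Cons y ys)
 then obtain ts where ts: "set ts \<subseteq> set ys" "strict_tower F ts"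
   "finite_extension F ts = finite_extension F ys" by (auto simp del: finite_extension.simps)
 have E: "subfield (finite_extension F ts) R" 
  using p_root_tower_subfield[OF F, of ts] ts(1) Cons.prems by auto
 show ?case
 proof (cases "y \<in> finite_extension F ts")
  case True
  then have "finite_extension F (y # ys) = finite_extension F ts"
   unfolding finite_extension_Cons ts(3)[symmetric]
   using simple_extension_of_member[OF subfieldE(1)[OF E]] by simp
  then show ?thesis using ts by (intro exI[of _ ts]) auto
 next
  case False
  have "finite_extension F (y # ts) = finite_extension F (y # ys)"
   unfolding finite_extension_Cons ts(3) ..
  then show ?thesis using ts(1,2) False
   by (intro exI[of _ "y # ts"]) (auto simp del: finite_extension.simps)
 qed
qed

text \<open>
 Let \<open>E = k(xs)\<close> for a maximal tower \<open>xs\<close> of transcendental generators, so that the field \<open>K\<close> is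
 finite over \<open>E\<close>. As \<open>k\<close> is perfect, \<open>E = E\<^sup>p(xs)\<close> and \<open>[E : E\<^sup>p]\<close> is at most \<open>p\<close> to the length of
 \<open>xs\<close>. Frobenius gives \<open>[K : E] = [K\<^sup>p : E\<^sup>p]\<close>, and computing \<open>[K : E\<^sup>p]\<close> along \<open>E\<close> and along \<open>K\<^sup>p\<close>
 shows \<open>[K : K\<^sup>p] = [E : E\<^sup>p]\<close>.
\<close>
theorem p_basis_length_le_transcendental_tower:
 assumes k: "subfield k R" and perfect: "(\<lambda>x. x [^] p) ` k = k"
  and ys: "set ys \<subseteq> carrier R"
  and frac: "\<And>x. x \<in> carrier R \<Longrightarrow>
   \<exists>a \<in> finite_extension k ys. \<exists>b \<in> finite_extension k ys. b \<noteq> \<zero> \<and> x = a \<otimes> inv b"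
 obtains ts xs where "set ts \<subseteq> carrier R" "strict_tower ((\<lambda>x. x [^] p) ` carrier R) ts"
  "finite_extension ((\<lambda>x. x [^] p) ` carrier R) ts = carrier R"
  "set xs \<subseteq> set ys" "transcendental_tower k xs" "length ts \<le> length xs"
proof -
 let ?Fr = "\<lambda>x. x [^] p"
 let ?Kp = "?Fr ` carrier R"
 interpret Fr: ring_hom_ring R R ?Fr by (rule power_p_ring_hom)
 have Kp: "subfield ?Kp R" using power_p_image_subfield[OF carrier_is_subfield] .
 have whole: "L = carrier R" if L: "subfield L R" "k \<subseteq> L" "set ys \<subseteq> L" for L
 proof -
  have gen: "finite_extension k ys \<subseteq> L"
   using finite_extension_subring_incl[OF subfieldE(1)[OF L(1)] L(2,3)] .
  have "x \<in> L" if xc: "x \<in> carrier R" for x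
  proof -
   obtain a b where ab: "a \<in> finite_extension k ys" "b \<in> finite_extension k ys" "b \<noteq> \<zero>"
    "x = a \<otimes> inv b" using frac[OF xc] by blast
   have "a \<in> L" "b \<in> L - {\<zero>}" using ab gen by auto
   then have "a \<otimes> inv b \<in> L"
    using subfield_m_inv(1)[OF L(1)] subringE(6)[OF subfieldE(1)[OF L(1)]] by blast
   then show ?thesis using ab(4) by simp
  qed
  then show ?thesis using subfieldE(3)[OF L(1)] by blast
 qed
 have kKp: "k \<subseteq> ?Kp" using image_mono[OF subfieldE(3)[OF k], of ?Fr] unfolding perfect .
 have rootKp: "\<forall>t\<in>set zs. t [^] p \<in> ?Kp" if "set zs \<subseteq> carrier R" for zs using that by auto
 obtain ts where ts: "set ts \<subseteq> set ys" "strict_tower ?Kp ts"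
   "finite_extension ?Kp ts = finite_extension ?Kp ys"
  using exists_strict_tower[OF Kp ys rootKp[OF ys]] by blast
 have tsc: "set ts \<subseteq> carrier R" using ts(1) ys by blast
 have "finite_extension ?Kp ys = carrier R"
  using whole[OF p_root_tower_subfield[OF Kp ys rootKp[OF ys]]]
   subset_trans[OF kKp finite_extension_incl[OF subfieldE(3)[OF Kp] ys]]
   finite_extension_mem[OF subfieldE(1)[OF Kp] ys] by simp
 then have tsK: "finite_extension ?Kp ts = carrier R" using ts(3) by simp
 have dimKp: "dimension (p ^ length ts) ?Kp (carrier R)"
  using p_root_tower_dimension[OF Kp tsc rootKp[OF tsc]] ts(2) tsK by metis
 obtain xs where xs: "set xs \<subseteq> set ys" "transcendental_tower k xs"
   "\<forall>y\<in>set ys. (algebraic over (finite_extension k xs)) y"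
  using exists_transcendental_tower[OF subfieldE(1)[OF k] ys] by blast
 have xsc: "set xs \<subseteq> carrier R" using xs(1) ys by blast
 define E where "E = generate_field R (k \<union> set xs)"
 have kxs: "k \<union> set xs \<subseteq> carrier R" using subfieldE(3)[OF k] xsc by blast
 have E: "subfield E R" unfolding E_def using generate_field_is_subfield[OF kxs] .
 have inE: "k \<subseteq> E" "set xs \<subseteq> E" unfolding E_def by (auto intro: generate_field.incl)
 have alg: "(algebraic over E) y" if "y \<in> set ys" for y
  using algebraic_mono[OF finite_extension_subring_incl[OF subfieldE(1)[OF E] inE]] xs(3) that by blast
 have "finite_extension E ys = carrier R" using whole[OF finite_extension_is_subfield[OF E ys alg]]
   subset_trans[OF inE(1) finite_extension_incl[OF subfieldE(3)[OF E] ys]]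
   finite_extension_mem[OF subfieldE(1)[OF E] ys] by simp
 then have "finite_dimension E (carrier R)"
  using finite_extension_finite_dimension(1)[OF E ys alg] by simp
 then obtain n where n: "dimension n E (carrier R)" by blast
 let ?Ep = "?Fr ` E"
 have Ep: "subfield ?Ep R" using power_p_image_subfield[OF E] .
 have n': "dimension n ?Ep ?Kp" using Fr.inj_hom_dimension[OF E one_not_zero power_p_inj_on n] .
 have powE: "t [^] p \<in> E" if "t \<in> E" for t
 proof -
  have "t [^] m \<in> E" for m :: nat
   by (induction m) (use that subringE[OF subfieldE(1)[OF E]] in auto)
  then show ?thesis .
 qed
 have rootEp: "\<forall>t\<in>set xs. t [^] p \<in> ?Ep" using inE(2) by auto
 have kEp: "k \<subseteq> ?Ep" using image_mono[OF inE(1), of ?Fr] unfolding perfect .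
 have "finite_extension ?Ep xs = E"
 proof
  show "finite_extension ?Ep xs \<subseteq> E"
   using finite_extension_subring_incl[OF subfieldE(1)[OF E], of ?Ep xs] powE inE(2) by auto
  show "E \<subseteq> finite_extension ?Ep xs" unfolding E_def
  proof (rule generate_field_min_subfield1[OF kxs])
   show "subfield (finite_extension (?Fr ` generate_field R (k \<union> set xs)) xs) R"
    using p_root_tower_subfield[OF Ep xsc rootEp] unfolding E_def .
   show "k \<union> set xs \<subseteq> finite_extension (?Fr ` generate_field R (k \<union> set xs)) xs"
    using subset_trans[OF kEp finite_extension_incl[OF subfieldE(3)[OF Ep] xsc]]
     finite_extension_mem[OF subfieldE(1)[OF Ep] xsc] unfolding E_def by simp
  qed
 qed
 then obtain m where m: "m \<le> p ^ length xs" "dimension m ?Ep E"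
  using p_root_tower_dimension[OF Ep xsc rootEp] by auto
 have "m * n = n * p ^ length ts"
  using dimension_is_inj[OF Ep telescopic_base[OF Ep E m(2) n] telescopic_base[OF Ep Kp n' dimKp]] .
 moreover have "n \<noteq> 0"
 proof
  assume "n = 0"
  then have "carrier R = {\<zero>}" using dimension_zero[OF E] n by blast
  then show False using one_not_zero one_closed by blast
 qed
 ultimately have "p ^ length ts \<le> p ^ length xs" using m(1) by simp
 then have "length ts \<le> length xs" using p_gt_1 by simp
 then show thesis using that[OF tsc ts(2) tsK xs(1,2)] by blast
qed

end

section \<open>Prime ideals avoiding a multiplicative set\<close>

text \<open>
 By Zorn's lemma there is a maximal ideal among those that contain \<open>I\<close> and avoid the multiplicative
 set; it is prime.
\<close>
lemma (in cring) exists_prime_avoiding: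
 assumes I: "ideal I R" and M: "M \<subseteq> carrier R" "\<one> \<in> M"
  and mult: "\<And>x y. x \<in> M \<Longrightarrow> y \<in> M \<Longrightarrow> x \<otimes> y \<in> M"
  and disj: "I \<inter> M = {}"
 shows "\<exists>Q. primeideal Q R \<and> I \<subseteq> Q \<and> Q \<inter> M = {}"
proof -
 define A where "A = {J. ideal J R \<and> I \<subseteq> J \<and> J \<inter> M = {}}"
 have "I \<in> A" using I disj unfolding A_def by blast
 have chain: "\<Union>C \<in> A" if "C \<noteq> {}" "subset.chain A C" for C
 proof -
  have CA: "\<And>J. J \<in> C \<Longrightarrow> ideal J R \<and> I \<subseteq> J \<and> J \<inter> M = {}"
   using that(2) unfolding subset.chain_def A_def by blast
  have lin: "\<And>J J'. J \<in> C \<Longrightarrow> J' \<in> C \<Longrightarrow> J \<subseteq> J' \<or> J' \<subseteq> J"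
   using that(2) unfolding subset.chain_def by blast
  have "ideal (\<Union>C) R"
  proof (rule idealI)
   show "ring R" by (rule ring_axioms)
   show "subgroup (\<Union>C) (add_monoid R)"
   proof (rule add.subgroupI)
    show "\<Union>C \<subseteq> carrier R" using CA ideal.Icarr by fast
    show "\<Union>C \<noteq> {}" using that(1) CA additive_subgroup.zero_closed ideal.axioms(1) by fast
    fix a assume "a \<in> \<Union>C"
    then obtain J where J: "J \<in> C" "a \<in> J" by blast
    then have "\<ominus> a \<in> J" using CA additive_subgroup.a_inv_closed ideal.axioms(1) by fast
    then show "\<ominus> a \<in> \<Union>C" using J by blast
    fix b assume "b \<in> \<Union>C"
    then obtain J' where J': "J' \<in> C" "b \<in> J'" by blast
    obtain J'' where "J'' \<in> C" "a \<in> J''" "b \<in> J''" using lin[OF J(1) J'(1)] J J' by blast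
    then show "a \<oplus> b \<in> \<Union>C" using CA additive_subgroup.a_closed ideal.axioms(1) by fast
   qed
  next
   fix a x assume "a \<in> \<Union>C" "x \<in> carrier R"
   then show "x \<otimes> a \<in> \<Union>C" "a \<otimes> x \<in> \<Union>C"
    using CA ideal.I_l_closed ideal.I_r_closed by fast+
  qed
  then show ?thesis using CA that(1) unfolding A_def by blast
 qed
 obtain Q where Q: "Q \<in> A" "\<And>X. X \<in> A \<Longrightarrow> Q \<subseteq> X \<Longrightarrow> X = Q"
  using subset_Zorn_nonempty[of A] \<open>I \<in> A\<close> chain by blast
 have QI: "ideal Q R" "I \<subseteq> Q" "Q \<inter> M = {}" using Q(1) unfolding A_def by auto
 interpret Q: ideal Q R by fact
 have bigger: "\<exists>q\<in>Q. \<exists>r\<in>carrier R. q \<oplus> r \<otimes> a \<in> M" if a: "a \<in> carrier R" "a \<notin> Q" for a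
 proof (rule ccontr)
  assume no: "\<not> ?thesis"
  let ?J = "Q <+>\<^bsub>R\<^esub> PIdl a"
  have J: "ideal ?J R" using add_ideals[OF QI(1) cgenideal_ideal[OF a(1)]] .
  have "?J \<inter> M = {}" using no unfolding set_add_def' cgenideal_def by blast
  moreover have "Q \<subseteq> ?J"
  proof
   fix q assume q: "q \<in> Q"
   then have "q = q \<oplus> \<zero> \<otimes> a" using a Q.Icarr by simp
   then show "q \<in> ?J" using q unfolding set_add_def' cgenideal_def by blast
  qed
  ultimately have "?J = Q" using Q(2)[of ?J] J QI(2) unfolding A_def by blast
  moreover have "a \<in> ?J"
  proof -
   have "a = \<zero> \<oplus> \<one> \<otimes> a" using a by simp
   then show ?thesis using Q.zero_closed unfolding set_add_def' cgenideal_def by blast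
  qed
  ultimately show False using a(2) by simp
 qed
 have "primeideal Q R"
 proof (rule primeidealI)
  show "ideal Q R" by fact
  show "cring R" by (rule cring_axioms)
  show "carrier R \<noteq> Q" using QI(3) M by blast
  fix a b assume ab: "a \<in> carrier R" "b \<in> carrier R" "a \<otimes> b \<in> Q"
  show "a \<in> Q \<or> b \<in> Q"
  proof (rule ccontr)
   assume "\<not> (a \<in> Q \<or> b \<in> Q)"
   then obtain q r q' r' where q: "q \<in> Q" "r \<in> carrier R" "q \<oplus> r \<otimes> a \<in> M"
    "q' \<in> Q" "r' \<in> carrier R" "q' \<oplus> r' \<otimes> b \<in> M" using bigger ab by meson
   have qc: "q \<in> carrier R" "q' \<in> carrier R" using q Q.Icarr by auto
   have "(q \<oplus> r \<otimes> a) \<otimes> (q' \<oplus> r' \<otimes> b)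
     = q \<otimes> (q' \<oplus> r' \<otimes> b) \<oplus> (r \<otimes> a \<otimes> q' \<oplus> (r \<otimes> r') \<otimes> (a \<otimes> b))"
    using q qc ab by algebra
   also have "\<dots> \<in> Q"
   proof (intro Q.a_closed)
    show "q \<otimes> (q' \<oplus> r' \<otimes> b) \<in> Q" using q qc ab by (intro Q.I_r_closed) auto
    show "r \<otimes> a \<otimes> q' \<in> Q" using q qc ab by (auto intro!: Q.I_l_closed[of "a \<otimes> b"] Q.I_l_closed[of q'])
    show "(r \<otimes> r') \<otimes> (a \<otimes> b) \<in> Q" using q qc ab by (auto intro!: Q.I_l_closed[of "a \<otimes> b"] Q.I_l_closed[of q'])
   qed
   finally show False using mult[OF q(3,6)] QI(3) by blast
  qed
 qed
 then show ?thesis using QI by blast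
qed

section \<open>Chains of prime ideals\<close>

text \<open>
 The elements of \<open>D[s]\<close> that are polynomial expressions in \<open>s\<close> of degree less than \<open>n\<close>.
\<close>
primrec (in ring) poly_span :: "'a set \<Rightarrow> 'a \<Rightarrow> nat \<Rightarrow> 'a set" where
 "poly_span D s 0 = {\<zero>}"
| "poly_span D s (Suc n) = {r \<oplus> d \<otimes> s [^] n | r d. r \<in> poly_span D s n \<and> d \<in> D}"

context cring
begin

lemma poly_span_closed:
 assumes "D \<subseteq> carrier R" "s \<in> carrier R"
 shows "poly_span D s n \<subseteq> carrier R" by (induction n) (use assms in auto)

lemma poly_span_zero:
 assumes "subring D R" "s \<in> carrier R"
 shows "\<zero> \<in> poly_span D s n"
proof (induction n)
 case (Suc n)
 have "\<zero> = \<zero> \<oplus> \<zero> \<otimes> s [^] n" using assms by simp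
 then show ?case using Suc subringE(2)[OF assms(1)] by auto
qed simp

lemma poly_span_Suc_mono:
 assumes "subring D R" "s \<in> carrier R" "x \<in> poly_span D s n"
 shows "x \<in> poly_span D s (Suc n)"
proof -
 have "x = x \<oplus> \<zero> \<otimes> s [^] n"
  using assms poly_span_closed[OF subringE(1)[OF assms(1)] assms(2), of n] by auto
 then show ?thesis using assms(3) subringE(2)[OF assms(1)] by auto
qed

lemma poly_span_mono:
 assumes "subring D R" "s \<in> carrier R" "n \<le> m"
 shows "poly_span D s n \<subseteq> poly_span D s m"
 using assms(3) by (induction m rule: dec_induct) (use poly_span_Suc_mono[OF assms(1,2)] in blast)+

lemma poly_span_add:
 assumes D: "subring D R" "s \<in> carrier R" and "x \<in> poly_span D s n" "y \<in> poly_span D s n"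
 shows "x \<oplus> y \<in> poly_span D s n" using assms(3,4)
proof (induction n arbitrary: x y)
 case (Suc n)
 then obtain r d r' d' where
  r: "r \<in> poly_span D s n" "d \<in> D" "x = r \<oplus> d \<otimes> s [^] n"
   "r' \<in> poly_span D s n" "d' \<in> D" "y = r' \<oplus> d' \<otimes> s [^] n" by auto
 have c: "r \<in> carrier R" "r' \<in> carrier R" "d \<in> carrier R" "d' \<in> carrier R"
  using r poly_span_closed[OF subringE(1)[OF D(1)] D(2)] subringE(1)[OF D(1)] by auto
 have "x \<oplus> y = (r \<oplus> r') \<oplus> (d \<oplus> d') \<otimes> s [^] n"
  using c D(2) nat_pow_closed[OF D(2), of n] r(3,6) by algebra
 then show ?case using Suc.IH[OF r(1,4)] subringE(7)[OF D(1) r(2,5)] by auto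
qed simp

lemma poly_span_scale:
 assumes D: "subring D R" "s \<in> carrier R" and "x \<in> poly_span D s n" "c \<in> D"
 shows "c \<otimes> x \<in> poly_span D s n" using assms(3)
proof (induction n arbitrary: x)
 case 0
 then show ?case using assms(4) subringE(1)[OF D(1)] by auto
next
 case (Suc n)
 then obtain r d where r: "r \<in> poly_span D s n" "d \<in> D" "x = r \<oplus> d \<otimes> s [^] n" by auto
 have c: "r \<in> carrier R" "d \<in> carrier R" "c \<in> carrier R"
  using r assms(4) poly_span_closed[OF subringE(1)[OF D(1)] D(2)] subringE(1)[OF D(1)] by auto
 have "c \<otimes> x = c \<otimes> r \<oplus> (c \<otimes> d) \<otimes> s [^] n"
  using c D(2) nat_pow_closed[OF D(2), of n] r(3) by algebra
 then show ?case using Suc.IH[OF r(1)] subringE(6)[OF D(1) assms(4) r(2)] by auto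
qed

lemma poly_span_minus:
 assumes D: "subring D R" "s \<in> carrier R" and "x \<in> poly_span D s n"
 shows "\<ominus> x \<in> poly_span D s n"
proof -
 have "\<ominus> x = (\<ominus> \<one>) \<otimes> x"
  using assms poly_span_closed[OF subringE(1)[OF D(1)] D(2), of n] by (auto simp: l_minus)
 then show ?thesis using poly_span_scale[OF assms] subringE(3,5)[OF D(1)] by simp
qed

lemma poly_span_diff:
 assumes D: "subring D R" "s \<in> carrier R" and "x \<in> poly_span D s n" "y \<in> poly_span D s n"
 shows "x \<ominus> y \<in> poly_span D s n"
 unfolding a_minus_def using poly_span_add[OF D assms(3) poly_span_minus[OF D assms(4)]] .

lemma poly_span_shift:
 assumes D: "subring D R" "s \<in> carrier R" and "x \<in> poly_span D s n"
 shows "x \<otimes> s [^] m \<in> poly_span D s (n + m)" using assms(3)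
proof (induction n arbitrary: x)
 case 0
 then show ?case using D poly_span_zero[OF D] by simp
next
 case (Suc n)
 then obtain r d where r: "r \<in> poly_span D s n" "d \<in> D" "x = r \<oplus> d \<otimes> s [^] n" by auto
 have c: "r \<in> carrier R" "d \<in> carrier R"
  using r poly_span_closed[OF subringE(1)[OF D(1)] D(2)] subringE(1)[OF D(1)] by auto
 have "x \<otimes> s [^] m = r \<otimes> s [^] m \<oplus> d \<otimes> s [^] (n + m)"
  unfolding r(3) using c D(2) by (simp add: l_distr m_assoc nat_pow_mult)
 then show ?case using Suc.IH[OF r(1)] r(2) by auto
qed

lemma poly_span_const:
 assumes "subring D R" "s \<in> carrier R" "d \<in> D"
 shows "d \<in> poly_span D s (Suc n)"
proof -
 have "d = \<zero> \<oplus> d \<otimes> s [^] (0::nat)" using assms subringE(1)[OF assms(1)] by auto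
 then have "d \<in> poly_span D s (Suc 0)" using assms(3) by auto
 then show ?thesis using poly_span_mono[OF assms(1,2), of "Suc 0" "Suc n"] by auto
qed

lemma poly_span_mult:
 assumes D: "subring D R" "s \<in> carrier R" and "x \<in> poly_span D s n" "y \<in> poly_span D s (Suc m)"
 shows "x \<otimes> y \<in> poly_span D s (n + m)" using assms(4)
proof (induction m arbitrary: y)
 case 0
 have xc: "x \<in> carrier R" using assms(3) poly_span_closed[OF subringE(1)[OF D(1)] D(2)] by blast
 from 0 obtain d where d: "d \<in> D" "y = \<zero> \<oplus> d \<otimes> s [^] (0::nat)" by auto
 then have "x \<otimes> y = d \<otimes> x" using xc D subringE(1)[OF D(1)] by (auto simp: m_comm)
 then show ?case using poly_span_scale[OF D assms(3) d(1)] by simp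
next
 case (Suc m)
 have xc: "x \<in> carrier R" using assms(3) poly_span_closed[OF subringE(1)[OF D(1)] D(2)] by blast
 from Suc.prems obtain r d where r: "r \<in> poly_span D s (Suc m)" "d \<in> D" "y = r \<oplus> d \<otimes> s [^] Suc m" by auto
 have c: "r \<in> carrier R" "d \<in> carrier R"
  using subsetD[OF poly_span_closed[OF subringE(1)[OF D(1)] D(2)] r(1)]
   subsetD[OF subringE(1)[OF D(1)] r(2)] by auto
 have "x \<otimes> y = x \<otimes> r \<oplus> d \<otimes> (x \<otimes> s [^] Suc m)"
  unfolding r(3) using c xc D(2) by (simp add: r_distr m_lcomm del: nat_pow_Suc)
 moreover have "x \<otimes> r \<in> poly_span D s (n + Suc m)"
  using poly_span_mono[OF D, of "n + m" "n + Suc m"] Suc.IH[OF r(1)] by auto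
 moreover have "d \<otimes> (x \<otimes> s [^] Suc m) \<in> poly_span D s (n + Suc m)"
  by (rule poly_span_scale[OF D poly_span_shift[OF D assms(3)] r(2)])
 ultimately show ?case using poly_span_add[OF D] by presburger
qed

lemma simple_extension_eq_poly_span:
 assumes D: "subring D R" "s \<in> carrier R"
 shows "simple_extension D s = (\<Union>n. poly_span D s n)"
proof
 show "simple_extension D s \<subseteq> (\<Union>n. poly_span D s n)"
 proof
  fix x assume "x \<in> simple_extension D s"
  then show "x \<in> (\<Union>n. poly_span D s n)"
  proof (induction rule: simple_extension.induct)
   case zero
   then show ?case using poly_span_zero[OF D] by blast
  next
   case (lin k1 k2)
   then obtain n where n: "k1 \<in> poly_span D s n" by blast
   have "k1 \<otimes> s [^] (1::nat) \<in> poly_span D s (Suc n)"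
    using poly_span_shift[OF D n, of 1] by simp
   then have "k1 \<otimes> s \<in> poly_span D s (Suc n)" using D by simp
   then have "k1 \<otimes> s \<oplus> k2 \<in> poly_span D s (Suc n)"
    by (rule poly_span_add[OF D _ poly_span_const[OF D lin(2)]])
   then show ?case by blast
  qed
 qed
next
 have sub: "poly_span D s n \<subseteq> simple_extension D s" for n
 proof (induction n)
  case 0
  then show ?case by simp
 next
  case (Suc n)
  have pow: "d \<otimes> s [^] m \<in> simple_extension D s" if "d \<in> D" for d and m :: nat
  proof (induction m)
   case 0
   have "\<zero> \<otimes> s \<oplus> d \<in> simple_extension D s" using that by (intro lin) auto
   then show ?case using that D subringE(1)[OF D(1)] by auto
  next
   case (Suc m)
   then have "(d \<otimes> s [^] m) \<otimes> s \<oplus> \<zero> \<in> simple_extension D s"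
    using subringE(2)[OF D(1)] by (intro lin) auto
   then show ?case using that D subringE(1)[OF D(1)] by (auto simp: m_assoc)
  qed
  have add: "x \<oplus> y \<in> simple_extension D s"
   if "x \<in> simple_extension D s" "y \<in> simple_extension D s" for x y using that
  proof (induction arbitrary: y rule: simple_extension.induct)
   case zero
   then show ?case using simple_extension_in_carrier[OF subringE(1)[OF D(1)] D(2)] by auto
  next
   case (lin k1 k2)
   note cc = simple_extension_in_carrier[OF subringE(1)[OF D(1)] D(2)]
   from lin.prems show ?case
   proof (cases rule: simple_extension.cases)
    case zero
    have "k1 \<otimes> s \<oplus> k2 \<in> simple_extension D s" using lin by (intro simple_extension.lin)
    moreover from this have "k1 \<otimes> s \<oplus> k2 \<in> carrier R" using cc by blast
    ultimately show ?thesis using zero by simp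
   next
    case (lin l1 l2)
    have c: "k1 \<in> carrier R" "l1 \<in> carrier R" "k2 \<in> carrier R" "l2 \<in> carrier R"
     using lin \<open>k1 \<in> simple_extension D s\<close> \<open>k2 \<in> D\<close> cc subringE(1)[OF D(1)] by auto
    have "(k1 \<otimes> s \<oplus> k2) \<oplus> y = (k1 \<oplus> l1) \<otimes> s \<oplus> (k2 \<oplus> l2)"
     unfolding lin(1) using c D(2) by algebra
    moreover have "(k1 \<oplus> l1) \<otimes> s \<oplus> (k2 \<oplus> l2) \<in> simple_extension D s"
     using lin(2,3) \<open>k2 \<in> D\<close> subringE(7)[OF D(1)]
      \<open>\<And>y. y \<in> simple_extension D s \<Longrightarrow> k1 \<oplus> y \<in> simple_extension D s\<close>
     by (intro simple_extension.lin) auto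
    ultimately show ?thesis by simp
   qed
  qed
  show ?case using Suc pow add by auto
 qed
 then show "(\<Union>n. poly_span D s n) \<subseteq> simple_extension D s" by blast
qed

lemma simple_extension_subring:
 assumes D: "subring D R" "s \<in> carrier R"
 shows "subring (simple_extension D s) R"
proof (rule subringI)
 note U = simple_extension_eq_poly_span[OF D]
 show "simple_extension D s \<subseteq> carrier R"
  using simple_extension_in_carrier[OF subringE(1)[OF D(1)] D(2)] .
 show "\<one> \<in> simple_extension D s"
  using simple_extension_incl[OF subringE(1)[OF D(1)] D(2)] subringE(3)[OF D(1)] by blast
 show "\<ominus> h \<in> simple_extension D s" if "h \<in> simple_extension D s" for h
  using that poly_span_minus[OF D] unfolding U by blast
 fix x y assume "x \<in> simple_extension D s" "y \<in> simple_extension D s"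
 then obtain n m where nm: "x \<in> poly_span D s n" "y \<in> poly_span D s m" unfolding U by blast
 then have xy: "x \<in> poly_span D s (max n m)" "y \<in> poly_span D s (max n m)"
  using poly_span_mono[OF D, of n "max n m"] poly_span_mono[OF D, of m "max n m"] by auto
 moreover have "y \<in> poly_span D s (Suc (max n m))" using poly_span_Suc_mono[OF D xy(2)] .
 ultimately show "x \<otimes> y \<in> simple_extension D s" "x \<oplus> y \<in> simple_extension D s"
  using poly_span_mult[OF D xy(1)] poly_span_add[OF D xy] unfolding U by (meson UN_I UNIV_I)+
qed

lemma finite_extension_subring:
 assumes "subring D R" "set xs \<subseteq> carrier R"
 shows "subring (finite_extension D xs) R"
 using assms(2) by (induction xs) (use assms(1) simple_extension_subring in auto)

lemma finite_extension_members:
 assumes "subring D R" "set xs \<subseteq> carrier R"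
 shows "set xs \<subseteq> finite_extension D xs" using assms(2)
proof (induction xs)
 case (Cons x xs)
 then have "subring (finite_extension D xs) R" using finite_extension_subring[OF assms(1)] by simp
 then show ?case using Cons simple_extension_mem[of "finite_extension D xs" x]
   simple_extension_incl[OF subringE(1), of "finite_extension D xs" x] by auto
qed simp

end

context ring
begin

lemma eval_in_poly_span:
 assumes "set q \<subseteq> D" "D \<subseteq> carrier R" "s \<in> carrier R"
 shows "eval q s \<in> poly_span D s (length q)" using assms(1)
proof (induction q)
 case (Cons d q)
 have "eval q s \<in> carrier R" using Cons assms by (intro eval_in_carrier) auto
 then have "eval (d # q) s = eval q s \<oplus> d \<otimes> s [^] length q"
  using Cons.prems assms by (auto intro: a_comm)
 then show ?case using Cons by auto
qed simp

lemma poly_span_as_eval: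
 assumes "x \<in> poly_span D s n" "D \<subseteq> carrier R" "s \<in> carrier R"
 shows "\<exists>q. set q \<subseteq> D \<and> length q = n \<and> eval q s = x" using assms(1)
proof (induction n arbitrary: x)
 case (Suc n)
 then obtain r d where r: "r \<in> poly_span D s n" "d \<in> D" "x = r \<oplus> d \<otimes> s [^] n" by auto
 obtain q where q: "set q \<subseteq> D" "length q = n" "eval q s = r" using Suc.IH[OF r(1)] by blast
 have "r \<in> carrier R" using q assms(2,3) eval_in_carrier by blast
 then have "eval (d # q) s = x" using q r assms(2,3) by (auto intro: a_comm)
 then show ?case using q r by (intro exI[of _ "d # q"]) auto
qed simp

definition relation_free :: "'a set \<Rightarrow> 'a \<Rightarrow> bool" where
 "relation_free D s \<longleftrightarrow>
   (\<forall>n. \<forall>r\<in>poly_span D s n. \<forall>d\<in>D. r \<oplus> d \<otimes> s [^] n = \<zero> \<longrightarrow> d = \<zero>)"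

lemma transcendental_imp_relation_free:
 assumes "D \<subseteq> carrier R" "s \<in> carrier R" "(transcendental over D) s"
 shows "relation_free D s" unfolding relation_free_def
proof (intro allI ballI impI)
 fix n r d assume r: "r \<in> poly_span D s n" "d \<in> D" "r \<oplus> d \<otimes> s [^] n = \<zero>"
 show "d = \<zero>"
 proof (rule ccontr)
  assume d: "d \<noteq> \<zero>"
  obtain q where q: "set q \<subseteq> D" "length q = n" "eval q s = r"
   using poly_span_as_eval[OF r(1) assms(1,2)] by blast
  have "d # q \<in> carrier (D[X])"
   using q r d unfolding sym[OF univ_poly_carrier] polynomial_def by simp
  moreover have "r \<in> carrier R" using q assms(1,2) eval_in_carrier by blast
  then have "eval (d # q) s = \<zero>" using q r assms(1,2) a_comm[of r "d \<otimes> s [^] n"] by auto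
  ultimately show False using eval_transcendental[OF assms(3)] by blast
 qed
qed

lemma (in domain) not_relation_free:
 assumes "subring D R" "s \<in> carrier R" "(algebraic over D) s"
 obtains n r d where "r \<in> poly_span D s n" "d \<in> D" "d \<noteq> \<zero>" "r \<oplus> d \<otimes> s [^] n = \<zero>"
proof -
 obtain q where q: "q \<in> carrier (D[X])" "q \<noteq> []" "eval q s = \<zero>"
  using algebraicE[OF assms] by blast
 then obtain d q' where d: "q = d # q'" by (cases q) auto
 have D: "set q \<subseteq> D" "d \<noteq> \<zero>"
  using q d unfolding sym[OF univ_poly_carrier] polynomial_def by auto
 have e: "eval q' s \<in> poly_span D s (length q')"
  using D d subringE(1)[OF assms(1)] assms(2) by (intro eval_in_poly_span) auto
 have "eval q' s \<in> carrier R" "d \<in> carrier R"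
  using D d subringE(1)[OF assms(1)] assms(2) by (auto intro!: eval_in_carrier)
 then have "eval q' s \<oplus> d \<otimes> s [^] length q' = \<zero>"
  using q(3) d assms(2) by (simp add: a_comm)
 then show thesis using that[OF e] D d by auto
qed

end

context cring
begin

lemma poly_span_leading_term:
 assumes "x \<in> poly_span D s n" "x \<noteq> \<zero>" "subring D R" "s \<in> carrier R"
 shows "\<exists>m r d. m < n \<and> r \<in> poly_span D s m \<and> d \<in> D \<and> d \<noteq> \<zero> \<and> x = r \<oplus> d \<otimes> s [^] m"
 using assms(1,2)
proof (induction n arbitrary: x)
 case (Suc n)
 then obtain r d where r: "r \<in> poly_span D s n" "d \<in> D" "x = r \<oplus> d \<otimes> s [^] n" by auto
 show ?case
 proof (cases "d = \<zero>")
  case True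
  have "r \<in> carrier R" using r(1) poly_span_closed[OF subringE(1)[OF assms(3)] assms(4)] by blast
  then have "x = r" using r True assms(4) by simp
  then show ?thesis using Suc.IH[OF r(1)] Suc.prems(2) less_SucI by metis
 qed (use r in blast)
qed simp

lemma leading_term_mult:
 assumes D: "subring D R" "s \<in> carrier R"
  and x: "r \<in> poly_span D s m" "d \<in> D" and y: "r' \<in> poly_span D s n" "e \<in> D"
 shows "\<exists>r''\<in>poly_span D s (m + n).
  (r \<oplus> d \<otimes> s [^] m) \<otimes> (r' \<oplus> e \<otimes> s [^] n) = r'' \<oplus> (d \<otimes> e) \<otimes> s [^] (m + n)"
proof -
 note cl = subsetD[OF poly_span_closed[OF subringE(1)[OF D(1)] D(2)]] subsetD[OF subringE(1)[OF D(1)]]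
 have c: "r \<in> carrier R" "r' \<in> carrier R" "d \<in> carrier R" "e \<in> carrier R"
  "s [^] m \<in> carrier R" "s [^] n \<in> carrier R" using cl x y D(2) by auto
 let ?y = "r' \<oplus> e \<otimes> s [^] n"
 have "?y \<in> poly_span D s (Suc n)" using y by auto
 then have 1: "r \<otimes> ?y \<in> poly_span D s (m + n)" using poly_span_mult[OF D x(1)] by simp
 have 2: "d \<otimes> (r' \<otimes> s [^] m) \<in> poly_span D s (m + n)"
  using poly_span_scale[OF D poly_span_shift[OF D y(1), of m] x(2)] by (simp add: add.commute)
 have "(r \<oplus> d \<otimes> s [^] m) \<otimes> ?y = (r \<otimes> ?y \<oplus> d \<otimes> (r' \<otimes> s [^] m)) \<oplus> (d \<otimes> e) \<otimes> (s [^] m \<otimes> s [^] n)"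
  using c by algebra
 also have "s [^] m \<otimes> s [^] n = s [^] (m + n)" using D(2) by (simp add: nat_pow_mult)
 finally show ?thesis using poly_span_add[OF D 1 2] by blast
qed

lemma leading_term_pow:
 assumes D: "subring D R" "s \<in> carrier R" and x: "r \<in> poly_span D s m" "d \<in> D"
 shows "d [^] (N::nat) \<in> D \<and> (\<exists>r'\<in>poly_span D s (m * N).
  (r \<oplus> d \<otimes> s [^] m) [^] N = r' \<oplus> d [^] N \<otimes> s [^] (m * N))"
proof (induction N)
 case 0
 then show ?case using subringE(3)[OF D(1)] D by simp
next
 case (Suc N)
 then obtain r' where r': "r' \<in> poly_span D s (m * N)" "d [^] N \<in> D"
  "(r \<oplus> d \<otimes> s [^] m) [^] N = r' \<oplus> d [^] N \<otimes> s [^] (m * N)" by blast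
 have "\<exists>r''\<in>poly_span D s (m * N + m).
  (r' \<oplus> d [^] N \<otimes> s [^] (m * N)) \<otimes> (r \<oplus> d \<otimes> s [^] m)
   = r'' \<oplus> (d [^] N \<otimes> d) \<otimes> s [^] (m * N + m)"
  using leading_term_mult[OF D r'(1,2) x] .
 then show ?case using r' subringE(6)[OF D(1) r'(2) x(2)] by (simp add: add.commute)
qed

lemma leading_term_unique:
 assumes D: "subring D R" "s \<in> carrier R" and free: "relation_free D s"
  and x: "r \<in> poly_span D s m" "d \<in> D" "d \<noteq> \<zero>" and y: "r' \<in> poly_span D s n" "e \<in> D" "e \<noteq> \<zero>"
  and eq: "r \<oplus> d \<otimes> s [^] m = r' \<oplus> e \<otimes> s [^] n"
 shows "m = n \<and> d = e"
proof -
 note cl = subsetD[OF poly_span_closed[OF subringE(1)[OF D(1)] D(2)]] subsetD[OF subringE(1)[OF D(1)]]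
 have c: "r \<in> carrier R" "r' \<in> carrier R" "d \<in> carrier R" "e \<in> carrier R"
  "s [^] m \<in> carrier R" "s [^] n \<in> carrier R" using cl x y D(2) by auto
 have lt: False if "m' < n'" "a \<in> poly_span D s m'" "b \<in> D" "a' \<in> poly_span D s n'" "b' \<in> D" "b' \<noteq> \<zero>"
  "a \<oplus> b \<otimes> s [^] m' = a' \<oplus> b' \<otimes> s [^] n'" for m' n' a b a' b'
 proof -
  have "a \<oplus> b \<otimes> s [^] m' \<in> poly_span D s (Suc m')"
   unfolding poly_span.simps using that(2,3) by blast
  then have "a \<oplus> b \<otimes> s [^] m' \<in> poly_span D s n'"
   using poly_span_mono[OF D, of "Suc m'" n'] that(1) by (meson Suc_leI subsetD)
  then have "a' \<ominus> (a \<oplus> b \<otimes> s [^] m') \<in> poly_span D s n'"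
   using poly_span_diff[OF D that(4)] by simp
  moreover have "a' \<in> carrier R" "b' \<otimes> s [^] n' \<in> carrier R" using cl that D(2) by auto
  then have "(a' \<ominus> (a' \<oplus> b' \<otimes> s [^] n')) \<oplus> b' \<otimes> s [^] n' = \<zero>" by algebra
  ultimately show False using free that(5,6,7) unfolding relation_free_def by metis
 qed
 have "m = n" using lt[OF _ x(1,2) y eq] lt[OF _ y(1,2) x eq[symmetric]] by (meson linorder_neqE_nat)
 have "(r \<ominus> r') \<oplus> (d \<ominus> e) \<otimes> s [^] m = (r \<oplus> d \<otimes> s [^] m) \<ominus> (r' \<oplus> e \<otimes> s [^] m)"
  using c by algebra
 also have "\<dots> = \<zero>" using eq \<open>m = n\<close> c by simp
 finally have "d \<ominus> e = \<zero>"
  using free poly_span_diff[OF D x(1)] y(1) \<open>m = n\<close> subringE(5,7)[OF D(1)] x(2) y(2)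
  unfolding relation_free_def a_minus_def by blast
 then show ?thesis using \<open>m = n\<close> c by simp
qed

end

context field
begin

lemma generate_field_denominator:
 assumes D: "subring D R" and z: "z \<in> generate_field R D"
 shows "\<exists>e\<in>D. e \<noteq> \<zero> \<and> e \<otimes> z \<in> D"
proof -
 note DE = subringE[OF D]
 have gc: "x \<in> carrier R" if "x \<in> generate_field R D" for x
  using generate_field_in_carrier[OF DE(1) that] .
 from z show ?thesis
 proof (induction rule: generate_field.induct)
  case one
  then show ?case using DE(3) by (intro bexI[of _ \<one>]) auto
 next
  case (incl h)
  then show ?case using DE by (intro bexI[of _ \<one>]) auto
 next
  case (a_inv h)
  then obtain e where e: "e \<in> D" "e \<noteq> \<zero>" "e \<otimes> h \<in> D" by blast
  have "e \<otimes> (\<ominus> h) = \<ominus> (e \<otimes> h)" using e DE(1) gc[OF a_inv.hyps] by (auto simp: r_minus)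
  then show ?case using e DE(5) by metis
 next
  case (m_inv h)
  then obtain e where e: "e \<in> D" "e \<noteq> \<zero>" "e \<otimes> h \<in> D" by blast
  have c: "e \<in> carrier R" "h \<in> carrier R" "h \<in> Units R" "inv h \<in> carrier R"
   using e DE(1) gc m_inv field_Units by auto
  have "(e \<otimes> h) \<otimes> inv h = e" using c by (simp add: m_assoc)
  moreover have "e \<otimes> h \<noteq> \<zero>" using e m_inv c integral_iff by blast
  ultimately show ?case using e by metis
 next
  case (eng_add h1 h2)
  then obtain e1 e2 where e: "e1 \<in> D" "e1 \<noteq> \<zero>" "e1 \<otimes> h1 \<in> D" "e2 \<in> D" "e2 \<noteq> \<zero>" "e2 \<otimes> h2 \<in> D" by blast
  have c: "e1 \<in> carrier R" "e2 \<in> carrier R" "h1 \<in> carrier R" "h2 \<in> carrier R"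
   using e DE(1) gc eng_add by auto
  have "(e1 \<otimes> e2) \<otimes> (h1 \<oplus> h2) = e2 \<otimes> (e1 \<otimes> h1) \<oplus> e1 \<otimes> (e2 \<otimes> h2)" using c by algebra
  also have "\<dots> \<in> D" using e DE by auto
  finally show ?case using e DE(6)[of e1 e2] c integral_iff[of e1 e2] by blast
 next
  case (eng_mult h1 h2)
  then obtain e1 e2 where e: "e1 \<in> D" "e1 \<noteq> \<zero>" "e1 \<otimes> h1 \<in> D" "e2 \<in> D" "e2 \<noteq> \<zero>" "e2 \<otimes> h2 \<in> D" by blast
  have c: "e1 \<in> carrier R" "e2 \<in> carrier R" "h1 \<in> carrier R" "h2 \<in> carrier R"
   using e DE(1) gc eng_mult by auto
  have "(e1 \<otimes> e2) \<otimes> (h1 \<otimes> h2) = (e1 \<otimes> h1) \<otimes> (e2 \<otimes> h2)" using c by algebra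
  also have "\<dots> \<in> D" using e DE by auto
  finally show ?case using e DE(6)[of e1 e2] c integral_iff[of e1 e2] by blast
 qed
qed

lemma algebraic_extension_divides_constant:
 assumes D: "subring D R" "s \<in> carrier R" and alg: "(algebraic over D) s"
  and b: "b \<in> simple_extension D s" "b \<noteq> \<zero>"
 shows "\<exists>e\<in>D. e \<noteq> \<zero> \<and> (\<exists>y\<in>simple_extension D s. e = b \<otimes> y)"
proof -
 note DE = subringE[OF D(1)]
 define L where "L = generate_field R D"
 have L: "subfield L R" "D \<subseteq> L" "L \<subseteq> carrier R"
  unfolding L_def using generate_field_is_subfield[OF DE(1)] generate_field_incl[OF DE(1)]
  by (auto intro: generate_field.incl)
 have SD: "subring (simple_extension D s) R" using simple_extension_subring[OF D] .
 have "subfield (simple_extension L s) R"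
  using simple_extension_is_subfield[OF L(1) D(2)] algebraic_mono[OF L(2)] alg by blast
 moreover have bL: "b \<in> simple_extension L s" using mono_simple_extension[OF L(2)] b(1) by blast
 ultimately have "inv b \<in> simple_extension L s" using subfield_m_inv(1) b(2) by blast
 moreover have "\<exists>e\<in>D. e \<noteq> \<zero> \<and> e \<otimes> z \<in> simple_extension D s" if "z \<in> simple_extension L s" for z
  using that
 proof (induction rule: simple_extension.induct)
  case zero
  then show ?case using DE(1,3) subringE(2)[OF SD] by (intro bexI[of _ \<one>]) auto
 next
  case (lin k1 k2)
  then obtain e1 where e1: "e1 \<in> D" "e1 \<noteq> \<zero>" "e1 \<otimes> k1 \<in> simple_extension D s" by blast
  obtain e2 where e2: "e2 \<in> D" "e2 \<noteq> \<zero>" "e2 \<otimes> k2 \<in> D"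
   using generate_field_denominator[OF D(1)] lin(2) unfolding L_def by blast
  have c: "e1 \<in> carrier R" "e2 \<in> carrier R" "k1 \<in> carrier R" "k2 \<in> carrier R"
   using e1 e2 DE(1) lin L(3) simple_extension_in_carrier[OF L(3) D(2)] by auto
  have DS: "D \<subseteq> simple_extension D s" using simple_extension_incl[OF DE(1) D(2)] .
  have "(e1 \<otimes> e2) \<otimes> (k1 \<otimes> s \<oplus> k2) = (e2 \<otimes> (e1 \<otimes> k1)) \<otimes> s \<oplus> e1 \<otimes> (e2 \<otimes> k2)"
   using c D(2) by algebra
  also have "\<dots> \<in> simple_extension D s"
  proof (rule simple_extension.lin)
   show "e2 \<otimes> (e1 \<otimes> k1) \<in> simple_extension D s" using subringE(6)[OF SD] DS e1 e2 by blast
   show "e1 \<otimes> (e2 \<otimes> k2) \<in> D" using e1 e2 DE(6) by blast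
  qed
  finally show ?case using e1 e2 DE(6)[of e1 e2] c integral_iff[of e1 e2] by blast
 qed
 ultimately obtain e where e: "e \<in> D" "e \<noteq> \<zero>" "e \<otimes> inv b \<in> simple_extension D s" by blast
 have "b \<in> carrier R" using bL simple_extension_in_carrier[OF L(3) D(2)] by blast
 then have bi: "inv b \<in> carrier R" "b \<otimes> inv b = \<one>" using b(2) field_Units by auto
 have "e \<in> carrier R" using e(1) DE(1) by blast
 then have "e = b \<otimes> (e \<otimes> inv b)"
  using bi \<open>b \<in> carrier R\<close> m_lcomm[of b e "inv b"] by simp
 then show ?thesis using e by blast
qed

text \<open>
 If \<open>s\<close> is transcendental, \<open>a\<close> is the leading coefficient of \<open>b\<close>. If \<open>s\<close> is algebraic of degree
 \<open>d\<close>, powers of the leading coefficient \<open>l\<close> of a minimal relation reduce every element of \<open>D[s]\<close> to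
 degree less than \<open>d\<close>, where the representation is unique, so that a divisibility relation between
 elements of \<open>D\<close> can be read off from the constant terms; then \<open>a = l e\<close> with \<open>e\<close> a multiple of \<open>b\<close>.
\<close>
lemma divisibility_descends_simple:
 assumes D: "subring D R" "s \<in> carrier R" and b: "b \<in> simple_extension D s" "b \<noteq> \<zero>"
 shows "\<exists>a\<in>D. a \<noteq> \<zero> \<and> (\<forall>h\<in>D. \<forall>c\<in>D. \<forall>N::nat.
  (\<exists>y\<in>simple_extension D s. c \<otimes> b [^] N = h \<otimes> y) \<longrightarrow>
  (\<exists>M::nat. \<exists>y\<in>D. c \<otimes> a [^] M = h \<otimes> y))"
proof -
 note DE = subringE[OF D(1)]
 note cl = subsetD[OF poly_span_closed[OF DE(1) D(2)]] subsetD[OF DE(1)]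
 note U = simple_extension_eq_poly_span[OF D]
 have SD: "subring (simple_extension D s) R" using simple_extension_subring[OF D] .
 have bc: "b \<in> carrier R" using b(1) subringE(1)[OF SD] by blast
 show ?thesis
 proof (cases "(algebraic over D) s")
  case False
  then have free: "relation_free D s"
   using transcendental_imp_relation_free[OF DE(1) D(2)] by (simp add: over_def)
  obtain nb where "b \<in> poly_span D s nb" using b(1) unfolding U by blast
  then obtain m r d where br: "r \<in> poly_span D s m" "d \<in> D" "d \<noteq> \<zero>" "b = r \<oplus> d \<otimes> s [^] m"
   using poly_span_leading_term[OF _ b(2) D] by blast
  show ?thesis
  proof (intro bexI[of _ d] conjI ballI allI impI)
   fix h c and N :: nat
   assume h: "h \<in> D" and c: "c \<in> D" and "\<exists>y\<in>simple_extension D s. c \<otimes> b [^] N = h \<otimes> y"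
   then obtain y where y: "y \<in> simple_extension D s" "c \<otimes> b [^] N = h \<otimes> y" by blast
   have cc: "h \<in> carrier R" "c \<in> carrier R" "d \<in> carrier R" using h c br cl by auto
   show "\<exists>M::nat. \<exists>y\<in>D. c \<otimes> d [^] M = h \<otimes> y"
   proof (cases "c = \<zero>")
    case True
    then show ?thesis using DE(2) cc by (intro exI[of _ 0] bexI[of _ \<zero>]) auto
   next
    case cn: False
    have "b [^] N \<noteq> \<zero>" using bc b(2) by (induction N) (auto simp: integral_iff)
    then have "h \<otimes> y \<noteq> \<zero>" using y(2) cn cc bc integral_iff[of c "b [^] N"] by auto
    moreover have yc: "y \<in> carrier R" using y(1) subringE(1)[OF SD] by blast
    ultimately have hy: "h \<noteq> \<zero>" "y \<noteq> \<zero>" using cc by auto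
    obtain ny where "y \<in> poly_span D s ny" using y(1) unfolding U by blast
    then obtain n r1 g where yr: "r1 \<in> poly_span D s n" "g \<in> D" "g \<noteq> \<zero>" "y = r1 \<oplus> g \<otimes> s [^] n"
     using poly_span_leading_term[OF _ hy(2) D] by blast
    obtain r2 where r2: "d [^] N \<in> D" "r2 \<in> poly_span D s (m * N)"
      "b [^] N = r2 \<oplus> d [^] N \<otimes> s [^] (m * N)"
     using leading_term_pow[OF D br(1,2), of N] br(4) by blast
    have dN: "d [^] N \<noteq> \<zero>" using cc br(3) by (induction N) (auto simp: integral_iff)
    have c2: "r1 \<in> carrier R" "r2 \<in> carrier R" "g \<in> carrier R" using yr r2 cl by auto
    have "c \<otimes> r2 \<oplus> (c \<otimes> d [^] N) \<otimes> s [^] (m * N) = h \<otimes> r1 \<oplus> (h \<otimes> g) \<otimes> s [^] n"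
     using y(2) unfolding yr(4) r2(3) using cc c2 D(2) by (simp add: r_distr m_assoc)
    then have "c \<otimes> d [^] N = h \<otimes> g"
     using leading_term_unique[OF D free poly_span_scale[OF D r2(2) c] DE(6)[OF c r2(1)] _
       poly_span_scale[OF D yr(1) h] DE(6)[OF h yr(2)]]
      integral_iff cn dN hy(1) yr(3) cc c2 by auto
    then show ?thesis using yr(2) by blast
   qed
  qed (use br in auto)
 next
  case True
  define P where "P n = (\<exists>r\<in>poly_span D s n. \<exists>l\<in>D. l \<noteq> \<zero> \<and> r \<oplus> l \<otimes> s [^] n = \<zero>)" for n
  have "\<exists>n. P n" using not_relation_free[OF D True] unfolding P_def by metis
  define d where "d = (LEAST n. P n)"
  have "P d" unfolding d_def using \<open>\<exists>n. P n\<close> by (rule LeastI_ex)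
  then obtain r l where rl: "r \<in> poly_span D s d" "l \<in> D" "l \<noteq> \<zero>" "r \<oplus> l \<otimes> s [^] d = \<zero>"
   unfolding P_def by blast
  have minimal: "e = \<zero>" if "m < d" "r' \<in> poly_span D s m" "e \<in> D" "r' \<oplus> e \<otimes> s [^] m = \<zero>" for m r' e
   using not_less_Least[of m P] that unfolding P_def d_def by blast
  have lc: "l \<in> carrier R" "r \<in> carrier R" using rl cl by auto
  have d0: "d > 0"
  proof (rule ccontr)
   assume "\<not> d > 0"
   then show False using rl lc by simp
  qed
  have ls: "l \<otimes> s [^] d = \<ominus> r"
   using rl(4) lc D(2) by (metis a_comm m_closed minus_equality nat_pow_closed)
  have pw: "x [^] (M::nat) \<in> D" if "x \<in> D" for x M by (induction M) (use that DE in auto)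
  have reduce: "\<exists>M::nat. l [^] M \<otimes> y \<in> poly_span D s d" if "y \<in> poly_span D s n" for y n
   using that
  proof (induction n arbitrary: y)
   case 0
   then have "l [^] (0::nat) \<otimes> y \<in> poly_span D s d" using poly_span_zero[OF D] by simp
   then show ?case by blast
  next
   case (Suc n)
   show ?case
   proof (cases "Suc n \<le> d")
    case True
    then have "y \<in> poly_span D s d" using poly_span_mono[OF D True] Suc.prems by blast
    then have "l [^] (0::nat) \<otimes> y \<in> poly_span D s d" using cl(1)[OF Suc.prems] by simp
    then show ?thesis by blast
   next
    case False
    obtain r1 e where y: "r1 \<in> poly_span D s n" "e \<in> D" "y = r1 \<oplus> e \<otimes> s [^] n"
     using Suc.prems by auto
    obtain j where j: "n = d + j" using False by (metis le_Suc_ex not_less_eq_eq)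
    have c: "r1 \<in> carrier R" "e \<in> carrier R" "s [^] j \<in> carrier R" "s [^] d \<in> carrier R"
     using y cl D(2) by auto
    have "l \<otimes> y = l \<otimes> r1 \<oplus> e \<otimes> ((l \<otimes> s [^] d) \<otimes> s [^] j)"
     unfolding y(3) j nat_pow_mult[OF D(2), symmetric] using c lc by algebra
    also have "\<dots> = l \<otimes> r1 \<oplus> e \<otimes> ((\<ominus> r) \<otimes> s [^] j)" unfolding ls ..
    also have "\<dots> \<in> poly_span D s n"
    proof (rule poly_span_add[OF D poly_span_scale[OF D y(1) rl(2)]])
     show "e \<otimes> ((\<ominus> r) \<otimes> s [^] j) \<in> poly_span D s n"
      using poly_span_scale[OF D poly_span_shift[OF D poly_span_minus[OF D rl(1)], of j] y(2)]
      unfolding j .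
    qed
    finally obtain M :: nat where "l [^] M \<otimes> (l \<otimes> y) \<in> poly_span D s d" using Suc.IH by blast
    then have "l [^] Suc M \<otimes> y \<in> poly_span D s d"
     using lc y(3) c D(2) by (simp add: m_assoc)
    then show ?thesis by blast
   qed
  qed
  have const_term: "\<exists>q0\<in>D. x = h \<otimes> q0"
   if "q \<in> poly_span D s m" "m \<le> d" "m > 0" "x \<in> D" "h \<in> D" "x = h \<otimes> q" for q m x h
   using that
  proof (induction m arbitrary: q)
   case (Suc m)
   then obtain r1 e where y: "r1 \<in> poly_span D s m" "e \<in> D" "q = r1 \<oplus> e \<otimes> s [^] m" by auto
   have c: "r1 \<in> carrier R" "e \<in> carrier R" "s [^] m \<in> carrier R" "x \<in> carrier R" "h \<in> carrier R"
    using y cl D(2) Suc.prems by auto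
   show ?case
   proof (cases "m = 0")
    case True
    then have "q = e" using y c by simp
    then show ?thesis using Suc.prems y by blast
   next
    case False
    then have xm: "x \<in> poly_span D s m"
     using poly_span_const[OF D Suc.prems(4), of "m - 1"] by simp
    have eq: "h \<otimes> (r1 \<oplus> e \<otimes> s [^] m) = x" using Suc.prems(6) y(3) by simp
    have "(h \<otimes> r1 \<ominus> x) \<oplus> (h \<otimes> e) \<otimes> s [^] m = h \<otimes> (r1 \<oplus> e \<otimes> s [^] m) \<ominus> x"
     using c by algebra
    also have "\<dots> = \<zero>" unfolding eq using c by simp
    finally have "h \<otimes> e = \<zero>"
     using minimal[of m "h \<otimes> r1 \<ominus> x" "h \<otimes> e"] Suc.prems(2) DE(6)[OF Suc.prems(5) y(2)]
      poly_span_diff[OF D poly_span_scale[OF D y(1) Suc.prems(5)] xm] by simp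
    then have "x = h \<otimes> r1" using eq c by (simp add: r_distr m_assoc[symmetric])
    then show ?thesis using Suc.IH[OF y(1)] Suc.prems False by simp
   qed
  qed simp
  obtain e y0 where e: "e \<in> D" "e \<noteq> \<zero>" "y0 \<in> simple_extension D s" "e = b \<otimes> y0"
   using algebraic_extension_divides_constant[OF D True b] by blast
  have ec: "e \<in> carrier R" "y0 \<in> carrier R" using e cl subringE(1)[OF SD] by auto
  show ?thesis
  proof (intro bexI[of _ "l \<otimes> e"] conjI ballI allI impI)
   show "l \<otimes> e \<noteq> \<zero>" using rl(3) e(2) lc ec integral_iff by blast
   show "l \<otimes> e \<in> D" using DE(6) rl(2) e(1) by blast
   fix h c and N :: nat
   assume h: "h \<in> D" and c: "c \<in> D" and "\<exists>y\<in>simple_extension D s. c \<otimes> b [^] N = h \<otimes> y"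
   then obtain y where y: "y \<in> simple_extension D s" "c \<otimes> b [^] N = h \<otimes> y" by blast
   have y0N: "y0 [^] N \<in> simple_extension D s"
    by (induction N) (use e(3) subringE[OF SD] in auto)
   then have "y \<otimes> y0 [^] N \<in> simple_extension D s" using subringE(6)[OF SD] y(1) by blast
   then obtain n where "y \<otimes> y0 [^] N \<in> poly_span D s n" unfolding U by blast
   then obtain M :: nat where M: "l [^] M \<otimes> (y \<otimes> y0 [^] N) \<in> poly_span D s d"
    using reduce by blast
   have cc: "h \<in> carrier R" "c \<in> carrier R" "y \<in> carrier R"
    using h c cl y(1) subringE(1)[OF SD] by auto
   have "l [^] M \<otimes> (c \<otimes> e [^] N) = l [^] M \<otimes> ((c \<otimes> b [^] N) \<otimes> y0 [^] N)"
    unfolding e(4) using bc ec cc by (simp add: nat_pow_distrib m_assoc)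
   also have "\<dots> = h \<otimes> (l [^] M \<otimes> (y \<otimes> y0 [^] N))"
    unfolding y(2) using cc lc ec by (simp add: m_assoc m_lcomm)
   finally have eq: "l [^] M \<otimes> (c \<otimes> e [^] N) = h \<otimes> (l [^] M \<otimes> (y \<otimes> y0 [^] N))" .
   have "l [^] M \<otimes> (c \<otimes> e [^] N) \<in> D" using DE(6) pw rl(2) e(1) c by blast
   then obtain q0 where q0: "q0 \<in> D" "l [^] M \<otimes> (c \<otimes> e [^] N) = h \<otimes> q0"
    using const_term[OF M le_refl d0 _ h eq] by blast
   have "c \<otimes> (l \<otimes> e) [^] (M + N) = (l [^] M \<otimes> (c \<otimes> e [^] N)) \<otimes> (l [^] N \<otimes> e [^] M)"
   proof -
    have "l [^] M \<in> carrier R" "l [^] N \<in> carrier R" "e [^] M \<in> carrier R" "e [^] N \<in> carrier R"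
     using lc ec by auto
    then show ?thesis unfolding nat_pow_distrib[OF lc(1) ec(1)] nat_pow_mult[OF lc(1), symmetric]
      nat_pow_mult[OF ec(1), symmetric] using cc by algebra
   qed
   also have "\<dots> = h \<otimes> (q0 \<otimes> (l [^] N \<otimes> e [^] M))"
    unfolding q0(2) using cc q0(1) cl lc ec by (simp add: m_assoc)
   finally show "\<exists>M::nat. \<exists>y\<in>D. c \<otimes> (l \<otimes> e) [^] M = h \<otimes> y"
    using DE(6)[OF q0(1) DE(6)[OF pw[OF rl(2)] pw[OF e(1)]]] by (intro exI bexI)
  qed
 qed
qed

lemma divisibility_descends:
 assumes D: "subring D R" and "set xs \<subseteq> carrier R" "b \<in> finite_extension D xs" "b \<noteq> \<zero>"
 shows "\<exists>a\<in>D. a \<noteq> \<zero> \<and> (\<forall>h\<in>D. \<forall>c\<in>D. \<forall>N::nat.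
  (\<exists>y\<in>finite_extension D xs. c \<otimes> b [^] N = h \<otimes> y) \<longrightarrow>
  (\<exists>M::nat. \<exists>y\<in>D. c \<otimes> a [^] M = h \<otimes> y))" using assms(2-4)
proof (induction xs arbitrary: b)
 case Nil
 then show ?case by auto
next
 case (Cons x xs)
 let ?E = "finite_extension D xs"
 have E: "subring ?E R" using finite_extension_subring[OF D] Cons.prems by simp
 have DE: "D \<subseteq> ?E" using finite_extension_incl[OF subringE(1)[OF D]] Cons.prems by simp
 have x: "x \<in> carrier R" and b: "b \<in> simple_extension ?E x" using Cons.prems by auto
 obtain a1 where a1: "a1 \<in> ?E" "a1 \<noteq> \<zero>" "\<And>h c N. h \<in> ?E \<Longrightarrow> c \<in> ?E \<Longrightarrow>
   (\<exists>y\<in>simple_extension ?E x. c \<otimes> b [^] (N::nat) = h \<otimes> y) \<Longrightarrow>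
   (\<exists>M::nat. \<exists>y\<in>?E. c \<otimes> a1 [^] M = h \<otimes> y)"
  using divisibility_descends_simple[OF E x b Cons.prems(3)] by blast
 have "set xs \<subseteq> carrier R" using Cons.prems by simp
 from Cons.IH[OF this a1(1,2)] obtain a where a: "a \<in> D" "a \<noteq> \<zero>"
  "\<forall>h\<in>D. \<forall>c\<in>D. \<forall>N::nat. (\<exists>y\<in>?E. c \<otimes> a1 [^] N = h \<otimes> y) \<longrightarrow>
   (\<exists>M::nat. \<exists>y\<in>D. c \<otimes> a [^] M = h \<otimes> y)" by blast
 have "\<exists>M::nat. \<exists>y\<in>D. c \<otimes> a [^] M = h \<otimes> y"
  if hyp: "h \<in> D" "c \<in> D" "\<exists>y\<in>simple_extension ?E x. c \<otimes> b [^] N = h \<otimes> y" for h c and N :: nat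
 proof -
  obtain M :: nat where "\<exists>y\<in>?E. c \<otimes> a1 [^] M = h \<otimes> y"
   using a1(3)[OF subsetD[OF DE hyp(1)] subsetD[OF DE hyp(2)] hyp(3)] by blast
  then show ?thesis using a(3) hyp(1,2) by blast
 qed
 then show ?case using a(1,2) by (intro bexI[of _ a]) auto
qed

end

context field
begin

text \<open>
 Take \<open>h = 1 + t a\<close> with \<open>a\<close> as in the previous lemma for \<open>b = 1\<close>. A nonzero multiple \<open>c\<close>
 of \<open>h\<close> in \<open>G\<close> would make \<open>h\<close> divide \<open>c a\<^sup>M\<close> and hence \<open>c (t a)\<^sup>M\<close> in \<open>G[t]\<close>. But \<open>t a \<equiv> -1\<close> modulo \<open>h\<close>,
 so \<open>h\<close>, which has positive degree in \<open>t\<close>, would divide the constant \<open>\<plusminus>c\<close>.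
\<close>
lemma exists_multiple_avoiding_subring:
 assumes G: "subring G R" and t: "t \<in> carrier R" "(transcendental over G) t"
  and xs: "set xs \<subseteq> carrier R"
 shows "\<exists>h \<in> finite_extension (simple_extension G t) xs. h \<noteq> \<zero> \<and>
  (\<forall>y \<in> finite_extension (simple_extension G t) xs. h \<otimes> y \<in> G \<longrightarrow> h \<otimes> y = \<zero>)"
proof -
 let ?D = "simple_extension G t"
 let ?A = "finite_extension ?D xs"
 note GE = subringE[OF G]
 note GT = G t(1)
 note U = simple_extension_eq_poly_span[OF GT]
 have D: "subring ?D R" using simple_extension_subring[OF GT] .
 note DE = subringE[OF D]
 have A: "subring ?A R" using finite_extension_subring[OF D xs] .
 have free: "relation_free G t" using transcendental_imp_relation_free[OF GE(1) t] .
 have DA: "?D \<subseteq> ?A" using finite_extension_incl[OF DE(1) xs] .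
 have GD: "G \<subseteq> ?D" using simple_extension_incl[OF GE(1) t(1)] .
 have tD: "t \<in> ?D" using simple_extension_mem[OF GT] .
 obtain a where a: "a \<in> ?D" "a \<noteq> \<zero>" "\<And>h c N. h \<in> ?D \<Longrightarrow> c \<in> ?D \<Longrightarrow>
   (\<exists>y\<in>?A. c \<otimes> \<one> [^] (N::nat) = h \<otimes> y) \<Longrightarrow> (\<exists>M::nat. \<exists>y\<in>?D. c \<otimes> a [^] M = h \<otimes> y)"
  using divisibility_descends[OF D xs subringE(3)[OF A]] by auto
 obtain n r \<alpha> where ar: "r \<in> poly_span G t n" "\<alpha> \<in> G" "\<alpha> \<noteq> \<zero>" "a = r \<oplus> \<alpha> \<otimes> t [^] n"
  using a(1,2) poly_span_leading_term[OF _ a(2) GT] unfolding U by blast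
 note cl = subsetD[OF poly_span_closed[OF GE(1) t(1)]] subsetD[OF GE(1)] subsetD[OF DE(1)]
 have c: "a \<in> carrier R" "r \<in> carrier R" "\<alpha> \<in> carrier R" "t [^] n \<in> carrier R"
  using a ar cl t by auto
 define h where "h = \<one> \<oplus> t \<otimes> a"
 define r1 where "r1 = \<one> \<oplus> r \<otimes> t [^] (1::nat)"
 have hD: "h \<in> ?D" unfolding h_def using DE(7)[OF DE(3) DE(6)[OF tD a(1)]] .
 have r1: "r1 \<in> poly_span G t (Suc n)"
 proof -
  have "r \<otimes> t [^] (1::nat) \<in> poly_span G t (Suc n)"
   using poly_span_shift[OF GT ar(1), of 1] by (metis Suc_eq_plus1)
  then show ?thesis unfolding r1_def using poly_span_add[OF GT poly_span_const[OF GT GE(3)]] by blast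
 qed
 have hlead: "h = r1 \<oplus> \<alpha> \<otimes> t [^] Suc n"
 proof -
  define T where "T = t [^] n"
  have "T \<in> carrier R" unfolding T_def using t by simp
  then have "\<one> \<oplus> t \<otimes> (r \<oplus> \<alpha> \<otimes> T) = (\<one> \<oplus> r \<otimes> t) \<oplus> \<alpha> \<otimes> (T \<otimes> t)"
   using c t by algebra
  then show ?thesis unfolding h_def r1_def ar(4) T_def using t by simp
 qed
 have hc: "h \<in> carrier R" "r1 \<in> carrier R" using cl(3)[OF hD] cl(1)[OF r1] by blast+
 have key: "c = \<zero>" if cG: "c \<in> G" and cy: "y \<in> ?D" "c = h \<otimes> y" for c y
 proof (rule ccontr)
  assume c0: "c \<noteq> \<zero>"
  have cc: "c \<in> carrier R" "y \<in> carrier R" using cG cy cl by auto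
  have y0: "y \<noteq> \<zero>" using c0 cy(2) hc by auto
  obtain m r' \<omega> where yr: "r' \<in> poly_span G t m" "\<omega> \<in> G" "\<omega> \<noteq> \<zero>" "y = r' \<oplus> \<omega> \<otimes> t [^] m"
   using cy(1) poly_span_leading_term[OF _ y0 GT] unfolding U by blast
  obtain r'' where r'': "r'' \<in> poly_span G t (Suc n + m)"
    "h \<otimes> y = r'' \<oplus> (\<alpha> \<otimes> \<omega>) \<otimes> t [^] (Suc n + m)"
   using leading_term_mult[OF GT r1 ar(2) yr(1,2)] unfolding hlead yr(4) by blast
  have "\<zero> \<oplus> c \<otimes> t [^] (0::nat) = r'' \<oplus> (\<alpha> \<otimes> \<omega>) \<otimes> t [^] (Suc n + m)"
   using r''(2) cy(2) cc by simp
  moreover have "\<alpha> \<otimes> \<omega> \<noteq> \<zero>" using integral_iff[of \<alpha> \<omega>] ar yr cl by auto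
  ultimately show False
   using leading_term_unique[OF GT free, of \<zero> 0 c r'' "Suc n + m" "\<alpha> \<otimes> \<omega>"] cG c0 r''(1) GE(6)[OF ar(2) yr(2)]
   by simp
 qed
 have avoid: "h \<otimes> y = \<zero>" if y: "y \<in> ?A" "h \<otimes> y \<in> G" for y
 proof -
  define c where "c = h \<otimes> y"
  have cG: "c \<in> G" unfolding c_def using y by simp
  have cc: "c \<in> carrier R" using cG cl by auto
  have "\<exists>y\<in>?A. c \<otimes> \<one> [^] (0::nat) = h \<otimes> y" using y(1) cc unfolding c_def by auto
  then obtain M :: nat and y1 where y1: "y1 \<in> ?D" "c \<otimes> a [^] M = h \<otimes> y1"
   using a(3)[OF hD] cG GD by blast
  have pw: "\<exists>w\<in>?D. (t \<otimes> a) [^] (k::nat) = (\<ominus> \<one>) [^] k \<oplus> h \<otimes> w" for k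
  proof (induction k)
   case 0
   then show ?case using DE(2) hc by (intro bexI[of _ \<zero>]) auto
  next
   case (Suc k)
   then obtain w where w: "w \<in> ?D" "(t \<otimes> a) [^] k = (\<ominus> \<one>) [^] k \<oplus> h \<otimes> w" by blast
   define u where "u = (\<ominus> \<one>) [^] k"
   have uD: "u \<in> ?D" unfolding u_def by (induction k) (use DE in auto)
   have wc: "w \<in> carrier R" "u \<in> carrier R" using w uD cl by auto
   have "(t \<otimes> a) [^] Suc k = (u \<oplus> h \<otimes> w) \<otimes> (h \<ominus> \<one>)"
    unfolding nat_pow_Suc w(2) u_def[symmetric] h_def using c t by algebra
   also have "\<dots> = u \<otimes> (\<ominus> \<one>) \<oplus> h \<otimes> (u \<oplus> w \<otimes> (h \<ominus> \<one>))"
    using wc hc by algebra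
   finally show ?case unfolding nat_pow_Suc u_def[symmetric]
    using DE(7)[OF uD DE(6)[OF w(1) DE(7)[OF hD DE(5)[OF DE(3)]]]] unfolding a_minus_def by blast
  qed
  obtain w where w: "w \<in> ?D" "(t \<otimes> a) [^] M = (\<ominus> \<one>) [^] M \<oplus> h \<otimes> w" using pw by blast
  have tM: "t [^] M \<in> ?D" by (induction M) (use tD DE in auto)
  define u where "u = (\<ominus> \<one>) [^] M"
  have uG: "u \<in> G" unfolding u_def by (induction M) (use GE in auto)
  have cs: "w \<in> carrier R" "u \<in> carrier R" "y1 \<in> carrier R" "t [^] M \<in> carrier R" "a [^] M \<in> carrier R"
   using w uG cl y1 t c by auto
  have "(c \<otimes> a [^] M) \<otimes> t [^] M = c \<otimes> (t \<otimes> a) [^] M"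
   unfolding nat_pow_distrib[OF t(1) c(1)] using cs cc
   by (simp add: m_assoc m_comm[of "a [^] M" "t [^] M"])
  also have "\<dots> = c \<otimes> (u \<oplus> h \<otimes> w)" unfolding w(2) u_def ..
  finally have "(c \<otimes> a [^] M) \<otimes> t [^] M = c \<otimes> (u \<oplus> h \<otimes> w)" .
  then have "c \<otimes> u \<oplus> c \<otimes> (h \<otimes> w) = h \<otimes> y1 \<otimes> t [^] M"
   unfolding y1(2) using cs cc hc by (simp add: r_distr)
  then have "c \<otimes> u = h \<otimes> y1 \<otimes> t [^] M \<ominus> c \<otimes> (h \<otimes> w)"
   using cs cc hc by (metis add.inv_solve_right' a_minus_def m_closed)
  also have "\<dots> = h \<otimes> (y1 \<otimes> t [^] M \<ominus> c \<otimes> w)"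
   using cs cc hc by algebra
  finally have eq: "c \<otimes> u = h \<otimes> (y1 \<otimes> t [^] M \<ominus> c \<otimes> w)" .
  have "y1 \<otimes> t [^] M \<ominus> c \<otimes> w \<in> ?D"
   unfolding a_minus_def using DE(7)[OF DE(6)[OF y1(1) tM] DE(5)[OF DE(6)[OF subsetD[OF GD cG] w(1)]]] .
  then have "c \<otimes> u = \<zero>" using key[OF GE(6)[OF cG uG] _ eq] by simp
  moreover have "u \<noteq> \<zero>"
  proof -
   have "u \<otimes> u = \<one>"
    unfolding u_def by (simp add: nat_pow_distrib[symmetric] l_minus r_minus)
   then show ?thesis using one_not_zero cs by auto
  qed
  ultimately show ?thesis using integral_iff cc cs unfolding c_def by blast
 qed
 have "h \<noteq> \<zero>"
 proof
  assume "h = \<zero>"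
  then have "r1 \<oplus> \<alpha> \<otimes> t [^] Suc n = \<zero>" using hlead by simp
  then show False using free r1 ar(2,3) unfolding relation_free_def by blast
 qed
 then show ?thesis using avoid hD DA by blast
qed

end

section \<open>Localization\<close>

locale multiplicative_set = cring R for R :: "'a ring" (structure) +
 fixes S
 assumes S_carrier: "S \<subseteq> carrier R" and one_S: "\<one> \<in> S"
  and mult_S: "\<And>s t. s \<in> S \<Longrightarrow> t \<in> S \<Longrightarrow> s \<otimes> t \<in> S"
begin

abbreviation frac :: "'a \<Rightarrow> 'a \<Rightarrow> ('a \<times> 'a) set" where "frac \<equiv> fraction R S"

abbreviation Loc :: "('a \<times> 'a) set ring" where "Loc \<equiv> localization R S"

lemma Sc [simp]: "s \<in> S \<Longrightarrow> s \<in> carrier R"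
 using S_carrier by blast

lemma mem_frac:
 "(b, t) \<in> frac a s \<longleftrightarrow>
  b \<in> carrier R \<and> t \<in> S \<and> (\<exists>u\<in>S. u \<otimes> (t \<otimes> a \<ominus> s \<otimes> b) = \<zero>)"
 unfolding fraction_def by simp

lemma frac_self:
 assumes "a \<in> carrier R" "s \<in> S"
 shows "(a, s) \<in> frac a s"
proof -
 have "\<one> \<otimes> (s \<otimes> a \<ominus> s \<otimes> a) = \<zero>" using assms by simp
 then show ?thesis using assms one_S unfolding mem_frac by blast
qed

lemma frac_trans_aux:
 assumes a: "a \<in> carrier R" "s \<in> S" and b: "b \<in> carrier R" "t \<in> S" and c: "c \<in> carrier R" "r \<in> S"
  and u: "u \<in> S" "u \<otimes> (t \<otimes> a \<ominus> s \<otimes> b) = \<zero>"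
  and v: "v \<in> S" "v \<otimes> (r \<otimes> b \<ominus> t \<otimes> c) = \<zero>"
 shows "\<exists>w\<in>S. w \<otimes> (r \<otimes> a \<ominus> s \<otimes> c) = \<zero>"
proof -
 have cc: "s \<in> carrier R" "t \<in> carrier R" "r \<in> carrier R" "u \<in> carrier R" "v \<in> carrier R"
  using assms by auto
 have "(u \<otimes> v \<otimes> t) \<otimes> (r \<otimes> a \<ominus> s \<otimes> c)
   = (v \<otimes> r) \<otimes> (u \<otimes> (t \<otimes> a \<ominus> s \<otimes> b)) \<oplus> (u \<otimes> s) \<otimes> (v \<otimes> (r \<otimes> b \<ominus> t \<otimes> c))"
  using cc a(1) b(1) c(1) by algebra
 also have "\<dots> = \<zero>" unfolding u(2) v(2) using cc by simp
 finally show ?thesis using mult_S u(1) v(1) b(2) by blast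
qed

lemma frac_sym_aux:
 assumes a: "a \<in> carrier R" "s \<in> S" and b: "b \<in> carrier R" "t \<in> S"
  and u: "u \<in> S" "u \<otimes> (t \<otimes> a \<ominus> s \<otimes> b) = \<zero>"
 shows "u \<otimes> (s \<otimes> b \<ominus> t \<otimes> a) = \<zero>"
proof -
 have cc: "s \<in> carrier R" "t \<in> carrier R" "u \<in> carrier R" using assms by auto
 have "u \<otimes> (s \<otimes> b \<ominus> t \<otimes> a) = \<ominus> (u \<otimes> (t \<otimes> a \<ominus> s \<otimes> b))" using cc a b by algebra
 then show ?thesis using u(2) by simp
qed

lemma frac_eq_iff:
 assumes a: "a \<in> carrier R" "s \<in> S" and b: "b \<in> carrier R" "t \<in> S"
 shows "frac a s = frac b t \<longleftrightarrow> (\<exists>u\<in>S. u \<otimes> (t \<otimes> a \<ominus> s \<otimes> b) = \<zero>)"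
proof
 assume "frac a s = frac b t"
 then have "(b, t) \<in> frac a s" using frac_self[OF b] by simp
 then show "\<exists>u\<in>S. u \<otimes> (t \<otimes> a \<ominus> s \<otimes> b) = \<zero>" unfolding mem_frac by blast
next
 assume "\<exists>u\<in>S. u \<otimes> (t \<otimes> a \<ominus> s \<otimes> b) = \<zero>"
 then obtain u where u: "u \<in> S" "u \<otimes> (t \<otimes> a \<ominus> s \<otimes> b) = \<zero>" by blast
 have "(c, r) \<in> frac a s \<longleftrightarrow> (c, r) \<in> frac b t" for c r
 proof
  assume "(c, r) \<in> frac a s"
  then obtain v where v: "c \<in> carrier R" "r \<in> S" "v \<in> S" "v \<otimes> (r \<otimes> a \<ominus> s \<otimes> c) = \<zero>"
   unfolding mem_frac by blast
  show "(c, r) \<in> frac b t"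
   using frac_trans_aux[OF b a v(1,2) u(1) frac_sym_aux[OF a b u] v(3,4)] v(1,2)
   unfolding mem_frac by blast
 next
  assume "(c, r) \<in> frac b t"
  then obtain v where v: "c \<in> carrier R" "r \<in> S" "v \<in> S" "v \<otimes> (r \<otimes> b \<ominus> t \<otimes> c) = \<zero>"
   unfolding mem_frac by blast
  show "(c, r) \<in> frac a s"
   using frac_trans_aux[OF a b v(1,2) u v(3,4)] v(1,2) unfolding mem_frac by blast
 qed
 then show "frac a s = frac b t" by auto
qed

lemma frac_eqI:
 assumes a: "a \<in> carrier R" "s \<in> S" and b: "b \<in> carrier R" "t \<in> S"
  and eq: "t \<otimes> a = s \<otimes> b"
 shows "frac a s = frac b t"
proof -
 have "\<one> \<otimes> (t \<otimes> a \<ominus> s \<otimes> b) = \<zero>" using a b eq by simp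
 then show ?thesis using frac_eq_iff[OF a b] one_S by blast
qed

lemma frac_memD:
 assumes "(b, t) \<in> frac a s" "a \<in> carrier R" "s \<in> S"
 shows "b \<in> carrier R" "t \<in> S" "frac a s = frac b t"
 using assms frac_eq_iff[of a s b t] unfolding mem_frac by blast+

lemma frac_eqD:
 assumes "a \<in> carrier R" "s \<in> S" "b \<in> carrier R" "t \<in> S" "frac a s = frac b t"
 obtains u where "u \<in> S" "u \<otimes> (t \<otimes> a) = u \<otimes> (s \<otimes> b)"
proof -
 obtain u where u: "u \<in> S" "u \<otimes> (t \<otimes> a \<ominus> s \<otimes> b) = \<zero>"
  using frac_eq_iff[OF assms(1-4)] assms(5) by blast
 have cc: "u \<in> carrier R" "s \<in> carrier R" "t \<in> carrier R" using u assms by auto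
 have "u \<otimes> (t \<otimes> a) \<ominus> u \<otimes> (s \<otimes> b) = u \<otimes> (t \<otimes> a \<ominus> s \<otimes> b)"
  using cc assms(1,3) by algebra
 then have "u \<otimes> (t \<otimes> a) = u \<otimes> (s \<otimes> b)" using u cc assms(1,3) by simp
 then show thesis using that u(1) by blast
qed

lemma frac_eqI':
 assumes a: "a \<in> carrier R" "s \<in> S" and b: "b \<in> carrier R" "t \<in> S"
  and u: "u \<in> S" "u \<otimes> (t \<otimes> a) = u \<otimes> (s \<otimes> b)"
 shows "frac a s = frac b t"
proof -
 have cc: "u \<in> carrier R" "s \<in> carrier R" "t \<in> carrier R" using assms by auto
 have "u \<otimes> (t \<otimes> a \<ominus> s \<otimes> b) = u \<otimes> (t \<otimes> a) \<ominus> u \<otimes> (s \<otimes> b)"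
  using cc a b by algebra
 also have "\<dots> = \<zero>" using u(2) cc a b by simp
 finally show ?thesis using frac_eq_iff[OF a b] u(1) by blast
qed

lemma carrier_Loc: "carrier Loc = {frac a s | a s. a \<in> carrier R \<and> s \<in> S}"
 and one_Loc: "\<one>\<^bsub>Loc\<^esub> = frac \<one> \<one>" and zero_Loc: "\<zero>\<^bsub>Loc\<^esub> = frac \<zero> \<one>"
 by (simp_all add: localization_def)

lemma Loc_cases:
 assumes "x \<in> carrier Loc"
 obtains a s where "a \<in> carrier R" "s \<in> S" "x = frac a s"
 using assms unfolding carrier_Loc by blast

lemma frac_closed [intro]: "a \<in> carrier R \<Longrightarrow> s \<in> S \<Longrightarrow> frac a s \<in> carrier Loc"
 unfolding carrier_Loc by blast

lemma mult_frac:
 assumes a: "a \<in> carrier R" "s \<in> S" and b: "b \<in> carrier R" "t \<in> S"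
 shows "frac a s \<otimes>\<^bsub>Loc\<^esub> frac b t = frac (a \<otimes> b) (s \<otimes> t)"
proof -
 have wd: "frac (a' \<otimes> b') (s' \<otimes> t') = frac (a \<otimes> b) (s \<otimes> t)"
  if "(a', s') \<in> frac a s" "(b', t') \<in> frac b t" for a' s' b' t'
 proof -
  note A = frac_memD[OF that(1) a] and B = frac_memD[OF that(2) b]
  obtain u where u: "u \<in> S" "u \<otimes> (s' \<otimes> a) = u \<otimes> (s \<otimes> a')" using frac_eqD[OF a A(1,2,3)] .
  obtain v where v: "v \<in> S" "v \<otimes> (t' \<otimes> b) = v \<otimes> (t \<otimes> b')" using frac_eqD[OF b B(1,2,3)] .
  have cc: "u \<in> carrier R" "v \<in> carrier R" "s \<in> carrier R" "t \<in> carrier R" "s' \<in> carrier R" "t' \<in> carrier R"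
   using u v a b A B by auto
  have "(u \<otimes> v) \<otimes> ((s \<otimes> t) \<otimes> (a' \<otimes> b')) = (u \<otimes> (s \<otimes> a')) \<otimes> (v \<otimes> (t \<otimes> b'))"
   using cc A B by algebra
  also have "\<dots> = (u \<otimes> (s' \<otimes> a)) \<otimes> (v \<otimes> (t' \<otimes> b))" unfolding u(2) v(2) ..
  also have "\<dots> = (u \<otimes> v) \<otimes> ((s' \<otimes> t') \<otimes> (a \<otimes> b))" using cc a b by algebra
  finally show ?thesis using a b A B u v by (intro frac_eqI'[of _ _ _ _ "u \<otimes> v"]) (auto intro: mult_S)
 qed
 have "frac a s \<otimes>\<^bsub>Loc\<^esub> frac b t = (THE z. \<exists>a' s' b' t'. (a', s') \<in> frac a s \<and> (b', t') \<in> frac b t \<and>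
   z = frac (a' \<otimes> b') (s' \<otimes> t'))" by (simp add: localization_def)
 also have "\<dots> = frac (a \<otimes> b) (s \<otimes> t)"
  by (rule the_equality) (use wd frac_self[OF a] frac_self[OF b] in blast)+
 finally show ?thesis .
qed

lemma add_frac:
 assumes a: "a \<in> carrier R" "s \<in> S" and b: "b \<in> carrier R" "t \<in> S"
 shows "frac a s \<oplus>\<^bsub>Loc\<^esub> frac b t = frac (t \<otimes> a \<oplus> s \<otimes> b) (s \<otimes> t)"
proof -
 have wd: "frac (t' \<otimes> a' \<oplus> s' \<otimes> b') (s' \<otimes> t') = frac (t \<otimes> a \<oplus> s \<otimes> b) (s \<otimes> t)"
  if "(a', s') \<in> frac a s" "(b', t') \<in> frac b t" for a' s' b' t'
 proof -
  note A = frac_memD[OF that(1) a] and B = frac_memD[OF that(2) b]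
  obtain u where u: "u \<in> S" "u \<otimes> (s' \<otimes> a) = u \<otimes> (s \<otimes> a')" using frac_eqD[OF a A(1,2,3)] .
  obtain v where v: "v \<in> S" "v \<otimes> (t' \<otimes> b) = v \<otimes> (t \<otimes> b')" using frac_eqD[OF b B(1,2,3)] .
  have cc: "u \<in> carrier R" "v \<in> carrier R" "s \<in> carrier R" "t \<in> carrier R" "s' \<in> carrier R" "t' \<in> carrier R"
   using u v a b A B by auto
  have "(u \<otimes> v) \<otimes> ((s \<otimes> t) \<otimes> (t' \<otimes> a' \<oplus> s' \<otimes> b'))
    = (u \<otimes> (s \<otimes> a')) \<otimes> (v \<otimes> t \<otimes> t') \<oplus> (v \<otimes> (t \<otimes> b')) \<otimes> (u \<otimes> s \<otimes> s')"
   using cc A(1) B(1) by algebra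
  also have "\<dots> = (u \<otimes> (s' \<otimes> a)) \<otimes> (v \<otimes> t \<otimes> t') \<oplus> (v \<otimes> (t' \<otimes> b)) \<otimes> (u \<otimes> s \<otimes> s')"
   unfolding u(2) v(2) ..
  also have "\<dots> = (u \<otimes> v) \<otimes> ((s' \<otimes> t') \<otimes> (t \<otimes> a \<oplus> s \<otimes> b))" using cc a(1) b(1) by algebra
  finally show ?thesis using a b A B u v by (intro frac_eqI'[of _ _ _ _ "u \<otimes> v"]) (auto intro: mult_S)
 qed
 have "frac a s \<oplus>\<^bsub>Loc\<^esub> frac b t = (THE z. \<exists>a' s' b' t'. (a', s') \<in> frac a s \<and> (b', t') \<in> frac b t \<and>
   z = frac (t' \<otimes> a' \<oplus> s' \<otimes> b') (s' \<otimes> t'))" by (simp add: localization_def)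
 also have "\<dots> = frac (t \<otimes> a \<oplus> s \<otimes> b) (s \<otimes> t)"
  by (rule the_equality) (use wd frac_self[OF a] frac_self[OF b] in blast)+
 finally show ?thesis .
qed

lemma Loc_cring: "cring Loc"
proof (rule cringI)
 show "abelian_group Loc"
 proof (rule abelian_groupI)
  fix x y assume x: "x \<in> carrier Loc" and y: "y \<in> carrier Loc"
  obtain a s where A: "a \<in> carrier R" "s \<in> S" "x = frac a s" using Loc_cases[OF x] .
  obtain b t where B: "b \<in> carrier R" "t \<in> S" "y = frac b t" using Loc_cases[OF y] .
  show "x \<oplus>\<^bsub>Loc\<^esub> y \<in> carrier Loc"
   unfolding A(3) B(3) add_frac[OF A(1,2) B(1,2)] using A B mult_S by auto
  show "x \<oplus>\<^bsub>Loc\<^esub> y = y \<oplus>\<^bsub>Loc\<^esub> x"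
   unfolding A(3) B(3) add_frac[OF A(1,2) B(1,2)] add_frac[OF B(1,2) A(1,2)]
   using A B by (simp add: a_comm m_comm)
  fix z assume z: "z \<in> carrier Loc"
  obtain c r where C: "c \<in> carrier R" "r \<in> S" "z = frac c r" using Loc_cases[OF z] .
  have cc: "s \<in> carrier R" "t \<in> carrier R" "r \<in> carrier R" using A B C by auto
  have "r \<otimes> (t \<otimes> a \<oplus> s \<otimes> b) \<oplus> (s \<otimes> t) \<otimes> c = (t \<otimes> r) \<otimes> a \<oplus> s \<otimes> (r \<otimes> b \<oplus> t \<otimes> c)"
   "(s \<otimes> t) \<otimes> r = s \<otimes> (t \<otimes> r)" using cc A(1) B(1) C(1) by algebra+
  then show "x \<oplus>\<^bsub>Loc\<^esub> y \<oplus>\<^bsub>Loc\<^esub> z = x \<oplus>\<^bsub>Loc\<^esub> (y \<oplus>\<^bsub>Loc\<^esub> z)"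
   unfolding A(3) B(3) C(3) using A(1,2) B(1,2) C(1,2) mult_S by (simp add: add_frac)
 next
  show "\<zero>\<^bsub>Loc\<^esub> \<in> carrier Loc" unfolding zero_Loc using one_S by auto
 next
  fix x assume x: "x \<in> carrier Loc"
  obtain a s where A: "a \<in> carrier R" "s \<in> S" "x = frac a s" using Loc_cases[OF x] .
  show "\<zero>\<^bsub>Loc\<^esub> \<oplus>\<^bsub>Loc\<^esub> x = x"
   unfolding A(3) zero_Loc using A(1,2) one_S by (simp add: add_frac)
  have "frac (\<ominus> a) s \<oplus>\<^bsub>Loc\<^esub> x = frac \<zero> \<one>"
   unfolding A(3) using A(1,2) one_S mult_S
   by (simp add: add_frac r_minus l_neg) (intro frac_eqI, auto)
  then show "\<exists>y\<in>carrier Loc. y \<oplus>\<^bsub>Loc\<^esub> x = \<zero>\<^bsub>Loc\<^esub>"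
   unfolding zero_Loc using A(1,2) by blast
 qed
 show "comm_monoid Loc"
 proof (rule comm_monoidI)
  fix x y assume x: "x \<in> carrier Loc" and y: "y \<in> carrier Loc"
  obtain a s where A: "a \<in> carrier R" "s \<in> S" "x = frac a s" using Loc_cases[OF x] .
  obtain b t where B: "b \<in> carrier R" "t \<in> S" "y = frac b t" using Loc_cases[OF y] .
  show "x \<otimes>\<^bsub>Loc\<^esub> y \<in> carrier Loc"
   unfolding A(3) B(3) mult_frac[OF A(1,2) B(1,2)] using A B mult_S by auto
  show "x \<otimes>\<^bsub>Loc\<^esub> y = y \<otimes>\<^bsub>Loc\<^esub> x"
   unfolding A(3) B(3) mult_frac[OF A(1,2) B(1,2)] mult_frac[OF B(1,2) A(1,2)]
   using A B by (simp add: m_comm)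
  fix z assume z: "z \<in> carrier Loc"
  obtain c r where C: "c \<in> carrier R" "r \<in> S" "z = frac c r" using Loc_cases[OF z] .
  show "x \<otimes>\<^bsub>Loc\<^esub> y \<otimes>\<^bsub>Loc\<^esub> z = x \<otimes>\<^bsub>Loc\<^esub> (y \<otimes>\<^bsub>Loc\<^esub> z)"
   unfolding A(3) B(3) C(3) using A(1,2) B(1,2) C(1,2) mult_S by (simp add: mult_frac m_assoc)
 next
  show "\<one>\<^bsub>Loc\<^esub> \<in> carrier Loc" unfolding one_Loc using one_S by auto
 next
  fix x assume x: "x \<in> carrier Loc"
  obtain a s where A: "a \<in> carrier R" "s \<in> S" "x = frac a s" using Loc_cases[OF x] .
  show "\<one>\<^bsub>Loc\<^esub> \<otimes>\<^bsub>Loc\<^esub> x = x"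
   unfolding A(3) one_Loc using A(1,2) one_S by (simp add: mult_frac)
 qed
next
 fix x y z assume x: "x \<in> carrier Loc" and y: "y \<in> carrier Loc" and z: "z \<in> carrier Loc"
 obtain a s where A: "a \<in> carrier R" "s \<in> S" "x = frac a s" using Loc_cases[OF x] .
 obtain b t where B: "b \<in> carrier R" "t \<in> S" "y = frac b t" using Loc_cases[OF y] .
 obtain c r where C: "c \<in> carrier R" "r \<in> S" "z = frac c r" using Loc_cases[OF z] .
 have cc: "s \<in> carrier R" "t \<in> carrier R" "r \<in> carrier R" using A B C by auto
 have "frac ((t \<otimes> a \<oplus> s \<otimes> b) \<otimes> c) (s \<otimes> t \<otimes> r)
   = frac ((t \<otimes> r) \<otimes> (a \<otimes> c) \<oplus> (s \<otimes> r) \<otimes> (b \<otimes> c)) ((s \<otimes> r) \<otimes> (t \<otimes> r))"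
 proof (rule frac_eqI)
  show "((s \<otimes> r) \<otimes> (t \<otimes> r)) \<otimes> ((t \<otimes> a \<oplus> s \<otimes> b) \<otimes> c)
    = (s \<otimes> t \<otimes> r) \<otimes> ((t \<otimes> r) \<otimes> (a \<otimes> c) \<oplus> (s \<otimes> r) \<otimes> (b \<otimes> c))"
   using cc A(1) B(1) C(1) by algebra
 qed (use A B C mult_S in auto)
 then show "(x \<oplus>\<^bsub>Loc\<^esub> y) \<otimes>\<^bsub>Loc\<^esub> z = x \<otimes>\<^bsub>Loc\<^esub> z \<oplus>\<^bsub>Loc\<^esub> y \<otimes>\<^bsub>Loc\<^esub> z"
  unfolding A(3) B(3) C(3) using A(1,2) B(1,2) C(1,2) mult_S by (simp add: mult_frac add_frac)
qed

lemma frac_hom: "(\<lambda>a. frac a \<one>) \<in> ring_hom R Loc"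
 by (rule ring_hom_memI) (auto simp: one_S mult_frac add_frac one_Loc)

lemma frac_eq_zero_iff:
 assumes "a \<in> carrier R" "s \<in> S"
 shows "frac a s = \<zero>\<^bsub>Loc\<^esub> \<longleftrightarrow> (\<exists>u\<in>S. u \<otimes> a = \<zero>)"
 unfolding zero_Loc frac_eq_iff[OF assms zero_closed one_S] using assms by (auto simp: a_minus_def)

lemma frac_inverse:
 assumes "a \<in> S" "s \<in> S"
 shows "frac a s \<otimes>\<^bsub>Loc\<^esub> frac s a = \<one>\<^bsub>Loc\<^esub>"
 using assms one_S mult_S by (simp add: mult_frac one_Loc) (intro frac_eqI, auto simp: m_comm)

end

locale plain_domain = domain R for R :: "'a ring" (structure)

lemma (in plain_domain) nonzero_multiplicative_set: "multiplicative_set R (carrier R - {\<zero>})"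
 by unfold_locales (use integral in auto)

lemma (in plain_domain) fraction_field_field: "field (fraction_field R)"
proof -
 interpret M: multiplicative_set R "carrier R - {\<zero>}" by (rule nonzero_multiplicative_set)
 interpret L: cring M.Loc by (rule M.Loc_cring)
 have z: "M.frac a s = \<zero>\<^bsub>M.Loc\<^esub> \<longleftrightarrow> a = \<zero>"
  if a: "a \<in> carrier R" and s: "s \<in> carrier R - {\<zero>}" for a s
  unfolding M.frac_eq_zero_iff[OF a s] using integral_iff[OF _ a] one_not_zero one_closed a
  by (metis DiffD1 DiffD2 DiffI r_null singletonD singletonI)
 have "field M.Loc"
 proof (rule L.cring_fieldI2)
  show "\<zero>\<^bsub>M.Loc\<^esub> \<noteq> \<one>\<^bsub>M.Loc\<^esub>"
   using z[OF one_closed M.one_S] one_not_zero unfolding M.one_Loc by metis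
  fix x assume x: "x \<in> carrier M.Loc" "x \<noteq> \<zero>\<^bsub>M.Loc\<^esub>"
  then obtain a s where A: "a \<in> carrier R" "s \<in> carrier R - {\<zero>}" "x = M.frac a s"
   using M.Loc_cases by metis
  then have "a \<in> carrier R - {\<zero>}" using x(2) z by auto
  then show "\<exists>y\<in>carrier M.Loc. x \<otimes>\<^bsub>M.Loc\<^esub> y = \<one>\<^bsub>M.Loc\<^esub>"
   using M.frac_inverse A by blast
 qed
 then show ?thesis unfolding fraction_field_def .
qed

lemma (in plain_domain) to_fraction_field_hom: "to_fraction_field R \<in> ring_hom R (fraction_field R)"
 unfolding to_fraction_field_def[abs_def] fraction_field_def
 using multiplicative_set.frac_hom[OF nonzero_multiplicative_set] .

lemma (in plain_domain) to_fraction_field_inj: "inj_on (to_fraction_field R) (carrier R)"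
proof -
 interpret M: multiplicative_set R "carrier R - {\<zero>}" by (rule nonzero_multiplicative_set)
 have "a = b" if a: "a \<in> carrier R" and b: "b \<in> carrier R" and eq: "M.frac a \<one> = M.frac b \<one>" for a b
 proof -
  obtain u where u: "u \<in> carrier R - {\<zero>}" "u \<otimes> (\<one> \<otimes> a) = u \<otimes> (\<one> \<otimes> b)"
   using M.frac_eqD[OF a M.one_S b M.one_S eq] .
  then show ?thesis using m_lcancel[of u a b] a b by simp
 qed
 then show ?thesis unfolding inj_on_def to_fraction_field_def by blast
qed

lemma (in primeideal) exists_field_hom:
 "\<exists>(K :: ('a set \<times> 'a set) set ring) \<phi>. field K \<and> \<phi> \<in> ring_hom R K \<and>
   I = {x \<in> carrier R. \<phi> x = \<zero>\<^bsub>K\<^esub>}"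
proof -
 interpret Q: plain_domain "R Quot I" unfolding plain_domain_def by (rule quotient_is_domain)
 let ?K = "fraction_field (R Quot I)"
 let ?\<phi> = "to_fraction_field (R Quot I) \<circ> (+>) I"
 interpret K: field ?K by (rule Q.fraction_field_field)
 have hom: "?\<phi> \<in> ring_hom R ?K"
  using ring_hom_trans[OF rcos_ring_hom Q.to_fraction_field_hom] .
 have h0: "to_fraction_field (R Quot I) \<zero>\<^bsub>R Quot I\<^esub> = \<zero>\<^bsub>?K\<^esub>"
  using ring_hom_zero[OF Q.to_fraction_field_hom Q.ring_axioms K.ring_axioms] .
 have "?\<phi> x = \<zero>\<^bsub>?K\<^esub> \<longleftrightarrow> x \<in> I" if x: "x \<in> carrier R" for x
 proof -
  have c: "I +> x \<in> carrier (R Quot I)" using ring_hom_memE(1)[OF rcos_ring_hom x] .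
  have "?\<phi> x = \<zero>\<^bsub>?K\<^esub> \<longleftrightarrow> I +> x = \<zero>\<^bsub>R Quot I\<^esub>"
   using inj_onD[OF Q.to_fraction_field_inj _ c Q.zero_closed] h0 by auto
  also have "\<dots> \<longleftrightarrow> x \<in> I"
   unfolding FactRing_def using rcos_const_imp_mem[OF x] a_rcos_const by auto
  finally show ?thesis .
 qed
 then show ?thesis using K.field_axioms hom Icarr by (intro exI[of _ ?K] exI[of _ ?\<phi>]) blast
qed

context ring_hom_ring
begin

lemma image_poly_span:
 assumes "D \<subseteq> carrier R" "s \<in> carrier R"
 shows "h ` ring.poly_span R D s n = ring.poly_span S (h ` D) (h s) n"
proof (induction n)
 case (Suc n)
 have c: "ring.poly_span R D s n \<subseteq> carrier R"
 proof (induction n)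
  case (Suc n)
  then show ?case using assms by auto
 qed simp
 show ?case
 proof
  show "h ` ring.poly_span R D s (Suc n) \<subseteq> ring.poly_span S (h ` D) (h s) (Suc n)"
  proof
   fix y assume "y \<in> h ` ring.poly_span R D s (Suc n)"
   then obtain r d where rd: "r \<in> ring.poly_span R D s n" "d \<in> D" "y = h (r \<oplus>\<^bsub>R\<^esub> d \<otimes>\<^bsub>R\<^esub> s [^]\<^bsub>R\<^esub> n)"
    by auto
   moreover have "r \<in> carrier R" "d \<in> carrier R" using rd c assms by auto
   ultimately have "y = h r \<oplus>\<^bsub>S\<^esub> h d \<otimes>\<^bsub>S\<^esub> h s [^]\<^bsub>S\<^esub> n" using assms by (simp add: hom_nat_pow)
   moreover have "h r \<in> ring.poly_span S (h ` D) (h s) n" using rd(1) Suc by blast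
   ultimately show "y \<in> ring.poly_span S (h ` D) (h s) (Suc n)" using rd(2) by auto
  qed
  show "ring.poly_span S (h ` D) (h s) (Suc n) \<subseteq> h ` ring.poly_span R D s (Suc n)"
  proof
   fix y assume "y \<in> ring.poly_span S (h ` D) (h s) (Suc n)"
   then obtain r' d where rd: "r' \<in> ring.poly_span S (h ` D) (h s) n" "d \<in> D"
    "y = r' \<oplus>\<^bsub>S\<^esub> h d \<otimes>\<^bsub>S\<^esub> h s [^]\<^bsub>S\<^esub> n" by auto
   then obtain r where r: "r \<in> ring.poly_span R D s n" "r' = h r" using Suc by blast
   have "r \<in> carrier R" "d \<in> carrier R" using rd r c assms by auto
   then have "y = h (r \<oplus>\<^bsub>R\<^esub> d \<otimes>\<^bsub>R\<^esub> s [^]\<^bsub>R\<^esub> n)" using assms rd r by (simp add: hom_nat_pow)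
   then show "y \<in> h ` ring.poly_span R D s (Suc n)" using r rd by auto
  qed
 qed
qed simp

lemma image_simple_extension:
 assumes "D \<subseteq> carrier R" "s \<in> carrier R"
 shows "h ` ring.simple_extension R D s = ring.simple_extension S (h ` D) (h s)"
proof
 have c: "ring.simple_extension R D s \<subseteq> carrier R"
  using R.simple_extension_in_carrier[OF assms] .
 show "h ` ring.simple_extension R D s \<subseteq> ring.simple_extension S (h ` D) (h s)"
 proof
  fix y assume "y \<in> h ` ring.simple_extension R D s"
  then obtain x where "x \<in> ring.simple_extension R D s" "y = h x" by blast
  then show "y \<in> ring.simple_extension S (h ` D) (h s)"
  proof (induction arbitrary: y rule: R.simple_extension.induct)
   case zero
   then show ?case by simp
  next
   case (lin k1 k2)
   then have "k1 \<in> carrier R" "k2 \<in> carrier R" using c assms by auto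
   then have "y = h k1 \<otimes>\<^bsub>S\<^esub> h s \<oplus>\<^bsub>S\<^esub> h k2" using lin assms by simp
   then show ?case using lin by (auto intro: S.simple_extension.lin)
  qed
 qed
 show "ring.simple_extension S (h ` D) (h s) \<subseteq> h ` ring.simple_extension R D s"
 proof
  fix y assume "y \<in> ring.simple_extension S (h ` D) (h s)"
  then show "y \<in> h ` ring.simple_extension R D s"
  proof (induction rule: S.simple_extension.induct)
   case zero
   then show ?case using R.simple_extension.zero hom_zero by (metis image_eqI)
  next
   case (lin k1 k2)
   then obtain x1 x2 where x: "x1 \<in> ring.simple_extension R D s" "k1 = h x1" "x2 \<in> D" "k2 = h x2"
    by blast
   then have "x1 \<in> carrier R" "x2 \<in> carrier R" using c assms by auto
   then have "k1 \<otimes>\<^bsub>S\<^esub> h s \<oplus>\<^bsub>S\<^esub> k2 = h (x1 \<otimes>\<^bsub>R\<^esub> s \<oplus>\<^bsub>R\<^esub> x2)" using x assms by simp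
   then show ?case using R.simple_extension.lin[OF x(1,3)] by blast
  qed
 qed
qed

lemma image_finite_extension:
 assumes "D \<subseteq> carrier R" "set xs \<subseteq> carrier R"
 shows "h ` ring.finite_extension R D xs = ring.finite_extension S (h ` D) (map h xs)"
 using assms(2)
proof (induction xs)
 case (Cons x xs)
 have "ring.finite_extension R D xs \<subseteq> carrier R"
  using R.finite_extension_in_carrier[OF assms(1)] Cons.prems by simp
 then show ?case using Cons image_simple_extension[of "ring.finite_extension R D xs" x] by simp
qed simp

end

primrec (in ring) relation_free_tower :: "'a set \<Rightarrow> 'a list \<Rightarrow> bool" where
 "relation_free_tower k [] \<longleftrightarrow> True"
| "relation_free_tower k (x # xs) \<longleftrightarrow>
   relation_free_tower k xs \<and> relation_free (finite_extension k xs) x"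

lemma (in ring_hom_ring) transcendental_tower_pullback:
 assumes inj: "inj_on h (carrier R)" and k: "k \<subseteq> carrier R" and "set xs \<subseteq> carrier R"
  and "ring.transcendental_tower S (h ` k) (map h xs)"
 shows "ring.relation_free_tower R k xs" using assms(3,4)
proof (induction xs)
 case (Cons x xs)
 let ?E = "ring.finite_extension R k xs"
 have x: "x \<in> carrier R" and xs: "set xs \<subseteq> carrier R" using Cons.prems by auto
 have E: "?E \<subseteq> carrier R" using R.finite_extension_in_carrier[OF k xs] .
 have "ring.transcendental S (h ` ?E) (h x)"
  using Cons.prems(2) unfolding image_finite_extension[OF k xs] by (simp add: over_def)
 then have free: "ring.relation_free S (h ` ?E) (h x)"
 proof (intro S.transcendental_imp_relation_free)
  show "h ` ?E \<subseteq> carrier S" using E hom_closed by blast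
 qed (use x in \<open>simp_all add: over_def del: R.finite_extension.simps\<close>)
 have "d = \<zero>\<^bsub>R\<^esub>" if r: "r \<in> ring.poly_span R ?E x n" and d: "d \<in> ?E"
  and eq: "r \<oplus>\<^bsub>R\<^esub> d \<otimes>\<^bsub>R\<^esub> x [^]\<^bsub>R\<^esub> n = \<zero>\<^bsub>R\<^esub>" for n r d
 proof -
  have hr: "h r \<in> ring.poly_span S (h ` ?E) (h x) n" using r image_poly_span[OF E x] by blast
  have rc: "r \<in> carrier R"
  proof -
   have "ring.poly_span R ?E x m \<subseteq> carrier R" for m
   proof (induction m)
    case (Suc m)
    then show ?case using E x by auto
   qed simp
   then show ?thesis using r by blast
  qed
  have dc: "d \<in> carrier R" using d E by blast
  have "h r \<oplus>\<^bsub>S\<^esub> h d \<otimes>\<^bsub>S\<^esub> h x [^]\<^bsub>S\<^esub> n = h (r \<oplus>\<^bsub>R\<^esub> d \<otimes>\<^bsub>R\<^esub> x [^]\<^bsub>R\<^esub> n)"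
   using rc dc x by (simp add: hom_nat_pow)
  then have "h d = \<zero>\<^bsub>S\<^esub>" using free hr d eq unfolding S.relation_free_def by auto
  then show ?thesis using inj_onD[OF inj _ dc R.zero_closed] by simp
 qed
 then show ?case
  using Cons.IH[OF xs] Cons.prems(2) unfolding R.relation_free_tower.simps R.relation_free_def by auto
qed simp

text \<open>
 Passing to the fraction field of \<open>R/P\<close>, some \<open>h\<close> outside \<open>P\<close> has no multiple that is congruent
 modulo \<open>P\<close> to a nonzero element of \<open>G\<close>. Then \<open>P + hR\<close> avoids \<open>G - {0}\<close>, and so does some prime
 ideal containing it.
\<close>
lemma exists_larger_prime_avoiding_subring:
 fixes R :: "'a ring" (structure)
 assumes R: "cring R" and P: "primeideal P R" and G: "subring G R" "G \<inter> P = {\<zero>}"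
  and t: "t \<in> carrier R"
  and free: "\<And>n r d. r \<in> ring.poly_span R G t n \<Longrightarrow> d \<in> G \<Longrightarrow> r \<oplus> d \<otimes> t [^] n \<in> P \<Longrightarrow> d = \<zero>"
  and xs: "set xs \<subseteq> carrier R"
  and gen: "ring.finite_extension R (ring.simple_extension R G t) xs = carrier R"
 shows "\<exists>Q. primeideal Q R \<and> P \<subset> Q \<and> G \<inter> Q = {\<zero>}"
proof -
 interpret R: cring R by fact
 interpret P: primeideal P R by fact
 obtain K :: "('a set \<times> 'a set) set ring" and \<phi> where K: "field K" and \<phi>: "\<phi> \<in> ring_hom R K"
  and ker: "P = {x \<in> carrier R. \<phi> x = \<zero>\<^bsub>K\<^esub>}"
  using P.exists_field_hom by blast
 interpret K: field K by fact
 interpret h: ring_hom_ring R K \<phi>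
  using ring_hom_ringI2 R.ring_axioms K.ring_axioms \<phi> by blast
 note GE = subringE[OF G(1)]
 let ?G = "\<phi> ` G"
 have G': "subring ?G K" using h.img_is_subring[OF G(1)] .
 have t': "\<phi> t \<in> carrier K" using t by simp
 have trans: "ring.transcendental K ?G (\<phi> t)"
 proof (rule ccontr)
  assume "\<not> ?thesis"
  then have "(K.algebraic over ?G) (\<phi> t)" unfolding over_def by simp
  then obtain n r' d' where rd: "r' \<in> K.poly_span ?G (\<phi> t) n" "d' \<in> ?G" "d' \<noteq> \<zero>\<^bsub>K\<^esub>"
   "r' \<oplus>\<^bsub>K\<^esub> d' \<otimes>\<^bsub>K\<^esub> \<phi> t [^]\<^bsub>K\<^esub> n = \<zero>\<^bsub>K\<^esub>"
   using K.not_relation_free[OF G' t'] by metis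
  obtain r d where r: "r \<in> R.poly_span G t n" "r' = \<phi> r" "d \<in> G" "d' = \<phi> d"
   using rd h.image_poly_span[OF GE(1) t, of n] by blast
  have c: "r \<in> carrier R" "d \<in> carrier R"
   using r R.poly_span_closed[OF GE(1) t] GE(1) by auto
  have "\<phi> (r \<oplus> d \<otimes> t [^] n) = \<zero>\<^bsub>K\<^esub>" using rd r c t by (simp add: h.hom_nat_pow)
  then have "r \<oplus> d \<otimes> t [^] n \<in> P" unfolding ker using c t by simp
  then have "d = \<zero>" using free r by blast
  then show False using rd r by simp
 qed
 have SG: "R.simple_extension G t \<subseteq> carrier R"
  using R.simple_extension_in_carrier[OF GE(1) t] .
 let ?A = "K.finite_extension (K.simple_extension ?G (\<phi> t)) (map \<phi> xs)"
 have A: "?A = \<phi> ` carrier R" unfolding h.image_simple_extension[OF GE(1) t, symmetric]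
   h.image_finite_extension[OF SG xs, symmetric] gen ..
 have xs': "set (map \<phi> xs) \<subseteq> carrier K" using xs by auto
 obtain x where x: "x \<in> ?A" "x \<noteq> \<zero>\<^bsub>K\<^esub>" "\<forall>y\<in>?A. x \<otimes>\<^bsub>K\<^esub> y \<in> ?G \<longrightarrow> x \<otimes>\<^bsub>K\<^esub> y = \<zero>\<^bsub>K\<^esub>"
  using K.exists_multiple_avoiding_subring[OF G' t' _ xs'] trans unfolding over_def by blast
 obtain w where w: "w \<in> carrier R" "x = \<phi> w" using x(1) unfolding A by blast
 have wP: "w \<notin> P" using x(2) w unfolding ker by simp
 let ?I = "P <+>\<^bsub>R\<^esub> PIdl w"
 have I: "ideal ?I R" using R.add_ideals[OF P.is_ideal R.cgenideal_ideal[OF w(1)]] .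
 have PI: "P \<subseteq> ?I"
 proof
  fix q assume q: "q \<in> P"
  then have "q = q \<oplus> \<zero> \<otimes> w" using w P.Icarr by simp
  then show "q \<in> ?I" using q unfolding set_add_def' cgenideal_def by blast
 qed
 have wI: "w \<in> ?I"
 proof -
  have "w = \<zero> \<oplus> \<one> \<otimes> w" using w by simp
  then show ?thesis using P.zero_closed unfolding set_add_def' cgenideal_def by blast
 qed
 have one_P: "\<one> \<notin> P" using P.I_notcarr P.one_imp_carrier by blast
 have "?I \<inter> (G - {\<zero>}) = {}"
 proof (rule ccontr)
  assume "\<not> ?thesis"
  then obtain g q y where g: "g \<in> G" "g \<noteq> \<zero>" "q \<in> P" "y \<in> carrier R" "g = q \<oplus> y \<otimes> w"
   unfolding set_add_def' cgenideal_def by blast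
  have "\<phi> q = \<zero>\<^bsub>K\<^esub>" "q \<in> carrier R" using g(3) unfolding ker by auto
  then have "\<phi> g = \<phi> y \<otimes>\<^bsub>K\<^esub> \<phi> w" using g w by simp
  then have "\<phi> g = x \<otimes>\<^bsub>K\<^esub> \<phi> y" using w g K.m_comm by simp
  moreover have "\<phi> y \<in> ?A" using g(4) unfolding A by blast
  ultimately have "\<phi> g = \<zero>\<^bsub>K\<^esub>" using x(3) g(1) by auto
  then have "g \<in> G \<inter> P" using g(1) GE(1) unfolding ker by auto
  then show False using G(2) g(2) by blast
 qed
 moreover have "a \<otimes> b \<in> G - {\<zero>}" if "a \<in> G - {\<zero>}" "b \<in> G - {\<zero>}" for a b
 proof -
  have ab: "a \<in> carrier R" "b \<in> carrier R" "a \<notin> P" "b \<notin> P" using that GE(1) G(2) by auto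
  then have "a \<otimes> b \<notin> P" using P.I_prime by blast
  then have "a \<otimes> b \<noteq> \<zero>" using P.zero_closed by metis
  then show ?thesis using GE(6) that by blast
 qed
 moreover have "\<one> \<in> G - {\<zero>}" using GE(3) one_P P.zero_closed by auto
 ultimately obtain Q where Q: "primeideal Q R" "?I \<subseteq> Q" "Q \<inter> (G - {\<zero>}) = {}"
  using R.exists_prime_avoiding[OF I, of "G - {\<zero>}"] GE(1) by blast
 interpret Q: primeideal Q R by fact
 have "G \<inter> Q = {\<zero>}" using Q(3) GE(2) Q.zero_closed by blast
 then show ?thesis using Q PI wI wP by blast
qed

lemma exists_prime_chain:
 fixes R :: "'a ring" (structure)
 assumes R: "cring R" and k: "subring k R"
  and ys: "set ys \<subseteq> carrier R" "ring.finite_extension R k ys = carrier R"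
  and xs: "set xs \<subseteq> carrier R" "ring.relation_free_tower R k xs"
  and P: "primeideal P R" "ring.finite_extension R k xs \<inter> P = {\<zero>}"
 shows "\<exists>Z. Z 0 = P \<and> (\<forall>i\<le>length xs. primeideal (Z i) R) \<and> (\<forall>i<length xs. Z i \<subset> Z (Suc i))"
 using xs P
proof (induction xs arbitrary: P)
 case Nil
 then show ?case by (intro exI[of _ "\<lambda>_. P"]) simp
next
 case (Cons x xs)
 interpret R: cring R by fact
 let ?G = "R.finite_extension k xs"
 have x: "x \<in> carrier R" and xs: "set xs \<subseteq> carrier R" using Cons.prems by auto
 have G: "subring ?G R" using R.finite_extension_subring[OF k xs] .
 have S: "subring (R.simple_extension ?G x) R" using R.simple_extension_subring[OF G x] .
 interpret P: primeideal P R by fact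
 have GS: "?G \<subseteq> R.simple_extension ?G x" using R.simple_extension_incl[OF subringE(1)[OF G] x] .
 have SP: "R.simple_extension ?G x \<inter> P = {\<zero>}" using Cons.prems(4) by simp
 have GP: "?G \<inter> P = {\<zero>}" using SP GS subringE(2)[OF G] P.zero_closed by blast
 have kS: "k \<subseteq> R.simple_extension ?G x"
  using subset_trans[OF R.finite_extension_incl[OF subringE(1)[OF k] xs] GS] .
 have gen: "R.finite_extension (R.simple_extension ?G x) ys = carrier R"
  using R.mono_finite_extension[OF kS, of ys] ys(2)
   R.finite_extension_in_carrier[OF subringE(1)[OF S] ys(1)] by auto
 have free: "d = \<zero>" if r: "r \<in> R.poly_span ?G x n" and d: "d \<in> ?G" and rP: "r \<oplus> d \<otimes> x [^] n \<in> P" for n r d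
 proof -
  have "r \<oplus> d \<otimes> x [^] n \<in> R.poly_span ?G x (Suc n)" using r d by auto
  then have "r \<oplus> d \<otimes> x [^] n \<in> R.simple_extension ?G x"
   unfolding R.simple_extension_eq_poly_span[OF G x] by blast
  then have "r \<oplus> d \<otimes> x [^] n = \<zero>" using SP rP by blast
  then show ?thesis using Cons.prems(2) r d unfolding R.relation_free_tower.simps R.relation_free_def by blast
 qed
 obtain Q where Q: "primeideal Q R" "P \<subset> Q" "?G \<inter> Q = {\<zero>}"
  using exists_larger_prime_avoiding_subring[OF R Cons.prems(3) G GP x _ ys(1) gen] free by metis
 obtain Z where Z: "Z 0 = Q" "\<forall>i\<le>length xs. primeideal (Z i) R" "\<forall>i<length xs. Z i \<subset> Z (Suc i)"
  using Cons.IH[OF xs _ Q(1,3)] Cons.prems(2) by auto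
 let ?Z = "\<lambda>i. case i of 0 \<Rightarrow> P | Suc j \<Rightarrow> Z j"
 show ?case
 proof (intro exI[of _ ?Z] conjI allI impI)
  show "primeideal (?Z i) R" if "i \<le> length (x # xs)" for i
   using that Z(2) Cons.prems(3) by (cases i) auto
  show "?Z i \<subset> ?Z (Suc i)" if "i < length (x # xs)" for i
   using that Z(1,3) Q(2) by (cases i) auto
 qed simp
qed

section \<open>Local rings with \<open>p\<close>-th powers in a coefficient field\<close>

lemma max_ideal_eqI:
 fixes R :: "'a ring" (structure)
 assumes R: "cring R" and N: "ideal N R" "N \<noteq> carrier R"
  and unit: "\<And>x. x \<in> carrier R \<Longrightarrow> x \<notin> N \<Longrightarrow> x \<in> Units R"
 shows "max_ideal R = N"
proof -
 interpret R: cring R by fact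
 interpret N: ideal N R by fact
 have max: "maximalideal N R"
 proof (rule maximalidealI[OF N(1)])
  show "carrier R \<noteq> N" using N(2) by simp
  fix J assume J: "ideal J R" "N \<subseteq> J" "J \<subseteq> carrier R"
  interpret J: ideal J R by fact
  show "J = N \<or> J = carrier R"
  proof (cases "J = N")
   case False
   then obtain x where x: "x \<in> J" "x \<notin> N" using J(2) by blast
   then have "x \<in> Units R" using unit J(3) by blast
   then have "inv x \<otimes> x = \<one>" "inv x \<in> carrier R" by auto
   then have "\<one> \<in> J" using J.I_l_closed[OF x(1)] by metis
   then show ?thesis using J.one_imp_carrier by blast
  qed simp
 qed
 have "M = N" if M: "maximalideal M R" for M
 proof -
  interpret M: maximalideal M R by fact
  have "M \<subseteq> N"
  proof
   fix x assume x: "x \<in> M"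
   show "x \<in> N"
   proof (rule ccontr)
    assume "x \<notin> N"
    then have "x \<in> Units R" using unit M.Icarr[OF x] by blast
    then have "inv x \<otimes> x = \<one>" "inv x \<in> carrier R" by auto
    then have "\<one> \<in> M" using M.I_l_closed[OF x] by metis
    then show False using M.one_imp_carrier M.I_notcarr by simp
   qed
  qed
  then show ?thesis using M.I_maximal[OF N(1)] N(2) N.Icarr by blast
 qed
 then show ?thesis unfolding max_ideal_def using max by (rule the_equality[rotated])
qed

lemma edim_le:
 assumes "C \<subseteq> carrier R" "finite C" "Idl\<^bsub>R\<^esub> C = max_ideal R"
 shows "edim R \<le> enat (card C)" unfolding edim_def by (rule INF_lower) (use assms in blast)

text \<open>
 All \<open>p\<close>-th powers lie in the field \<open>T\<close>, so an element is either nilpotent or invertible.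
\<close>
locale height_one_algebra = char_p_cring R p for R :: "'a ring" (structure) and p +
 fixes T
 assumes T: "subfield T R"
  and power_p_T: "\<And>z. z \<in> carrier R \<Longrightarrow> z [^] p \<in> T"
begin

definition nil where "nil = {z \<in> carrier R. z [^] p = \<zero>}"

lemma nil_ideal: "ideal nil R"
proof (rule idealI)
 show "ring R" by (rule ring_axioms)
 have z: "\<zero> [^] p = \<zero>" using p_gt_1 by (simp add: nat_pow_zero)
 show "subgroup nil (add_monoid R)"
  by (rule add.subgroupI) (auto simp: nil_def power_p_add power_p_minus z)
 fix a x assume "a \<in> nil" "x \<in> carrier R"
 then show "x \<otimes> a \<in> nil" "a \<otimes> x \<in> nil" unfolding nil_def by (auto simp: nat_pow_distrib)
qed

sublocale nil: ideal nil R by (rule nil_ideal)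

lemma one_neq_zero: "\<one> \<noteq> \<zero>"
 using subfieldE(6)[OF T] by blast

lemma one_notin_nil: "\<one> \<notin> nil"
 unfolding nil_def using one_neq_zero by simp

lemma nil_neq_carrier: "nil \<noteq> carrier R"
 using one_notin_nil one_closed by metis

lemma inverse_in_subring:
 assumes "subring A R" "T \<subseteq> A" "z \<in> A" "z \<notin> nil"
 obtains y where "y \<in> A" "z \<otimes> y = \<one>"
proof -
 note AE = subringE[OF assms(1)]
 have z: "z \<in> carrier R" using assms AE by blast
 have "z [^] p \<in> T - {\<zero>}" using power_p_T[OF z] assms(4) z unfolding nil_def by auto
 then have i: "inv (z [^] p) \<in> T" "z [^] p \<otimes> inv (z [^] p) = \<one>"
  using subfield_m_inv(1,2)[OF T] by auto
 obtain m where m: "p = Suc m" using p_gt_1 by (cases p) auto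
 have zm: "z [^] n \<in> A" for n :: nat by (induction n) (use AE assms in auto)
 have "z \<otimes> (z [^] m \<otimes> inv (z [^] p)) = z [^] p \<otimes> inv (z [^] p)"
  using z i(1) subfieldE(3)[OF T] unfolding m by (simp add: m_assoc[symmetric] m_comm subsetD)
 then show thesis using that[of "z [^] m \<otimes> inv (z [^] p)"] i AE(6) zm assms(2) by auto
qed

lemma max_ideal_eq_nil: "max_ideal R = nil"
proof (rule max_ideal_eqI[OF cring_axioms nil_ideal nil_neq_carrier])
 fix x assume x: "x \<in> carrier R" "x \<notin> nil"
 obtain y where "y \<in> carrier R" "x \<otimes> y = \<one>"
  using inverse_in_subring[OF carrier_is_subring subfieldE(3)[OF T] x] .
 then show "x \<in> Units R" using x m_comm[of x y] unfolding Units_def by (auto intro!: bexI[of _ y])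
qed

text \<open>
 Let \<open>f(\<tau>)\<close> be a nilpotent monic expression of least degree over \<open>A\<close>. By division with remainder
 it generates, together with the nilpotent elements of \<open>A\<close>, all nilpotent elements of \<open>A[\<tau>]\<close>.
\<close>
lemma nil_of_simple_extension:
 assumes A: "subring A R" "T \<subseteq> A" and \<tau>: "\<tau> \<in> carrier R"
  and C: "C \<subseteq> nil" "nil \<inter> A \<subseteq> Idl C"
 shows "\<exists>f\<in>nil. nil \<inter> simple_extension A \<tau> \<subseteq> Idl (insert f C)"
proof -
 note D = A(1) \<tau>
 note AE = subringE[OF A(1)]
 note U = simple_extension_eq_poly_span[OF D]
 note cl = subsetD[OF poly_span_closed[OF AE(1) \<tau>]] subsetD[OF AE(1)]
 define P where "P n = (\<exists>r\<in>poly_span A \<tau> n. r \<oplus> \<tau> [^] n \<in> nil)" for n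
 have Cc: "C \<subseteq> carrier R" using C(1) unfolding nil_def by blast
 have monic: "P n" if rn: "r \<in> poly_span A \<tau> n" and u: "u \<in> A" "u \<notin> nil" "r \<oplus> u \<otimes> \<tau> [^] n \<in> nil" for r u n
 proof -
  obtain v where v: "v \<in> A" "u \<otimes> v = \<one>" by (rule inverse_in_subring[OF A u(1,2)])
  have c: "r \<in> carrier R" "u \<in> carrier R" "v \<in> carrier R" "\<tau> [^] n \<in> carrier R"
   using rn u v cl \<tau> by auto
  have "v \<otimes> (r \<oplus> u \<otimes> \<tau> [^] n) = v \<otimes> r \<oplus> (u \<otimes> v) \<otimes> \<tau> [^] n" using c by algebra
  then have "v \<otimes> r \<oplus> \<tau> [^] n \<in> nil" using nil.I_l_closed[OF u(3) c(3)] v(2) c by simp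
  then show ?thesis unfolding P_def using poly_span_scale[OF D rn v(1)] by blast
 qed
 show ?thesis
 proof (cases "\<exists>n. P n")
  case False
  have "z \<in> Idl C" if "z \<in> nil" "z \<in> poly_span A \<tau> n" for z n using that
  proof (induction n arbitrary: z)
   case 0
   then show ?case using genideal_ideal[OF Cc] ideal.axioms(1) additive_subgroup.zero_closed by fastforce
  next
   case (Suc n)
   then obtain r u where ru: "r \<in> poly_span A \<tau> n" "u \<in> A" "z = r \<oplus> u \<otimes> \<tau> [^] n" by auto
   interpret I: ideal "Idl C" R using genideal_ideal[OF Cc] .
   have c: "r \<in> carrier R" "u \<in> carrier R" "\<tau> [^] n \<in> carrier R" using ru cl \<tau> by auto
   have un: "u \<in> nil" using monic[OF ru(1,2)] False Suc.prems(1) ru(3) by blast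
   have "z \<ominus> u \<otimes> \<tau> [^] n = r" unfolding ru(3) using c by algebra
   moreover have "z \<ominus> u \<otimes> \<tau> [^] n \<in> nil"
    unfolding a_minus_def using nil.a_closed[OF Suc.prems(1) nil.a_inv_closed[OF nil.I_r_closed[OF un c(3)]]] .
   ultimately have "r \<in> Idl C" using Suc.IH[OF _ ru(1)] by simp
   moreover have "u \<otimes> \<tau> [^] n \<in> Idl C" using I.I_r_closed[OF _ c(3)] un ru(2) C(2) by blast
   ultimately show ?case unfolding ru(3) using I.a_closed by blast
  qed
  then have "nil \<inter> simple_extension A \<tau> \<subseteq> Idl C" unfolding U by blast
  moreover have "Idl C \<subseteq> Idl (insert \<zero> C)" 
   using Cc genideal_self[of "insert \<zero> C"] genideal_minimal[OF genideal_ideal[of "insert \<zero> C"], of C]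
   by simp
  ultimately show ?thesis using nil.zero_closed by (intro bexI[of _ \<zero>]) auto
 next
  case True
  define d where "d = (LEAST n. P n)"
  have "P d" unfolding d_def using True by (rule LeastI_ex)
  then obtain r0 where r0: "r0 \<in> poly_span A \<tau> d" "r0 \<oplus> \<tau> [^] d \<in> nil" unfolding P_def by blast
  define f where "f = r0 \<oplus> \<tau> [^] d"
  have f: "f \<in> nil" unfolding f_def by (rule r0)
  have fc: "f \<in> carrier R" using f unfolding nil_def by simp
  have fC: "insert f C \<subseteq> carrier R" using Cc fc by blast
  interpret I: ideal "Idl (insert f C)" R using genideal_ideal[OF fC] .
  have fI: "f \<in> Idl (insert f C)" and CI: "Idl C \<subseteq> Idl (insert f C)"
   using genideal_self[OF fC] genideal_minimal[OF genideal_ideal[OF fC], of C] by simp_all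
  have "z \<in> Idl (insert f C)" if "z \<in> nil" "z \<in> poly_span A \<tau> n" for z n using that
  proof (induction n arbitrary: z)
   case 0
   then show ?case by simp
  next
   case (Suc n)
   then obtain r u where ru: "r \<in> poly_span A \<tau> n" "u \<in> A" "z = r \<oplus> u \<otimes> \<tau> [^] n" by auto
   have c: "r \<in> carrier R" "u \<in> carrier R" "\<tau> [^] n \<in> carrier R" "r0 \<in> carrier R"
    using ru r0 cl \<tau> by auto
   show ?case
   proof (cases "n < d")
    case True
    have un: "u \<in> nil"
     using monic[OF ru(1,2)] not_less_Least[of n P] True Suc.prems(1) ru(3) unfolding d_def by blast
    have "z \<ominus> u \<otimes> \<tau> [^] n = r" unfolding ru(3) using c by algebra
    moreover have "z \<ominus> u \<otimes> \<tau> [^] n \<in> nil"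
     unfolding a_minus_def using nil.a_closed[OF Suc.prems(1) nil.a_inv_closed[OF nil.I_r_closed[OF un c(3)]]] .
    ultimately have "r \<in> Idl (insert f C)" using Suc.IH[OF _ ru(1)] by simp
    moreover have "u \<otimes> \<tau> [^] n \<in> Idl (insert f C)" using I.I_r_closed[OF _ c(3)] un ru(2) C(2) CI by blast
    ultimately show ?thesis unfolding ru(3) using I.a_closed by blast
   next
    case False
    then obtain j where j: "n = d + j" by (metis le_add_diff_inverse not_less)
    have cj: "\<tau> [^] j \<in> carrier R" "\<tau> [^] d \<in> carrier R" using \<tau> by auto
    define q where "q = u \<otimes> \<tau> [^] j"
    have qc: "q \<in> carrier R" unfolding q_def using c cj by simp
    have "z \<ominus> q \<otimes> f = r \<ominus> u \<otimes> (r0 \<otimes> \<tau> [^] j)"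
     unfolding ru(3) f_def q_def j nat_pow_mult[OF \<tau>, symmetric] using c cj by algebra
    moreover have "r \<ominus> u \<otimes> (r0 \<otimes> \<tau> [^] j) \<in> poly_span A \<tau> n"
    proof (rule poly_span_diff[OF D ru(1)])
     show "u \<otimes> (r0 \<otimes> \<tau> [^] j) \<in> poly_span A \<tau> n"
      using poly_span_scale[OF D poly_span_shift[OF D r0(1), of j] ru(2)] unfolding j .
    qed
    moreover have "z \<ominus> q \<otimes> f \<in> nil"
     unfolding a_minus_def using nil.a_closed[OF Suc.prems(1) nil.a_inv_closed[OF nil.I_l_closed[OF f qc]]] .
    ultimately have "z \<ominus> q \<otimes> f \<in> Idl (insert f C)" using Suc.IH by simp
    moreover have "q \<otimes> f \<in> Idl (insert f C)" using I.I_l_closed[OF fI qc] .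
    ultimately have "(z \<ominus> q \<otimes> f) \<oplus> q \<otimes> f \<in> Idl (insert f C)" using I.a_closed by blast
    moreover have "z \<in> carrier R" using Suc.prems(1) nil.Icarr by blast
    then have "(z \<ominus> q \<otimes> f) \<oplus> q \<otimes> f = z" using qc fc by algebra
    ultimately show ?thesis by simp
   qed
  qed
  then have "nil \<inter> simple_extension A \<tau> \<subseteq> Idl (insert f C)" unfolding U by blast
  then show ?thesis using f by blast
 qed
qed

lemma nil_of_finite_extension:
 assumes "\<tau>s \<noteq> []" and "set \<tau>s \<subseteq> carrier R"
  and reduced: "nil \<inter> simple_extension T (last \<tau>s) \<subseteq> {\<zero>}"
 shows "\<exists>C. finite C \<and> card C < length \<tau>s \<and> C \<subseteq> nil \<and> nil \<inter> finite_extension T \<tau>s \<subseteq> Idl C"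
 using assms
proof (induction \<tau>s rule: list_nonempty_induct)
 case (single x)
 have "{\<zero>} \<subseteq> Idl {}"
  using genideal_ideal[of "{}"] ideal.axioms(1) additive_subgroup.zero_closed by fastforce
 then show ?case using single by (intro exI[of _ "{}"]) auto
next
 case (cons x xs)
 then obtain C where C: "finite C" "card C < length xs" "C \<subseteq> nil" "nil \<inter> finite_extension T xs \<subseteq> Idl C"
  by auto
 have sub: "subring (finite_extension T xs) R" "T \<subseteq> finite_extension T xs"
  using finite_extension_subring[OF subfieldE(1)[OF T]] finite_extension_incl[OF subfieldE(3)[OF T]] cons.prems
  by auto
 have x: "x \<in> carrier R" using cons.prems by simp
 obtain f where f: "f \<in> nil" "nil \<inter> simple_extension (finite_extension T xs) x \<subseteq> Idl (insert f C)"
  using nil_of_simple_extension[OF sub x C(3,4)] by blast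
 have "card (insert f C) < length (x # xs)"
  using C(2) card_insert_le_m1[of "length (x # xs) - 1" C f] C(1) by (simp add: card_insert_if)
 then show ?case using f C by (intro exI[of _ "insert f C"]) auto
qed

theorem edim_less_length:
 assumes "\<tau>s \<noteq> []" and "set \<tau>s \<subseteq> carrier R" and "finite_extension T \<tau>s = carrier R"
  and "nil \<inter> simple_extension T (last \<tau>s) \<subseteq> {\<zero>}"
 shows "edim R < enat (length \<tau>s)"
proof -
 obtain C where C: "finite C" "card C < length \<tau>s" "C \<subseteq> nil" "nil \<inter> carrier R \<subseteq> Idl C"
  using nil_of_finite_extension[OF assms(1,2,4)] assms(3) by auto
 have Cc: "C \<subseteq> carrier R" using C(3) nil.Icarr by blast
 have "Idl C = nil" using genideal_minimal[OF nil_ideal C(3)] C(4) nil.Icarr by blast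
 then have "edim R \<le> enat (card C)" using edim_le[OF Cc C(1)] max_ideal_eq_nil by simp
 then show ?thesis using C(2) by (meson enat_ord_simps(2) le_less_trans)
qed

lemma edim_coefficient_field:
 assumes "T = carrier R"
 shows "edim R = 0"
proof -
 have "nil = {\<zero>}"
 proof -
  have "z = \<zero>" if z: "z \<in> nil" for z
  proof (rule ccontr)
   assume "z \<noteq> \<zero>"
   then have "z \<in> T - {\<zero>}" using assms nil.Icarr[OF z] by blast
   then have "inv z \<in> carrier R" "z \<otimes> inv z = \<one>" using subfield_m_inv(1,2)[OF T] assms by auto
   then show False using nil.I_r_closed[OF z] one_notin_nil by metis
  qed
  then show ?thesis using nil.zero_closed by blast
 qed
 moreover have "Idl {} = {\<zero>}"
  using genideal_minimal[OF zeroideal, of "{}"] genideal_ideal[of "{}"] ideal.axioms(1)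
   additive_subgroup.zero_closed by fastforce
 ultimately have "edim R \<le> enat (card ({} :: 'a set))"
  using edim_le[of "{}" R] max_ideal_eq_nil by simp
 then show ?thesis by (simp add: zero_enat_def[symmetric])
qed

end

section \<open>Tensor products\<close>

lemma frag_extend_diff_fun:
 "frag_extend (\<lambda>x. g x - h x) s = frag_extend g s - frag_extend h s"
 using subset_UNIV[of "Poly_Mapping.keys s"]
 by (induction s rule: frag_induction) (auto simp: frag_extend_diff algebra_simps)

locale two_rings = A: cring A + B: cring B for A :: "'a ring" and B :: "'b ring"
begin

abbreviation F where "F \<equiv> free_product_ring A B"

lemma carrier_F: "t \<in> carrier F \<longleftrightarrow> Poly_Mapping.keys t \<subseteq> carrier A \<times> carrier B"
 and zero_F: "\<zero>\<^bsub>F\<^esub> = 0" and one_F: "\<one>\<^bsub>F\<^esub> = frag_of (\<one>\<^bsub>A\<^esub>, \<one>\<^bsub>B\<^esub>)" and add_F: "s \<oplus>\<^bsub>F\<^esub> t = s + t"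
 by (simp_all add: free_product_ring_def)

lemma mult_F: "s \<otimes>\<^bsub>F\<^esub> t = frag_extend (\<lambda>(a, b).
  frag_extend (\<lambda>(a', b'). frag_of (a \<otimes>\<^bsub>A\<^esub> a', b \<otimes>\<^bsub>B\<^esub> b')) t) s"
 by (simp add: free_product_ring_def)

lemma mult_of: "frag_of (a, b) \<otimes>\<^bsub>F\<^esub> frag_of (a', b') = frag_of (a \<otimes>\<^bsub>A\<^esub> a', b \<otimes>\<^bsub>B\<^esub> b')"
 by (simp add: mult_F)

lemma mult_diff_left: "(s - s') \<otimes>\<^bsub>F\<^esub> t = s \<otimes>\<^bsub>F\<^esub> t - s' \<otimes>\<^bsub>F\<^esub> t"
 by (simp add: mult_F frag_extend_diff)

lemma mult_diff_right: "s \<otimes>\<^bsub>F\<^esub> (t - t') = s \<otimes>\<^bsub>F\<^esub> t - s \<otimes>\<^bsub>F\<^esub> t'"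
 by (simp add: mult_F frag_extend_diff split_def frag_extend_diff_fun)

lemma mult_0: "0 \<otimes>\<^bsub>F\<^esub> t = 0" "s \<otimes>\<^bsub>F\<^esub> 0 = 0"
 using mult_diff_left[of 0 0 t] mult_diff_right[of s 0 0] by auto

lemma mult_add_left: "(s + s') \<otimes>\<^bsub>F\<^esub> t = s \<otimes>\<^bsub>F\<^esub> t + s' \<otimes>\<^bsub>F\<^esub> t"
 by (simp add: mult_F frag_extend_add)

lemma F_induct [consumes 1, case_names zero of diff]:
 assumes "t \<in> carrier F" and "P 0"
  and "\<And>a b. a \<in> carrier A \<Longrightarrow> b \<in> carrier B \<Longrightarrow> P (frag_of (a, b))"
  and "\<And>s t. s \<in> carrier F \<Longrightarrow> t \<in> carrier F \<Longrightarrow> P s \<Longrightarrow> P t \<Longrightarrow> P (s - t)"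
 shows "P t"
proof (rule free_Abelian_group_induct[where S = "carrier A \<times> carrier B"])
 show "Poly_Mapping.keys t \<subseteq> carrier A \<times> carrier B" using assms(1) unfolding carrier_F .
qed (use assms(2-4) in \<open>auto simp: carrier_F\<close>)

lemma of_closed [simp]: "frag_of (a, b) \<in> carrier F \<longleftrightarrow> a \<in> carrier A \<and> b \<in> carrier B"
 by (auto simp: carrier_F)

lemma zero_closed_F [simp]: "0 \<in> carrier F"
 by (simp add: carrier_F)

lemma diff_closed_F [simp]: "s \<in> carrier F \<Longrightarrow> t \<in> carrier F \<Longrightarrow> s - t \<in> carrier F"
 unfolding carrier_F using keys_diff[of s t] by blast

lemma add_closed_F [simp]: "s \<in> carrier F \<Longrightarrow> t \<in> carrier F \<Longrightarrow> s + t \<in> carrier F"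
 unfolding carrier_F using Poly_Mapping.keys_add[of s t] by blast

lemma mult_closed_F: "s \<in> carrier F \<Longrightarrow> t \<in> carrier F \<Longrightarrow> s \<otimes>\<^bsub>F\<^esub> t \<in> carrier F"
proof (induction s rule: F_induct)
 case (of a b)
 from of(3) of(1,2) show ?case
  by (induction rule: F_induct) (simp_all add: mult_of mult_0 mult_diff_right)
qed (simp_all add: mult_0 mult_diff_left)

lemma cring_F: "cring F"
proof (rule cringI)
 show "abelian_group F"
 proof (rule abelian_groupI)
  show "\<exists>y\<in>carrier F. y \<oplus>\<^bsub>F\<^esub> x = \<zero>\<^bsub>F\<^esub>" if "x \<in> carrier F" for x
   using that by (intro bexI[of _ "0 - x"]) (simp_all add: add_F zero_F del: diff_0)
 qed (simp_all add: add_F zero_F add_ac)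
 show "comm_monoid F"
 proof (rule comm_monoidI)
  fix x y assume x: "x \<in> carrier F" and y: "y \<in> carrier F"
  show "x \<otimes>\<^bsub>F\<^esub> y \<in> carrier F" using mult_closed_F x y .
  show "x \<otimes>\<^bsub>F\<^esub> y = y \<otimes>\<^bsub>F\<^esub> x" using x y
  proof (induction x rule: F_induct)
   case (of a b)
   from of(3) of(1,2) show ?case by (induction rule: F_induct)
     (simp_all add: mult_of mult_0 mult_diff_right mult_diff_left A.m_comm B.m_comm)
  qed (simp_all add: mult_0 mult_diff_left mult_diff_right)
  fix z assume z: "z \<in> carrier F"
  show "x \<otimes>\<^bsub>F\<^esub> y \<otimes>\<^bsub>F\<^esub> z = x \<otimes>\<^bsub>F\<^esub> (y \<otimes>\<^bsub>F\<^esub> z)"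
   using x y z
  proof (induction x rule: F_induct)
   case (of a b)
   from of(3) of(1,2,4) show ?case
   proof (induction y rule: F_induct)
    case (of a' b')
    from of(5) of(1-4) show ?case by (induction rule: F_induct)
      (simp_all add: mult_of mult_0 mult_diff_right A.m_assoc B.m_assoc)
   qed (simp_all add: mult_0 mult_diff_left mult_diff_right)
  qed (simp_all add: mult_0 mult_diff_left)
 next
  show "\<one>\<^bsub>F\<^esub> \<in> carrier F" by (simp add: one_F)
  show "\<one>\<^bsub>F\<^esub> \<otimes>\<^bsub>F\<^esub> x = x" if "x \<in> carrier F" for x
   using that by (induction rule: F_induct) (simp_all add: one_F mult_of mult_0 mult_diff_right)
 qed
qed (simp add: add_F mult_add_left)

lemma a_minus_F:
 assumes "t \<in> carrier F"
 shows "s \<ominus>\<^bsub>F\<^esub> t = s - t"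
proof -
 interpret F: cring F by (rule cring_F)
 have "\<ominus>\<^bsub>F\<^esub> t = 0 - t"
  using assms by (intro F.minus_equality) (simp_all add: add_F zero_F del: diff_0)
 then show ?thesis unfolding a_minus_def by (simp add: add_F)
qed

end

locale tensor_data = two_rings A B for A :: "'a ring" and B :: "'b ring" +
 fixes C :: "'c ring" and \<phi> \<psi>
 assumes \<phi>_closed: "\<And>c. c \<in> carrier C \<Longrightarrow> \<phi> c \<in> carrier A"
  and \<psi>_closed: "\<And>c. c \<in> carrier C \<Longrightarrow> \<psi> c \<in> carrier B"
begin

abbreviation M where "M \<equiv> tensor_ring C A \<phi> B \<psi>"
abbreviation rels where "rels \<equiv> tensor_relations C A \<phi> B \<psi>"
abbreviation I where "I \<equiv> Idl\<^bsub>F\<^esub> rels"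
abbreviation cls where "cls \<equiv> tensor_class C A \<phi> B \<psi>"
abbreviation tens where "tens a b \<equiv> cls (frag_of (a, b))"

sublocale F: cring F by (rule cring_F)

lemma rels_closed: "rels \<subseteq> carrier F"
 unfolding tensor_relations_def using \<phi>_closed \<psi>_closed by auto

sublocale I: ideal I F using F.genideal_ideal[OF rels_closed] .

sublocale M: cring M unfolding tensor_ring_def by (rule I.quotient_is_cring[OF F.cring_axioms])

lemma cls_hom: "cls \<in> ring_hom F M"
 using I.rcos_ring_hom unfolding tensor_class_def[abs_def] tensor_ring_def .

sublocale cls: ring_hom_ring F M cls using ring_hom_ringI2[OF F.ring_axioms M.ring_axioms cls_hom] .

lemma cls_zero_iff: "t \<in> carrier F \<Longrightarrow> cls t = \<zero>\<^bsub>M\<^esub> \<longleftrightarrow> t \<in> I"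
 unfolding tensor_class_def tensor_ring_def FactRing_def
 using I.rcos_const_imp_mem[of t] I.a_rcos_const[of t] by auto

lemma cls_diff:
 assumes "s \<in> carrier F" "t \<in> carrier F"
 shows "cls (s - t) = cls s \<ominus>\<^bsub>M\<^esub> cls t"
 using assms a_minus_F[of t s] by (simp flip: a_minus_F add: a_minus_def)

lemma cls_eqI:
 assumes "s \<in> carrier F" "t \<in> carrier F" "s - t \<in> I"
 shows "cls s = cls t"
proof -
 have "cls s \<ominus>\<^bsub>M\<^esub> cls t = \<zero>\<^bsub>M\<^esub>"
  using cls_zero_iff[of "s - t"] assms cls_diff by simp
 then show ?thesis using assms by simp
qed

lemma rels_in_I: "r \<in> rels \<Longrightarrow> r \<in> I"
 using F.genideal_self[OF rels_closed] by blast

lemma tens_add_left: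
 assumes "a \<in> carrier A" "a' \<in> carrier A" "b \<in> carrier B"
 shows "tens (a \<oplus>\<^bsub>A\<^esub> a') b = tens a b \<oplus>\<^bsub>M\<^esub> tens a' b"
proof -
 have "frag_of (a \<oplus>\<^bsub>A\<^esub> a', b) - (frag_of (a, b) + frag_of (a', b)) \<in> I"
  unfolding diff_add_eq_diff_diff_swap
  by (rule rels_in_I) (use assms in \<open>auto simp: tensor_relations_def algebra_simps\<close>)
 then have "tens (a \<oplus>\<^bsub>A\<^esub> a') b = cls (frag_of (a, b) + frag_of (a', b))"
  using assms by (intro cls_eqI) auto
 also have "\<dots> = tens a b \<oplus>\<^bsub>M\<^esub> tens a' b"
  using assms cls.hom_add[of "frag_of (a, b)" "frag_of (a', b)"] by (simp add: add_F)
 finally show ?thesis .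
qed

lemma tens_add_right:
 assumes "a \<in> carrier A" "b \<in> carrier B" "b' \<in> carrier B"
 shows "tens a (b \<oplus>\<^bsub>B\<^esub> b') = tens a b \<oplus>\<^bsub>M\<^esub> tens a b'"
proof -
 have "frag_of (a, b \<oplus>\<^bsub>B\<^esub> b') - (frag_of (a, b) + frag_of (a, b')) \<in> I"
  unfolding diff_add_eq_diff_diff_swap
  by (rule rels_in_I) (use assms in \<open>auto simp: tensor_relations_def algebra_simps\<close>)
 then have "tens a (b \<oplus>\<^bsub>B\<^esub> b') = cls (frag_of (a, b) + frag_of (a, b'))"
  using assms by (intro cls_eqI) auto
 also have "\<dots> = tens a b \<oplus>\<^bsub>M\<^esub> tens a b'"
  using assms cls.hom_add[of "frag_of (a, b)" "frag_of (a, b')"] by (simp add: add_F)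
 finally show ?thesis .
qed

lemma tens_balanced:
 assumes "c \<in> carrier C" "a \<in> carrier A" "b \<in> carrier B"
 shows "tens (\<phi> c \<otimes>\<^bsub>A\<^esub> a) b = tens a (\<psi> c \<otimes>\<^bsub>B\<^esub> b)"
proof (rule cls_eqI)
 show "frag_of (\<phi> c \<otimes>\<^bsub>A\<^esub> a, b) - frag_of (a, \<psi> c \<otimes>\<^bsub>B\<^esub> b) \<in> I"
  by (rule rels_in_I) (use assms in \<open>auto simp: tensor_relations_def\<close>)
qed (use assms \<phi>_closed \<psi>_closed in auto)

lemma tens_mult:
 assumes "a \<in> carrier A" "b \<in> carrier B" "a' \<in> carrier A" "b' \<in> carrier B"
 shows "tens a b \<otimes>\<^bsub>M\<^esub> tens a' b' = tens (a \<otimes>\<^bsub>A\<^esub> a') (b \<otimes>\<^bsub>B\<^esub> b')"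
 using cls.hom_mult[of "frag_of (a, b)" "frag_of (a', b')"] assms by (simp add: mult_of)

lemma one_M: "\<one>\<^bsub>M\<^esub> = tens \<one>\<^bsub>A\<^esub> \<one>\<^bsub>B\<^esub>"
 using cls.hom_one by (simp add: one_F)

lemma left_hom: "(\<lambda>a. tens a \<one>\<^bsub>B\<^esub>) \<in> ring_hom A M"
 by (rule ring_hom_memI) (simp_all add: tens_mult tens_add_left one_M)

lemma right_hom: "(\<lambda>b. tens \<one>\<^bsub>A\<^esub> b) \<in> ring_hom B M"
 by (rule ring_hom_memI) (simp_all add: tens_mult tens_add_right one_M)

lemma M_cases:
 assumes "x \<in> carrier M"
 obtains t where "t \<in> carrier F" "x = cls t"
 using assms unfolding tensor_ring_def tensor_class_def FactRing_def A_RCOSETS_def' by auto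

lemma M_in_subring:
 assumes S: "subring S M" and "\<And>a b. a \<in> carrier A \<Longrightarrow> b \<in> carrier B \<Longrightarrow> tens a b \<in> S"
 shows "S = carrier M"
proof -
 have "cls t \<in> S" if "t \<in> carrier F" for t using that
 proof (induction rule: F_induct)
  case zero
  then show ?case using cls.hom_zero subringE(2)[OF S] by (simp add: zero_F)
 next
  case (diff s t)
  then show ?case using cls_diff subringE(5,7)[OF S] by (simp add: a_minus_def)
 qed (use assms in auto)
 then show ?thesis using subringE(1)[OF S] M_cases by blast
qed

lemma exists_hom_from_F:
 assumes Z: "cring Z" and \<alpha>: "\<alpha> \<in> ring_hom A Z" and \<beta>: "\<beta> \<in> ring_hom B Z"
 shows "\<exists>h \<in> ring_hom F Z. \<forall>a\<in>carrier A. \<forall>b\<in>carrier B. h (frag_of (a, b)) = \<alpha> a \<otimes>\<^bsub>Z\<^esub> \<beta> b"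
proof -
 interpret Z: cring Z by fact
 interpret \<alpha>: ring_hom_ring A Z \<alpha> using ring_hom_ringI2[OF A.ring_axioms Z.ring_axioms \<alpha>] .
 interpret \<beta>: ring_hom_ring B Z \<beta> using ring_hom_ringI2[OF B.ring_axioms Z.ring_axioms \<beta>] .
 let ?f = "\<lambda>(a, b). \<alpha> a \<otimes>\<^bsub>Z\<^esub> \<beta> b"
 have "?f ` (carrier A \<times> carrier B) \<subseteq> carrier (add_monoid Z)" by auto
 then obtain h where h: "h \<in> hom (free_Abelian_group (carrier A \<times> carrier B)) (add_monoid Z)"
   "\<And>x. x \<in> carrier A \<times> carrier B \<Longrightarrow> h (frag_of x) = ?f x"
  using comm_group.free_Abelian_group_universal[OF Z.a_comm_group] by blast
 interpret G: group_hom "free_Abelian_group (carrier A \<times> carrier B)" "add_monoid Z" h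
  using h(1) by (simp add: group_hom_def group_hom_axioms_def Z.add.is_group)
 have cl: "h t \<in> carrier Z" if "t \<in> carrier F" for t
  using G.hom_closed[of t] that by (simp add: carrier_F)
 have add: "h (s + t) = h s \<oplus>\<^bsub>Z\<^esub> h t" if "s \<in> carrier F" "t \<in> carrier F" for s t
  using G.hom_mult[of s t] that by (simp add: carrier_F)
 have diff: "h (s - t) = h s \<ominus>\<^bsub>Z\<^esub> h t" if "s \<in> carrier F" "t \<in> carrier F" for s t
 proof -
  have "h (s - t) \<oplus>\<^bsub>Z\<^esub> h t = h s" using add[of "s - t" t] that by simp
  then show ?thesis using cl that by (metis Z.add.inv_solve_right' Z.minus_eq diff_closed_F)
 qed
 have zero: "h 0 = \<zero>\<^bsub>Z\<^esub>" using G.hom_one by simp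
 have mult: "h (s \<otimes>\<^bsub>F\<^esub> t) = h s \<otimes>\<^bsub>Z\<^esub> h t" if "s \<in> carrier F" "t \<in> carrier F" for s t
  using that
 proof (induction s rule: F_induct)
  case zero
  then show ?case using cl \<open>h 0 = \<zero>\<^bsub>Z\<^esub>\<close> by (simp add: mult_0)
 next
  case (of a b)
  from of(3) of(1,2) show ?case
  proof (induction t rule: F_induct)
   case zero
   then show ?case using cl[of "frag_of (a, b)"] \<open>h 0 = \<zero>\<^bsub>Z\<^esub>\<close> by (simp add: mult_0)
  next
   case (of a' b')
   then show ?case using h(2) by (simp add: mult_of Z.m_ac)
  next
   case (diff s t)
   then show ?case
    using cl[of "frag_of (a, b)"] cl[of s] cl[of t] \<open>\<And>s t. s \<in> carrier F \<Longrightarrow> t \<in> carrier F \<Longrightarrow> h (s - t) = h s \<ominus>\<^bsub>Z\<^esub> h t\<close>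
    by (simp add: mult_diff_right mult_closed_F Z.minus_eq Z.r_distr Z.r_minus)
  qed
 next
  case (diff s t')
  then show ?case
   using cl[of t] cl[of s] cl[of t'] \<open>\<And>s t. s \<in> carrier F \<Longrightarrow> t \<in> carrier F \<Longrightarrow> h (s - t) = h s \<ominus>\<^bsub>Z\<^esub> h t\<close>
   by (simp add: mult_diff_left mult_closed_F Z.minus_eq Z.l_distr Z.l_minus)
 qed
 have "h \<in> ring_hom F Z"
  by (rule ring_hom_memI) (use cl mult add h(2) in \<open>simp_all add: add_F one_F\<close>)
 then show ?thesis using h(2) by auto
qed

lemma nontrivial:
 assumes Z: "cring Z" "\<one>\<^bsub>Z\<^esub> \<noteq> \<zero>\<^bsub>Z\<^esub>" and \<alpha>: "\<alpha> \<in> ring_hom A Z" and \<beta>: "\<beta> \<in> ring_hom B Z"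
  and comp: "\<And>c. c \<in> carrier C \<Longrightarrow> \<alpha> (\<phi> c) = \<beta> (\<psi> c)"
 shows "\<one>\<^bsub>M\<^esub> \<noteq> \<zero>\<^bsub>M\<^esub>"
proof
 assume one: "\<one>\<^bsub>M\<^esub> = \<zero>\<^bsub>M\<^esub>"
 interpret Z: cring Z by fact
 interpret \<alpha>: ring_hom_ring A Z \<alpha> using ring_hom_ringI2[OF A.ring_axioms Z.ring_axioms \<alpha>] .
 interpret \<beta>: ring_hom_ring B Z \<beta> using ring_hom_ringI2[OF B.ring_axioms Z.ring_axioms \<beta>] .
 obtain h where h: "h \<in> ring_hom F Z"
  "\<And>a b. a \<in> carrier A \<Longrightarrow> b \<in> carrier B \<Longrightarrow> h (frag_of (a, b)) = \<alpha> a \<otimes>\<^bsub>Z\<^esub> \<beta> b"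
  using exists_hom_from_F[OF Z(1) \<alpha> \<beta>] by blast
 interpret h: ring_hom_ring F Z h using ring_hom_ringI2[OF F.ring_axioms Z.ring_axioms h(1)] .
 have diff: "h (s - t) = h s \<ominus>\<^bsub>Z\<^esub> h t" if "s \<in> carrier F" "t \<in> carrier F" for s t
  using that by (simp flip: a_minus_F add: a_minus_def)
 have cancel: "x \<oplus>\<^bsub>Z\<^esub> (y \<oplus>\<^bsub>Z\<^esub> (\<ominus>\<^bsub>Z\<^esub> x \<oplus>\<^bsub>Z\<^esub> \<ominus>\<^bsub>Z\<^esub> y)) = \<zero>\<^bsub>Z\<^esub>"
  if "x \<in> carrier Z" "y \<in> carrier Z" for x y using that by algebra
 have "rels \<subseteq> a_kernel F Z h" unfolding a_kernel_def' tensor_relations_def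
  using comp \<phi>_closed \<psi>_closed
  by (auto simp: diff h(2) Z.l_distr Z.r_distr Z.m_ac Z.minus_eq Z.minus_add Z.a_ac Z.r_neg Z.r_neg1 Z.r_neg2 cancel)
 then have "I \<subseteq> a_kernel F Z h" using F.genideal_minimal[OF h.kernel_is_ideal] by blast
 moreover have "\<one>\<^bsub>F\<^esub> \<in> I" using one cls_zero_iff[OF F.one_closed] by simp
 ultimately have "h \<one>\<^bsub>F\<^esub> = \<zero>\<^bsub>Z\<^esub>" unfolding a_kernel_def' by blast
 then show False using Z(2) by simp
qed

end

section \<open>Extension by \<open>p\<close>-th roots\<close>

lemma (in ring_hom_ring) hom_nat_add_pow:
 assumes "x \<in> carrier R"
 shows "h ([n] \<cdot>\<^bsub>R\<^esub> x) = [(n::nat)] \<cdot>\<^bsub>S\<^esub> h x"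
 by (induction n) (use assms in auto)

lemma char_p_cring_hom:
 assumes R: "cring R" "Factorial_Ring.prime p" "[p] \<cdot>\<^bsub>R\<^esub> \<one>\<^bsub>R\<^esub> = \<zero>\<^bsub>R\<^esub>" and S: "cring S" and h: "h \<in> ring_hom R S"
 shows "char_p_cring S p"
proof -
 interpret R: cring R by fact
 interpret S: cring S by fact
 interpret h: ring_hom_ring R S h using ring_hom_ringI2[OF R.ring_axioms S.ring_axioms h] .
 show ?thesis by unfold_locales (use R h.hom_nat_add_pow[of "\<one>\<^bsub>R\<^esub>" p] in auto)
qed

lemma (in algebraically_closed) exists_root_of_power:
 assumes c: "c \<in> carrier L" and n: "n > 0"
 shows "\<exists>r\<in>carrier L. r [^]\<^bsub>L\<^esub> (n::nat) = c"
proof -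
 obtain m where m: "n = Suc m" using n by (cases n) auto
 define q where "q = \<one>\<^bsub>L\<^esub> # replicate m \<zero>\<^bsub>L\<^esub> @ [\<ominus>\<^bsub>L\<^esub> c]"
 have q: "q \<in> carrier (poly_ring L)"
  unfolding sym[OF univ_poly_carrier] polynomial_def q_def using c by auto
 have "degree q = n" unfolding q_def m by simp
 then have "roots q \<noteq> {#}" using roots_over_carrier[OF q] n unfolding splitted_def by auto
 then obtain r where "r \<in># roots q" by blast
 then have r: "r \<in> carrier L" "eval q r = \<zero>\<^bsub>L\<^esub>"
  using roots_mem_iff_is_root[OF q] unfolding is_root_def by auto
 have "eval q r = r [^]\<^bsub>L\<^esub> n \<oplus>\<^bsub>L\<^esub> \<ominus>\<^bsub>L\<^esub> c"
  unfolding q_def using r c m by (simp add: eval_replicate)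
 then have "r [^]\<^bsub>L\<^esub> n = c" using r c by (metis r_neg2 minus_equality minus_minus a_comm add.inv_closed nat_pow_closed)
 then show ?thesis using r by blast
qed

lemma (in char_p_field) p_root_relation_free:
 assumes S: "subfield S R" and t: "t \<in> carrier R" "t [^] p \<in> S" "t \<notin> S" and "m < p"
  and r: "r \<in> poly_span S t m" "d \<in> S" "r \<oplus> d \<otimes> t [^] m = \<zero>"
 shows "d = \<zero>"
proof (rule ccontr)
 assume d: "d \<noteq> \<zero>"
 have Sc: "S \<subseteq> carrier R" using subfieldE(3)[OF S] .
 obtain q where q: "set q \<subseteq> S" "length q = m" "eval q t = r"
  using poly_span_as_eval[OF r(1) Sc t(1)] by blast
 have pol: "d # q \<in> carrier (S[X])"
  using q r d unfolding sym[OF univ_poly_carrier] polynomial_def by simp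
 have "r \<in> carrier R" using q Sc t(1) eval_in_carrier by blast
 then have "eval (d # q) t = \<zero>" using q r Sc t(1) a_comm[of r "d \<otimes> t [^] m"] by auto
 then have "Irr S t pdivides (d # q)"
  using Irr_minimal[OF S t(1) degree_Irr_p_root(1)[OF S t(1,2)] pol] by blast
 then have "degree (Irr S t) \<le> degree (d # q)"
  using pdivides_imp_degree_le[OF subfieldE(1)[OF S] IrrE(1)[OF S t(1) degree_Irr_p_root(1)[OF S t(1,2)]] pol]
  by simp
 then show False using degree_Irr_p_root(3)[OF S t] q(2) \<open>m < p\<close> by simp
qed

lemma (in ring) last_strict_tower:
 assumes "strict_tower E ts" "ts \<noteq> []"
 shows "last ts \<notin> E" using assms by (induction ts) (auto split: if_splits)

locale p_root_extension = char_p_field K p for K :: "'r ring" and p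
begin

abbreviation \<Omega> where "\<Omega> \<equiv> field.alg_closure K"
abbreviation \<iota> :: "'r \<Rightarrow> ('r list \<times> nat) multiset \<Rightarrow> 'r" where "\<iota> \<equiv> ring.indexed_const K"
abbreviation L where "L \<equiv> p_root_field p K"

sublocale \<Omega>: algebraic_closure \<Omega> "\<iota> ` carrier K" by (rule alg_closureE(1))

lemma \<iota>_hom: "\<iota> \<in> ring_hom K \<Omega>" by (rule alg_closureE(2))

sublocale \<iota>: ring_hom_ring K \<Omega> \<iota>
 using ring_hom_ringI2[OF ring_axioms \<Omega>.ring_axioms \<iota>_hom] .

sublocale \<Omega>p: char_p_field \<Omega> p
 using char_p_cring_hom[OF cring_axioms prime_p char_p \<Omega>.cring_axioms \<iota>_hom]
 by (intro char_p_field.intro \<Omega>.field_axioms)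

definition Lc where "Lc = {x \<in> carrier \<Omega>. x [^]\<^bsub>\<Omega>\<^esub> p \<in> \<iota> ` carrier K}"

lemma L_def': "L = \<Omega>\<lparr>carrier := Lc\<rparr>"
 by (simp add: p_root_field_def Lc_def)

lemma K_sub: "subfield (\<iota> ` carrier K) \<Omega>"
 by (rule \<Omega>.subfield_axioms)

lemma Lc_subfield: "subfield Lc \<Omega>"
proof (rule \<Omega>.subfieldI')
 note KE = subringE[OF subfieldE(1)[OF K_sub]]
 show "subring Lc \<Omega>" by (rule \<Omega>.subringI)
   (use KE in \<open>auto simp: Lc_def \<Omega>p.power_p_minus \<Omega>p.power_p_add \<Omega>.nat_pow_distrib\<close>)
 fix x assume x: "x \<in> Lc - {\<zero>\<^bsub>\<Omega>\<^esub>}"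
 then have xc: "x \<in> carrier \<Omega>" "x \<in> Units \<Omega>" "x [^]\<^bsub>\<Omega>\<^esub> p \<in> \<iota> ` carrier K"
  unfolding Lc_def \<Omega>.field_Units by auto
 have i: "inv\<^bsub>\<Omega>\<^esub> x \<in> carrier \<Omega>" using xc(2) by simp
 have "x [^]\<^bsub>\<Omega>\<^esub> p \<otimes>\<^bsub>\<Omega>\<^esub> (inv\<^bsub>\<Omega>\<^esub> x) [^]\<^bsub>\<Omega>\<^esub> p = \<one>\<^bsub>\<Omega>\<^esub>"
  using xc i by (simp add: \<Omega>.nat_pow_distrib[symmetric])
 moreover have "x [^]\<^bsub>\<Omega>\<^esub> p \<noteq> \<zero>\<^bsub>\<Omega>\<^esub>" using \<Omega>p.nat_pow_eq_zero[OF xc(1), of p] x by blast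
 ultimately have "(inv\<^bsub>\<Omega>\<^esub> x) [^]\<^bsub>\<Omega>\<^esub> p \<in> \<iota> ` carrier K"
  using \<Omega>.subfield_m_inv_simprule[OF K_sub, of "x [^]\<^bsub>\<Omega>\<^esub> p" "(inv\<^bsub>\<Omega>\<^esub> x) [^]\<^bsub>\<Omega>\<^esub> p"] xc i KE(3) by simp
 then show "inv\<^bsub>\<Omega>\<^esub> x \<in> Lc" unfolding Lc_def using i by simp
qed

lemma L_field: "field L"
 unfolding L_def' using \<Omega>.subfield_iff(2)[OF Lc_subfield] .

sublocale L: field L by (rule L_field)

lemma L_simps: "carrier L = Lc" "x \<otimes>\<^bsub>L\<^esub> y = x \<otimes>\<^bsub>\<Omega>\<^esub> y" "x \<oplus>\<^bsub>L\<^esub> y = x \<oplus>\<^bsub>\<Omega>\<^esub> y" "\<one>\<^bsub>L\<^esub> = \<one>\<^bsub>\<Omega>\<^esub>"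
 "\<zero>\<^bsub>L\<^esub> = \<zero>\<^bsub>\<Omega>\<^esub>" unfolding L_def' by simp_all

lemma L_pow: "x [^]\<^bsub>L\<^esub> (n::nat) = x [^]\<^bsub>\<Omega>\<^esub> n"
 unfolding L_def' by (simp add: nat_pow_def)

lemma \<iota>_in_L: "c \<in> carrier K \<Longrightarrow> \<iota> c \<in> carrier L"
 unfolding L_simps Lc_def by (auto simp: \<iota>.hom_nat_pow[symmetric])

lemma \<iota>_hom_L: "\<iota> \<in> ring_hom K L"
 by (rule ring_hom_memI) (simp_all add: \<iota>_in_L, simp_all add: L_simps)

sublocale \<iota>L: ring_hom_ring K L \<iota>
 using ring_hom_ringI2[OF ring_axioms L.ring_axioms \<iota>_hom_L] .

sublocale Lp: char_p_field L p
 using char_p_cring_hom[OF cring_axioms prime_p char_p L.cring_axioms \<iota>_hom_L]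
 by (intro char_p_field.intro L.field_axioms)

lemma L_power_p: "l \<in> carrier L \<Longrightarrow> \<exists>c\<in>carrier K. l [^]\<^bsub>L\<^esub> p = \<iota> c"
 unfolding L_pow L_simps Lc_def by blast

lemma exists_p_root_in_L:
 assumes "c \<in> carrier K"
 shows "\<exists>l\<in>carrier L. l [^]\<^bsub>L\<^esub> p = \<iota> c"
proof -
 obtain r where "r \<in> carrier \<Omega>" "r [^]\<^bsub>\<Omega>\<^esub> p = \<iota> c"
  using \<Omega>.exists_root_of_power[of "\<iota> c" p] assms p_gt_1 by auto
 then show ?thesis using assms unfolding L_pow L_simps Lc_def by blast
qed

lemma L_generated:
 assumes ts: "set ts \<subseteq> carrier K" "finite_extension ((\<lambda>x. x [^]\<^bsub>K\<^esub> p) ` carrier K) ts = carrier K"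
  and \<rho>: "\<And>t. t \<in> set ts \<Longrightarrow> \<rho> t \<in> carrier L \<and> \<rho> t [^]\<^bsub>L\<^esub> p = \<iota> t"
 shows "L.finite_extension (\<iota> ` carrier K) (map \<rho> ts) = carrier L"
proof -
 let ?E = "L.finite_extension (\<iota> ` carrier K) (map \<rho> ts)"
 interpret Fr: ring_hom_ring L L "\<lambda>x. x [^]\<^bsub>L\<^esub> p" by (rule Lp.power_p_ring_hom)
 have \<iota>K: "\<iota> ` carrier K \<subseteq> carrier L" using \<iota>_in_L by blast
 have \<rho>c: "set (map \<rho> ts) \<subseteq> carrier L" using \<rho> by auto
 have Ec: "?E \<subseteq> carrier L" using L.finite_extension_in_carrier[OF \<iota>K \<rho>c] .
 have Kpc: "(\<lambda>x. x [^]\<^bsub>K\<^esub> p) ` carrier K \<subseteq> carrier K" by auto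
 have im: "(\<lambda>x. x [^]\<^bsub>L\<^esub> p) ` \<iota> ` carrier K = \<iota> ` (\<lambda>x. x [^]\<^bsub>K\<^esub> p) ` carrier K"
  unfolding image_image by (intro image_cong) (simp_all add: \<iota>L.hom_nat_pow)
 have "(\<lambda>x. x [^]\<^bsub>L\<^esub> p) ` ?E = L.finite_extension ((\<lambda>x. x [^]\<^bsub>L\<^esub> p) ` \<iota> ` carrier K)
   (map (\<lambda>x. x [^]\<^bsub>L\<^esub> p) (map \<rho> ts))"
  using Fr.image_finite_extension[OF \<iota>K \<rho>c] .
 also have "map (\<lambda>x. x [^]\<^bsub>L\<^esub> p) (map \<rho> ts) = map \<iota> ts" using \<rho> by simp
 also have "L.finite_extension ((\<lambda>x. x [^]\<^bsub>L\<^esub> p) ` \<iota> ` carrier K) (map \<iota> ts) = \<iota> ` carrier K"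
  unfolding im \<iota>L.image_finite_extension[OF Kpc ts(1), symmetric] ts(2) ..
 finally have FE: "(\<lambda>x. x [^]\<^bsub>L\<^esub> p) ` ?E = \<iota> ` carrier K" .
 have "l \<in> ?E" if l: "l \<in> carrier L" for l
 proof -
  have "l [^]\<^bsub>L\<^esub> p \<in> (\<lambda>x. x [^]\<^bsub>L\<^esub> p) ` ?E" unfolding FE using L_power_p[OF l] by blast
  then obtain e where e: "e \<in> ?E" "l [^]\<^bsub>L\<^esub> p = e [^]\<^bsub>L\<^esub> p" by blast
  then have "l = e" using Lp.power_p_inj[OF l] Ec by blast
  then show ?thesis using e(1) by simp
 qed
 then show ?thesis using Ec by blast
qed

end

text \<open>
 The hypothesis \<open>p_closed\<close> says that \<open>K\<close> contains all \<open>p\<close>-th roots that its elements have in \<open>T\<close>.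
\<close>
locale p_closed_extension = p_root_extension K p + T: field T
 for K :: "'r ring" and p and T :: "'s ring" +
 fixes \<theta>
 assumes \<theta>: "\<theta> \<in> ring_hom K T"
  and p_closed: "\<And>c w. c \<in> carrier K \<Longrightarrow> w \<in> carrier T \<Longrightarrow> w [^]\<^bsub>T\<^esub> p = \<theta> c \<Longrightarrow>
   c \<in> (\<lambda>x. x [^]\<^bsub>K\<^esub> p) ` carrier K"
begin

sublocale \<theta>: ring_hom_ring K T \<theta>
 using ring_hom_ringI2[OF ring_axioms T.ring_axioms \<theta>] .

sublocale Tp: char_p_field T p
 using char_p_cring_hom[OF cring_axioms prime_p char_p T.cring_axioms \<theta>]
 by (intro char_p_field.intro T.field_axioms)

sublocale TD: tensor_data T L K \<theta> \<iota> by unfold_locales (simp_all add: \<iota>_in_L)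

abbreviation M where "M \<equiv> tensor_ring K T \<theta> L \<iota>"

text \<open>
 Both \<open>T\<close> and \<open>L\<close> map to the algebraic closure of \<open>T\<close>, the latter by taking unique \<open>p\<close>-th roots.
\<close>
lemma M_nontrivial: "\<one>\<^bsub>M\<^esub> \<noteq> \<zero>\<^bsub>M\<^esub>"
proof -
 let ?Z = "field.alg_closure T"
 let ?\<alpha> = "ring.indexed_const T :: 's \<Rightarrow> ('s list \<times> nat) multiset \<Rightarrow> 's"
 interpret Z: algebraic_closure ?Z "?\<alpha> ` carrier T" by (rule T.alg_closureE(1))
 have \<alpha>: "?\<alpha> \<in> ring_hom T ?Z" by (rule T.alg_closureE(2))
 interpret \<alpha>: ring_hom_ring T ?Z ?\<alpha> using ring_hom_ringI2[OF T.ring_axioms Z.ring_axioms \<alpha>] .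
 interpret Zp: char_p_field ?Z p
  using char_p_cring_hom[OF T.cring_axioms prime_p Tp.char_p Z.cring_axioms \<alpha>]
  by (intro char_p_field.intro Z.field_axioms)
 have inj: "inj_on \<iota> (carrier K)"
  using \<iota>.img_is_subfield(1)[OF carrier_is_subfield \<Omega>.one_not_zero] .
 define g where "g l = ?\<alpha> (\<theta> (inv_into (carrier K) \<iota> (l [^]\<^bsub>L\<^esub> p)))" for l
 have g_eq: "g l = ?\<alpha> (\<theta> c)" if "c \<in> carrier K" "l [^]\<^bsub>L\<^esub> p = \<iota> c" for l c
  unfolding g_def that(2) using inv_into_f_f[OF inj that(1)] by simp
 have "\<exists>r. r \<in> carrier ?Z \<and> r [^]\<^bsub>?Z\<^esub> p = g l" if lL: "l \<in> carrier L" for l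
 proof -
  obtain c where "c \<in> carrier K" "l [^]\<^bsub>L\<^esub> p = \<iota> c" using L_power_p[OF lL] by blast
  then have "g l \<in> carrier ?Z" using g_eq by simp
  then show ?thesis using Z.exists_root_of_power[of "g l" p] p_gt_1 by auto
 qed
 then obtain \<beta> where \<beta>: "\<And>l. l \<in> carrier L \<Longrightarrow> \<beta> l \<in> carrier ?Z"
  "\<And>l. l \<in> carrier L \<Longrightarrow> \<beta> l [^]\<^bsub>?Z\<^esub> p = g l" by metis
 have \<beta>_eq: "\<beta> l = z" if "l \<in> carrier L" "z \<in> carrier ?Z" "z [^]\<^bsub>?Z\<^esub> p = g l" for l z
  using Zp.power_p_inj \<beta> that by metis
 have \<beta>_hom: "\<beta> \<in> ring_hom L ?Z"
 proof (rule ring_hom_memI)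
  fix l l' assume l: "l \<in> carrier L" and l': "l' \<in> carrier L"
  obtain c c' where c: "c \<in> carrier K" "l [^]\<^bsub>L\<^esub> p = \<iota> c" "c' \<in> carrier K" "l' [^]\<^bsub>L\<^esub> p = \<iota> c'"
   using L_power_p[OF l] L_power_p[OF l'] by blast
  have "(l \<otimes>\<^bsub>L\<^esub> l') [^]\<^bsub>L\<^esub> p = \<iota> (c \<otimes>\<^bsub>K\<^esub> c')"
   unfolding L.nat_pow_distrib[OF l l'] c(2,4) \<iota>L.hom_mult[OF c(1,3)] ..
  from g_eq[OF m_closed[OF c(1,3)] this] have "g (l \<otimes>\<^bsub>L\<^esub> l') = g l \<otimes>\<^bsub>?Z\<^esub> g l'"
   unfolding g_eq[OF c(1,2)] g_eq[OF c(3,4)] using c(1,3) by simp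
  then show "\<beta> (l \<otimes>\<^bsub>L\<^esub> l') = \<beta> l \<otimes>\<^bsub>?Z\<^esub> \<beta> l'"
   using l l' \<beta> by (intro \<beta>_eq) (simp_all add: Z.nat_pow_distrib)
  have "(l \<oplus>\<^bsub>L\<^esub> l') [^]\<^bsub>L\<^esub> p = \<iota> (c \<oplus>\<^bsub>K\<^esub> c')"
   unfolding Lp.power_p_add[OF l l'] c(2,4) \<iota>L.hom_add[OF c(1,3)] ..
  from g_eq[OF a_closed[OF c(1,3)] this] have "g (l \<oplus>\<^bsub>L\<^esub> l') = g l \<oplus>\<^bsub>?Z\<^esub> g l'"
   unfolding g_eq[OF c(1,2)] g_eq[OF c(3,4)] using c(1,3) by simp
  then show "\<beta> (l \<oplus>\<^bsub>L\<^esub> l') = \<beta> l \<oplus>\<^bsub>?Z\<^esub> \<beta> l'"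
   using l l' \<beta> by (intro \<beta>_eq) (simp_all add: Zp.power_p_add)
 next
  have "\<one>\<^bsub>L\<^esub> [^]\<^bsub>L\<^esub> p = \<iota> \<one>\<^bsub>K\<^esub>" unfolding \<iota>L.hom_one by (rule L.nat_pow_one)
  from g_eq[OF one_closed this] have "g \<one>\<^bsub>L\<^esub> = \<one>\<^bsub>?Z\<^esub>" by simp
  then show "\<beta> \<one>\<^bsub>L\<^esub> = \<one>\<^bsub>?Z\<^esub>" by (intro \<beta>_eq) simp_all
 qed (use \<beta> in simp)
 have "?\<alpha> (\<theta> c) = \<beta> (\<iota> c)" if c: "c \<in> carrier K" for c
 proof (rule \<beta>_eq[symmetric])
  have "g (\<iota> c) = ?\<alpha> (\<theta> (c [^]\<^bsub>K\<^esub> p))"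
   by (rule g_eq[OF nat_pow_closed[OF c] \<iota>L.hom_nat_pow[OF c, symmetric]])
  then show "?\<alpha> (\<theta> c) [^]\<^bsub>?Z\<^esub> p = g (\<iota> c)" using c by (simp add: \<alpha>.hom_nat_pow \<theta>.hom_nat_pow)
 qed (use c \<iota>_in_L in simp_all)
 then show ?thesis using TD.nontrivial[OF Z.cring_axioms _ \<alpha> \<beta>_hom] Z.one_not_zero by simp
qed

sublocale left: ring_hom_ring T M "\<lambda>a. TD.tens a \<one>\<^bsub>L\<^esub>"
 using ring_hom_ringI2[OF T.ring_axioms TD.M.ring_axioms TD.left_hom] .

sublocale right: ring_hom_ring L M "\<lambda>b. TD.tens \<one>\<^bsub>T\<^esub> b"
 using ring_hom_ringI2[OF L.ring_axioms TD.M.ring_axioms TD.right_hom] .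

definition T' where "T' = (\<lambda>a. TD.tens a \<one>\<^bsub>L\<^esub>) ` carrier T"

lemma T'_subfield: "subfield T' M" and left_inj: "inj_on (\<lambda>a. TD.tens a \<one>\<^bsub>L\<^esub>) (carrier T)"
 using left.img_is_subfield[OF T.carrier_is_subfield M_nontrivial] unfolding T'_def by auto

lemma right_\<iota>: "c \<in> carrier K \<Longrightarrow> TD.tens \<one>\<^bsub>T\<^esub> (\<iota> c) = TD.tens (\<theta> c) \<one>\<^bsub>L\<^esub>"
 using TD.tens_balanced[of c "\<one>\<^bsub>T\<^esub>" "\<one>\<^bsub>L\<^esub>"] by (simp add: \<iota>_in_L)

lemma tens_split:
 "a \<in> carrier T \<Longrightarrow> l \<in> carrier L \<Longrightarrow> TD.tens a l = TD.tens a \<one>\<^bsub>L\<^esub> \<otimes>\<^bsub>M\<^esub> TD.tens \<one>\<^bsub>T\<^esub> l"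
 by (simp add: TD.tens_mult)

sublocale Mp: char_p_cring M p
 using char_p_cring_hom[OF T.cring_axioms prime_p Tp.char_p TD.M.cring_axioms TD.left_hom] .

lemma right_power_p:
 assumes "l \<in> carrier L"
 shows "TD.tens \<one>\<^bsub>T\<^esub> l [^]\<^bsub>M\<^esub> p \<in> T'"
proof -
 obtain c where c: "c \<in> carrier K" "l [^]\<^bsub>L\<^esub> p = \<iota> c" using L_power_p[OF assms] by blast
 have "TD.tens \<one>\<^bsub>T\<^esub> l [^]\<^bsub>M\<^esub> p = TD.tens (\<theta> c) \<one>\<^bsub>L\<^esub>"
  using right.hom_nat_pow[OF assms, of p] c right_\<iota> by simp
 then show ?thesis unfolding T'_def using c by auto
qed

sublocale H: height_one_algebra M p T'
proof (rule height_one_algebra.intro[OF Mp.char_p_cring_axioms], rule height_one_algebra_axioms.intro)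
 note TE = subringE[OF subfieldE(1)[OF T'_subfield]]
 show "subfield T' M" by (rule T'_subfield)
 let ?S = "{z \<in> carrier M. z [^]\<^bsub>M\<^esub> p \<in> T'}"
 have S: "subring ?S M" by (rule TD.M.subringI)
   (use TE in \<open>auto simp: Mp.power_p_minus Mp.power_p_add TD.M.nat_pow_distrib\<close>)
 have "TD.tens a l \<in> ?S" if a: "a \<in> carrier T" and l: "l \<in> carrier L" for a l
 proof -
  have "TD.tens a \<one>\<^bsub>L\<^esub> [^]\<^bsub>M\<^esub> p \<in> T'"
   using left.hom_nat_pow[OF a, of p] a unfolding T'_def by auto
  then have "TD.tens a l [^]\<^bsub>M\<^esub> p \<in> T'"
   unfolding tens_split[OF a l] using a l right_power_p[OF l] TE(6) by (simp add: TD.M.nat_pow_distrib)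
  then show ?thesis using a l by simp
 qed
 then have "?S = carrier M" using TD.M_in_subring[OF S] by blast
 then show "z [^]\<^bsub>M\<^esub> p \<in> T'" if "z \<in> carrier M" for z using that by blast
qed

lemma M_generated:
 assumes ts: "set ts \<subseteq> carrier K" "finite_extension ((\<lambda>x. x [^]\<^bsub>K\<^esub> p) ` carrier K) ts = carrier K"
  and \<rho>: "\<And>t. t \<in> set ts \<Longrightarrow> \<rho> t \<in> carrier L \<and> \<rho> t [^]\<^bsub>L\<^esub> p = \<iota> t"
 shows "TD.M.finite_extension T' (map (\<lambda>t. TD.tens \<one>\<^bsub>T\<^esub> (\<rho> t)) ts) = carrier M"
proof (rule TD.M_in_subring)
 let ?\<tau> = "map (\<lambda>t. TD.tens \<one>\<^bsub>T\<^esub> (\<rho> t)) ts"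
 let ?S = "TD.M.finite_extension T' ?\<tau>"
 have \<tau>: "set ?\<tau> \<subseteq> carrier M" using \<rho> by auto
 show S: "subring ?S M" using TD.M.finite_extension_subring[OF subfieldE(1)[OF T'_subfield] \<tau>] .
 have TS: "T' \<subseteq> ?S" using TD.M.finite_extension_incl[OF subfieldE(3)[OF T'_subfield] \<tau>] .
 have \<iota>K: "\<iota> ` carrier K \<subseteq> carrier L" using \<iota>_in_L by blast
 have \<rho>c: "set (map \<rho> ts) \<subseteq> carrier L" using \<rho> by auto
 have Lg: "L.finite_extension (\<iota> ` carrier K) (map \<rho> ts) = carrier L"
  using L_generated[OF ts(1,2)] \<rho> by blast
 have "(\<lambda>b. TD.tens \<one>\<^bsub>T\<^esub> b) ` carrier L
   = TD.M.finite_extension ((\<lambda>b. TD.tens \<one>\<^bsub>T\<^esub> b) ` \<iota> ` carrier K) (map (\<lambda>b. TD.tens \<one>\<^bsub>T\<^esub> b) (map \<rho> ts))"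
  using right.image_finite_extension[OF \<iota>K \<rho>c] unfolding Lg .
 also have "\<dots> = TD.M.finite_extension ((\<lambda>b. TD.tens \<one>\<^bsub>T\<^esub> b) ` \<iota> ` carrier K) ?\<tau>"
  by (simp only: map_map comp_def)
 also have "\<dots> \<subseteq> ?S"
  by (rule TD.M.mono_finite_extension) (auto simp: right_\<iota> T'_def)
 finally have rS: "(\<lambda>b. TD.tens \<one>\<^bsub>T\<^esub> b) ` carrier L \<subseteq> ?S" .
 show "TD.tens a l \<in> ?S" if a: "a \<in> carrier T" and l: "l \<in> carrier L" for a l
 proof -
  have "TD.tens a \<one>\<^bsub>L\<^esub> \<in> ?S" using TS a unfolding T'_def by blast
  moreover have "TD.tens \<one>\<^bsub>T\<^esub> l \<in> ?S" using rS l by blast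
  ultimately show ?thesis unfolding tens_split[OF a l] using subringE(6)[OF S] by blast
 qed
qed

text \<open>
 If \<open>t\<close> is not a \<open>p\<close>-th power in \<open>T\<close>, then \<open>T[X]/(X\<^sup>p - t)\<close> is a field.
\<close>
lemma reduced_simple_extension:
 assumes x: "x \<in> carrier K" "x \<notin> (\<lambda>x. x [^]\<^bsub>K\<^esub> p) ` carrier K"
  and l: "l \<in> carrier L" "l [^]\<^bsub>L\<^esub> p = \<iota> x"
 shows "H.nil \<inter> TD.M.simple_extension T' (TD.tens \<one>\<^bsub>T\<^esub> l) \<subseteq> {\<zero>\<^bsub>M\<^esub>}"
proof -
 let ?\<theta> = "\<lambda>a. TD.tens a \<one>\<^bsub>L\<^esub>"
 let ?\<tau> = "TD.tens \<one>\<^bsub>T\<^esub> l"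
 let ?t = "\<theta> x"
 let ?Tp = "(\<lambda>x. x [^]\<^bsub>T\<^esub> p) ` carrier T"
 have Tp: "subfield ?Tp T" using Tp.power_p_image_subfield[OF T.carrier_is_subfield] .
 have t: "?t \<in> carrier T" "?t \<notin> ?Tp" using x p_closed by auto
 have tp: "?t [^]\<^bsub>T\<^esub> p \<in> ?Tp" using t by blast
 have \<tau>: "?\<tau> \<in> carrier M" using l by simp
 have \<tau>p: "?\<tau> [^]\<^bsub>M\<^esub> p = ?\<theta> ?t"
  using right.hom_nat_pow[OF l(1), of p] l(2) right_\<iota>[OF x(1)] by simp
 have T'r: "subring T' M" using subfieldE(1)[OF T'_subfield] .
 note cl = subsetD[OF TD.M.poly_span_closed[OF subringE(1)[OF T'r] \<tau>]] subsetD[OF subringE(1)[OF T'r]]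
 have red: "TD.M.poly_span T' ?\<tau> n \<subseteq> TD.M.poly_span T' ?\<tau> p" for n
 proof (induction n rule: less_induct)
  case (less n)
  show ?case
  proof (cases "n \<le> p")
   case True
   then show ?thesis using TD.M.poly_span_mono[OF T'r \<tau>] by blast
  next
   case False
   then obtain m where m: "n = Suc m" "p \<le> m" by (cases n) auto
   obtain j where j: "m = p + j" using m(2) le_Suc_ex by blast
   show ?thesis
   proof
    fix z assume "z \<in> TD.M.poly_span T' ?\<tau> n"
    then obtain r a where z: "r \<in> TD.M.poly_span T' ?\<tau> m" "a \<in> T'" "z = r \<oplus>\<^bsub>M\<^esub> a \<otimes>\<^bsub>M\<^esub> ?\<tau> [^]\<^bsub>M\<^esub> m"
     unfolding m(1) by auto
    have r: "r \<in> TD.M.poly_span T' ?\<tau> p" using less[of m] m(1) z(1) by blast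
    define b where "b = a \<otimes>\<^bsub>M\<^esub> ?\<tau> [^]\<^bsub>M\<^esub> p"
    have b: "b \<in> T'" unfolding b_def using subringE(6)[OF T'r z(2)] H.power_p_T[OF \<tau>] by blast
    have "b \<otimes>\<^bsub>M\<^esub> ?\<tau> [^]\<^bsub>M\<^esub> j \<in> TD.M.poly_span T' ?\<tau> (Suc 0 + j)"
     by (rule TD.M.poly_span_shift[OF T'r \<tau> TD.M.poly_span_const[OF T'r \<tau> b]])
    then have "b \<otimes>\<^bsub>M\<^esub> ?\<tau> [^]\<^bsub>M\<^esub> j \<in> TD.M.poly_span T' ?\<tau> p"
     using less[of "Suc 0 + j"] m(1) j p_gt_1 by auto
    moreover have "a \<otimes>\<^bsub>M\<^esub> ?\<tau> [^]\<^bsub>M\<^esub> m = b \<otimes>\<^bsub>M\<^esub> ?\<tau> [^]\<^bsub>M\<^esub> j"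
     unfolding b_def j TD.M.nat_pow_mult[OF \<tau>, symmetric]
     using cl(2)[OF z(2)] \<tau> by (simp add: TD.M.m_assoc)
    ultimately show "z \<in> TD.M.poly_span T' ?\<tau> p"
     unfolding z(3) using TD.M.poly_span_add[OF T'r \<tau> r] by simp
   qed
  qed
 qed
 have pow_step: "(r \<oplus>\<^bsub>M\<^esub> ?\<theta> a \<otimes>\<^bsub>M\<^esub> ?\<tau> [^]\<^bsub>M\<^esub> n) [^]\<^bsub>M\<^esub> p
   = ?\<theta> (w \<oplus>\<^bsub>T\<^esub> (a [^]\<^bsub>T\<^esub> p) \<otimes>\<^bsub>T\<^esub> ?t [^]\<^bsub>T\<^esub> n)"
  if r: "r \<in> carrier M" and w: "w \<in> T.poly_span ?Tp ?t n" "r [^]\<^bsub>M\<^esub> p = ?\<theta> w" and a: "a \<in> carrier T"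
  for r a w and n :: nat
 proof -
  have wc: "w \<in> carrier T" using w(1) T.poly_span_closed[OF subfieldE(3)[OF Tp] t(1)] by blast
  have ac: "?\<theta> a \<in> carrier M" and tc: "?\<tau> [^]\<^bsub>M\<^esub> n \<in> carrier M" using a \<tau> by auto
  have pp: "(?\<tau> [^]\<^bsub>M\<^esub> n) [^]\<^bsub>M\<^esub> p = (?\<tau> [^]\<^bsub>M\<^esub> p) [^]\<^bsub>M\<^esub> n"
   by (simp only: TD.M.nat_pow_pow[OF \<tau>] mult.commute)
  have "(r \<oplus>\<^bsub>M\<^esub> ?\<theta> a \<otimes>\<^bsub>M\<^esub> ?\<tau> [^]\<^bsub>M\<^esub> n) [^]\<^bsub>M\<^esub> p
    = r [^]\<^bsub>M\<^esub> p \<oplus>\<^bsub>M\<^esub> (?\<theta> a) [^]\<^bsub>M\<^esub> p \<otimes>\<^bsub>M\<^esub> (?\<tau> [^]\<^bsub>M\<^esub> p) [^]\<^bsub>M\<^esub> n"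
   unfolding Mp.power_p_add[OF r TD.M.m_closed[OF ac tc]] TD.M.nat_pow_distrib[OF ac tc] pp ..
  also have "\<dots> = ?\<theta> w \<oplus>\<^bsub>M\<^esub> ?\<theta> (a [^]\<^bsub>T\<^esub> p) \<otimes>\<^bsub>M\<^esub> ?\<theta> (?t [^]\<^bsub>T\<^esub> n)"
   unfolding w(2) \<tau>p left.hom_nat_pow[OF a] left.hom_nat_pow[OF t(1)] ..
  also have "\<dots> = ?\<theta> (w \<oplus>\<^bsub>T\<^esub> (a [^]\<^bsub>T\<^esub> p) \<otimes>\<^bsub>T\<^esub> ?t [^]\<^bsub>T\<^esub> n)"
   using left.hom_mult[of "a [^]\<^bsub>T\<^esub> p" "?t [^]\<^bsub>T\<^esub> n"]
    left.hom_add[of w "(a [^]\<^bsub>T\<^esub> p) \<otimes>\<^bsub>T\<^esub> ?t [^]\<^bsub>T\<^esub> n"] wc a t(1)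
   by (metis T.m_closed T.nat_pow_closed)
  finally show ?thesis .
 qed
 have power: "\<exists>w\<in>T.poly_span ?Tp ?t n. z [^]\<^bsub>M\<^esub> p = ?\<theta> w" if "z \<in> TD.M.poly_span T' ?\<tau> n" for z n
  using that
 proof (induction n arbitrary: z)
  case 0
  then show ?case using p_gt_1 left.hom_zero by (simp add: TD.M.nat_pow_zero)
 next
  case (Suc n)
  then obtain r b where z: "r \<in> TD.M.poly_span T' ?\<tau> n" "b \<in> T'" "z = r \<oplus>\<^bsub>M\<^esub> b \<otimes>\<^bsub>M\<^esub> ?\<tau> [^]\<^bsub>M\<^esub> n"
   by auto
  obtain a where a: "a \<in> carrier T" "b = ?\<theta> a" using z(2) unfolding T'_def by blast
  obtain w where w: "w \<in> T.poly_span ?Tp ?t n" "r [^]\<^bsub>M\<^esub> p = ?\<theta> w" using Suc.IH[OF z(1)] by blast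
  have "z [^]\<^bsub>M\<^esub> p = ?\<theta> (w \<oplus>\<^bsub>T\<^esub> (a [^]\<^bsub>T\<^esub> p) \<otimes>\<^bsub>T\<^esub> ?t [^]\<^bsub>T\<^esub> n)"
   unfolding z(3) a(2) using pow_step[OF cl(1)[OF z(1)] w a(1)] .
  then show ?case using w(1) a(1) by auto
 qed
 have zero: "z = \<zero>\<^bsub>M\<^esub>" if "n \<le> p" "z \<in> TD.M.poly_span T' ?\<tau> n" "z [^]\<^bsub>M\<^esub> p = \<zero>\<^bsub>M\<^esub>" for z n
  using that
 proof (induction n arbitrary: z)
  case (Suc n)
  then obtain r b where z: "r \<in> TD.M.poly_span T' ?\<tau> n" "b \<in> T'" "z = r \<oplus>\<^bsub>M\<^esub> b \<otimes>\<^bsub>M\<^esub> ?\<tau> [^]\<^bsub>M\<^esub> n"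
   by auto
  obtain a where a: "a \<in> carrier T" "b = ?\<theta> a" using z(2) unfolding T'_def by blast
  obtain w where w: "w \<in> T.poly_span ?Tp ?t n" "r [^]\<^bsub>M\<^esub> p = ?\<theta> w" using power[OF z(1)] by blast
  have wc: "w \<in> carrier T" using w(1) T.poly_span_closed[OF subfieldE(3)[OF Tp] t(1)] by blast
  have rc: "r \<in> carrier M" using cl(1)[OF z(1)] .
  have "z [^]\<^bsub>M\<^esub> p = ?\<theta> (w \<oplus>\<^bsub>T\<^esub> (a [^]\<^bsub>T\<^esub> p) \<otimes>\<^bsub>T\<^esub> ?t [^]\<^bsub>T\<^esub> n)"
   unfolding z(3) a(2) using pow_step[OF rc w a(1)] .
  then have "?\<theta> (w \<oplus>\<^bsub>T\<^esub> (a [^]\<^bsub>T\<^esub> p) \<otimes>\<^bsub>T\<^esub> ?t [^]\<^bsub>T\<^esub> n) = ?\<theta> \<zero>\<^bsub>T\<^esub>"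
   using Suc.prems(3) left.hom_zero by simp
  then have "w \<oplus>\<^bsub>T\<^esub> (a [^]\<^bsub>T\<^esub> p) \<otimes>\<^bsub>T\<^esub> ?t [^]\<^bsub>T\<^esub> n = \<zero>\<^bsub>T\<^esub>"
   using inj_onD[OF left_inj] wc a(1) t(1) by simp
  then have "a [^]\<^bsub>T\<^esub> p = \<zero>\<^bsub>T\<^esub>"
   using Tp.p_root_relation_free[OF Tp t(1) tp t(2) _ w(1)] Suc.prems(1) a(1) by simp
  then have "a = \<zero>\<^bsub>T\<^esub>" by (rule Tp.nat_pow_eq_zero[OF a(1)])
  then have "b = \<zero>\<^bsub>M\<^esub>" unfolding a(2) using left.hom_zero by (simp only:)
  then have "z = r" using z(3) rc \<tau> by simp
  then show ?case using Suc.IH[of r] z(1) Suc.prems by simp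
 qed simp
 show ?thesis
  using red zero[OF le_refl] unfolding TD.M.simple_extension_eq_poly_span[OF T'r \<tau>] H.nil_def by blast
qed

theorem edim_tensor_p_root_field:
 assumes ts: "set ts \<subseteq> carrier K" "strict_tower ((\<lambda>x. x [^]\<^bsub>K\<^esub> p) ` carrier K) ts"
   "finite_extension ((\<lambda>x. x [^]\<^bsub>K\<^esub> p) ` carrier K) ts = carrier K"
  and n: "length ts \<le> n" "n > 0"
 shows "edim M < enat n"
proof -
 obtain \<rho> where \<rho>: "\<And>t. t \<in> carrier K \<Longrightarrow> \<rho> t \<in> carrier L \<and> \<rho> t [^]\<^bsub>L\<^esub> p = \<iota> t"
  using exists_p_root_in_L by metis
 let ?\<tau> = "map (\<lambda>t. TD.tens \<one>\<^bsub>T\<^esub> (\<rho> t)) ts"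
 have gen: "TD.M.finite_extension T' ?\<tau> = carrier M"
  using M_generated[OF ts(1,3)] \<rho> ts(1) by blast
 show ?thesis
 proof (cases "ts = []")
  case True
  then have "T' = carrier M" using gen by simp
  then show ?thesis using H.edim_coefficient_field n(2) by (simp add: zero_enat_def)
 next
  case False
  have last: "last ts \<in> carrier K" "last ts \<notin> (\<lambda>x. x [^]\<^bsub>K\<^esub> p) ` carrier K"
   using False ts(1) last_strict_tower[OF ts(2) False] by auto
  have "edim M < enat (length ?\<tau>)"
  proof (rule H.edim_less_length[OF _ _ gen])
   show "?\<tau> \<noteq> []" using False by simp
   show "set ?\<tau> \<subseteq> carrier M" using \<rho> ts(1) by auto
   have "last ?\<tau> = TD.tens \<one>\<^bsub>T\<^esub> (\<rho> (last ts))" using False by (simp add: last_map)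
   then show "H.nil \<inter> TD.M.simple_extension T' (last ?\<tau>) \<subseteq> {\<zero>\<^bsub>M\<^esub>}"
    using reduced_simple_extension[OF last] \<rho>[OF last(1)] by simp
  qed
  then show ?thesis using n(1) by (metis enat_ord_simps(1) length_map order_less_le_trans)
 qed
qed

end

section \<open>Stalks of presheaves of rings\<close>

abbreviation \<Gamma> where "\<Gamma> X U \<equiv> carrier (sections X U)"

text \<open>
 Stalks depend on the restriction maps alone. This generality covers spectra and the generic fibre as
 spaces of functions.
\<close>
locale ring_presheaf =
 fixes X :: "('p, 'r) ringed_space"
 assumes sections_cring: "\<And>U. is_open X U \<Longrightarrow> cring (sections X U)"
  and restr_hom: "\<And>U V. is_open X U \<Longrightarrow> is_open X V \<Longrightarrow> V \<subseteq> U \<Longrightarrow>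
   restr X U V \<in> ring_hom (sections X U) (sections X V)"
  and restr_id: "\<And>U s. is_open X U \<Longrightarrow> s \<in> \<Gamma> X U \<Longrightarrow> restr X U U s = s"
  and restr_restr: "\<And>U V W s. is_open X U \<Longrightarrow> is_open X V \<Longrightarrow> is_open X W \<Longrightarrow> W \<subseteq> V \<Longrightarrow> V \<subseteq> U \<Longrightarrow>
   s \<in> \<Gamma> X U \<Longrightarrow> restr X V W (restr X U V s) = restr X U W s"
begin

lemma restr_closed:
 "is_open X U \<Longrightarrow> is_open X V \<Longrightarrow> V \<subseteq> U \<Longrightarrow> s \<in> \<Gamma> X U \<Longrightarrow>
  restr X U V s \<in> \<Gamma> X V" by (rule ring_hom_memE(1)[OF restr_hom])

lemma restr_ring_hom:
 assumes "is_open X U" "is_open X V" "V \<subseteq> U"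
 shows "ring_hom_ring (sections X U) (sections X V) (restr X U V)"
 by (rule ring_hom_ringI2[OF cring.axioms(1)[OF sections_cring[OF assms(1)]]
   cring.axioms(1)[OF sections_cring[OF assms(2)]] restr_hom[OF assms]])

lemma germ_memI:
 assumes "is_open X U" "x \<in> U" "s \<in> \<Gamma> X U"
 shows "(U, s) \<in> germ X x U s" unfolding germ_def using assms by auto

lemma germ_eqI:
 assumes U: "is_open X U" "s \<in> \<Gamma> X U"
  and V: "is_open X V" "t \<in> \<Gamma> X V"
  and W: "is_open X W" "x \<in> W" "W \<subseteq> U" "W \<subseteq> V" "restr X U W s = restr X V W t"
 shows "germ X x U s = germ X x V t"
proof -
 have sub: "germ X x U s \<subseteq> germ X x V t"
  if U: "is_open X U" "s \<in> \<Gamma> X U"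
  and V: "is_open X V" "t \<in> \<Gamma> X V"
  and W: "W \<subseteq> U" "W \<subseteq> V" "restr X U W s = restr X V W t" for U s V t
 proof
  fix z assume "z \<in> germ X x U s"
  then obtain V' t' W' where z: "z = (V', t')" "is_open X V'" "x \<in> V'" "t' \<in> \<Gamma> X V'"
   "is_open X W'" "x \<in> W'" "W' \<subseteq> U \<inter> V'" "restr X U W' s = restr X V' W' t'"
   unfolding germ_def by blast
  have o: "is_open X (W \<inter> W')" using \<open>is_open X W\<close> z(5) by blast
  have "restr X V (W \<inter> W') t = restr X W (W \<inter> W') (restr X V W t)"
   using restr_restr[OF V(1) \<open>is_open X W\<close> o _ W(2) V(2)] by simp
  also have "\<dots> = restr X U (W \<inter> W') s"
   using restr_restr[OF U(1) \<open>is_open X W\<close> o _ W(1) U(2)] W(3) by simp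
  also have "\<dots> = restr X W' (W \<inter> W') (restr X U W' s)"
   using restr_restr[OF U(1) z(5) o _ _ U(2)] z(7) by simp
  also have "\<dots> = restr X V' (W \<inter> W') t'"
   using restr_restr[OF z(2,5) o _ _ z(4)] z(7,8) by simp
  finally show "z \<in> germ X x V t"
   unfolding germ_def z(1) using z(2-7) o \<open>x \<in> W\<close> W by (auto intro!: exI[of _ "W \<inter> W'"])
 qed
 show ?thesis using sub[OF U V W(3-5)] sub[OF V U W(4,3) W(5)[symmetric]] by blast
qed

lemma germ_eqD:
 assumes "germ X x U s = germ X x V t" "is_open X V" "x \<in> V" "t \<in> \<Gamma> X V"
 obtains W where "is_open X W" "x \<in> W" "W \<subseteq> U" "W \<subseteq> V" "restr X U W s = restr X V W t"
proof -
 have "(V, t) \<in> germ X x U s" using germ_memI[OF assms(2-4)] assms(1) by simp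
 then show thesis using that unfolding germ_def by blast
qed

lemma germ_memD:
 assumes "(V, t) \<in> germ X x U s" "is_open X U" "s \<in> \<Gamma> X U"
 shows "is_open X V" "x \<in> V" "t \<in> \<Gamma> X V" "germ X x V t = germ X x U s"
proof -
 show V: "is_open X V" "x \<in> V" "t \<in> \<Gamma> X V" using assms(1) unfolding germ_def by auto
 obtain W where W: "is_open X W" "x \<in> W" "W \<subseteq> U \<inter> V" "restr X U W s = restr X V W t"
  using assms(1) unfolding germ_def by blast
 show "germ X x V t = germ X x U s" using germ_eqI[OF V(1,3) assms(2,3) W(1,2)] W(3,4) by simp
qed

lemma germ_restr:
 assumes "is_open X U" "s \<in> \<Gamma> X U" "is_open X W" "x \<in> W" "W \<subseteq> U"
 shows "germ X x W (restr X U W s) = germ X x U s"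
 using assms restr_closed restr_id by (intro germ_eqI[where W = W]) auto

lemma stalk_carrier:
 "carrier (stalk X x) = {germ X x U s | U s. is_open X U \<and> x \<in> U \<and> s \<in> \<Gamma> X U}"
 by (simp add: stalk_def)

lemma stalk_cases:
 assumes "a \<in> carrier (stalk X x)"
 obtains U s where "is_open X U" "x \<in> U" "s \<in> \<Gamma> X U" "a = germ X x U s"
 using assms unfolding stalk_carrier by blast

lemma germ_closed:
 "is_open X U \<Longrightarrow> x \<in> U \<Longrightarrow> s \<in> \<Gamma> X U \<Longrightarrow> germ X x U s \<in> carrier (stalk X x)"
 unfolding stalk_carrier by blast

lemma stalk_cases2:
 assumes "a \<in> carrier (stalk X x)" "b \<in> carrier (stalk X x)"
 obtains U s t where "is_open X U" "x \<in> U" "s \<in> \<Gamma> X U" "t \<in> \<Gamma> X U"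
  "a = germ X x U s" "b = germ X x U t"
proof -
 obtain U s where U: "is_open X U" "x \<in> U" "s \<in> \<Gamma> X U" "a = germ X x U s"
  using stalk_cases[OF assms(1)] .
 obtain V t where V: "is_open X V" "x \<in> V" "t \<in> \<Gamma> X V" "b = germ X x V t"
  using stalk_cases[OF assms(2)] .
 have o: "is_open X (U \<inter> V)" using U(1) V(1) by blast
 show thesis using that[OF o, of "restr X U (U \<inter> V) s" "restr X V (U \<inter> V) t"] U V o
   restr_closed[OF U(1) o _ U(3)] restr_closed[OF V(1) o _ V(3)]
   germ_restr[OF U(1,3) o] germ_restr[OF V(1,3) o] by auto
qed

lemma stalk_cases3:
 assumes "a \<in> carrier (stalk X x)" "b \<in> carrier (stalk X x)" "c \<in> carrier (stalk X x)"
 obtains U s t r where "is_open X U" "x \<in> U" "s \<in> \<Gamma> X U" "t \<in> \<Gamma> X U"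
  "r \<in> \<Gamma> X U" "a = germ X x U s" "b = germ X x U t" "c = germ X x U r"
proof -
 obtain U s t where U: "is_open X U" "x \<in> U" "s \<in> \<Gamma> X U" "t \<in> \<Gamma> X U"
  "a = germ X x U s" "b = germ X x U t" using stalk_cases2[OF assms(1,2)] .
 obtain V r where V: "is_open X V" "x \<in> V" "r \<in> \<Gamma> X V" "c = germ X x V r"
  using stalk_cases[OF assms(3)] .
 have o: "is_open X (U \<inter> V)" using U(1) V(1) by blast
 show thesis
  using that[OF o, of "restr X U (U \<inter> V) s" "restr X U (U \<inter> V) t" "restr X V (U \<inter> V) r"] U V o
   restr_closed[OF U(1) o _ U(3)] restr_closed[OF U(1) o _ U(4)] restr_closed[OF V(1) o _ V(3)]
   germ_restr[OF U(1,3) o] germ_restr[OF U(1,4) o] germ_restr[OF V(1,3) o] by auto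
qed

lemma germ_operation_cong:
 assumes U: "is_open X U" "x \<in> U" "s \<in> \<Gamma> X U" "t \<in> \<Gamma> X U"
  and V: "(V, s') \<in> germ X x U s" "(V, t') \<in> germ X x U t"
 shows "germ X x V (s' \<otimes>\<^bsub>sections X V\<^esub> t') = germ X x U (s \<otimes>\<^bsub>sections X U\<^esub> t)"
  and "germ X x V (s' \<oplus>\<^bsub>sections X V\<^esub> t') = germ X x U (s \<oplus>\<^bsub>sections X U\<^esub> t)"
proof -
 note S = germ_memD[OF V(1) U(1,3)] and T = germ_memD[OF V(2) U(1,4)]
 obtain W1 where W1: "is_open X W1" "x \<in> W1" "W1 \<subseteq> V" "W1 \<subseteq> U" "restr X V W1 s' = restr X U W1 s"
  using germ_eqD[OF S(4) U(1,2,3)] .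
 obtain W2 where W2: "is_open X W2" "x \<in> W2" "W2 \<subseteq> V" "W2 \<subseteq> U" "restr X V W2 t' = restr X U W2 t"
  using germ_eqD[OF T(4) U(1,2,4)] .
 let ?W = "W1 \<inter> W2"
 have o: "is_open X ?W" using W1(1) W2(1) by blast
 have W: "?W \<subseteq> U" "?W \<subseteq> V" "x \<in> ?W" using W1 W2 by auto
 have s: "restr X V ?W s' = restr X U ?W s"
  using restr_restr[OF S(1) W1(1) o _ W1(3) S(3)] restr_restr[OF U(1) W1(1) o _ W1(4) U(3)] W1(5) by simp
 have t: "restr X V ?W t' = restr X U ?W t"
  using restr_restr[OF S(1) W2(1) o _ W2(3) T(3)] restr_restr[OF U(1) W2(1) o _ W2(4) U(4)] W2(5) by simp
 interpret U: cring "sections X U" using sections_cring U(1) .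
 interpret V: cring "sections X V" using sections_cring S(1) .
 note hU = ring_hom_memE[OF restr_hom[OF U(1) o W(1)]] and hV = ring_hom_memE[OF restr_hom[OF S(1) o W(2)]]
 show "germ X x V (s' \<otimes>\<^bsub>sections X V\<^esub> t') = germ X x U (s \<otimes>\<^bsub>sections X U\<^esub> t)"
  using hU(2)[OF U(3,4)] hV(2)[OF S(3) T(3)] s t U S(3) T(3) W
  by (intro germ_eqI[OF S(1) _ U(1) _ o]) auto
 show "germ X x V (s' \<oplus>\<^bsub>sections X V\<^esub> t') = germ X x U (s \<oplus>\<^bsub>sections X U\<^esub> t)"
  using hU(3)[OF U(3,4)] hV(3)[OF S(3) T(3)] s t U S(3) T(3) W
  by (intro germ_eqI[OF S(1) _ U(1) _ o]) auto
qed

lemma mult_germ: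
 assumes U: "is_open X U" "x \<in> U" "s \<in> \<Gamma> X U" "t \<in> \<Gamma> X U"
 shows "germ X x U s \<otimes>\<^bsub>stalk X x\<^esub> germ X x U t = germ X x U (s \<otimes>\<^bsub>sections X U\<^esub> t)"
proof -
 have "germ X x U s \<otimes>\<^bsub>stalk X x\<^esub> germ X x U t = (THE c. \<exists>V s' t'. (V, s') \<in> germ X x U s \<and>
   (V, t') \<in> germ X x U t \<and> c = germ X x V (s' \<otimes>\<^bsub>sections X V\<^esub> t'))"
  by (simp add: stalk_def)
 also have "\<dots> = germ X x U (s \<otimes>\<^bsub>sections X U\<^esub> t)" by (rule the_equality)
   (use germ_operation_cong(1)[OF U] germ_memI[OF U(1,2,3)] germ_memI[OF U(1,2,4)] in blast)+
 finally show ?thesis .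
qed

lemma add_germ:
 assumes U: "is_open X U" "x \<in> U" "s \<in> \<Gamma> X U" "t \<in> \<Gamma> X U"
 shows "germ X x U s \<oplus>\<^bsub>stalk X x\<^esub> germ X x U t = germ X x U (s \<oplus>\<^bsub>sections X U\<^esub> t)"
proof -
 have "germ X x U s \<oplus>\<^bsub>stalk X x\<^esub> germ X x U t = (THE c. \<exists>V s' t'. (V, s') \<in> germ X x U s \<and>
   (V, t') \<in> germ X x U t \<and> c = germ X x V (s' \<oplus>\<^bsub>sections X V\<^esub> t'))"
  by (simp add: stalk_def)
 also have "\<dots> = germ X x U (s \<oplus>\<^bsub>sections X U\<^esub> t)" by (rule the_equality)
   (use germ_operation_cong(2)[OF U] germ_memI[OF U(1,2,3)] germ_memI[OF U(1,2,4)] in blast)+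
 finally show ?thesis .
qed

lemma one_stalk: "is_open X U \<Longrightarrow> x \<in> U \<Longrightarrow> \<one>\<^bsub>stalk X x\<^esub> = germ X x U \<one>\<^bsub>sections X U\<^esub>"
 and zero_stalk: "is_open X U \<Longrightarrow> x \<in> U \<Longrightarrow> \<zero>\<^bsub>stalk X x\<^esub> = germ X x U \<zero>\<^bsub>sections X U\<^esub>"
proof -
 assume U: "is_open X U" "x \<in> U"
 have P: "is_open X (points X)" "U \<subseteq> points X" using U openin_subset by auto
 interpret U: cring "sections X U" using sections_cring U(1) .
 interpret P: cring "sections X (points X)" using sections_cring P(1) .
 interpret r: ring_hom_ring "sections X (points X)" "sections X U" "restr X (points X) U"
  by (rule restr_ring_hom[OF P(1) U(1) P(2)])
 show "\<one>\<^bsub>stalk X x\<^esub> = germ X x U \<one>\<^bsub>sections X U\<^esub>"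
  using germ_restr[OF P(1) P.one_closed U P(2)] by (simp add: stalk_def)
 show "\<zero>\<^bsub>stalk X x\<^esub> = germ X x U \<zero>\<^bsub>sections X U\<^esub>"
  using germ_restr[OF P(1) P.zero_closed U P(2)] by (simp add: stalk_def)
qed

lemma stalk_cring:
 assumes x: "x \<in> points X"
 shows "cring (stalk X x)"
proof (rule cringI)
 show "abelian_group (stalk X x)"
 proof (rule abelian_groupI)
  fix a b c assume a: "a \<in> carrier (stalk X x)" and b: "b \<in> carrier (stalk X x)"
  {
   obtain U s t where U: "is_open X U" "x \<in> U" "s \<in> \<Gamma> X U" "t \<in> \<Gamma> X U"
    "a = germ X x U s" "b = germ X x U t" using stalk_cases2[OF a b] .
   interpret U: cring "sections X U" using sections_cring U(1) .
   show "a \<oplus>\<^bsub>stalk X x\<^esub> b \<in> carrier (stalk X x)"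
    using U by (simp add: add_germ germ_closed)
   show "a \<oplus>\<^bsub>stalk X x\<^esub> b = b \<oplus>\<^bsub>stalk X x\<^esub> a"
    using U by (simp add: add_germ U.a_comm)
  }
  assume c: "c \<in> carrier (stalk X x)"
  obtain U s t r where U: "is_open X U" "x \<in> U" "s \<in> \<Gamma> X U" "t \<in> \<Gamma> X U"
   "r \<in> \<Gamma> X U" "a = germ X x U s" "b = germ X x U t" "c = germ X x U r"
   using stalk_cases3[OF a b c] .
  interpret U: cring "sections X U" using sections_cring U(1) .
  show "a \<oplus>\<^bsub>stalk X x\<^esub> b \<oplus>\<^bsub>stalk X x\<^esub> c = a \<oplus>\<^bsub>stalk X x\<^esub> (b \<oplus>\<^bsub>stalk X x\<^esub> c)"
   using U by (simp add: add_germ U.a_assoc)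
 next
  have P: "is_open X (points X)" by simp
  interpret P: cring "sections X (points X)" using sections_cring P .
  show "\<zero>\<^bsub>stalk X x\<^esub> \<in> carrier (stalk X x)"
   using x by (simp add: zero_stalk[OF P] germ_closed)
 next
  fix a assume a: "a \<in> carrier (stalk X x)"
  obtain U s where U: "is_open X U" "x \<in> U" "s \<in> \<Gamma> X U" "a = germ X x U s"
   using stalk_cases[OF a] .
  interpret U: cring "sections X U" using sections_cring U(1) .
  show "\<zero>\<^bsub>stalk X x\<^esub> \<oplus>\<^bsub>stalk X x\<^esub> a = a"
   using U by (simp add: zero_stalk[OF U(1,2)] add_germ)
  have "germ X x U (\<ominus>\<^bsub>sections X U\<^esub> s) \<oplus>\<^bsub>stalk X x\<^esub> a = \<zero>\<^bsub>stalk X x\<^esub>"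
   using U by (simp add: zero_stalk[OF U(1,2)] add_germ U.l_neg)
  then show "\<exists>y\<in>carrier (stalk X x). y \<oplus>\<^bsub>stalk X x\<^esub> a = \<zero>\<^bsub>stalk X x\<^esub>"
   using U germ_closed[OF U(1,2)] by blast
 qed
 show "comm_monoid (stalk X x)"
 proof (rule comm_monoidI)
  fix a b c assume a: "a \<in> carrier (stalk X x)" and b: "b \<in> carrier (stalk X x)"
  {
   obtain U s t where U: "is_open X U" "x \<in> U" "s \<in> \<Gamma> X U" "t \<in> \<Gamma> X U"
    "a = germ X x U s" "b = germ X x U t" using stalk_cases2[OF a b] .
   interpret U: cring "sections X U" using sections_cring U(1) .
   show "a \<otimes>\<^bsub>stalk X x\<^esub> b \<in> carrier (stalk X x)"
    using U by (simp add: mult_germ germ_closed)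
   show "a \<otimes>\<^bsub>stalk X x\<^esub> b = b \<otimes>\<^bsub>stalk X x\<^esub> a"
    using U by (simp add: mult_germ U.m_comm)
  }
  assume c: "c \<in> carrier (stalk X x)"
  obtain U s t r where U: "is_open X U" "x \<in> U" "s \<in> \<Gamma> X U" "t \<in> \<Gamma> X U"
   "r \<in> \<Gamma> X U" "a = germ X x U s" "b = germ X x U t" "c = germ X x U r"
   using stalk_cases3[OF a b c] .
  interpret U: cring "sections X U" using sections_cring U(1) .
  show "a \<otimes>\<^bsub>stalk X x\<^esub> b \<otimes>\<^bsub>stalk X x\<^esub> c = a \<otimes>\<^bsub>stalk X x\<^esub> (b \<otimes>\<^bsub>stalk X x\<^esub> c)"
   using U by (simp add: mult_germ U.m_assoc)
 next
  have P: "is_open X (points X)" by simp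
  interpret P: cring "sections X (points X)" using sections_cring P .
  show "\<one>\<^bsub>stalk X x\<^esub> \<in> carrier (stalk X x)"
   using x by (simp add: one_stalk[OF P] germ_closed)
 next
  fix a assume a: "a \<in> carrier (stalk X x)"
  obtain U s where U: "is_open X U" "x \<in> U" "s \<in> \<Gamma> X U" "a = germ X x U s"
   using stalk_cases[OF a] .
  interpret U: cring "sections X U" using sections_cring U(1) .
  show "\<one>\<^bsub>stalk X x\<^esub> \<otimes>\<^bsub>stalk X x\<^esub> a = a"
   using U by (simp add: one_stalk[OF U(1,2)] mult_germ)
 qed
next
 fix a b c assume a: "a \<in> carrier (stalk X x)" and b: "b \<in> carrier (stalk X x)" and c: "c \<in> carrier (stalk X x)"
 obtain U s t r where U: "is_open X U" "x \<in> U" "s \<in> \<Gamma> X U" "t \<in> \<Gamma> X U"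
  "r \<in> \<Gamma> X U" "a = germ X x U s" "b = germ X x U t" "c = germ X x U r"
  using stalk_cases3[OF a b c] .
 interpret U: cring "sections X U" using sections_cring U(1) .
 show "(a \<oplus>\<^bsub>stalk X x\<^esub> b) \<otimes>\<^bsub>stalk X x\<^esub> c = a \<otimes>\<^bsub>stalk X x\<^esub> c \<oplus>\<^bsub>stalk X x\<^esub> b \<otimes>\<^bsub>stalk X x\<^esub> c"
  using U by (simp add: mult_germ add_germ U.l_distr)
qed

lemma germ_hom:
 assumes "is_open X U" "x \<in> U"
 shows "germ X x U \<in> ring_hom (sections X U) (stalk X x)"
 by (rule ring_hom_memI) (use assms in \<open>simp_all add: germ_closed mult_germ add_germ one_stalk\<close>)

lemma germ_ring_hom:
 assumes "is_open X U" "x \<in> U"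
 shows "ring_hom_ring (sections X U) (stalk X x) (germ X x U)"
proof -
 have "x \<in> points X" using assms openin_subset by blast
 then show ?thesis
  by (intro ring_hom_ringI2[OF _ _ germ_hom[OF assms]] cring.axioms(1) sections_cring[OF assms(1)] stalk_cring)
qed

end

lemma ringed_space_presheaf:
 assumes "is_ringed_space X"
 shows "ring_presheaf X"
proof -
 note a = assms[unfolded is_ringed_space_def]
 note a1 = conjunct1[OF a] and a2 = conjunct1[OF conjunct2[OF a]]
  and a3 = conjunct1[OF conjunct2[OF conjunct2[OF a]]]
  and a4 = conjunct1[OF conjunct2[OF conjunct2[OF conjunct2[OF a]]]]
 show ?thesis
 proof (rule ring_presheaf.intro)
  show "cring (sections X U)" if "is_open X U" for U using a1 that by simp
  show "restr X U V \<in> ring_hom (sections X U) (sections X V)"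
   if "is_open X U" "is_open X V" "V \<subseteq> U" for U V using a2 that by simp
  show "restr X U U s = s" if "is_open X U" "s \<in> \<Gamma> X U" for U s using a3 that by simp
  show "restr X V W (restr X U V s) = restr X U W s"
   if "is_open X U" "is_open X V" "is_open X W" "W \<subseteq> V" "V \<subseteq> U" "s \<in> \<Gamma> X U" for U V W s
   using a4 that by simp
 qed
qed

section \<open>Presheaves of functions\<close>

text \<open>
 The admissible functions need to be closed under the ring operations only after shrinking their
 domain, because sections are locally admissible.
\<close>
locale function_presheaf =
 fixes T :: "'p topology" and R :: "'p \<Rightarrow> 'r ring" and adm
 assumes R_cring: "\<And>x. x \<in> topspace T \<Longrightarrow> cring (R x)"
  and adm_cong: "\<And>V W s s'. adm V s \<Longrightarrow> W \<subseteq> V \<Longrightarrow> (\<And>x. x \<in> W \<Longrightarrow> s' x = s x) \<Longrightarrow> adm W s'"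
  and adm_zero: "\<And>x. x \<in> topspace T \<Longrightarrow> \<exists>V. openin T V \<and> x \<in> V \<and> adm V (\<lambda>y. \<zero>\<^bsub>R y\<^esub>)"
  and adm_one: "\<And>x. x \<in> topspace T \<Longrightarrow> \<exists>V. openin T V \<and> x \<in> V \<and> adm V (\<lambda>y. \<one>\<^bsub>R y\<^esub>)"
  and adm_minus: "\<And>x V s. openin T V \<Longrightarrow> x \<in> V \<Longrightarrow> adm V s \<Longrightarrow>
   \<exists>W. openin T W \<and> x \<in> W \<and> W \<subseteq> V \<and> adm W (\<lambda>y. \<ominus>\<^bsub>R y\<^esub> s y)"
  and adm_add: "\<And>x V s t. openin T V \<Longrightarrow> x \<in> V \<Longrightarrow> adm V s \<Longrightarrow> adm V t \<Longrightarrow>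
   \<exists>W. openin T W \<and> x \<in> W \<and> W \<subseteq> V \<and> adm W (\<lambda>y. s y \<oplus>\<^bsub>R y\<^esub> t y)"
  and adm_mult: "\<And>x V s t. openin T V \<Longrightarrow> x \<in> V \<Longrightarrow> adm V s \<Longrightarrow> adm V t \<Longrightarrow>
   \<exists>W. openin T W \<and> x \<in> W \<and> W \<subseteq> V \<and> adm W (\<lambda>y. s y \<otimes>\<^bsub>R y\<^esub> t y)"
begin

abbreviation Y where "Y \<equiv> function_space T R adm"

lemma top_Y: "space_top Y = T" and restr_Y: "restr Y U V s = restrict s V"
 by (simp_all add: function_space_def)

lemma carrier_sec: "s \<in> \<Gamma> Y U \<longleftrightarrow>
  s \<in> (\<Pi>\<^sub>E x\<in>U. carrier (R x)) \<and> (\<forall>x\<in>U. \<exists>V. openin T V \<and> x \<in> V \<and> V \<subseteq> U \<and> adm V s)"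
 by (simp add: function_space_def)

lemma sec_ops: "s \<otimes>\<^bsub>sections Y U\<^esub> t = (\<lambda>x\<in>U. s x \<otimes>\<^bsub>R x\<^esub> t x)"
 "s \<oplus>\<^bsub>sections Y U\<^esub> t = (\<lambda>x\<in>U. s x \<oplus>\<^bsub>R x\<^esub> t x)"
 "\<one>\<^bsub>sections Y U\<^esub> = (\<lambda>x\<in>U. \<one>\<^bsub>R x\<^esub>)" "\<zero>\<^bsub>sections Y U\<^esub> = (\<lambda>x\<in>U. \<zero>\<^bsub>R x\<^esub>)"
 by (simp_all add: function_space_def)

lemma sec_value: "s \<in> \<Gamma> Y U \<Longrightarrow> x \<in> U \<Longrightarrow> s x \<in> carrier (R x)"
 unfolding carrier_sec by blast

lemma sec_ext:
 assumes "s \<in> \<Gamma> Y U" "t \<in> \<Gamma> Y U" "\<And>x. x \<in> U \<Longrightarrow> s x = t x"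
 shows "s = t" using assms(1,2) unfolding carrier_sec
 by (intro PiE_ext[of s U "\<lambda>x. carrier (R x)" t]) (auto simp: assms(3))

lemma adm_pair:
 assumes U: "openin T U" and s: "s \<in> \<Gamma> Y U" "t \<in> \<Gamma> Y U" and x: "x \<in> U"
 obtains V where "openin T V" "x \<in> V" "V \<subseteq> U" "adm V s" "adm V t"
proof -
 obtain V where V: "openin T V" "x \<in> V" "V \<subseteq> U" "adm V s" using s(1) x unfolding carrier_sec by blast
 obtain W where W: "openin T W" "x \<in> W" "W \<subseteq> U" "adm W t" using s(2) x unfolding carrier_sec by blast
 have "adm (V \<inter> W) s" "adm (V \<inter> W) t"
  using adm_cong[OF V(4), of "V \<inter> W" s] adm_cong[OF W(4), of "V \<inter> W" t] by auto
 then show thesis using that[of "V \<inter> W"] V W by auto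
qed

lemma sec_restrictI:
 assumes "openin T U" "\<And>x. x \<in> U \<Longrightarrow> f x \<in> carrier (R x)"
  and "\<And>x. x \<in> U \<Longrightarrow> \<exists>V. openin T V \<and> x \<in> V \<and> adm V f"
 shows "restrict f U \<in> \<Gamma> Y U" unfolding carrier_sec
proof (intro conjI ballI)
 show "restrict f U \<in> (\<Pi>\<^sub>E x\<in>U. carrier (R x))" using assms(2) by auto
 fix x assume x: "x \<in> U"
 then obtain V where V: "openin T V" "x \<in> V" "adm V f" using assms(3) by blast
 have "adm (V \<inter> U) (restrict f U)" using adm_cong[OF V(3), of "V \<inter> U" "restrict f U"] by simp
 then show "\<exists>V. openin T V \<and> x \<in> V \<and> V \<subseteq> U \<and> adm V (restrict f U)"
  using V assms(1) x by (intro exI[of _ "V \<inter> U"]) auto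
qed

lemma sec_closed:
 assumes U: "openin T U"
 shows "\<one>\<^bsub>sections Y U\<^esub> \<in> \<Gamma> Y U" "\<zero>\<^bsub>sections Y U\<^esub> \<in> \<Gamma> Y U"
  and "s \<in> \<Gamma> Y U \<Longrightarrow> t \<in> \<Gamma> Y U \<Longrightarrow>
   s \<otimes>\<^bsub>sections Y U\<^esub> t \<in> \<Gamma> Y U"
  and "s \<in> \<Gamma> Y U \<Longrightarrow> t \<in> \<Gamma> Y U \<Longrightarrow>
   s \<oplus>\<^bsub>sections Y U\<^esub> t \<in> \<Gamma> Y U"
  and "s \<in> \<Gamma> Y U \<Longrightarrow> (\<lambda>x\<in>U. \<ominus>\<^bsub>R x\<^esub> s x) \<in> \<Gamma> Y U"
proof -
 have UT: "U \<subseteq> topspace T" using openin_subset[OF U] .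
 have c: "cring (R x)" if "x \<in> U" for x using R_cring UT that by blast
 note rc = cring.axioms(1)[OF c]
 show "\<one>\<^bsub>sections Y U\<^esub> \<in> \<Gamma> Y U"
  unfolding sec_ops by (rule sec_restrictI[OF U]) (use rc adm_one UT ring.ring_simprules(6) in blast)+
 show "\<zero>\<^bsub>sections Y U\<^esub> \<in> \<Gamma> Y U"
  unfolding sec_ops by (rule sec_restrictI[OF U]) (use rc adm_zero UT ring.ring_simprules(2) in blast)+
 {
  assume s: "s \<in> \<Gamma> Y U"
  show "(\<lambda>x\<in>U. \<ominus>\<^bsub>R x\<^esub> s x) \<in> \<Gamma> Y U"
  proof (rule sec_restrictI[OF U])
   show "\<ominus>\<^bsub>R x\<^esub> s x \<in> carrier (R x)" if "x \<in> U" for x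
    using ring.ring_simprules(3)[OF rc[OF that]] sec_value[OF s that] by blast
   show "\<exists>V. openin T V \<and> x \<in> V \<and> adm V (\<lambda>x. \<ominus>\<^bsub>R x\<^esub> s x)" if "x \<in> U" for x
    using adm_pair[OF U s s that] adm_minus by metis
  qed
  assume t: "t \<in> \<Gamma> Y U"
  show "s \<otimes>\<^bsub>sections Y U\<^esub> t \<in> \<Gamma> Y U" unfolding sec_ops
  proof (rule sec_restrictI[OF U])
   show "s x \<otimes>\<^bsub>R x\<^esub> t x \<in> carrier (R x)" if "x \<in> U" for x
    using ring.ring_simprules(5)[OF rc[OF that]] sec_value[OF s that] sec_value[OF t that] by blast
   show "\<exists>V. openin T V \<and> x \<in> V \<and> adm V (\<lambda>x. s x \<otimes>\<^bsub>R x\<^esub> t x)" if "x \<in> U" for x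
    using adm_pair[OF U s t that] adm_mult by metis
  qed
  show "s \<oplus>\<^bsub>sections Y U\<^esub> t \<in> \<Gamma> Y U" unfolding sec_ops
  proof (rule sec_restrictI[OF U])
   show "s x \<oplus>\<^bsub>R x\<^esub> t x \<in> carrier (R x)" if "x \<in> U" for x
    using ring.ring_simprules(1)[OF rc[OF that]] sec_value[OF s that] sec_value[OF t that] by blast
   show "\<exists>V. openin T V \<and> x \<in> V \<and> adm V (\<lambda>x. s x \<oplus>\<^bsub>R x\<^esub> t x)" if "x \<in> U" for x
    using adm_pair[OF U s t that] adm_add by metis
  qed
 }
qed

lemma sections_cring_Y:
 assumes U: "openin T U"
 shows "cring (sections Y U)"
proof -
 have c: "cring (R x)" if "x \<in> U" for x using R_cring openin_subset[OF U] that by blast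
 note cl = sec_closed[OF U] and val = sec_value
 note ext = sec_ext
 show ?thesis
 proof (rule cringI)
  show "abelian_group (sections Y U)"
  proof (rule abelian_groupI)
   fix s t r assume s: "s \<in> \<Gamma> Y U" and t: "t \<in> \<Gamma> Y U"
   show "s \<oplus>\<^bsub>sections Y U\<^esub> t \<in> \<Gamma> Y U" using cl(4)[OF s t] .
   show "s \<oplus>\<^bsub>sections Y U\<^esub> t = t \<oplus>\<^bsub>sections Y U\<^esub> s"
    by (rule ext[OF cl(4)[OF s t] cl(4)[OF t s]])
     (simp add: sec_ops cring.cring_simprules(10)[OF c] val[OF s] val[OF t])
   assume r: "r \<in> \<Gamma> Y U"
   show "s \<oplus>\<^bsub>sections Y U\<^esub> t \<oplus>\<^bsub>sections Y U\<^esub> r = s \<oplus>\<^bsub>sections Y U\<^esub> (t \<oplus>\<^bsub>sections Y U\<^esub> r)"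
    by (rule ext[OF cl(4)[OF cl(4)[OF s t] r] cl(4)[OF s cl(4)[OF t r]]])
     (simp add: sec_ops cring.cring_simprules(7)[OF c] val[OF s] val[OF t] val[OF r])
  next
   fix s assume s: "s \<in> \<Gamma> Y U"
   show "\<zero>\<^bsub>sections Y U\<^esub> \<oplus>\<^bsub>sections Y U\<^esub> s = s"
    by (rule ext[OF cl(4)[OF cl(2) s] s]) (simp add: sec_ops cring.cring_simprules(8)[OF c] val[OF s])
   have "(\<lambda>x\<in>U. \<ominus>\<^bsub>R x\<^esub> s x) \<oplus>\<^bsub>sections Y U\<^esub> s = \<zero>\<^bsub>sections Y U\<^esub>"
    by (rule ext[OF cl(4)[OF cl(5)[OF s] s] cl(2)]) (simp add: sec_ops cring.cring_simprules(9)[OF c] val[OF s])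
   then show "\<exists>y\<in>\<Gamma> Y U. y \<oplus>\<^bsub>sections Y U\<^esub> s = \<zero>\<^bsub>sections Y U\<^esub>" using cl(5)[OF s] by blast
  qed (rule cl(2))
  show "comm_monoid (sections Y U)"
  proof (rule comm_monoidI)
   fix s t r assume s: "s \<in> \<Gamma> Y U" and t: "t \<in> \<Gamma> Y U"
   show "s \<otimes>\<^bsub>sections Y U\<^esub> t \<in> \<Gamma> Y U" using cl(3)[OF s t] .
   show "s \<otimes>\<^bsub>sections Y U\<^esub> t = t \<otimes>\<^bsub>sections Y U\<^esub> s"
    by (rule ext[OF cl(3)[OF s t] cl(3)[OF t s]])
     (simp add: sec_ops cring.cring_simprules(14)[OF c] val[OF s] val[OF t])
   assume r: "r \<in> \<Gamma> Y U"
   show "s \<otimes>\<^bsub>sections Y U\<^esub> t \<otimes>\<^bsub>sections Y U\<^esub> r = s \<otimes>\<^bsub>sections Y U\<^esub> (t \<otimes>\<^bsub>sections Y U\<^esub> r)"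
    by (rule ext[OF cl(3)[OF cl(3)[OF s t] r] cl(3)[OF s cl(3)[OF t r]]])
     (simp add: sec_ops cring.cring_simprules(11)[OF c] val[OF s] val[OF t] val[OF r])
  next
   fix s assume s: "s \<in> \<Gamma> Y U"
   show "\<one>\<^bsub>sections Y U\<^esub> \<otimes>\<^bsub>sections Y U\<^esub> s = s"
    by (rule ext[OF cl(3)[OF cl(1) s] s]) (simp add: sec_ops cring.cring_simprules(12)[OF c] val[OF s])
  qed (rule cl(1))
 next
  fix s t r assume s: "s \<in> \<Gamma> Y U" and t: "t \<in> \<Gamma> Y U"
   and r: "r \<in> \<Gamma> Y U"
  show "(s \<oplus>\<^bsub>sections Y U\<^esub> t) \<otimes>\<^bsub>sections Y U\<^esub> r
    = s \<otimes>\<^bsub>sections Y U\<^esub> r \<oplus>\<^bsub>sections Y U\<^esub> t \<otimes>\<^bsub>sections Y U\<^esub> r"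
   by (rule ext[OF cl(3)[OF cl(4)[OF s t] r] cl(4)[OF cl(3)[OF s r] cl(3)[OF t r]]])
    (simp add: sec_ops cring.cring_simprules(13)[OF c] val[OF s] val[OF t] val[OF r])
 qed
qed

lemma restrict_closed:
 assumes "openin T U" "openin T V" "V \<subseteq> U" "s \<in> \<Gamma> Y U"
 shows "restrict s V \<in> \<Gamma> Y V"
proof (rule sec_restrictI[OF assms(2)])
 show "s x \<in> carrier (R x)" if "x \<in> V" for x using sec_value[OF assms(4)] assms(3) that by blast
 show "\<exists>W. openin T W \<and> x \<in> W \<and> adm W s" if "x \<in> V" for x
  using assms(3,4) that unfolding carrier_sec by blast
qed

sublocale Y: ring_presheaf Y
proof (rule ring_presheaf.intro)
 show "cring (sections Y U)" if "is_open Y U" for U using sections_cring_Y that by (simp add: top_Y)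
next
 fix U V assume UV: "is_open Y U" "is_open Y V" "V \<subseteq> U"
 show "restr Y U V \<in> ring_hom (sections Y U) (sections Y V)"
 proof (rule ring_hom_memI)
  show "restr Y U V s \<in> \<Gamma> Y V" if "s \<in> \<Gamma> Y U" for s
   using restrict_closed[of U V s] UV that by (simp add: top_Y restr_Y)
 qed (use UV(3) in \<open>auto simp: restr_Y sec_ops restrict_def fun_eq_iff\<close>)
next
 fix U s assume "is_open Y U" "s \<in> \<Gamma> Y U"
 then have "s \<in> (\<Pi>\<^sub>E x\<in>U. carrier (R x))" unfolding carrier_sec by blast
 then show "restr Y U U s = s" unfolding restr_Y by (rule PiE_restrict)
next
 fix U V W :: "'p set" and s assume "W \<subseteq> V"
 then show "restr Y V W (restr Y U V s) = restr Y U W s"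
  unfolding restr_Y by (auto simp: restrict_def fun_eq_iff)
qed

end

section \<open>Affine schemes\<close>

lemma (in primeideal) complement_multiplicative_set:
 assumes "\<one> \<in> carrier R"
 shows "carrier R - I \<subseteq> carrier R" "\<one> \<in> carrier R - I"
  "\<And>s t. s \<in> carrier R - I \<Longrightarrow> t \<in> carrier R - I \<Longrightarrow> s \<otimes> t \<in> carrier R - I"
proof -
 show "\<one> \<in> carrier R - I" using one_imp_carrier I_notcarr by auto
 show "s \<otimes> t \<in> carrier R - I" if "s \<in> carrier R - I" "t \<in> carrier R - I" for s t
  using that I_prime by blast
qed auto

locale affine_scheme = cring R for R :: "'r ring" (structure)
begin

abbreviation zopen where "zopen \<equiv> openin (zariski_topology R)"
abbreviation primes where "primes \<equiv> {P. primeideal P R}"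

lemma prime_multiplicative_set:
 assumes "primeideal P R"
 shows "multiplicative_set R (carrier R - P)"
proof -
 interpret P: primeideal P R by fact
 show ?thesis using P.complement_multiplicative_set[OF one_closed]
  by (intro multiplicative_set.intro multiplicative_set_axioms.intro cring_axioms) auto
qed

definition zariski_open where "zariski_open E = {P. primeideal P R \<and> \<not> E \<subseteq> P}"

lemma zariski_open_inter:
 assumes "E \<subseteq> carrier R" "E' \<subseteq> carrier R"
 shows "zariski_open E \<inter> zariski_open E' = zariski_open {e \<otimes> e' | e e'. e \<in> E \<and> e' \<in> E'}"
proof -
 have "\<not> E \<subseteq> P \<and> \<not> E' \<subseteq> P \<longleftrightarrow> \<not> {e \<otimes> e' | e e'. e \<in> E \<and> e' \<in> E'} \<subseteq> P" if P: "primeideal P R" for P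
 proof -
  interpret P: primeideal P R by fact
  show ?thesis
  proof
   assume "\<not> E \<subseteq> P \<and> \<not> E' \<subseteq> P"
   then obtain e e' where e: "e \<in> E" "e \<notin> P" "e' \<in> E'" "e' \<notin> P" by blast
   then have "e \<otimes> e' \<notin> P" using P.I_prime assms by blast
   then show "\<not> {e \<otimes> e' | e e'. e \<in> E \<and> e' \<in> E'} \<subseteq> P" using e by blast
  next
   assume "\<not> {e \<otimes> e' | e e'. e \<in> E \<and> e' \<in> E'} \<subseteq> P"
   then obtain e e' where e: "e \<in> E" "e' \<in> E'" "e \<otimes> e' \<notin> P" by blast
   then have "e \<notin> P" "e' \<notin> P" using P.I_l_closed P.I_r_closed assms by blast+
   then show "\<not> E \<subseteq> P \<and> \<not> E' \<subseteq> P" using e by blast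
  qed
 qed
 then show ?thesis unfolding zariski_open_def by auto
qed

lemma openin_zariski: "zopen U \<longleftrightarrow> (\<exists>E\<subseteq>carrier R. U = zariski_open E)"
proof -
 have "istopology (\<lambda>U. \<exists>E\<subseteq>carrier R. U = zariski_open E)"
  unfolding istopology_def
 proof (intro conjI allI impI)
  fix S T assume "\<exists>E\<subseteq>carrier R. S = zariski_open E" "\<exists>E\<subseteq>carrier R. T = zariski_open E"
  then obtain E E' where E: "E \<subseteq> carrier R" "S = zariski_open E" "E' \<subseteq> carrier R" "T = zariski_open E'"
   by blast
  then show "\<exists>E\<subseteq>carrier R. S \<inter> T = zariski_open E"
   using zariski_open_inter[of E E'] by (intro exI[of _ "{e \<otimes> e' | e e'. e \<in> E \<and> e' \<in> E'}"]) auto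
 next
  fix \<K> assume "\<forall>K\<in>\<K>. \<exists>E\<subseteq>carrier R. K = zariski_open E"
  then obtain E where E: "\<And>K. K \<in> \<K> \<Longrightarrow> E K \<subseteq> carrier R \<and> K = zariski_open (E K)" by metis
  have "\<Union>\<K> = zariski_open (\<Union>(E ` \<K>))"
  proof
   show "\<Union>\<K> \<subseteq> zariski_open (\<Union>(E ` \<K>))"
   proof
    fix P assume "P \<in> \<Union>\<K>"
    then obtain K where K: "K \<in> \<K>" "P \<in> K" by blast
    then have "P \<in> zariski_open (E K)" using E by blast
    then show "P \<in> zariski_open (\<Union>(E ` \<K>))" using K(1) unfolding zariski_open_def by blast
   qed
   show "zariski_open (\<Union>(E ` \<K>)) \<subseteq> \<Union>\<K>"
   proof
    fix P assume "P \<in> zariski_open (\<Union>(E ` \<K>))"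
    then obtain K where K: "K \<in> \<K>" "primeideal P R" "\<not> E K \<subseteq> P" unfolding zariski_open_def by blast
    then have "P \<in> zariski_open (E K)" unfolding zariski_open_def by blast
    then show "P \<in> \<Union>\<K>" using K(1) E by blast
   qed
  qed
  moreover have "\<Union>(E ` \<K>) \<subseteq> carrier R" using E by blast
  ultimately show "\<exists>F\<subseteq>carrier R. \<Union>\<K> = zariski_open F" by blast
 qed
 then have "istopology (\<lambda>U. \<exists>E\<subseteq>carrier R. U = {P. primeideal P R \<and> \<not> E \<subseteq> P})"
  unfolding zariski_open_def .
 from topology_inverse'[OF this] show ?thesis unfolding zariski_topology_def zariski_open_def by simp
qed

lemma basic_open: "a \<in> carrier R \<Longrightarrow> zopen {P. primeideal P R \<and> a \<notin> P}"
 unfolding openin_zariski zariski_open_def by (intro exI[of _ "{a}"]) auto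

lemma topspace_zariski: "topspace (zariski_topology R) = primes"
proof
 have "zopen (topspace (zariski_topology R))" by simp
 then show "topspace (zariski_topology R) \<subseteq> primes" unfolding openin_zariski zariski_open_def by auto
 have "primes = {P. primeideal P R \<and> \<one> \<notin> P}"
  using ideal.one_imp_carrier primeideal.I_notcarr primeideal.axioms(1) by metis
 then have "zopen primes" using basic_open[OF one_closed] by simp
 then show "primes \<subseteq> topspace (zariski_topology R)" by (rule openin_subset)
qed

abbreviation frac where "frac P \<equiv> fraction R (carrier R - P)"
abbreviation loc where "loc P \<equiv> localization R (carrier R - P)"

abbreviation spec_adm where "spec_adm V s \<equiv> \<exists>a \<in> carrier R. \<exists>b \<in> carrier R.
 \<forall>P\<in>V. b \<notin> P \<and> s P = frac P a b"

lemma spec_admI: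
 assumes "a \<in> carrier R" "b \<in> carrier R" "\<forall>P\<in>V. b \<notin> P \<and> s P = frac P a b"
 shows "spec_adm V s" using assms by (intro bexI)

lemma minus_frac:
 assumes "multiplicative_set R S" "a \<in> carrier R" "b \<in> S"
 shows "\<ominus>\<^bsub>localization R S\<^esub> fraction R S a b = fraction R S (\<ominus> a) b"
proof -
 interpret M: multiplicative_set R S by fact
 interpret L: cring M.Loc by (rule M.Loc_cring)
 have "M.frac (\<ominus> a) b \<oplus>\<^bsub>M.Loc\<^esub> M.frac a b = \<zero>\<^bsub>M.Loc\<^esub>"
  using assms(2,3) M.one_S M.mult_S
  by (simp add: M.add_frac r_minus l_neg M.zero_Loc) (intro M.frac_eqI, auto)
 then show ?thesis using assms(2,3) by (intro L.minus_equality) auto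
qed

lemma spec_function_presheaf:
 "function_presheaf (zariski_topology R) (\<lambda>P. loc P) (\<lambda>V s. spec_adm V s)"
proof (rule function_presheaf.intro)
 note ms = prime_multiplicative_set
 have prime: "primeideal P R" if "P \<in> V" "zopen V" for P V
  using that openin_subset topspace_zariski by blast
 show "cring (loc P)" if "P \<in> topspace (zariski_topology R)" for P
  using multiplicative_set.Loc_cring[OF ms] that topspace_zariski by blast
 show "spec_adm W s'" if "spec_adm V s" "W \<subseteq> V" "\<And>x. x \<in> W \<Longrightarrow> s' x = s x" for V W s s'
  using that by (metis subsetD)
 have all: "zopen primes" using topspace_zariski by (metis openin_topspace)
 have one: "\<one> \<notin> P" if "primeideal P R" for P
  using that ideal.one_imp_carrier primeideal.I_notcarr primeideal.axioms(1) by metis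
 show "\<exists>V. zopen V \<and> P \<in> V \<and> spec_adm V (\<lambda>P. \<zero>\<^bsub>loc P\<^esub>)"
  if "P \<in> topspace (zariski_topology R)" for P
  using that all one spec_admI[OF zero_closed one_closed, of primes] multiplicative_set.zero_Loc[OF ms]
  unfolding topspace_zariski by (intro exI[of _ primes]) auto
 show "\<exists>V. zopen V \<and> P \<in> V \<and> spec_adm V (\<lambda>P. \<one>\<^bsub>loc P\<^esub>)"
  if "P \<in> topspace (zariski_topology R)" for P
  using that all one spec_admI[OF one_closed one_closed, of primes] multiplicative_set.one_Loc[OF ms]
  unfolding topspace_zariski by (intro exI[of _ primes]) auto
 {
  fix x V s assume V: "zopen V" "x \<in> V" and "spec_adm V s"
  then obtain a b where ab: "a \<in> carrier R" "b \<in> carrier R" "\<forall>P\<in>V. b \<notin> P \<and> s P = frac P a b" by blast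
  have *: "\<forall>P\<in>V. b \<notin> P \<and> \<ominus>\<^bsub>loc P\<^esub> s P = frac P (\<ominus> a) b"
   using ab minus_frac[OF ms] prime[OF _ V(1)] by auto
  then have "spec_adm V (\<lambda>P. \<ominus>\<^bsub>loc P\<^esub> s P)" using spec_admI[OF _ ab(2) *] ab(1) by simp
  then show "\<exists>W. zopen W \<and> x \<in> W \<and> W \<subseteq> V \<and> spec_adm W (\<lambda>P. \<ominus>\<^bsub>loc P\<^esub> s P)"
   using V by blast
  fix t assume "spec_adm V t"
  then obtain c d where cd: "c \<in> carrier R" "d \<in> carrier R" "\<forall>P\<in>V. d \<notin> P \<and> t P = frac P c d" by blast
  have bd: "b \<otimes> d \<notin> P" if "P \<in> V" for P
   using primeideal.I_prime[OF prime[OF that V(1)] ab(2) cd(2)] ab(3) cd(3) that by blast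
  have *: "\<forall>P\<in>V. b \<otimes> d \<notin> P \<and> s P \<oplus>\<^bsub>loc P\<^esub> t P = frac P (d \<otimes> a \<oplus> b \<otimes> c) (b \<otimes> d)"
   using ab cd bd multiplicative_set.add_frac[OF ms] prime[OF _ V(1)] by auto
  then have "spec_adm V (\<lambda>P. s P \<oplus>\<^bsub>loc P\<^esub> t P)"
   using spec_admI[OF _ _ *] ab(1,2) cd(1,2) by simp
  then show "\<exists>W. zopen W \<and> x \<in> W \<and> W \<subseteq> V \<and> spec_adm W (\<lambda>P. s P \<oplus>\<^bsub>loc P\<^esub> t P)"
   using V by blast
  have *: "\<forall>P\<in>V. b \<otimes> d \<notin> P \<and> s P \<otimes>\<^bsub>loc P\<^esub> t P = frac P (a \<otimes> c) (b \<otimes> d)"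
   using ab cd bd multiplicative_set.mult_frac[OF ms] prime[OF _ V(1)] by auto
  then have "spec_adm V (\<lambda>P. s P \<otimes>\<^bsub>loc P\<^esub> t P)"
   using spec_admI[OF _ _ *] ab(1,2) cd(1,2) by simp
  then show "\<exists>W. zopen W \<and> x \<in> W \<and> W \<subseteq> V \<and> spec_adm W (\<lambda>P. s P \<otimes>\<^bsub>loc P\<^esub> t P)"
   using V by blast
 }
qed

sublocale S: function_presheaf "zariski_topology R" "\<lambda>P. loc P" "\<lambda>V s. spec_adm V s"
 by (rule spec_function_presheaf)

lemma Spec_eq: "Spec R = S.Y"
 by (simp add: Spec_def)

lemma Spec_presheaf: "ring_presheaf (Spec R)"
 unfolding Spec_eq by (rule S.Y.ring_presheaf_axioms)

lemma points_Spec: "points (Spec R) = primes"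
 unfolding Spec_eq S.top_Y topspace_zariski ..

lemma open_Spec: "is_open (Spec R) U \<longleftrightarrow> zopen U"
 unfolding Spec_eq S.top_Y ..

lemma restr_Spec: "restr (Spec R) U V s = restrict s V"
 unfolding Spec_eq S.restr_Y ..

lemmas sec_Spec = S.carrier_sec[folded Spec_eq] and sec_ops_Spec = S.sec_ops[folded Spec_eq]
 and sec_ext_Spec = S.sec_ext[folded Spec_eq]

lemma one_notin_prime: "primeideal P R \<Longrightarrow> \<one> \<notin> P"
 using ideal.one_imp_carrier primeideal.I_notcarr primeideal.axioms(1) by metis

lemma const_section_closed:
 assumes a: "a \<in> carrier R"
 shows "const_section R a \<in> carrier (sections (Spec R) primes)"
 unfolding const_section_def points_Spec
proof (rule S.sec_restrictI[folded Spec_eq])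
 show "zopen primes" using topspace_zariski by (metis openin_topspace)
 then show "\<exists>V. zopen V \<and> x \<in> V \<and> spec_adm V (\<lambda>P. frac P a \<one>)" if "x \<in> primes" for x
  using that a one_notin_prime spec_admI[OF a one_closed, of primes "\<lambda>P. frac P a \<one>"]
  by (intro exI[of _ primes]) auto
 show "frac x a \<one> \<in> carrier (loc x)" if "x \<in> primes" for x
 proof -
  interpret M: multiplicative_set R "carrier R - x" using prime_multiplicative_set that by simp
  show ?thesis using a M.one_S by auto
 qed
qed

lemma const_section_hom: "const_section R \<in> ring_hom R (sections (Spec R) primes)"
proof (rule ring_hom_memI)
 fix a b assume ab: "a \<in> carrier R" "b \<in> carrier R"
 have *: "frac P (a \<otimes> b) \<one> = frac P a \<one> \<otimes>\<^bsub>loc P\<^esub> frac P b \<one>"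
  "frac P (a \<oplus> b) \<one> = frac P a \<one> \<oplus>\<^bsub>loc P\<^esub> frac P b \<one>" if "primeideal P R" for P
 proof -
  interpret M: multiplicative_set R "carrier R - P" using prime_multiplicative_set that by simp
  show "frac P (a \<otimes> b) \<one> = frac P a \<one> \<otimes>\<^bsub>loc P\<^esub> frac P b \<one>"
   "frac P (a \<oplus> b) \<one> = frac P a \<one> \<oplus>\<^bsub>loc P\<^esub> frac P b \<one>"
   using ring_hom_memE(2,3)[OF M.frac_hom] ab by auto
 qed
 show "const_section R (a \<otimes> b) = const_section R a \<otimes>\<^bsub>sections (Spec R) primes\<^esub> const_section R b"
  "const_section R (a \<oplus> b) = const_section R a \<oplus>\<^bsub>sections (Spec R) primes\<^esub> const_section R b"
  unfolding const_section_def points_Spec sec_ops_Spec using * by (auto simp: fun_eq_iff restrict_def)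
next
 show "const_section R \<one> = \<one>\<^bsub>sections (Spec R) primes\<^esub>"
  unfolding const_section_def points_Spec sec_ops_Spec
  using multiplicative_set.one_Loc[OF prime_multiplicative_set] by (auto simp: fun_eq_iff restrict_def)
qed (rule const_section_closed)

text \<open>
 If \<open>a\<close> is not zero, then its annihilator is contained in a prime ideal, at which \<open>a\<close> survives.
\<close>
lemma const_section_zero:
 assumes a: "a \<in> carrier R" and zero: "const_section R a = \<zero>\<^bsub>sections (Spec R) primes\<^esub>"
 shows "a = \<zero>"
proof (rule ccontr)
 assume a0: "a \<noteq> \<zero>"
 define A where "A = {x \<in> carrier R. x \<otimes> a = \<zero>}"
 have A: "ideal A R"
 proof (rule idealI)
  show "ring R" by (rule ring_axioms)
  show "subgroup A (add_monoid R)"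
   by (rule add.subgroupI) (use a in \<open>auto simp: A_def l_distr l_minus\<close>)
  show l: "x \<otimes> y \<in> A" if "y \<in> A" "x \<in> carrier R" for x y
   using that a unfolding A_def by (simp add: m_assoc)
  show "y \<otimes> x \<in> A" if "y \<in> A" "x \<in> carrier R" for x y
   using l[OF that] that m_comm[of x y] unfolding A_def by simp
 qed
 have "A \<inter> {\<one>} = {}" using a a0 unfolding A_def by auto
 then obtain P where P: "primeideal P R" "A \<subseteq> P"
  using exists_prime_avoiding[OF A, of "{\<one>}"] by auto
 interpret M: multiplicative_set R "carrier R - P" using prime_multiplicative_set P(1) by simp
 have "const_section R a P = \<zero>\<^bsub>sections (Spec R) primes\<^esub> P" using zero by simp
 then have "frac P a \<one> = \<zero>\<^bsub>loc P\<^esub>" using P(1) unfolding const_section_def points_Spec sec_ops_Spec by simp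
 then obtain u where "u \<in> carrier R - P" "u \<otimes> a = \<zero>"
  using M.frac_eq_zero_iff[OF a M.one_S] by blast
 then show False using P(2) unfolding A_def by blast
qed

lemma domain_of_global_sections:
 assumes "domain (sections (Spec R) primes)"
 shows "domain R"
proof -
 interpret D: domain "sections (Spec R) primes" by fact
 interpret c: ring_hom_ring R "sections (Spec R) primes" "const_section R"
  using ring_hom_ringI2[OF ring_axioms D.ring_axioms const_section_hom] .
 show ?thesis
 proof (rule domain.intro[OF cring_axioms], rule domain_axioms.intro)
  show "\<one> \<noteq> \<zero>" using c.hom_one c.hom_zero D.one_not_zero by metis
  fix a b assume ab: "a \<otimes> b = \<zero>" "a \<in> carrier R" "b \<in> carrier R"
  then have "const_section R a \<otimes>\<^bsub>sections (Spec R) primes\<^esub> const_section R b = \<zero>\<^bsub>sections (Spec R) primes\<^esub>"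
   using c.hom_mult c.hom_zero by metis
  then show "a = \<zero> \<or> b = \<zero>" using D.integral ab const_section_zero c.hom_closed by metis
 qed
qed

lemma spec_T0:
 assumes "primeideal P R" "primeideal Q R"
  and "\<And>U. zopen U \<Longrightarrow> P \<in> U \<longleftrightarrow> Q \<in> U"
 shows "P = Q"
proof -
 interpret P: primeideal P R by fact
 interpret Q: primeideal Q R by fact
 have "a \<in> P \<longleftrightarrow> a \<in> Q" if "a \<in> carrier R" for a
  using assms(3)[OF basic_open[OF that]] assms(1,2) by blast
 then show ?thesis using P.Icarr Q.Icarr by blast
qed

end

locale integral_affine_scheme = affine_scheme R + domain R for R :: "'r ring" (structure)
begin

sublocale plain_domain R ..

lemma zero_prime: "primeideal {\<zero>} R"
 using zeroprimeideal .

lemma zero_in_open: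
 assumes "zopen U" "U \<noteq> {}"
 shows "{\<zero>} \<in> U"
proof -
 obtain E where E: "E \<subseteq> carrier R" "U = zariski_open E" using assms(1) unfolding openin_zariski by blast
 then obtain P where P: "primeideal P R" "\<not> E \<subseteq> P" using assms(2) unfolding zariski_open_def by blast
 interpret P: primeideal P R by fact
 have "\<not> E \<subseteq> {\<zero>}" using P(2) P.zero_closed by blast
 then show ?thesis using zero_prime E(2) unfolding zariski_open_def by blast
qed

lemma frac_zero_iff:
 assumes "a \<in> carrier R" "b \<in> carrier R" "b \<noteq> \<zero>"
 shows "frac {\<zero>} a b = \<zero>\<^bsub>loc {\<zero>}\<^esub> \<longleftrightarrow> a = \<zero>"
proof -
 interpret M: multiplicative_set R "carrier R - {\<zero>}" by (rule nonzero_multiplicative_set)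
 have "b \<in> carrier R - {\<zero>}" using assms by blast
 then show ?thesis using M.frac_eq_zero_iff[OF assms(1), of b] integral_iff[OF _ assms(1)] assms M.one_S
  by (metis DiffD1 DiffD2 r_null singletonI)
qed

lemma section_near_zero:
 assumes "zopen U" "{\<zero>} \<in> U" "s \<in> carrier (sections (Spec R) U)"
 obtains V a b where "zopen V" "{\<zero>} \<in> V" "V \<subseteq> U" "a \<in> carrier R" "b \<in> carrier R"
  "b \<noteq> \<zero>" "\<And>P. P \<in> V \<Longrightarrow> b \<notin> P \<and> s P = frac P a b"
proof -
 obtain V a b where V: "zopen V" "{\<zero>} \<in> V" "V \<subseteq> U" "a \<in> carrier R" "b \<in> carrier R"
  "\<forall>P\<in>V. b \<notin> P \<and> s P = frac P a b" using assms(2,3) unfolding sec_Spec by blast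
 then show thesis using that[OF V(1-5)] by blast
qed

text \<open>
 Every nonempty open set contains the zero ideal, so the local fractions that describe \<open>s\<close> can all be
 compared there, in the fraction field.
\<close>
lemma section_determined_by_generic_value:
 assumes U: "zopen U" "{\<zero>} \<in> U" and s: "s \<in> carrier (sections (Spec R) U)"
  and s0: "s {\<zero>} = \<zero>\<^bsub>loc {\<zero>}\<^esub>"
 shows "s = \<zero>\<^bsub>sections (Spec R) U\<^esub>"
proof -
 interpret S': cring "sections (Spec R) U" unfolding Spec_eq by (rule S.sections_cring_Y[OF U(1)])
 show ?thesis
 proof (rule sec_ext_Spec[OF s S'.zero_closed])
  fix P assume P: "P \<in> U"
  then obtain V a b where V: "zopen V" "P \<in> V" "V \<subseteq> U" "a \<in> carrier R" "b \<in> carrier R"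
   "\<forall>P\<in>V. b \<notin> P \<and> s P = frac P a b" using s unfolding sec_Spec by blast
  have Z: "{\<zero>} \<in> V" using zero_in_open[OF V(1)] V(2) by blast
  then have b: "b \<noteq> \<zero>" "s {\<zero>} = frac {\<zero>} a b" using V(6) by auto
  then have a: "a = \<zero>" using frac_zero_iff[OF V(4,5) b(1)] s0 by simp
  have prime: "primeideal P R" using P U(1) openin_subset topspace_zariski by blast
  interpret M: multiplicative_set R "carrier R - P" using prime_multiplicative_set prime by simp
  have bP: "b \<in> carrier R - P" using V by blast
  have "frac P a b = \<zero>\<^bsub>loc P\<^esub>"
   using M.frac_eq_zero_iff[OF V(4) bP] M.one_S a by (auto intro!: bexI[of _ \<one>])
  then show "s P = \<zero>\<^bsub>sections (Spec R) U\<^esub> P" using V P unfolding sec_ops_Spec by auto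
 qed
qed

text \<open>
 The denominators that work for \<open>s\<close> at the generic point form an ideal that lies in no prime ideal.
\<close>
lemma global_section_const:
 assumes s: "s \<in> carrier (sections (Spec R) primes)"
 shows "\<exists>a\<in>carrier R. s = const_section R a"
proof -
 interpret M: multiplicative_set R "carrier R - {\<zero>}" by (rule nonzero_multiplicative_set)
 interpret L: cring M.Loc by (rule M.Loc_cring)
 have U: "zopen primes" using topspace_zariski by (metis openin_topspace)
 have Z: "{\<zero>} \<in> primes" using zero_prime by simp
 obtain a0 b0 where ab0: "a0 \<in> carrier R" "b0 \<in> carrier R" "b0 \<noteq> \<zero>" "s {\<zero>} = frac {\<zero>} a0 b0"
  using section_near_zero[OF U Z s] by metis
 define D where "D = {b \<in> carrier R. \<exists>a\<in>carrier R. b \<otimes> a0 = a \<otimes> b0}"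
 have D: "ideal D R"
 proof (rule idealI)
  show "ring R" by (rule ring_axioms)
  show "subgroup D (add_monoid R)"
  proof (rule add.subgroupI)
   show "D \<subseteq> carrier R" unfolding D_def by blast
   have "\<zero> \<in> D" unfolding D_def using ab0 by (auto intro!: bexI[of _ \<zero>])
   then show "D \<noteq> {}" by blast
   fix x assume "x \<in> D"
   then obtain a where x: "x \<in> carrier R" "a \<in> carrier R" "x \<otimes> a0 = a \<otimes> b0" unfolding D_def by blast
   then have "\<ominus> x \<otimes> a0 = \<ominus> a \<otimes> b0" using ab0 by (simp add: l_minus)
   then show "\<ominus> x \<in> D" unfolding D_def using x by blast
   fix y assume "y \<in> D"
   then obtain b where y: "y \<in> carrier R" "b \<in> carrier R" "y \<otimes> a0 = b \<otimes> b0" unfolding D_def by blast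
   then have "(x \<oplus> y) \<otimes> a0 = (a \<oplus> b) \<otimes> b0" using x ab0 by (simp add: l_distr)
   then show "x \<oplus> y \<in> D" unfolding D_def using x y by blast
  qed
  show l: "x \<otimes> y \<in> D" if "y \<in> D" "x \<in> carrier R" for x y
  proof -
   obtain a where y: "y \<in> carrier R" "a \<in> carrier R" "y \<otimes> a0 = a \<otimes> b0" using \<open>y \<in> D\<close> unfolding D_def by blast
   have "(x \<otimes> y) \<otimes> a0 = (x \<otimes> a) \<otimes> b0" using y that ab0 by (simp add: m_assoc)
   then show ?thesis unfolding D_def using y that by blast
  qed
  show "y \<otimes> x \<in> D" if "y \<in> D" "x \<in> carrier R" for x y
   using l[OF that] that m_comm unfolding D_def by simp
 qed
 have "\<one> \<in> D"
 proof (rule ccontr)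
  assume "\<one> \<notin> D"
  then have "D \<inter> {\<one>} = {}" by blast
  then obtain P where P: "primeideal P R" "D \<subseteq> P"
   using exists_prime_avoiding[OF D, of "{\<one>}"] by auto
  obtain V a b where V: "zopen V" "P \<in> V" "V \<subseteq> primes" "a \<in> carrier R" "b \<in> carrier R"
   "\<forall>P\<in>V. b \<notin> P \<and> s P = frac P a b" using s P(1) unfolding sec_Spec by blast
  have "{\<zero>} \<in> V" using zero_in_open[OF V(1)] V(2) by blast
  then have b: "b \<noteq> \<zero>" "frac {\<zero>} a b = frac {\<zero>} a0 b0" using V(6) ab0(4) by auto
  obtain u where u: "u \<in> carrier R - {\<zero>}" "u \<otimes> (b0 \<otimes> a) = u \<otimes> (b \<otimes> a0)"
   using M.frac_eqD[of a b a0 b0] V ab0 b by auto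
  have u': "u \<noteq> \<zero>" "u \<in> carrier R" using u(1) by auto
  have "b0 \<otimes> a = b \<otimes> a0" using iffD1[OF m_lcancel[OF u' m_closed[OF ab0(2) V(4)] m_closed[OF V(5) ab0(1)]] u(2)] .
  then have "b \<otimes> a0 = a \<otimes> b0" using m_comm[OF ab0(2) V(4)] by simp
  then have "b \<in> D" unfolding D_def using V(4,5) by blast
  then show False using P(2) V(2,6) by blast
 qed
 then obtain a where a: "a \<in> carrier R" "a0 = a \<otimes> b0" unfolding D_def using ab0 by auto
 interpret S': cring "sections (Spec R) primes" unfolding Spec_eq by (rule S.sections_cring_Y[OF U])
 have c: "const_section R a \<in> carrier (sections (Spec R) primes)" using const_section_closed[OF a(1)] .
 have eq: "s {\<zero>} = const_section R a {\<zero>}"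
  unfolding const_section_def points_Spec ab0(4) using Z ab0 a M.one_S
  by (simp add: M.frac_eqI m_comm)
 have "(s \<ominus>\<^bsub>sections (Spec R) primes\<^esub> const_section R a) {\<zero>} = \<zero>\<^bsub>loc {\<zero>}\<^esub>"
 proof -
  let ?d = "s \<ominus>\<^bsub>sections (Spec R) primes\<^esub> const_section R a"
  have dc: "?d \<in> carrier (sections (Spec R) primes)" using s c by simp
  have "?d \<oplus>\<^bsub>sections (Spec R) primes\<^esub> const_section R a = s"
   using s c by (simp add: S'.minus_eq S'.a_assoc S'.l_neg)
  then have "(?d \<oplus>\<^bsub>sections (Spec R) primes\<^esub> const_section R a) {\<zero>} = s {\<zero>}" by simp
  then have "?d {\<zero>} \<oplus>\<^bsub>loc {\<zero>}\<^esub> s {\<zero>} = s {\<zero>}" unfolding sec_ops_Spec using Z eq by simp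
  moreover have "?d {\<zero>} \<in> carrier M.Loc" "s {\<zero>} \<in> carrier M.Loc"
   using S.sec_value[folded Spec_eq, OF dc Z] S.sec_value[folded Spec_eq, OF s Z] by auto
  ultimately show ?thesis using L.add.r_cancel_one by metis
 qed
 then have "s \<ominus>\<^bsub>sections (Spec R) primes\<^esub> const_section R a = \<zero>\<^bsub>sections (Spec R) primes\<^esub>"
  using section_determined_by_generic_value[OF U Z] s c by simp
 then show ?thesis using a(1) s c by auto
qed

end

section \<open>Affine charts\<close>

text \<open>
 The morphism \<open>g\<close> back from \<open>Y\<close> provides the isomorphisms of rings of sections; their inverses are
 the maps on sections of \<open>f\<close>.
\<close>
lemma isomorphic_restrictions:
 assumes U: "is_open X U" and iso: "isomorphic (open_subspace X U) Y"
 obtains h \<sigma> where "bij_betw h U (points Y)"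
  "\<And>V. V \<subseteq> U \<Longrightarrow> is_open X V \<longleftrightarrow> is_open Y (h ` V)"
  "\<And>V. is_open X V \<Longrightarrow> V \<subseteq> U \<Longrightarrow> \<sigma> V \<in> ring_iso (sections X V) (sections Y (h ` V))"
  "\<And>V W s. is_open X V \<Longrightarrow> is_open X W \<Longrightarrow> W \<subseteq> V \<Longrightarrow> V \<subseteq> U \<Longrightarrow> s \<in> \<Gamma> X V \<Longrightarrow>
   \<sigma> W (restr X V W s) = restr Y (h ` V) (h ` W) (\<sigma> V s)"
proof -
 let ?X = "open_subspace X U"
 obtain f g where f: "is_morphism ?X Y f" and g: "is_morphism Y ?X g"
  and gf: "mor_eq ?X ?X (comp_mor Y g f) id_mor" and fg: "mor_eq Y Y (comp_mor ?X f g) id_mor"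
  using iso unfolding isomorphic_def by blast
 have top: "space_top ?X = subtopology (space_top X) U" and sec: "sections ?X = sections X"
  and re: "restr ?X = restr X" unfolding open_subspace_def by simp_all
 have pts: "points ?X = U" unfolding top using openin_subset[OF U] by auto
 have open_iff: "is_open ?X V \<longleftrightarrow> V \<subseteq> U \<and> is_open X V" for V
  unfolding top using openin_open_subtopology[OF U] by blast
 have f_cont: "continuous_map (space_top ?X) (space_top Y) (pt_map f)"
  and f_hom: "\<And>V. is_open Y V \<Longrightarrow> sec_map f V \<in> ring_hom (sections Y V) (sections ?X (preimage ?X f V))"
  using f unfolding is_morphism_def by auto
 have g_cont: "continuous_map (space_top Y) (space_top ?X) (pt_map g)"
  and g_hom: "\<And>V. is_open ?X V \<Longrightarrow> sec_map g V \<in> ring_hom (sections ?X V) (sections Y (preimage Y g V))"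
  and g_restr: "\<And>V W s. is_open ?X V \<Longrightarrow> is_open ?X W \<Longrightarrow> W \<subseteq> V \<Longrightarrow> s \<in> \<Gamma> ?X V \<Longrightarrow>
    sec_map g W (restr ?X V W s) = restr Y (preimage Y g V) (preimage Y g W) (sec_map g V s)"
  using g unfolding is_morphism_def by auto
 define h where "h = pt_map f"
 have hg: "h (pt_map g y) = y" if "y \<in> points Y" for y
  using fg that unfolding mor_eq_def comp_mor_def id_mor_def h_def by simp
 have gh: "pt_map g (h x) = x" if "x \<in> U" for x
  using gf that unfolding mor_eq_def comp_mor_def id_mor_def h_def pts by simp
 have hY: "h x \<in> points Y" if "x \<in> U" for x
  using continuous_map_image_subset_topspace[OF f_cont] that unfolding h_def pts by blast
 have gU: "pt_map g y \<in> U" if "y \<in> points Y" for y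
  using continuous_map_image_subset_topspace[OF g_cont] that unfolding pts by blast
 have bij: "bij_betw h U (points Y)"
  by (rule bij_betw_byWitness[where f' = "pt_map g"]) (use hg gh hY gU in auto)
 have pre_g: "preimage Y g V = h ` V" if V: "V \<subseteq> U" for V
 proof
  show "preimage Y g V \<subseteq> h ` V"
  proof
   fix y assume "y \<in> preimage Y g V"
   then have y: "y \<in> points Y" "pt_map g y \<in> V" unfolding preimage_def by auto
   show "y \<in> h ` V" using imageI[OF y(2), of h] hg[OF y(1)] by simp
  qed
  show "h ` V \<subseteq> preimage Y g V"
   unfolding preimage_def using gh hY V by (auto simp: subset_iff)
 qed
 have pre_f: "preimage ?X f (h ` V) = V" if V: "V \<subseteq> U" for V
 proof -
  have "x \<in> V" if x: "x \<in> U" "h x \<in> h ` V" for x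
  proof -
   obtain v where v: "v \<in> V" "h x = h v" using x(2) by blast
   then show ?thesis using gh[OF x(1)] gh[of v] V by (metis subsetD)
  qed
  then show ?thesis unfolding preimage_def pts h_def[symmetric] using V by blast
 qed
 have oiff: "is_open X V \<longleftrightarrow> is_open Y (h ` V)" if V: "V \<subseteq> U" for V
 proof
  assume "is_open X V"
  then have "is_open ?X V" using open_iff V by blast
  then have "is_open Y {y \<in> points Y. pt_map g y \<in> V}" using openin_continuous_map_preimage[OF g_cont] by blast
  then show "is_open Y (h ` V)" using pre_g[OF V] unfolding preimage_def by simp
 next
  assume "is_open Y (h ` V)"
  then have "is_open ?X {x \<in> points ?X. pt_map f x \<in> h ` V}"
   using openin_continuous_map_preimage[OF f_cont] by blast
  then have "is_open ?X V" using pre_f[OF V] unfolding preimage_def by simp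
  then show "is_open X V" using open_iff by blast
 qed
 show thesis
 proof (rule that[of h "sec_map g"])
  fix V assume V: "is_open X V" "V \<subseteq> U"
  then have oV: "is_open ?X V" "is_open Y (h ` V)" using open_iff oiff by auto
  have gh: "sec_map g V \<in> ring_hom (sections X V) (sections Y (h ` V))"
   using g_hom[OF oV(1)] unfolding pre_g[OF V(2)] sec .
  have fh: "sec_map f (h ` V) \<in> ring_hom (sections Y (h ` V)) (sections X V)"
   using f_hom[OF oV(2)] unfolding pre_f[OF V(2)] sec .
  have 1: "sec_map f (h ` V) (sec_map g V s) = s" if "s \<in> \<Gamma> X V" for s
   using gf oV(1) that unfolding mor_eq_def comp_mor_def id_mor_def sec by (auto simp: pre_g[OF V(2)])
  have 2: "sec_map g V (sec_map f (h ` V) s) = s" if "s \<in> \<Gamma> Y (h ` V)" for s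
   using fg oV(2) that unfolding mor_eq_def comp_mor_def id_mor_def by (auto simp: pre_f[OF V(2)])
  have "bij_betw (sec_map g V) (\<Gamma> X V) (\<Gamma> Y (h ` V))"
   by (rule bij_betw_byWitness[where f' = "sec_map f (h ` V)"])
    (use 1 2 ring_hom_memE(1)[OF gh] ring_hom_memE(1)[OF fh] in auto)
  then show "sec_map g V \<in> ring_iso (sections X V) (sections Y (h ` V))"
   using gh unfolding ring_iso_def by blast
 next
  fix V W s assume *: "is_open X V" "is_open X W" "W \<subseteq> V" "V \<subseteq> U" "s \<in> \<Gamma> X V"
  then show "sec_map g W (restr X V W s) = restr Y (h ` V) (h ` W) (sec_map g V s)"
   using g_restr[of V W s] open_iff pre_g unfolding sec re by auto
 qed (use bij oiff in auto)
qed

locale affine_chart = ring_presheaf X + affine_scheme R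
 for X :: "('p, 'r) ringed_space" and R :: "'r ring" (structure) +
 fixes U :: "'p set" and h :: "'p \<Rightarrow> 'r set" and \<sigma> :: "'p set \<Rightarrow> 'r \<Rightarrow> 'r spec_section"
 assumes open_U: "is_open X U"
  and h_bij: "bij_betw h U primes"
  and h_open: "\<And>V. V \<subseteq> U \<Longrightarrow> is_open X V \<longleftrightarrow> zopen (h ` V)"
  and \<sigma>_iso: "\<And>V. is_open X V \<Longrightarrow> V \<subseteq> U \<Longrightarrow> \<sigma> V \<in> ring_iso (sections X V) (sections (Spec R) (h ` V))"
  and \<sigma>_restr: "\<And>V W s. is_open X V \<Longrightarrow> is_open X W \<Longrightarrow> W \<subseteq> V \<Longrightarrow> V \<subseteq> U \<Longrightarrow>
   s \<in> \<Gamma> X V \<Longrightarrow> \<sigma> W (restr X V W s) = restrict (\<sigma> V s) (h ` W)"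

lemma affine_open_chart:
 fixes X :: "('p, 'r) ringed_space"
 assumes X: "ring_presheaf X" and "affine_open X U"
 obtains R h \<sigma> where "affine_chart X R U h \<sigma>"
proof -
 obtain R :: "'r ring" where U: "is_open X U" and R: "cring R" and iso: "isomorphic (open_subspace X U) (Spec R)"
  using assms(2) unfolding affine_open_def by blast
 interpret affine_scheme R by (rule affine_scheme.intro[OF R])
 obtain h \<sigma> where h: "bij_betw h U (points (Spec R))"
  "\<And>V. V \<subseteq> U \<Longrightarrow> is_open X V \<longleftrightarrow> is_open (Spec R) (h ` V)"
  "\<And>V. is_open X V \<Longrightarrow> V \<subseteq> U \<Longrightarrow> \<sigma> V \<in> ring_iso (sections X V) (sections (Spec R) (h ` V))"
  "\<And>V W s. is_open X V \<Longrightarrow> is_open X W \<Longrightarrow> W \<subseteq> V \<Longrightarrow> V \<subseteq> U \<Longrightarrow> s \<in> \<Gamma> X V \<Longrightarrow>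
   \<sigma> W (restr X V W s) = restr (Spec R) (h ` V) (h ` W) (\<sigma> V s)"
  by (rule isomorphic_restrictions[OF U iso]) blast
 have "affine_chart X R U h \<sigma>"
  by (rule affine_chart.intro[OF X affine_scheme.intro[OF R]], rule affine_chart_axioms.intro)
   (use U h[unfolded points_Spec open_Spec restr_Spec] in blast)+
 then show thesis by (rule that)
qed

context affine_chart
begin

lemma h_prime: "x \<in> U \<Longrightarrow> primeideal (h x) R"
 using h_bij by (auto simp: bij_betw_def)

lemma h_U: "h ` U = primes"
 using h_bij by (simp add: bij_betw_def)

lemma h_inj: "inj_on h U"
 using h_bij by (simp add: bij_betw_def)

lemma \<sigma>_hom: "is_open X V \<Longrightarrow> V \<subseteq> U \<Longrightarrow> \<sigma> V \<in> ring_hom (sections X V) (sections (Spec R) (h ` V))"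
 and \<sigma>_bij: "is_open X V \<Longrightarrow> V \<subseteq> U \<Longrightarrow>
  bij_betw (\<sigma> V) (\<Gamma> X V) (carrier (sections (Spec R) (h ` V)))"
 using \<sigma>_iso unfolding ring_iso_def by auto

lemma section_eqI:
 assumes V: "is_open X V" "V \<subseteq> U" and s: "s \<in> \<Gamma> X V" "t \<in> \<Gamma> X V"
  and eq: "\<And>P. P \<in> h ` V \<Longrightarrow> \<sigma> V s P = \<sigma> V t P"
 shows "s = t"
proof -
 note c = ring_hom_memE(1)[OF \<sigma>_hom[OF V]]
 have "\<sigma> V s = \<sigma> V t" by (rule sec_ext_Spec[OF c[OF s(1)] c[OF s(2)] eq])
 then show ?thesis using \<sigma>_bij[OF V] s by (auto simp: bij_betw_def dest: inj_onD)
qed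

definition lift where
 "lift a = inv_into (\<Gamma> X U) (\<sigma> U) (const_section R a)"

lemma lift_hom: "lift \<in> ring_hom R (sections X U)"
proof -
 have r: "ring (sections X U)" using sections_cring[OF open_U] by (rule cring.axioms(1))
 have "inv_into (\<Gamma> X U) (\<sigma> U) \<in> ring_hom (sections (Spec R) primes) (sections X U)"
  using ring_iso_set_sym[OF r \<sigma>_iso[OF open_U order_refl]] unfolding h_U ring_iso_def by blast
 from ring_hom_trans[OF const_section_hom this] show ?thesis unfolding lift_def comp_def .
qed

lemma lift_closed: "a \<in> carrier R \<Longrightarrow> lift a \<in> \<Gamma> X U"
 by (rule ring_hom_memE(1)[OF lift_hom])

lemma \<sigma>_lift: "a \<in> carrier R \<Longrightarrow> \<sigma> U (lift a) = const_section R a"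
 unfolding lift_def
 by (rule f_inv_into_f) (use \<sigma>_bij[OF open_U order_refl] const_section_closed h_U in \<open>simp add: bij_betw_def\<close>)

lemma \<sigma>_restr_lift:
 assumes "is_open X V" "V \<subseteq> U" "a \<in> carrier R" "P \<in> h ` V"
 shows "\<sigma> V (restr X U V (lift a)) P = frac P a \<one>"
proof -
 have "P \<in> primes" using assms(2,4) h_U by blast
 then show ?thesis
  using assms by (simp add: \<sigma>_restr[OF open_U assms(1,2) order_refl lift_closed] \<sigma>_lift
    const_section_def points_Spec)
qed

lemma open_preimage:
 assumes "zopen E"
 shows "is_open X {x \<in> U. h x \<in> E}" "h ` {x \<in> U. h x \<in> E} = E"
proof -
 have "E \<subseteq> h ` U" using openin_subset[OF assms] h_U unfolding topspace_zariski by simp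
 then show eq: "h ` {x \<in> U. h x \<in> E} = E" by blast
 show "is_open X {x \<in> U. h x \<in> E}" using h_open[of "{x \<in> U. h x \<in> E}"] assms unfolding eq by blast
qed

lemma domain_of_sections:
 assumes "domain (sections X U)"
 shows "domain R"
proof (rule domain_of_global_sections)
 interpret D: domain "sections X U" by (rule assms)
 interpret S': cring "sections (Spec R) primes"
  unfolding Spec_eq using S.sections_cring_Y[of primes] h_open[of U] h_U open_U by simp
 interpret g: ring_hom_ring "sections X U" "sections (Spec R) primes" "\<sigma> U"
  by (rule ring_hom_ringI2[OF D.ring_axioms S'.ring_axioms \<sigma>_hom[OF open_U order_refl, unfolded h_U]])
 have "(sections (Spec R) primes)\<lparr>zero := \<sigma> U \<zero>\<^bsub>sections X U\<^esub>\<rparr> = sections (Spec R) primes"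
  using g.hom_zero by simp
 then show "domain (sections (Spec R) primes)"
  using D.ring_iso_imp_img_domain[OF \<sigma>_iso[OF open_U order_refl, unfolded h_U]] by simp
qed

lemma T0_on_chart:
 assumes "x \<in> U" "y \<in> U" "\<And>V. is_open X V \<Longrightarrow> x \<in> V \<longleftrightarrow> y \<in> V"
 shows "x = y"
proof -
 have "h x = h y"
 proof (rule spec_T0)
  fix E assume "zopen E"
  then show "h x \<in> E \<longleftrightarrow> h y \<in> E" using assms(3)[OF open_preimage(1)] assms(1,2) by blast
 qed (use assms h_prime in auto)
 then show ?thesis using h_inj assms by (auto dest: inj_onD)
qed

end

section \<open>Integral schemes\<close>

locale ring_sheaf = ring_presheaf X for X :: "('p, 'r) ringed_space" +
 assumes glue: "\<And>\<U> \<sigma>. (\<And>V. V \<in> \<U> \<Longrightarrow> is_open X V) \<Longrightarrow> (\<And>V. V \<in> \<U> \<Longrightarrow> \<sigma> V \<in> \<Gamma> X V) \<Longrightarrow>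
   (\<And>V W. V \<in> \<U> \<Longrightarrow> W \<in> \<U> \<Longrightarrow> restr X V (V \<inter> W) (\<sigma> V) = restr X W (V \<inter> W) (\<sigma> W)) \<Longrightarrow>
   \<exists>!s. s \<in> \<Gamma> X (\<Union>\<U>) \<and> (\<forall>V\<in>\<U>. restr X (\<Union>\<U>) V s = \<sigma> V)"

lemma ringed_space_sheaf:
 assumes "is_ringed_space X"
 shows "ring_sheaf X"
proof (rule ring_sheaf.intro[OF ringed_space_presheaf[OF assms]], rule ring_sheaf_axioms.intro)
 fix \<U> \<sigma>
 assume *: "\<And>V. V \<in> \<U> \<Longrightarrow> is_open X V" "\<And>V. V \<in> \<U> \<Longrightarrow> \<sigma> V \<in> \<Gamma> X V"
  "\<And>V W. V \<in> \<U> \<Longrightarrow> W \<in> \<U> \<Longrightarrow> restr X V (V \<inter> W) (\<sigma> V) = restr X W (V \<inter> W) (\<sigma> W)"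
 note a = conjunct2[OF conjunct2[OF conjunct2[OF conjunct2[OF assms[unfolded is_ringed_space_def]]]]]
 show "\<exists>!s. s \<in> \<Gamma> X (\<Union>\<U>) \<and> (\<forall>V\<in>\<U>. restr X (\<Union>\<U>) V s = \<sigma> V)"
  by (rule a[rule_format, of \<U> \<sigma>]) (use * in blast)+
qed

context ring_sheaf
begin

lemma section_eq_by_cover:
 assumes \<U>: "\<And>V. V \<in> \<U> \<Longrightarrow> is_open X V" "\<Union>\<U> = U"
  and s: "s \<in> \<Gamma> X U" "t \<in> \<Gamma> X U"
  and eq: "\<And>V. V \<in> \<U> \<Longrightarrow> restr X U V s = restr X U V t"
 shows "s = t"
proof -
 have U: "is_open X U" using \<U> openin_Union[of \<U>] by blast
 have sub: "V \<subseteq> U" if "V \<in> \<U>" for V using \<U>(2) that by blast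
 have "\<exists>!r. r \<in> \<Gamma> X (\<Union>\<U>) \<and> (\<forall>V\<in>\<U>. restr X (\<Union>\<U>) V r = restr X U V s)"
 proof (rule glue[OF \<U>(1)])
  show "restr X U V s \<in> \<Gamma> X V" if "V \<in> \<U>" for V
   using restr_closed[OF U \<U>(1)[OF that] sub[OF that] s(1)] .
  fix V W assume VW: "V \<in> \<U>" "W \<in> \<U>"
  have o: "is_open X (V \<inter> W)" using \<U>(1) VW by blast
  show "restr X V (V \<inter> W) (restr X U V s) = restr X W (V \<inter> W) (restr X U W s)"
   using restr_restr[OF U \<U>(1)[OF VW(1)] o _ sub[OF VW(1)] s(1)]
    restr_restr[OF U \<U>(1)[OF VW(2)] o _ sub[OF VW(2)] s(1)] by simp
 qed
 then show ?thesis using s eq unfolding \<U>(2) by (metis (no_types, lifting))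
qed

end

locale generic_point = ring_sheaf X for X :: "('p, 'r) ringed_space" +
 fixes \<xi> :: 'p
 assumes sections_domain: "\<And>U. is_open X U \<Longrightarrow> U \<noteq> {} \<Longrightarrow> domain (sections X U)"
  and charts: "\<And>x. x \<in> points X \<Longrightarrow> \<exists>U. x \<in> U \<and> affine_open X U"
  and generic: "\<And>U. is_open X U \<Longrightarrow> U \<noteq> {} \<Longrightarrow> \<xi> \<in> U"
  and \<xi>_point: "\<xi> \<in> points X"

text \<open>
 On the union of disjoint nonempty open sets, gluing \<open>0\<close> and \<open>1\<close> in both ways gives zero divisors.
\<close>
lemma integral_scheme_opens_meet:
 assumes "integral_scheme X" and U: "is_open X U" "U \<noteq> {}" and V: "is_open X V" "V \<noteq> {}"
 shows "U \<inter> V \<noteq> {}"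
proof
 assume disj: "U \<inter> V = {}"
 have rs: "is_ringed_space X" using assms(1)
  unfolding integral_scheme_def is_scheme_def locally_ringed_space_def by blast
 interpret ring_sheaf X by (rule ringed_space_sheaf[OF rs])
 have dom: "domain (sections X W)" if "is_open X W" "W \<noteq> {}" for W
  using assms(1) that unfolding integral_scheme_def by blast
 have o: "is_open X (U \<union> V)" using U V by blast
 interpret D: domain "sections X (U \<union> V)" by (rule dom[OF o]) (use U in blast)
 interpret DU: domain "sections X U" by (rule dom[OF U])
 interpret DV: domain "sections X V" by (rule dom[OF V])
 interpret rU: ring_hom_ring "sections X (U \<union> V)" "sections X U" "restr X (U \<union> V) U"
  by (rule restr_ring_hom[OF o U(1)]) simp
 interpret rV: ring_hom_ring "sections X (U \<union> V)" "sections X V" "restr X (U \<union> V) V"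
  by (rule restr_ring_hom[OF o V(1)]) simp
 have empty: "r = r'" if "r \<in> \<Gamma> X {}" "r' \<in> \<Gamma> X {}" for r r'
  by (rule section_eq_by_cover[of "{}", OF _ _ that]) auto
 have ex: "\<exists>s\<in>\<Gamma> X (U \<union> V). restr X (U \<union> V) U s = a \<and> restr X (U \<union> V) V s = b"
  if a: "a \<in> \<Gamma> X U" and b: "b \<in> \<Gamma> X V" for a b
 proof -
  define \<tau> where "\<tau> W = (if W = U then a else b)" for W
  have UV: "U \<noteq> V" using disj U(2) by blast
  have cl: "is_open X W \<and> \<tau> W \<in> \<Gamma> X W" if "W \<in> {U, V}" for W
   using that UV a b U V unfolding \<tau>_def by auto
  have "\<exists>!s. s \<in> \<Gamma> X (\<Union>{U, V}) \<and> (\<forall>W\<in>{U, V}. restr X (\<Union>{U, V}) W s = \<tau> W)"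
  proof (rule glue)
   fix W W' assume W: "W \<in> {U, V}" "W' \<in> {U, V}"
   show "restr X W (W \<inter> W') (\<tau> W) = restr X W' (W \<inter> W') (\<tau> W')"
   proof (cases "W = W'")
    case False
    then have e: "W \<inter> W' = {}" using W disj by blast
    show ?thesis unfolding e using cl[OF W(1)] cl[OF W(2)] by (intro empty restr_closed) auto
   qed simp
  qed (use cl in auto)
  then show ?thesis using UV unfolding \<tau>_def by auto
 qed
 obtain s where s: "s \<in> \<Gamma> X (U \<union> V)"
  "restr X (U \<union> V) U s = \<one>\<^bsub>sections X U\<^esub>" "restr X (U \<union> V) V s = \<zero>\<^bsub>sections X V\<^esub>"
  using ex[OF DU.one_closed DV.zero_closed] by blast
 obtain t where t: "t \<in> \<Gamma> X (U \<union> V)"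
  "restr X (U \<union> V) U t = \<zero>\<^bsub>sections X U\<^esub>" "restr X (U \<union> V) V t = \<one>\<^bsub>sections X V\<^esub>"
  using ex[OF DU.zero_closed DV.one_closed] by blast
 have "s \<otimes>\<^bsub>sections X (U \<union> V)\<^esub> t = \<zero>\<^bsub>sections X (U \<union> V)\<^esub>"
 proof (rule section_eq_by_cover[of "{U, V}"])
  fix W assume "W \<in> {U, V}"
  then show "restr X (U \<union> V) W (s \<otimes>\<^bsub>sections X (U \<union> V)\<^esub> t) = restr X (U \<union> V) W \<zero>\<^bsub>sections X (U \<union> V)\<^esub>"
   using s t by auto
 qed (use s t U V in auto)
 then have "s = \<zero>\<^bsub>sections X (U \<union> V)\<^esub> \<or> t = \<zero>\<^bsub>sections X (U \<union> V)\<^esub>" using D.integral s t by blast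
 then show False using s t DU.one_not_zero DV.one_not_zero by auto
qed

locale generic_chart = generic_point X \<xi> + affine_chart X R U h \<sigma>
 for X :: "('p, 'r) ringed_space" and \<xi> and R :: "'r ring" (structure) and U h \<sigma> +
 assumes U_nonempty: "U \<noteq> {}"
begin

lemma \<xi>_U: "\<xi> \<in> U"
 using generic[OF open_U U_nonempty] .

lemma R_domain: "domain R"
 by (rule domain_of_sections[OF sections_domain[OF open_U U_nonempty]])

sublocale integral_affine_scheme R
 by (rule integral_affine_scheme.intro[OF affine_scheme_axioms R_domain])

lemma h_\<xi>: "h \<xi> = {\<zero>}"
proof -
 obtain x where x: "x \<in> U" "h x = {\<zero>}" using zero_prime h_U by (metis (mono_tags, lifting) imageE mem_Collect_eq)
 have "\<xi> = x"
 proof (rule T0_on_chart[OF \<xi>_U x(1)])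
  fix V assume V: "is_open X V"
  have "x \<in> V" if "V \<noteq> {}"
  proof -
   have o: "is_open X (V \<inter> U)" using V open_U by blast
   have "\<xi> \<in> V \<inter> U" using generic[OF V that] \<xi>_U by blast
   then have "{\<zero>} \<in> h ` (V \<inter> U)"
    using zero_in_open[of "h ` (V \<inter> U)"] h_open[of "V \<inter> U"] o by blast
   then obtain y where "y \<in> V" "y \<in> U" "h y = h x" using x by auto
   then show ?thesis using h_inj x(1) by (auto dest: inj_onD)
  qed
  then show "\<xi> \<in> V \<longleftrightarrow> x \<in> V" using generic[OF V] by blast
 qed
 then show ?thesis using x(2) by simp
qed

lemma restr_zero_imp_zero:
 assumes V: "is_open X V" "V \<subseteq> U" and W: "is_open X W" "W \<subseteq> V" "W \<noteq> {}"
  and s: "s \<in> \<Gamma> X V" "restr X V W s = \<zero>\<^bsub>sections X W\<^esub>"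
 shows "s = \<zero>\<^bsub>sections X V\<^esub>"
proof -
 have ne: "V \<noteq> {}" using W by blast
 have z: "{\<zero>} \<in> h ` W" using generic[OF W(1,3)] h_\<xi> by (metis imageI)
 have WU: "W \<subseteq> U" using W V by blast
 have hV: "zopen (h ` V)" "zopen (h ` W)" using h_open[OF V(2)] h_open[OF WU] V W by auto
 interpret SV: ring "sections X V" using sections_cring[OF V(1)] by (rule cring.axioms(1))
 interpret SW: ring "sections X W" using sections_cring[OF W(1)] by (rule cring.axioms(1))
 interpret TV: ring "sections (Spec R) (h ` V)"
  unfolding Spec_eq by (rule cring.axioms(1)[OF S.sections_cring_Y[OF hV(1)]])
 interpret TW: ring "sections (Spec R) (h ` W)"
  unfolding Spec_eq by (rule cring.axioms(1)[OF S.sections_cring_Y[OF hV(2)]])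
 interpret rV: ring_hom_ring "sections X V" "sections (Spec R) (h ` V)" "\<sigma> V"
  by (rule ring_hom_ringI2[OF SV.ring_axioms TV.ring_axioms \<sigma>_hom[OF V]])
 interpret rW: ring_hom_ring "sections X W" "sections (Spec R) (h ` W)" "\<sigma> W"
  by (rule ring_hom_ringI2[OF SW.ring_axioms TW.ring_axioms \<sigma>_hom[OF W(1) WU]])
 have "restrict (\<sigma> V s) (h ` W) {\<zero>} = \<zero>\<^bsub>sections (Spec R) (h ` W)\<^esub> {\<zero>}"
  using \<sigma>_restr[OF V(1) W(1,2) V(2) s(1)] s(2) rW.hom_zero by simp
 then have "\<sigma> V s {\<zero>} = \<zero>\<^bsub>loc {\<zero>}\<^esub>" using z unfolding sec_ops_Spec by simp
 then have "\<sigma> V s = \<zero>\<^bsub>sections (Spec R) (h ` V)\<^esub>"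
  using section_determined_by_generic_value[OF hV(1) _ rV.hom_closed[OF s(1)]] z W(2) by blast
 then have "\<sigma> V s = \<sigma> V \<zero>\<^bsub>sections X V\<^esub>" by simp
 then show ?thesis using section_eqI[OF V s(1) SV.zero_closed] by simp
qed

end

context generic_point
begin

abbreviation F where "F \<equiv> stalk X \<xi>"

lemma generic_chart_of:
 assumes "affine_open X U" "U \<noteq> {}"
 obtains R h \<sigma> where "generic_chart X \<xi> R U h \<sigma>"
proof -
 obtain R h \<sigma> where c: "affine_chart X R U h \<sigma>"
  by (rule affine_open_chart[OF ring_presheaf_axioms assms(1)]) blast
 show thesis
  by (rule that, rule generic_chart.intro[OF generic_point_axioms c], rule generic_chart_axioms.intro[OF assms(2)])
qed

text \<open>
 Both \<open>V\<close> and the charts contain \<open>\<xi>\<close>, and on a chart a section is determined by its value at \<open>\<xi>\<close>.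
\<close>
lemma restr_generic_inj:
 assumes U: "is_open X U" "V \<subseteq> U" and V: "is_open X V" "V \<noteq> {}"
  and s: "s \<in> \<Gamma> X U" "restr X U V s = \<zero>\<^bsub>sections X V\<^esub>"
 shows "s = \<zero>\<^bsub>sections X U\<^esub>"
proof -
 interpret SU: ring "sections X U" using sections_cring[OF U(1)] by (rule cring.axioms(1))
 define \<U> where "\<U> = {W \<inter> U | W. affine_open X W \<and> W \<inter> U \<noteq> {}}"
 have *: "is_open X W'" "W' \<subseteq> U" "restr X U W' s = \<zero>\<^bsub>sections X W'\<^esub>" if "W' \<in> \<U>" for W'
 proof -
  obtain W where W: "affine_open X W" "W' = W \<inter> U" "W' \<noteq> {}" using \<open>W' \<in> \<U>\<close> unfolding \<U>_def by blast
  then have oW: "is_open X W" unfolding affine_open_def by blast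
  then show o: "is_open X W'" using W(2) U(1) by blast
  show sub: "W' \<subseteq> U" using W(2) by blast
  obtain R h \<sigma> where "generic_chart X \<xi> R W h \<sigma>"
   by (rule generic_chart_of[OF W(1)]) (use W in blast)+
  then interpret c: generic_chart X \<xi> R W h \<sigma> .
  have o': "is_open X (W' \<inter> V)" "W' \<inter> V \<noteq> {}" using o V generic[OF V] generic[OF o W(3)] by blast+
  interpret rr: ring_hom_ring "sections X V" "sections X (W' \<inter> V)" "restr X V (W' \<inter> V)"
   by (rule restr_ring_hom[OF V(1) o'(1)]) simp
  have "restr X W' (W' \<inter> V) (restr X U W' s) = restr X V (W' \<inter> V) (restr X U V s)"
   using restr_restr[OF U(1) o o'(1) _ sub s(1)] restr_restr[OF U(1) V(1) o'(1) _ U(2) s(1)] by simp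
  also have "\<dots> = \<zero>\<^bsub>sections X (W' \<inter> V)\<^esub>" using s(2) rr.hom_zero by simp
  finally have z: "restr X W' (W' \<inter> V) (restr X U W' s) = \<zero>\<^bsub>sections X (W' \<inter> V)\<^esub>" .
  show "restr X U W' s = \<zero>\<^bsub>sections X W'\<^esub>"
   by (rule c.restr_zero_imp_zero[OF o _ o'(1) _ o'(2) restr_closed[OF U(1) o sub s(1)]]) (use z W(2) in auto)
 qed
 show ?thesis
 proof (rule section_eq_by_cover[of \<U>])
  show "\<Union>\<U> = U"
  proof
   show "U \<subseteq> \<Union>\<U>"
   proof
    fix x assume x: "x \<in> U"
    then obtain W where W: "x \<in> W" "affine_open X W" using charts openin_subset[OF U(1)] by blast
    then have "W \<inter> U \<in> \<U>" using x unfolding \<U>_def by blast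
    then show "x \<in> \<Union>\<U>" using W x by blast
   qed
  qed (use *(2) in blast)
  fix W' assume W': "W' \<in> \<U>"
  interpret rr: ring_hom_ring "sections X U" "sections X W'" "restr X U W'"
   by (rule restr_ring_hom[OF U(1) *(1,2)[OF W']])
  show "restr X U W' s = restr X U W' \<zero>\<^bsub>sections X U\<^esub>" using *(3)[OF W'] rr.hom_zero by simp
 qed (use * s SU.zero_closed in auto)
qed

lemma germ_generic_zero:
 assumes U: "is_open X U" "U \<noteq> {}" and s: "s \<in> \<Gamma> X U" "germ X \<xi> U s = \<zero>\<^bsub>F\<^esub>"
 shows "s = \<zero>\<^bsub>sections X U\<^esub>"
proof -
 interpret SU: ring "sections X U" using sections_cring[OF U(1)] by (rule cring.axioms(1))
 have \<xi>: "\<xi> \<in> U" by (rule generic[OF U])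
 have "germ X \<xi> U s = germ X \<xi> U \<zero>\<^bsub>sections X U\<^esub>" using s(2) zero_stalk[OF U(1) \<xi>] by simp
 then obtain W where W: "is_open X W" "\<xi> \<in> W" "W \<subseteq> U" "restr X U W s = restr X U W \<zero>\<^bsub>sections X U\<^esub>"
  by (rule germ_eqD[OF _ U(1) \<xi> SU.zero_closed]) blast
 interpret rr: ring_hom_ring "sections X U" "sections X W" "restr X U W"
  by (rule restr_ring_hom[OF U(1) W(1,3)])
 show ?thesis using restr_generic_inj[OF U(1) W(3,1) _ s(1)] W(2,4) rr.hom_zero by auto
qed

lemma germ_generic_inj:
 assumes U: "is_open X U" "U \<noteq> {}"
 shows "inj_on (germ X \<xi> U) (\<Gamma> X U)"
proof -
 interpret g: ring_hom_ring "sections X U" "F" "germ X \<xi> U"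
  by (rule germ_ring_hom[OF U(1) generic[OF U]])
 have "a_kernel (sections X U) F (germ X \<xi> U) = {\<zero>\<^bsub>sections X U\<^esub>}"
  unfolding a_kernel_def' using germ_generic_zero[OF U] g.hom_zero by auto
 then show ?thesis by (rule g.trivial_ker_imp_inj)
qed

text \<open>
 Local sections with the same germ at \<open>\<xi>\<close> agree on overlaps, so they glue.
\<close>
lemma section_of_generic_germ:
 assumes U: "is_open X U" "U \<noteq> {}"
  and loc: "\<And>x. x \<in> U \<Longrightarrow> \<exists>N t. is_open X N \<and> x \<in> N \<and> N \<subseteq> U \<and> t \<in> \<Gamma> X N \<and> germ X \<xi> N t = \<alpha>"
 shows "\<exists>s\<in>\<Gamma> X U. germ X \<xi> U s = \<alpha>"
proof -
 define \<U> where "\<U> = {N. is_open X N \<and> N \<noteq> {} \<and> N \<subseteq> U \<and> (\<exists>t\<in>\<Gamma> X N. germ X \<xi> N t = \<alpha>)}"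
 have "\<forall>N\<in>\<U>. \<exists>t. t \<in> \<Gamma> X N \<and> germ X \<xi> N t = \<alpha>" unfolding \<U>_def by blast
 then obtain \<tau> where \<tau>: "\<And>N. N \<in> \<U> \<Longrightarrow> \<tau> N \<in> \<Gamma> X N \<and> germ X \<xi> N (\<tau> N) = \<alpha>" by metis
 have N: "is_open X N" "N \<noteq> {}" "N \<subseteq> U" "\<xi> \<in> N" if "N \<in> \<U>" for N
  using that generic[of N] unfolding \<U>_def by auto
 have cover: "\<Union>\<U> = U"
 proof
  show "U \<subseteq> \<Union>\<U>"
  proof
   fix x assume "x \<in> U"
   then obtain N t where "is_open X N" "x \<in> N" "N \<subseteq> U" "t \<in> \<Gamma> X N" "germ X \<xi> N t = \<alpha>"
    using loc by blast
   then have "N \<in> \<U>" unfolding \<U>_def by blast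
   then show "x \<in> \<Union>\<U>" using \<open>x \<in> N\<close> by blast
  qed
 qed (use N in blast)
 have "\<exists>!s. s \<in> \<Gamma> X (\<Union>\<U>) \<and> (\<forall>V\<in>\<U>. restr X (\<Union>\<U>) V s = \<tau> V)"
 proof (rule glue)
  fix V W assume V: "V \<in> \<U>" and W: "W \<in> \<U>"
  have o: "is_open X (V \<inter> W)" "\<xi> \<in> V \<inter> W" using N[OF V] N[OF W] by blast+
  have "germ X \<xi> (V \<inter> W) (restr X V (V \<inter> W) (\<tau> V)) = germ X \<xi> (V \<inter> W) (restr X W (V \<inter> W) (\<tau> W))"
   using germ_restr[OF N(1)[OF V] _ o] germ_restr[OF N(1)[OF W] _ o] \<tau>[OF V] \<tau>[OF W] by simp
  then show "restr X V (V \<inter> W) (\<tau> V) = restr X W (V \<inter> W) (\<tau> W)"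
   using inj_onD[OF germ_generic_inj[OF o(1)]] o(2)
    restr_closed[OF N(1)[OF V] o(1)] restr_closed[OF N(1)[OF W] o(1)] \<tau>[OF V] \<tau>[OF W] by blast
 qed (use N \<tau> in auto)
 then obtain s where s: "s \<in> \<Gamma> X U" "\<forall>V\<in>\<U>. restr X U V s = \<tau> V"
  unfolding cover by blast
 obtain V where V: "V \<in> \<U>" using cover U(2) by blast
 have "germ X \<xi> U s = \<alpha>" using germ_restr[OF U(1) s(1) N(1)[OF V] N(4)[OF V] N(3)[OF V]] s(2) V \<tau>[OF V] by simp
 then show ?thesis using s(1) by blast
qed

end

section \<open>The function field of an integral scheme\<close>

context generic_chart
begin

definition to_stalk where "to_stalk a = germ X \<xi> U (lift a)"

lemma to_stalk_hom: "to_stalk \<in> ring_hom R F"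
 using ring_hom_trans[OF lift_hom germ_hom[OF open_U \<xi>_U]] unfolding to_stalk_def comp_def .

lemma stalk_cring_\<xi>: "cring F"
 by (rule stalk_cring[OF \<xi>_point])

lemma to_stalk_ring_hom: "ring_hom_ring R F to_stalk"
 by (rule ring_hom_ringI2[OF ring_axioms cring.axioms(1)[OF stalk_cring_\<xi>] to_stalk_hom])

lemma lift_zero:
 assumes a: "a \<in> carrier R" and z: "lift a = \<zero>\<^bsub>sections X U\<^esub>"
 shows "a = \<zero>"
proof (rule const_section_zero[OF a])
 interpret SU: ring "sections X U" using sections_cring[OF open_U] by (rule cring.axioms(1))
 interpret TU: ring "sections (Spec R) primes"
  unfolding Spec_eq using S.sections_cring_Y[of primes] h_open[of U] h_U open_U by (simp add: cring.axioms(1))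
 interpret s: ring_hom_ring "sections X U" "sections (Spec R) primes" "\<sigma> U"
  by (rule ring_hom_ringI2[OF SU.ring_axioms TU.ring_axioms \<sigma>_hom[OF open_U order_refl, unfolded h_U]])
 show "const_section R a = \<zero>\<^bsub>sections (Spec R) primes\<^esub>"
  using \<sigma>_lift[OF a] z s.hom_zero by simp
qed

lemma to_stalk_zero:
 assumes a: "a \<in> carrier R" and z: "to_stalk a = \<zero>\<^bsub>F\<^esub>"
 shows "a = \<zero>"
 using lift_zero[OF a] germ_generic_zero[OF open_U U_nonempty lift_closed[OF a]] z
 unfolding to_stalk_def by blast

lemma to_stalk_inj: "inj_on to_stalk (carrier R)"
proof -
 interpret t: ring_hom_ring R "F" to_stalk by (rule to_stalk_ring_hom)
 have "a_kernel R F to_stalk = {\<zero>}"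
  unfolding a_kernel_def' using to_stalk_zero t.hom_zero by auto
 then show ?thesis by (rule t.trivial_ker_imp_inj)
qed

text \<open>
 On the chart a section near \<open>\<xi>\<close> is a fraction of elements of \<open>R\<close>.
\<close>
lemma stalk_fraction:
 assumes "\<alpha> \<in> carrier F"
 obtains a b where "a \<in> carrier R" "b \<in> carrier R" "b \<noteq> \<zero>" "to_stalk b \<otimes>\<^bsub>F\<^esub> \<alpha> = to_stalk a"
proof -
 obtain N s where N: "is_open X N" "\<xi> \<in> N" "s \<in> \<Gamma> X N" "\<alpha> = germ X \<xi> N s"
  using stalk_cases[OF assms] .
 define N' where "N' = N \<inter> U"
 have o: "is_open X N'" "\<xi> \<in> N'" "N' \<subseteq> U" "N' \<subseteq> N" using N open_U \<xi>_U unfolding N'_def by auto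
 define s' where "s' = restr X N N' s"
 have s': "s' \<in> \<Gamma> X N'" "germ X \<xi> N' s' = \<alpha>"
  using restr_closed[OF N(1) o(1,4) N(3)] germ_restr[OF N(1,3) o(1,2,4)] N(4) unfolding s'_def by auto
 have hN: "zopen (h ` N')" "{\<zero>} \<in> h ` N'"
  using h_open[OF o(3)] o h_\<xi> by (auto simp: image_iff intro!: bexI[of _ \<xi>])
 obtain E a b where E: "zopen E" "{\<zero>} \<in> E" "E \<subseteq> h ` N'" and
  ab: "a \<in> carrier R" "b \<in> carrier R" "b \<noteq> \<zero>" "\<And>P. P \<in> E \<Longrightarrow> b \<notin> P \<and> \<sigma> N' s' P = frac P a b"
  by (rule section_near_zero[OF hN ring_hom_memE(1)[OF \<sigma>_hom[OF o(1,3)] s'(1)]]) blast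
 define V where "V = {x \<in> U. h x \<in> E}"
 have hV: "is_open X V" "h ` V = E" using open_preimage[OF E(1)] unfolding V_def by auto
 have VU: "V \<subseteq> U" and \<xi>V: "\<xi> \<in> V" using \<xi>_U h_\<xi> E(2) unfolding V_def by auto
 have VN: "V \<subseteq> N'"
 proof
  fix x assume x: "x \<in> V"
  then have "h x \<in> h ` N'" "x \<in> U" using E(3) unfolding V_def by auto
  then show "x \<in> N'" using h_inj o(3) by (meson inj_on_image_mem_iff)
 qed
 note rb = restr_closed[OF open_U hV(1) VU lift_closed[OF ab(2)]]
  and ra = restr_closed[OF open_U hV(1) VU lift_closed[OF ab(1)]]
  and rs = restr_closed[OF o(1) hV(1) VN s'(1)]
 interpret SV: ring "sections X V" using sections_cring[OF hV(1)] by (rule cring.axioms(1))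
 have "restr X U V (lift b) \<otimes>\<^bsub>sections X V\<^esub> restr X N' V s' = restr X U V (lift a)"
 proof (rule section_eqI[OF hV(1) VU])
  fix P assume P: "P \<in> h ` V"
  then have PE: "P \<in> E" using hV(2) by simp
  have prime: "primeideal P R" using PE openin_subset[OF E(1)] unfolding topspace_zariski by blast
  interpret M: multiplicative_set R "carrier R - P" using prime_multiplicative_set prime by simp
  have bP: "b \<in> carrier R - P" "\<sigma> N' s' P = frac P a b" using ab(2,4) PE by auto
  have "\<sigma> V (restr X U V (lift b) \<otimes>\<^bsub>sections X V\<^esub> restr X N' V s') P =
    \<sigma> V (restr X U V (lift b)) P \<otimes>\<^bsub>loc P\<^esub> \<sigma> V (restr X N' V s') P"
   unfolding ring_hom_memE(2)[OF \<sigma>_hom[OF hV(1) VU] rb rs] sec_ops_Spec using P by simp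
  also have "\<dots> = frac P b \<one> \<otimes>\<^bsub>loc P\<^esub> frac P a b"
   using \<sigma>_restr_lift[OF hV(1) VU ab(2) P] \<sigma>_restr[OF o(1) hV(1) VN o(3) s'(1)] P bP by simp
  also have "\<dots> = frac P a \<one>" unfolding M.mult_frac[OF ab(2) M.one_S ab(1) bP(1)]
   by (rule M.frac_eqI) (use ab bP M.one_S in auto)
  also have "\<dots> = \<sigma> V (restr X U V (lift a)) P" using \<sigma>_restr_lift[OF hV(1) VU ab(1) P] by simp
  finally show "\<sigma> V (restr X U V (lift b) \<otimes>\<^bsub>sections X V\<^esub> restr X N' V s') P = \<sigma> V (restr X U V (lift a)) P" .
 qed (use ra rb rs in auto)
 then have "germ X \<xi> V (restr X U V (lift b)) \<otimes>\<^bsub>F\<^esub> germ X \<xi> V (restr X N' V s')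
   = germ X \<xi> V (restr X U V (lift a))" using mult_germ[OF hV(1) \<xi>V rb rs] by simp
 then have "to_stalk b \<otimes>\<^bsub>F\<^esub> \<alpha> = to_stalk a"
  unfolding to_stalk_def using germ_restr[OF open_U lift_closed[OF ab(1)] hV(1) \<xi>V VU]
   germ_restr[OF open_U lift_closed[OF ab(2)] hV(1) \<xi>V VU] germ_restr[OF o(1) s'(1) hV(1) \<xi>V VN] s'(2) by simp
 then show thesis using that ab by blast
qed

text \<open>
 The function \<open>1/a\<close> is defined where \<open>a\<close> lies outside the prime ideal, in particular at \<open>\<xi>\<close>.
\<close>
lemma to_stalk_unit:
 assumes a: "a \<in> carrier R" "a \<noteq> \<zero>"
 obtains \<beta> where "\<beta> \<in> carrier F" "to_stalk a \<otimes>\<^bsub>F\<^esub> \<beta> = \<one>\<^bsub>F\<^esub>"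
proof -
 define E where "E = {P. primeideal P R \<and> a \<notin> P}"
 have E: "zopen E" using basic_open[OF a(1)] unfolding E_def .
 define V where "V = {x \<in> U. h x \<in> E}"
 have hV: "is_open X V" "h ` V = E" using open_preimage[OF E] unfolding V_def by auto
 have VU: "V \<subseteq> U" and \<xi>V: "\<xi> \<in> V" using \<xi>_U h_\<xi> a zero_prime unfolding V_def E_def by auto
 have ms: "multiplicative_set R (carrier R - P)" "a \<in> carrier R - P" if "P \<in> E" for P
  using that a prime_multiplicative_set unfolding E_def by auto
 have "(\<lambda>P\<in>E. frac P \<one> a) \<in> carrier (sections (Spec R) E)"
 proof (rule S.sec_restrictI[folded Spec_eq, OF E])
  show "frac P \<one> a \<in> carrier (loc P)" if "P \<in> E" for P
   using multiplicative_set.frac_closed[OF ms(1)[OF that] _ ms(2)[OF that]] by simp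
  have "spec_adm E (\<lambda>P. frac P \<one> a)"
   by (rule spec_admI[OF one_closed a(1)]) (simp add: E_def)
  then show "\<exists>V. zopen V \<and> P \<in> V \<and> spec_adm V (\<lambda>P. frac P \<one> a)" if "P \<in> E" for P
   using E that by (intro exI[of _ E] conjI)
 qed
 then obtain u where u: "u \<in> \<Gamma> X V" "\<sigma> V u = (\<lambda>P\<in>E. frac P \<one> a)"
  using \<sigma>_bij[OF hV(1) VU] unfolding hV(2) bij_betw_def by (metis (no_types, lifting) imageE)
 interpret SV: ring "sections X V" using sections_cring[OF hV(1)] by (rule cring.axioms(1))
 note ra = restr_closed[OF open_U hV(1) VU lift_closed[OF a(1)]]
 have "restr X U V (lift a) \<otimes>\<^bsub>sections X V\<^esub> u = \<one>\<^bsub>sections X V\<^esub>"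
 proof (rule section_eqI[OF hV(1) VU])
  fix P assume P: "P \<in> h ` V"
  then have PE: "P \<in> E" using hV(2) by simp
  interpret M: multiplicative_set R "carrier R - P" by (rule ms(1)[OF PE])
  have "\<sigma> V (restr X U V (lift a) \<otimes>\<^bsub>sections X V\<^esub> u) P =
    \<sigma> V (restr X U V (lift a)) P \<otimes>\<^bsub>loc P\<^esub> \<sigma> V u P"
   unfolding ring_hom_memE(2)[OF \<sigma>_hom[OF hV(1) VU] ra u(1)] sec_ops_Spec using P by simp
  also have "\<dots> = frac P a \<one> \<otimes>\<^bsub>loc P\<^esub> frac P \<one> a"
   using \<sigma>_restr_lift[OF hV(1) VU a(1) P] u(2) PE by simp
  also have "\<dots> = frac P \<one> \<one>"
   unfolding M.mult_frac[OF a(1) M.one_S one_closed ms(2)[OF PE]]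
   by (rule M.frac_eqI) (use a ms(2)[OF PE] M.one_S in auto)
  also have "\<dots> = \<sigma> V \<one>\<^bsub>sections X V\<^esub> P"
   unfolding ring_hom_memE(4)[OF \<sigma>_hom[OF hV(1) VU]] sec_ops_Spec using P M.one_Loc by simp
  finally show "\<sigma> V (restr X U V (lift a) \<otimes>\<^bsub>sections X V\<^esub> u) P = \<sigma> V \<one>\<^bsub>sections X V\<^esub> P" .
 qed (use ra u in auto)
 then have "germ X \<xi> V (restr X U V (lift a)) \<otimes>\<^bsub>F\<^esub> germ X \<xi> V u = \<one>\<^bsub>F\<^esub>"
  using mult_germ[OF hV(1) \<xi>V ra u(1)] one_stalk[OF hV(1) \<xi>V] by simp
 then show thesis
  using that[OF germ_closed[OF hV(1) \<xi>V u(1)]] germ_restr[OF open_U lift_closed[OF a(1)] hV(1) \<xi>V VU]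
  unfolding to_stalk_def by simp
qed

lemma stalk_field_chart: "field F"
proof -
 interpret K: cring "F" by (rule stalk_cring_\<xi>)
 interpret t: ring_hom_ring R "F" to_stalk by (rule to_stalk_ring_hom)
 show ?thesis
 proof (rule K.cring_fieldI2)
  show "\<zero>\<^bsub>F\<^esub> \<noteq> \<one>\<^bsub>F\<^esub>"
   using to_stalk_zero[OF one_closed] t.hom_one one_not_zero by metis
  fix \<alpha> assume \<alpha>: "\<alpha> \<in> carrier F" "\<alpha> \<noteq> \<zero>\<^bsub>F\<^esub>"
  obtain a b where ab: "a \<in> carrier R" "b \<in> carrier R" "b \<noteq> \<zero>" "to_stalk b \<otimes>\<^bsub>F\<^esub> \<alpha> = to_stalk a"
   by (rule stalk_fraction[OF \<alpha>(1)])
  obtain \<beta> where \<beta>: "\<beta> \<in> carrier F" "to_stalk b \<otimes>\<^bsub>F\<^esub> \<beta> = \<one>\<^bsub>F\<^esub>"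
   by (rule to_stalk_unit[OF ab(2,3)])
  note tc = t.hom_closed[OF ab(1)] t.hom_closed[OF ab(2)]
  have \<alpha>_eq: "\<alpha> = \<beta> \<otimes>\<^bsub>F\<^esub> to_stalk a"
   using \<beta> ab(4) \<alpha>(1) tc by (metis K.l_one K.m_assoc K.m_comm)
  have "a \<noteq> \<zero>" using \<alpha>_eq \<alpha>(2) \<beta>(1) t.hom_zero K.r_null by metis
  then obtain \<gamma> where \<gamma>: "\<gamma> \<in> carrier F" "to_stalk a \<otimes>\<^bsub>F\<^esub> \<gamma> = \<one>\<^bsub>F\<^esub>"
   using to_stalk_unit[OF ab(1)] by blast
  have "\<alpha> \<otimes>\<^bsub>F\<^esub> (\<gamma> \<otimes>\<^bsub>F\<^esub> to_stalk b) =
    (to_stalk b \<otimes>\<^bsub>F\<^esub> \<beta>) \<otimes>\<^bsub>F\<^esub> (to_stalk a \<otimes>\<^bsub>F\<^esub> \<gamma>)"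
   unfolding \<alpha>_eq using \<beta>(1) \<gamma>(1) tc by (simp add: K.m_ac)
  also have "\<dots> = \<one>\<^bsub>F\<^esub>" using \<beta>(2) \<gamma>(2) by simp
  finally show "\<exists>\<delta>\<in>carrier F. \<alpha> \<otimes>\<^bsub>F\<^esub> \<delta> = \<one>\<^bsub>F\<^esub>"
   using \<gamma>(1) tc by blast
 qed
qed

lemma stalk_fraction_inv:
 assumes "\<alpha> \<in> carrier F"
 obtains a b where "a \<in> carrier R" "b \<in> carrier R" "b \<noteq> \<zero>" "to_stalk b \<noteq> \<zero>\<^bsub>F\<^esub>"
  "\<alpha> = to_stalk a \<otimes>\<^bsub>F\<^esub> inv\<^bsub>F\<^esub> (to_stalk b)"
proof -
 interpret K: field "F" by (rule stalk_field_chart)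
 interpret t: ring_hom_ring R "F" to_stalk by (rule to_stalk_ring_hom)
 obtain a b where ab: "a \<in> carrier R" "b \<in> carrier R" "b \<noteq> \<zero>" "to_stalk b \<otimes>\<^bsub>F\<^esub> \<alpha> = to_stalk a"
  by (rule stalk_fraction[OF assms])
 have b: "to_stalk b \<noteq> \<zero>\<^bsub>F\<^esub>" using to_stalk_zero ab(2,3) by blast
 then have bu: "to_stalk b \<in> Units F" using K.field_Units t.hom_closed[OF ab(2)] by blast
 have "to_stalk a \<otimes>\<^bsub>F\<^esub> inv\<^bsub>F\<^esub> (to_stalk b) = \<alpha>"
  unfolding ab(4)[symmetric] using bu assms t.hom_closed[OF ab(2)]
  by (simp add: K.m_comm[of "to_stalk b" \<alpha>] K.m_assoc K.Units_r_inv)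
 then show thesis using that[OF ab(1-3) b] by simp
qed

end

context generic_point
begin

lemma affine_open_exists:
 obtains U where "affine_open X U" "U \<noteq> {}" using charts[OF \<xi>_point] by blast

lemma stalk_field: "field F"
proof -
 obtain U where U: "affine_open X U" "U \<noteq> {}" by (rule affine_open_exists)
 obtain R h \<sigma> where "generic_chart X \<xi> R U h \<sigma>" by (rule generic_chart_of[OF U]) blast
 then show ?thesis by (rule generic_chart.stalk_field_chart)
qed

lemma generic_unique:
 assumes "x \<in> points X" "\<And>U. is_open X U \<Longrightarrow> U \<noteq> {} \<Longrightarrow> x \<in> U"
 shows "x = \<xi>"
proof -
 obtain U where U: "affine_open X U" "U \<noteq> {}" by (rule affine_open_exists)
 obtain R h \<sigma> where c: "generic_chart X \<xi> R U h \<sigma>" by (rule generic_chart_of[OF U]) blast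
 interpret generic_chart X \<xi> R U h \<sigma> by (rule c)
 show ?thesis
 proof (rule T0_on_chart)
  show "x \<in> U" "\<xi> \<in> U" using assms(2)[OF open_U U(2)] \<xi>_U by auto
  show "x \<in> V \<longleftrightarrow> \<xi> \<in> V" if "is_open X V" for V using assms(2)[OF that] generic[OF that] by blast
 qed
qed

end

lemma integral_scheme_sheaf: "integral_scheme X \<Longrightarrow> ring_sheaf X"
 by (rule ringed_space_sheaf) (simp add: integral_scheme_def is_scheme_def locally_ringed_space_def)

lemma generic_pointI:
 assumes "integral_scheme X" "\<xi> \<in> points X" "\<And>U. is_open X U \<Longrightarrow> U \<noteq> {} \<Longrightarrow> \<xi> \<in> U"
 shows "generic_point X \<xi>"
 by (rule generic_point.intro[OF integral_scheme_sheaf[OF assms(1)]], rule generic_point_axioms.intro)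
  (use assms in \<open>auto simp: integral_scheme_def is_scheme_def\<close>)

lemma is_generic_point_iff:
 "is_generic_point T x \<longleftrightarrow> x \<in> topspace T \<and> (\<forall>U. openin T U \<and> U \<noteq> {} \<longrightarrow> x \<in> U)"
proof
 assume "is_generic_point T x"
 then have x: "x \<in> topspace T" "T closure_of {x} = topspace T" unfolding is_generic_point_def by auto
 have "x \<in> U" if U: "openin T U" "U \<noteq> {}" for U
 proof -
  obtain y where y: "y \<in> U" using U(2) by blast
  then have "y \<in> T closure_of {x}" using openin_subset[OF U(1)] x(2) by blast
  then show ?thesis using y U(1) unfolding in_closure_of by blast
 qed
 then show "x \<in> topspace T \<and> (\<forall>U. openin T U \<and> U \<noteq> {} \<longrightarrow> x \<in> U)" using x(1) by blast
next
 assume x: "x \<in> topspace T \<and> (\<forall>U. openin T U \<and> U \<noteq> {} \<longrightarrow> x \<in> U)"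
 then have "y \<in> T closure_of {x}" if "y \<in> topspace T" for y
  using that unfolding in_closure_of by blast
 then show "is_generic_point T x"
  unfolding is_generic_point_def using x closure_of_subset_topspace[of T "{x}"] by blast
qed

lemma integral_scheme_generic_point:
 assumes X: "integral_scheme X"
 obtains \<xi> where "generic_point X \<xi>"
proof -
 interpret ring_sheaf X by (rule integral_scheme_sheaf[OF X])
 obtain x where "x \<in> points X" using X unfolding integral_scheme_def by blast
 then obtain U where U: "x \<in> U" "affine_open X U" using X unfolding integral_scheme_def is_scheme_def by blast
 obtain R h \<sigma> where "affine_chart X R U h \<sigma>" by (rule affine_open_chart[OF ring_presheaf_axioms U(2)]) blast
 then interpret affine_chart X R U h \<sigma> .
 have "domain (sections X U)" using X open_U U(1) unfolding integral_scheme_def by blast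
 then interpret integral_affine_scheme R
  by (intro integral_affine_scheme.intro affine_scheme_axioms domain_of_sections)
 obtain \<xi> where \<xi>: "\<xi> \<in> U" "h \<xi> = {\<zero>\<^bsub>R\<^esub>}" using zero_prime h_U by (metis (mono_tags, lifting) imageE mem_Collect_eq)
 have "\<xi> \<in> V" if V: "is_open X V" "V \<noteq> {}" for V
 proof -
  have "V \<inter> U \<noteq> {}" using integral_scheme_opens_meet[OF X V open_U] U(1) by blast
  then have "{\<zero>\<^bsub>R\<^esub>} \<in> h ` (V \<inter> U)"
   using zero_in_open[of "h ` (V \<inter> U)"] h_open[of "V \<inter> U"] V open_U by blast
  then obtain y where "y \<in> V" "y \<in> U" "h y = h \<xi>" using \<xi> by auto
  then show ?thesis using h_inj \<xi>(1) by (auto dest: inj_onD)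
 qed
 moreover have "\<xi> \<in> points X" using \<xi>(1) openin_subset[OF open_U] by blast
 ultimately show thesis using that generic_pointI[OF X] by blast
qed

section \<open>The dimension of a scheme of finite type\<close>

context affine_chart
begin

lemma closure_of_point_irreducible:
 assumes "x \<in> points X"
 shows "irreducible_closed (space_top X) (space_top X closure_of {x})"
 unfolding irreducible_closed_def
proof (intro conjI allI impI)
 have x: "x \<in> space_top X closure_of {x}" using assms unfolding in_closure_of by blast
 then show "space_top X closure_of {x} \<noteq> {}" by blast
 fix Z1 Z2 assume *: "closedin (space_top X) Z1 \<and> closedin (space_top X) Z2 \<and> space_top X closure_of {x} \<subseteq> Z1 \<union> Z2"
 then have "x \<in> Z1 \<or> x \<in> Z2" using x by blast
 then show "space_top X closure_of {x} \<subseteq> Z1 \<or> space_top X closure_of {x} \<subseteq> Z2"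
  using * closure_of_minimal[of "{x}" _ "space_top X"] by blast
qed simp

text \<open>
 The closures of the points of the chart that correspond to the prime ideals form a chain in the
 reverse order. Their inclusions are strict since distinct points of a chart have distinct closures.
\<close>
lemma krull_dim_prime_chain:
 assumes Z: "\<And>i. i \<le> n \<Longrightarrow> primeideal (Z i) R" "\<And>i. i < n \<Longrightarrow> Z i \<subset> Z (Suc i)"
 shows "enat n \<le> krull_dim (space_top X)"
proof -
 have "\<exists>x\<in>U. h x = Z i" if "i \<le> n" for i using Z(1)[OF that] h_U by (metis (mono_tags, lifting) imageE mem_Collect_eq)
 then obtain b where b: "\<And>i. i \<le> n \<Longrightarrow> b i \<in> U \<and> h (b i) = Z i" by metis
 have pt: "b i \<in> points X" if "i \<le> n" for i using b[OF that] openin_subset[OF open_U] by blast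
 let ?C = "\<lambda>i. space_top X closure_of {b i}"
 have step: "?C (Suc i) \<subset> ?C i" if i: "i < n" for i
 proof
  note bi = b[of i] b[of "Suc i"]
  have "b (Suc i) \<in> ?C i" unfolding in_closure_of
  proof (intro conjI allI impI)
   show "b (Suc i) \<in> points X" using pt i by simp
   fix V assume V: "b (Suc i) \<in> V \<and> is_open X V"
   have o: "is_open X (V \<inter> U)" using V open_U by blast
   then have "zopen (h ` (V \<inter> U))" using h_open[of "V \<inter> U"] by blast
   then obtain E where E: "h ` (V \<inter> U) = zariski_open E" unfolding openin_zariski by blast
   have "Z (Suc i) \<in> zariski_open E" unfolding E[symmetric] using V bi i by force
   then have "Z i \<in> zariski_open E" using Z(1)[of i] Z(2)[OF i] i unfolding zariski_open_def by auto
   then obtain y where y: "y \<in> V" "y \<in> U" "h y = h (b i)" unfolding E[symmetric] using bi i by auto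
   then have "y = b i" using inj_onD[OF h_inj y(3) y(2)] bi i by simp
   then show "\<exists>y. y \<in> {b i} \<and> y \<in> V" using y by blast
  qed
  then show "?C (Suc i) \<subseteq> ?C i" by (intro closure_of_minimal) auto
  show "?C (Suc i) \<noteq> ?C i"
  proof
   assume eq: "?C (Suc i) = ?C i"
   have "b i \<in> ?C i" "b (Suc i) \<in> ?C (Suc i)"
    using pt[of i] pt[of "Suc i"] i unfolding in_closure_of by auto
   then have m: "b i \<in> ?C (Suc i)" "b (Suc i) \<in> ?C i" using eq by auto
   have "b i = b (Suc i)"
   proof (rule T0_on_chart)
    show "b i \<in> U" "b (Suc i) \<in> U" using bi i by auto
    show "b i \<in> V \<longleftrightarrow> b (Suc i) \<in> V" if "is_open X V" for V
     using m that unfolding in_closure_of by blast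
   qed
   then show False using Z(2)[OF i] bi i by auto
  qed
 qed
 have "n \<in> {n. \<exists>Z. (\<forall>i\<le>n. irreducible_closed (space_top X) (Z i)) \<and> (\<forall>i<n. Z i \<subset> Z (Suc i))}"
 proof (rule CollectI, rule exI[of _ "\<lambda>i. ?C (n - i)"], intro conjI allI impI)
  show "irreducible_closed (space_top X) (?C (n - i))" if "i \<le> n" for i
   by (rule closure_of_point_irreducible[OF pt]) simp
  show "?C (n - i) \<subset> ?C (n - Suc i)" if "i < n" for i
   using step[of "n - Suc i"] that by (simp add: Suc_diff_Suc)
 qed
 then show ?thesis unfolding krull_dim_def by (rule SUP_upper)
qed

end

lemma (in field) primeideal_zero:
 "primeideal P R \<longleftrightarrow> P = {\<zero>}"
proof
 assume "primeideal P R"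
 then interpret P: primeideal P R .
 have "P = {\<zero>} \<or> P = carrier R" using all_ideals P.is_ideal by blast
 then show "P = {\<zero>}" using P.I_notcarr by blast
qed (simp add: zeroprimeideal)

text \<open>
 Noether normalization enters through the tower of transcendental elements among the generators of
 a chart: its length bounds that of a \<open>p\<close>-basis of the function field from above and is bounded by the
 dimension, since the tower yields a chain of prime ideals of this length.
\<close>
lemma p_basis_length_le_krull_dim:
 fixes k :: "'k ring" and B :: "('c, 'd) ringed_space"
 assumes k: "field k" and p: "Factorial_Ring.prime p" and char: "[p] \<cdot>\<^bsub>k\<^esub> \<one>\<^bsub>k\<^esub> = \<zero>\<^bsub>k\<^esub>"
  and perfect: "(\<lambda>a. a [^]\<^bsub>k\<^esub> p) ` carrier k = carrier k"
  and B: "generic_point B \<eta>" and ft: "finite_type B (Spec k) \<pi>"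
 obtains ts where "char_p_field (stalk B \<eta>) p" "set ts \<subseteq> carrier (stalk B \<eta>)"
  "ring.strict_tower (stalk B \<eta>) ((\<lambda>x. x [^]\<^bsub>stalk B \<eta>\<^esub> p) ` carrier (stalk B \<eta>)) ts"
  "ring.finite_extension (stalk B \<eta>) ((\<lambda>x. x [^]\<^bsub>stalk B \<eta>\<^esub> p) ` carrier (stalk B \<eta>)) ts
   = carrier (stalk B \<eta>)"
  "enat (length ts) \<le> krull_dim (space_top B)"
proof -
 interpret k: field k by (rule k)
 interpret Sk: integral_affine_scheme k
  by (intro integral_affine_scheme.intro affine_scheme.intro k.cring_axioms k.domain_axioms)
 interpret B: generic_point B \<eta> by (rule B)
 have pk: "points (Spec k) = {{\<zero>\<^bsub>k\<^esub>}}" unfolding Sk.points_Spec k.primeideal_zero by simp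
 have mor: "is_morphism B (Spec k) \<pi>" using ft unfolding finite_type_def by blast
 obtain V \<U> where V: "{\<zero>\<^bsub>k\<^esub>} \<in> V" "affine_open (Spec k) V" and \<U>: "\<Union>\<U> = preimage B \<pi> V"
  "\<And>U. U \<in> \<U> \<Longrightarrow> affine_open B U \<and> finitely_generated_algebra (sections (Spec k) V) (sections B U)
        (\<lambda>s. restr B (preimage B \<pi> V) U (sec_map \<pi> V s))"
  using ft pk unfolding finite_type_def by auto
 have Vk: "is_open (Spec k) V" "V = points (Spec k)"
  using V openin_subset[of "space_top (Spec k)" V] unfolding affine_open_def pk by blast+
 have Vp: "V = Sk.primes" using Vk(2) Sk.points_Spec by simp
 have cont: "continuous_map (space_top B) (space_top (Spec k)) (pt_map \<pi>)"
  using mor unfolding is_morphism_def by (elim conjE)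
 have "pt_map \<pi> \<in> points B \<rightarrow> points (Spec k)"
  using continuous_map_funspace[OF cont] .
 then have pre: "preimage B \<pi> V = points B" unfolding preimage_def Vk(2) by auto
 then obtain U where U: "U \<in> \<U>" "\<eta> \<in> U" using \<U>(1) B.\<xi>_point by blast
 have aff: "affine_open B U" using \<U>(2)[OF U(1)] by blast
 obtain R h \<sigma> where "generic_chart B \<eta> R U h \<sigma>" by (rule B.generic_chart_of[OF aff]) (use U in blast)+
 then interpret c: generic_chart B \<eta> R U h \<sigma> .
 interpret K: field "stalk B \<eta>" by (rule B.stalk_field)
 interpret t: ring_hom_ring R "stalk B \<eta>" c.to_stalk by (rule c.to_stalk_ring_hom)
 interpret SU: cring "sections B U" by (rule B.sections_cring[OF c.open_U])
 define \<phi> where "\<phi> = (\<lambda>s. restr B (points B) U (sec_map \<pi> V s))"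
 obtain S where S: "finite S" "S \<subseteq> \<Gamma> B U"
  "generate_ring (sections B U) (\<phi> ` carrier (sections (Spec k) V) \<union> S) = \<Gamma> B U"
  using \<U>(2)[OF U(1)] unfolding finitely_generated_algebra_def \<phi>_def pre by blast
 have oB: "is_open B (points B)" "U \<subseteq> points B" using openin_subset[OF c.open_U] by auto
 have "sec_map \<pi> V \<in> ring_hom (sections (Spec k) V) (sections B (points B))"
  using mor Vk(1) pre unfolding is_morphism_def by metis
 from ring_hom_trans[OF this B.restr_hom[OF oB(1) c.open_U oB(2)]]
 have \<phi>: "\<phi> \<in> ring_hom (sections (Spec k) V) (sections B U)" unfolding \<phi>_def comp_def .
 have lift_surj: "\<exists>a\<in>carrier R. c.lift a = s" if s: "s \<in> \<Gamma> B U" for s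
 proof -
  have "\<sigma> U s \<in> carrier (sections (Spec R) c.primes)"
   using ring_hom_memE(1)[OF c.\<sigma>_hom[OF c.open_U order_refl] s] unfolding c.h_U .
  then obtain a where a: "a \<in> carrier R" "\<sigma> U s = const_section R a" using c.global_section_const by blast
  then have "c.lift a = s"
   using c.section_eqI[OF c.open_U order_refl c.lift_closed[OF a(1)] s] c.\<sigma>_lift[OF a(1)] by simp
  then show ?thesis using a(1) by blast
 qed
 have lift_inj: "inj_on c.lift (carrier R)"
  using c.to_stalk_inj unfolding c.to_stalk_def inj_on_def by auto
 have lift_iso: "c.lift \<in> ring_iso R (sections B U)"
  unfolding ring_iso_def bij_betw_def using c.lift_hom lift_inj lift_surj c.lift_closed by auto
 define unlift where "unlift = inv_into (carrier R) c.lift"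
 have unlift: "unlift \<in> ring_hom (sections B U) R"
  using ring_iso_set_sym[OF c.ring_axioms lift_iso] unfolding unlift_def ring_iso_def by blast
 have lift_unlift: "c.lift (unlift s) = s" if "s \<in> \<Gamma> B U" for s
  unfolding unlift_def by (rule f_inv_into_f) (use lift_surj[OF that] in blast)
 define \<kappa> where "\<kappa> c = unlift (\<phi> (const_section k c))" for c
 have "const_section k \<in> ring_hom k (sections (Spec k) V)" using Sk.const_section_hom Vp by simp
 from ring_hom_trans[OF ring_hom_trans[OF this \<phi>] unlift]
 have \<kappa>_hom: "\<kappa> \<in> ring_hom k R" unfolding \<kappa>_def comp_def .
 interpret \<kappa>: ring_hom_ring k R \<kappa> by (rule ring_hom_ringI2[OF k.ring_axioms c.ring_axioms \<kappa>_hom])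
 have kR: "subring (\<kappa> ` carrier k) R" by (rule \<kappa>.img_is_subring[OF k.carrier_is_subring])
 obtain ys' where ys': "set ys' = S" using finite_list[OF S(1)] by blast
 define ys where "ys = map unlift ys'"
 have ys: "set ys \<subseteq> carrier R" unfolding ys_def using ys' S(2) ring_hom_memE(1)[OF unlift] by auto
 let ?A = "ring.finite_extension R (\<kappa> ` carrier k) ys"
 have A: "subring ?A R" by (rule c.finite_extension_subring[OF kR ys])
 interpret l: ring_hom_ring R "sections B U" c.lift
  by (rule ring_hom_ringI2[OF c.ring_axioms SU.ring_axioms c.lift_hom])
 \<comment> \<open>The image of \<open>?A\<close> contains the generators of the ring of sections over \<open>U\<close>.\<close>
 have whole: "?A = carrier R"
 proof
  show "?A \<subseteq> carrier R" using subringE(1)[OF A] .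
  have "\<phi> ` carrier (sections (Spec k) V) \<union> S \<subseteq> c.lift ` ?A"
  proof
   fix s assume "s \<in> \<phi> ` carrier (sections (Spec k) V) \<union> S"
   then show "s \<in> c.lift ` ?A"
   proof
    assume "s \<in> \<phi> ` carrier (sections (Spec k) V)"
    then obtain r where r: "r \<in> carrier (sections (Spec k) Sk.primes)" "s = \<phi> r" using Vp by blast
    then obtain e where e: "e \<in> carrier k" "r = const_section k e" using Sk.global_section_const by blast
    have "s \<in> \<Gamma> B U" using ring_hom_memE(1)[OF \<phi>] r Vp by simp
    then have "s = c.lift (\<kappa> e)" using lift_unlift r e unfolding \<kappa>_def by simp
    moreover have "\<kappa> e \<in> ?A"
     using c.finite_extension_incl[OF subringE(1)[OF kR] ys] e(1) by blast
    ultimately show ?thesis by blast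
   next
    assume s: "s \<in> S"
    then have "unlift s \<in> set ys" unfolding ys_def using ys' by simp
    then have "unlift s \<in> ?A" using c.finite_extension_members[OF kR ys] by blast
    moreover have "s = c.lift (unlift s)" using lift_unlift s S(2) by auto
    ultimately show ?thesis by blast
   qed
  qed
  moreover have "\<phi> ` carrier (sections (Spec k) V) \<union> S \<subseteq> \<Gamma> B U"
   using S(2) ring_hom_memE(1)[OF \<phi>] by blast
  ultimately have gen: "\<Gamma> B U \<subseteq> c.lift ` ?A"
   using SU.generate_ring_min_subring1[OF _ l.img_is_subring[OF A]] S(3) by metis
  show "carrier R \<subseteq> ?A"
  proof
   fix a assume a: "a \<in> carrier R"
   obtain a' where a': "a' \<in> ?A" "c.lift a = c.lift a'" using gen c.lift_closed[OF a] by blast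
   then show "a \<in> ?A" using inj_onD[OF lift_inj a'(2) a] subringE(1)[OF A] by blast
  qed
 qed
 let ?h = c.to_stalk
 let ?k = "?h ` \<kappa> ` carrier k"
 have \<tau>_hom: "(\<lambda>x. ?h (\<kappa> x)) \<in> ring_hom k (stalk B \<eta>)"
  using ring_hom_trans[OF \<kappa>_hom c.to_stalk_hom] unfolding comp_def .
 interpret \<tau>: ring_hom_ring k "stalk B \<eta>" "\<lambda>x. ?h (\<kappa> x)"
  by (rule ring_hom_ringI2[OF k.ring_axioms K.ring_axioms \<tau>_hom])
 have kK: "subfield ?k (stalk B \<eta>)"
  using \<tau>.img_is_subfield[OF k.carrier_is_subfield] K.one_not_zero by (simp add: image_image)
 have "[p] \<cdot>\<^bsub>stalk B \<eta>\<^esub> \<one>\<^bsub>stalk B \<eta>\<^esub> = \<zero>\<^bsub>stalk B \<eta>\<^esub>"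
  using \<tau>.hom_nat_add_pow[of "\<one>\<^bsub>k\<^esub>" p] char by simp
 then have cK: "char_p_field (stalk B \<eta>) p"
  by (intro char_p_field.intro char_p_cring.intro char_p_cring_axioms.intro K.cring_axioms K.field_axioms p)
 interpret K: char_p_field "stalk B \<eta>" p by (rule cK)
 have perfK: "(\<lambda>x. x [^]\<^bsub>stalk B \<eta>\<^esub> p) ` ?k = ?k"
 proof -
  have "(\<lambda>x. x [^]\<^bsub>stalk B \<eta>\<^esub> p) ` ?k = (\<lambda>x. ?h (\<kappa> x)) ` (\<lambda>a. a [^]\<^bsub>k\<^esub> p) ` carrier k"
   by (simp add: image_image \<tau>.hom_nat_pow cong: image_cong)
  then show ?thesis unfolding perfect by (simp add: image_image)
 qed
 have ysK: "set (map ?h ys) \<subseteq> carrier (stalk B \<eta>)" using ys by auto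
 have img: "?h ` carrier R = K.finite_extension ?k (map ?h ys)"
  using t.image_finite_extension[OF subringE(1)[OF kR] ys] whole by simp
 obtain ts xs' where ts: "set ts \<subseteq> carrier (stalk B \<eta>)"
  "K.strict_tower ((\<lambda>x. x [^]\<^bsub>stalk B \<eta>\<^esub> p) ` carrier (stalk B \<eta>)) ts"
  "K.finite_extension ((\<lambda>x. x [^]\<^bsub>stalk B \<eta>\<^esub> p) ` carrier (stalk B \<eta>)) ts = carrier (stalk B \<eta>)"
  and xs': "set xs' \<subseteq> set (map ?h ys)" "K.transcendental_tower ?k xs'" "length ts \<le> length xs'"
 proof (rule K.p_basis_length_le_transcendental_tower[OF kK perfK ysK])
  fix x assume x: "x \<in> carrier (stalk B \<eta>)"
  obtain a b where "a \<in> carrier R" "b \<in> carrier R" "b \<noteq> \<zero>\<^bsub>R\<^esub>" "?h b \<noteq> \<zero>\<^bsub>stalk B \<eta>\<^esub>"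
   "x = ?h a \<otimes>\<^bsub>stalk B \<eta>\<^esub> inv\<^bsub>stalk B \<eta>\<^esub> (?h b)" by (rule c.stalk_fraction_inv[OF x])
  then show "\<exists>a\<in>K.finite_extension ?k (map ?h ys). \<exists>b\<in>K.finite_extension ?k (map ?h ys).
    b \<noteq> \<zero>\<^bsub>stalk B \<eta>\<^esub> \<and> x = a \<otimes>\<^bsub>stalk B \<eta>\<^esub> inv\<^bsub>stalk B \<eta>\<^esub> b" unfolding img[symmetric] by blast
 qed blast
 obtain xs where xs: "xs' = map ?h xs" "set xs \<subseteq> carrier R"
 proof -
  have "set xs' \<subseteq> ?h ` carrier R" using xs'(1) ys by auto
  then have "map ?h (map (inv_into (carrier R) ?h) xs') = xs'"
   "set (map (inv_into (carrier R) ?h) xs') \<subseteq> carrier R"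
   using f_inv_into_f[of _ ?h "carrier R"] inv_into_into[of _ ?h "carrier R"]
   by (auto intro!: map_idI)
  then show thesis using that by metis
 qed
 have "c.relation_free_tower (\<kappa> ` carrier k) xs"
  by (rule t.transcendental_tower_pullback[OF c.to_stalk_inj subringE(1)[OF kR] xs(2)])
   (use xs'(2) xs(1) in simp)
 moreover have "subring (ring.finite_extension R (\<kappa> ` carrier k) xs) R" by (rule c.finite_extension_subring[OF kR xs(2)])
 then have "ring.finite_extension R (\<kappa> ` carrier k) xs \<inter> {\<zero>\<^bsub>R\<^esub>} = {\<zero>\<^bsub>R\<^esub>}" using subringE(2) by blast
 ultimately obtain Z where "Z 0 = {\<zero>\<^bsub>R\<^esub>}" "\<forall>i\<le>length xs. primeideal (Z i) R" "\<forall>i<length xs. Z i \<subset> Z (Suc i)"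
  using exists_prime_chain[OF c.cring_axioms kR ys whole xs(2) _ c.zero_prime] by blast
 then have "enat (length xs) \<le> krull_dim (space_top B)" using c.krull_dim_prime_chain[of "length xs" Z] by blast
 moreover have "length ts \<le> length xs" using xs'(3) xs(1) by simp
 ultimately have "enat (length ts) \<le> krull_dim (space_top B)" by (meson enat_ord_simps(1) order_trans)
 then show thesis using that cK ts by blast
qed

section \<open>Roots of functions on normal schemes\<close>

text \<open>
 The fraction \<open>a/b\<close> is a root of the monic polynomial \<open>Z\<^sup>n - s\<close>.
\<close>
lemma normal_domain_root:
 fixes D :: "'r ring" (structure)
 assumes D: "normal_domain D" and ab: "a \<in> carrier D" "b \<in> carrier D" "b \<noteq> \<zero>"
  and s: "s \<in> carrier D" and n: "n > 0" and eq: "a [^] n = b [^] (n::nat) \<otimes> s"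
 shows "\<exists>d\<in>carrier D. a = b \<otimes> d"
proof -
 interpret domain D using D unfolding normal_domain_def by blast
 interpret plain_domain D ..
 interpret M: multiplicative_set D "carrier D - {\<zero>}" by (rule nonzero_multiplicative_set)
 interpret Q: field "fraction_field D" by (rule fraction_field_field)
 have Q_eq: "fraction_field D = M.Loc" by (simp add: fraction_field_def)
 have tf_eq: "to_fraction_field D x = M.frac x \<one>" for x by (simp add: to_fraction_field_def)
 interpret tf: ring_hom_ring D "fraction_field D" "to_fraction_field D"
  by (rule ring_hom_ringI2[OF ring_axioms Q.ring_axioms to_fraction_field_hom])
 have bS: "b \<in> carrier D - {\<zero>}" using ab by simp
 define z where "z = M.frac a b"
 have z: "z \<in> carrier (fraction_field D)" unfolding z_def Q_eq using ab(1) bS by blast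
 have tb: "to_fraction_field D b \<noteq> \<zero>\<^bsub>fraction_field D\<^esub>"
  using to_fraction_field_inj tf.hom_zero ab(2,3) by (metis inj_onD zero_closed)
 have zb: "z \<otimes>\<^bsub>fraction_field D\<^esub> to_fraction_field D b = to_fraction_field D a"
  unfolding z_def tf_eq Q_eq M.mult_frac[OF ab(1) bS ab(2) M.one_S]
  by (rule M.frac_eqI) (use ab bS in \<open>auto simp: m_comm\<close>)
 have "(z [^]\<^bsub>fraction_field D\<^esub> n) \<otimes>\<^bsub>fraction_field D\<^esub> (to_fraction_field D b [^]\<^bsub>fraction_field D\<^esub> n)
   = to_fraction_field D (a [^] n)"
  using zb z ab by (simp add: Q.nat_pow_distrib[symmetric] tf.hom_nat_pow)
 also have "\<dots> = to_fraction_field D s \<otimes>\<^bsub>fraction_field D\<^esub> (to_fraction_field D b [^]\<^bsub>fraction_field D\<^esub> n)"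
  unfolding eq using ab s by (simp add: tf.hom_nat_pow Q.m_comm)
 finally have *: "(z [^]\<^bsub>fraction_field D\<^esub> n) \<otimes>\<^bsub>fraction_field D\<^esub> (to_fraction_field D b [^]\<^bsub>fraction_field D\<^esub> n)
   = to_fraction_field D s \<otimes>\<^bsub>fraction_field D\<^esub> (to_fraction_field D b [^]\<^bsub>fraction_field D\<^esub> n)" .
 have "to_fraction_field D b \<in> Units (fraction_field D)" using Q.field_Units tb tf.hom_closed[OF ab(2)] by blast
 then have "to_fraction_field D b [^]\<^bsub>fraction_field D\<^esub> n \<in> Units (fraction_field D)"
  by (rule Q.Units_pow_closed)
 then have tbn: "to_fraction_field D b [^]\<^bsub>fraction_field D\<^esub> n \<noteq> \<zero>\<^bsub>fraction_field D\<^esub>"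
  "to_fraction_field D b [^]\<^bsub>fraction_field D\<^esub> n \<in> carrier (fraction_field D)"
  using Q.field_Units by auto
 have zn: "z [^]\<^bsub>fraction_field D\<^esub> n = to_fraction_field D s"
  using Q.m_rcancel[OF tbn Q.nat_pow_closed[OF z] tf.hom_closed[OF s]] * by blast
 \<comment> \<open>The coefficients of the polynomial \<open>Z\<^sup>n - s\<close>.\<close>
 define c where "c = (\<lambda>i::nat. if i = 0 then \<ominus> s else \<zero>)"
 have c: "c \<in> {..<n} \<rightarrow> carrier D" unfolding c_def using s by auto
 have "(\<Oplus>\<^bsub>fraction_field D\<^esub> i\<in>{..<n}. to_fraction_field D (c i) \<otimes>\<^bsub>fraction_field D\<^esub> z [^]\<^bsub>fraction_field D\<^esub> i)
   = (\<Oplus>\<^bsub>fraction_field D\<^esub> i\<in>{..<n}. if 0 = i then to_fraction_field D (\<ominus> s) else \<zero>\<^bsub>fraction_field D\<^esub>)"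
  by (rule Q.finsum_cong') (use z s in \<open>auto simp: c_def\<close>)
 also have "\<dots> = to_fraction_field D (\<ominus> s)"
  using Q.finsum_singleton[of 0 "{..<n}" "\<lambda>_. to_fraction_field D (\<ominus> s)"] n s by auto
 finally have "z [^]\<^bsub>fraction_field D\<^esub> n \<oplus>\<^bsub>fraction_field D\<^esub>
   (\<Oplus>\<^bsub>fraction_field D\<^esub> i\<in>{..<n}. to_fraction_field D (c i) \<otimes>\<^bsub>fraction_field D\<^esub> z [^]\<^bsub>fraction_field D\<^esub> i)
   = \<zero>\<^bsub>fraction_field D\<^esub>" unfolding zn using s by (simp add: Q.r_neg)
 then have "z \<in> to_fraction_field D ` carrier D"
  using D z c unfolding normal_domain_def by blast
 then obtain d where d: "d \<in> carrier D" "z = to_fraction_field D d" by blast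
 have "to_fraction_field D a = to_fraction_field D (b \<otimes> d)"
  using zb d ab by (simp add: Q.m_comm)
 then have "a = b \<otimes> d" using inj_onD[OF to_fraction_field_inj] ab d by simp
 then show ?thesis using d(1) by blast
qed

locale presheaf_map = X: ring_presheaf X + B: ring_presheaf B
 for X :: "('a, 'b) ringed_space" and B :: "('c, 'd) ringed_space" +
 fixes f :: "('a, 'b, 'c, 'd) lrs_map"
 assumes cont: "continuous_map (space_top X) (space_top B) (pt_map f)"
  and sec_hom: "\<And>V. is_open B V \<Longrightarrow> sec_map f V \<in> ring_hom (sections B V) (sections X (preimage X f V))"
  and sec_restr: "\<And>V W s. is_open B V \<Longrightarrow> is_open B W \<Longrightarrow> W \<subseteq> V \<Longrightarrow> s \<in> \<Gamma> B V \<Longrightarrow>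
   sec_map f W (restr B V W s) = restr X (preimage X f V) (preimage X f W) (sec_map f V s)"
begin

lemma open_preimage: "is_open B V \<Longrightarrow> is_open X (preimage X f V)"
 unfolding preimage_def by (rule openin_continuous_map_preimage[OF cont])

lemma preimage_mono: "W \<subseteq> V \<Longrightarrow> preimage X f W \<subseteq> preimage X f V"
 unfolding preimage_def by blast

lemma sec_closed: "is_open B V \<Longrightarrow> s \<in> \<Gamma> B V \<Longrightarrow>
  sec_map f V s \<in> \<Gamma> X (preimage X f V)" by (rule ring_hom_memE(1)[OF sec_hom])

lemma stalk_map_germ:
 assumes x: "x \<in> points X" and V: "is_open B V" "pt_map f x \<in> V" "s \<in> \<Gamma> B V"
 shows "stalk_map X B f x (germ B (pt_map f x) V s) = germ X x (preimage X f V) (sec_map f V s)"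
 unfolding stalk_map_def
proof (rule the_equality)
 show "\<exists>V' s'. (V', s') \<in> germ B (pt_map f x) V s \<and>
   germ X x (preimage X f V) (sec_map f V s) = germ X x (preimage X f V') (sec_map f V' s')"
  using B.germ_memI[OF V] by blast
 fix b assume "\<exists>V' s'. (V', s') \<in> germ B (pt_map f x) V s \<and> b = germ X x (preimage X f V') (sec_map f V' s')"
 then obtain V' s' where m: "(V', s') \<in> germ B (pt_map f x) V s" "b = germ X x (preimage X f V') (sec_map f V' s')"
  by blast
 note V' = B.germ_memD[OF m(1) V(1,3)]
 obtain W where W: "is_open B W" "pt_map f x \<in> W" "W \<subseteq> V'" "W \<subseteq> V" "restr B V' W s' = restr B V W s"
  using B.germ_eqD[OF V'(4) V] by blast
 show "b = germ X x (preimage X f V) (sec_map f V s)" unfolding m(2)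
 proof (rule X.germ_eqI[OF open_preimage[OF V'(1)] sec_closed[OF V'(1,3)] open_preimage[OF V(1)] sec_closed[OF V(1,3)]
    open_preimage[OF W(1)]])
  show "restr X (preimage X f V') (preimage X f W) (sec_map f V' s') =
    restr X (preimage X f V) (preimage X f W) (sec_map f V s)"
   using sec_restr[OF V'(1) W(1,3) V'(3)] sec_restr[OF V(1) W(1,4) V(3)] W(5) by simp
 qed (use x W preimage_mono in \<open>auto simp: preimage_def\<close>)
qed

lemma stalk_map_hom:
 assumes x: "x \<in> points X"
 shows "stalk_map X B f x \<in> ring_hom (stalk B (pt_map f x)) (stalk X x)"
proof -
 have pre: "x \<in> preimage X f V" if "pt_map f x \<in> V" for V using that x unfolding preimage_def by simp
 have fx: "pt_map f x \<in> points B" using continuous_map_image_subset_topspace[OF cont] x by blast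
 show ?thesis
 proof (rule ring_hom_memI)
  fix a b assume a: "a \<in> carrier (stalk B (pt_map f x))" and b: "b \<in> carrier (stalk B (pt_map f x))"
  obtain V s t where V: "is_open B V" "pt_map f x \<in> V" "s \<in> \<Gamma> B V" "t \<in> \<Gamma> B V"
   "a = germ B (pt_map f x) V s" "b = germ B (pt_map f x) V t" using B.stalk_cases2[OF a b] .
  interpret SV: ring "sections B V" using B.sections_cring[OF V(1)] by (rule cring.axioms(1))
  note sm = stalk_map_germ[OF x V(1,2)] and h = ring_hom_memE[OF sec_hom[OF V(1)]]
  note o = open_preimage[OF V(1)] pre[OF V(2)]
  show "stalk_map X B f x a \<in> carrier (stalk X x)"
   unfolding V(5) sm[OF V(3)] by (rule X.germ_closed[OF o h(1)[OF V(3)]])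
  show "stalk_map X B f x (a \<otimes>\<^bsub>stalk B (pt_map f x)\<^esub> b) = stalk_map X B f x a \<otimes>\<^bsub>stalk X x\<^esub> stalk_map X B f x b"
   unfolding V(5,6) B.mult_germ[OF V(1-4)] sm[OF V(3)] sm[OF V(4)] sm[OF SV.m_closed[OF V(3,4)]]
    h(2)[OF V(3,4)] X.mult_germ[OF o h(1)[OF V(3)] h(1)[OF V(4)]] ..
  show "stalk_map X B f x (a \<oplus>\<^bsub>stalk B (pt_map f x)\<^esub> b) = stalk_map X B f x a \<oplus>\<^bsub>stalk X x\<^esub> stalk_map X B f x b"
   unfolding V(5,6) B.add_germ[OF V(1-4)] sm[OF V(3)] sm[OF V(4)] sm[OF SV.a_closed[OF V(3,4)]]
    h(3)[OF V(3,4)] X.add_germ[OF o h(1)[OF V(3)] h(1)[OF V(4)]] ..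
 next
  have oB: "is_open B (points B)" by simp
  interpret SB: ring "sections B (points B)" using B.sections_cring[OF oB] by (rule cring.axioms(1))
  show "stalk_map X B f x \<one>\<^bsub>stalk B (pt_map f x)\<^esub> = \<one>\<^bsub>stalk X x\<^esub>"
   unfolding B.one_stalk[OF oB fx] stalk_map_germ[OF x oB fx SB.one_closed] ring_hom_memE(4)[OF sec_hom[OF oB]]
    X.one_stalk[OF open_preimage[OF oB] pre[OF fx]] ..
 qed
qed

end

lemma morphism_presheaf_map:
 assumes "is_morphism X B f"
 shows "presheaf_map X B f"
proof -
 have lr: "is_ringed_space X" "is_ringed_space B"
  using assms unfolding is_morphism_def locally_ringed_space_def by blast+
 note m = assms[unfolded is_morphism_def]
 note m3 = conjunct2[OF conjunct2[OF m]]
 show ?thesis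
  by (rule presheaf_map.intro[OF ringed_space_presheaf[OF lr(1)] ringed_space_presheaf[OF lr(2)]],
    rule presheaf_map_axioms.intro)
   (use conjunct1[OF m3] conjunct1[OF conjunct2[OF m3]] conjunct1[OF conjunct2[OF conjunct2[OF m3]]] in simp_all)
qed

locale dominant_map = X: generic_point X \<xi> + B: generic_point B \<eta> + presheaf_map X B f
 for X :: "('a, 'b) ringed_space" and \<xi> and B :: "('c, 'd) ringed_space" and \<eta>
  and f :: "('a, 'b, 'c, 'd) lrs_map" +
 assumes f_\<xi>: "pt_map f \<xi> = \<eta>"

text \<open>
 The preimage of a nonempty open set \<open>V\<close> has nonzero functions, those of \<open>V\<close>, so it is not empty and
 contains \<open>\<xi>\<close>. Hence \<open>f \<xi>\<close> lies in all nonempty open subsets of \<open>B\<close>.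
\<close>
lemma dominant_mapI:
 assumes X: "generic_point X \<xi>" and B: "generic_point B \<eta>" and f: "is_morphism X B f"
  and push: "\<And>V. is_open B V \<Longrightarrow>
   bij_betw (sec_map f V) (\<Gamma> B V) (\<Gamma> X (preimage X f V))"
 shows "dominant_map X \<xi> B \<eta> f"
proof -
 interpret X: generic_point X \<xi> by (rule X)
 interpret B: generic_point B \<eta> by (rule B)
 interpret presheaf_map X B f by (rule morphism_presheaf_map[OF f])
 have "pt_map f \<xi> \<in> V" if V: "is_open B V" "V \<noteq> {}" for V
 proof -
  interpret D: domain "sections B V" by (rule B.sections_domain[OF V])
  have "preimage X f V \<noteq> {}"
  proof
   assume e: "preimage X f V = {}"
   have "sec_map f V \<one>\<^bsub>sections B V\<^esub> = sec_map f V \<zero>\<^bsub>sections B V\<^esub>"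
    by (rule X.section_eq_by_cover[of "{}" "{}"])
     (use sec_closed[OF V(1) D.one_closed] sec_closed[OF V(1) D.zero_closed] e in auto)
   then show False using inj_onD[OF bij_betw_imp_inj_on[OF push[OF V(1)]]] D.one_not_zero by blast
  qed
  then have "\<xi> \<in> preimage X f V" using X.generic[OF open_preimage[OF V(1)]] by blast
  then show ?thesis unfolding preimage_def by blast
 qed
 moreover have "pt_map f \<xi> \<in> points B" using continuous_map_image_subset_topspace[OF cont] X.\<xi>_point by blast
 ultimately have "pt_map f \<xi> = \<eta>" by (intro B.generic_unique)
 then show ?thesis by (intro dominant_map.intro X B presheaf_map_axioms dominant_map_axioms.intro)
qed

context dominant_map
begin

abbreviation F where "F \<equiv> stalk X \<xi>"

abbreviation \<phi> where "\<phi> x \<equiv> stalk_map X B f x"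

lemma \<phi>_hom: "x \<in> points X \<Longrightarrow> pt_map f x = \<eta> \<Longrightarrow> \<phi> x \<in> ring_hom (stalk B \<eta>) (stalk X x)"
 using stalk_map_hom by metis

text \<open>
 An \<open>n\<close>-th root in the function field is integral over the local rings of the normal scheme \<open>X\<close>,
 so it is a section over the whole preimage of the open set on which the radicand is defined.
\<close>
lemma root_descends:
 assumes normal: "\<And>x. x \<in> points X \<Longrightarrow> normal_domain (stalk X x)"
  and push: "\<And>V. is_open B V \<Longrightarrow>
   bij_betw (sec_map f V) (\<Gamma> B V) (\<Gamma> X (preimage X f V))"
  and c: "c \<in> carrier (stalk B \<eta>)" and \<alpha>: "\<alpha> \<in> carrier F" and n: "n > 0"
  and root: "\<alpha> [^]\<^bsub>F\<^esub> (n::nat) = \<phi> \<xi> c"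
 shows "\<exists>d\<in>carrier (stalk B \<eta>). c = d [^]\<^bsub>stalk B \<eta>\<^esub> n"
proof -
 obtain V s where V: "is_open B V" "\<eta> \<in> V" "s \<in> \<Gamma> B V" "c = germ B \<eta> V s"
  using B.stalk_cases[OF c] .
 define V' where "V' = preimage X f V"
 have V': "is_open X V'" "\<xi> \<in> V'"
  using open_preimage[OF V(1)] X.\<xi>_point f_\<xi> V(2) unfolding V'_def by (auto simp: preimage_def)
 define \<sigma> where "\<sigma> = sec_map f V s"
 have \<sigma>: "\<sigma> \<in> \<Gamma> X V'" using sec_closed[OF V(1,3)] unfolding \<sigma>_def V'_def .
 have root\<sigma>: "\<alpha> [^]\<^bsub>F\<^esub> n = germ X \<xi> V' \<sigma>"
  unfolding root V(4) \<sigma>_def V'_def using stalk_map_germ[OF X.\<xi>_point V(1) _ V(3)] f_\<xi> V(2) by simp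
 interpret L: field "F" by (rule X.stalk_field)
 have loc: "\<exists>N t. is_open X N \<and> x \<in> N \<and> N \<subseteq> V' \<and> t \<in> \<Gamma> X N \<and> germ X \<xi> N t = \<alpha>"
  if x: "x \<in> V'" for x
 proof -
  have xp: "x \<in> points X" using x openin_subset[OF V'(1)] by blast
  obtain U where U: "x \<in> U" "affine_open X U" using X.charts[OF xp] by blast
  obtain R h \<tau> where "generic_chart X \<xi> R U h \<tau>" by (rule X.generic_chart_of[OF U(2)]) (use U(1) in blast)+
  then interpret c: generic_chart X \<xi> R U h \<tau> .
  obtain a b where ab: "a \<in> carrier R" "b \<in> carrier R" "b \<noteq> \<zero>\<^bsub>R\<^esub>" "c.to_stalk b \<otimes>\<^bsub>F\<^esub> \<alpha> = c.to_stalk a"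
   by (rule c.stalk_fraction[OF \<alpha>])
  interpret t: ring_hom_ring R "F" c.to_stalk by (rule c.to_stalk_ring_hom)
  have b\<xi>: "c.to_stalk b \<noteq> \<zero>\<^bsub>F\<^esub>" using c.to_stalk_zero ab(2,3) by blast
  note tc = t.hom_closed[OF ab(1)] t.hom_closed[OF ab(2)]
  define N where "N = U \<inter> V'"
  have N: "is_open X N" "x \<in> N" "\<xi> \<in> N" "N \<subseteq> U" "N \<subseteq> V'"
   using c.open_U V' x U(1) c.\<xi>_U unfolding N_def by auto
  define A where "A = restr X U N (c.lift a)"
  define D where "D = restr X U N (c.lift b)"
  define S where "S = restr X V' N \<sigma>"
  have cl: "A \<in> \<Gamma> X N" "D \<in> \<Gamma> X N" "S \<in> \<Gamma> X N"
   unfolding A_def D_def S_def using X.restr_closed[OF c.open_U N(1,4)] X.restr_closed[OF V'(1) N(1,5) \<sigma>]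
    c.lift_closed ab by auto
  have g\<xi>: "germ X \<xi> N A = c.to_stalk a" "germ X \<xi> N D = c.to_stalk b" "germ X \<xi> N S = \<alpha> [^]\<^bsub>F\<^esub> n"
   unfolding A_def D_def S_def c.to_stalk_def root\<sigma>
   using X.germ_restr[OF c.open_U c.lift_closed N(1,3,4)] X.germ_restr[OF V'(1) \<sigma> N(1,3,5)] ab by auto
  interpret SN: cring "sections X N" by (rule X.sections_cring[OF N(1)])
  interpret g: ring_hom_ring "sections X N" "F" "germ X \<xi> N" by (rule X.germ_ring_hom[OF N(1,3)])
  interpret gx: ring_hom_ring "sections X N" "stalk X x" "germ X x N" by (rule X.germ_ring_hom[OF N(1,2)])
  have "germ X \<xi> N (A [^]\<^bsub>sections X N\<^esub> n) = germ X \<xi> N (D [^]\<^bsub>sections X N\<^esub> n \<otimes>\<^bsub>sections X N\<^esub> S)"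
   using cl tc \<alpha> by (simp add: g\<xi> g.hom_nat_pow ab(4)[symmetric] L.nat_pow_distrib)
  then have "A [^]\<^bsub>sections X N\<^esub> n = D [^]\<^bsub>sections X N\<^esub> n \<otimes>\<^bsub>sections X N\<^esub> S"
   using inj_onD[OF X.germ_generic_inj[OF N(1)]] N(2) cl by blast
  then have eqx: "germ X x N A [^]\<^bsub>stalk X x\<^esub> n = germ X x N D [^]\<^bsub>stalk X x\<^esub> n \<otimes>\<^bsub>stalk X x\<^esub> germ X x N S"
   using cl by (metis SN.nat_pow_closed gx.hom_mult gx.hom_nat_pow)
  \<comment> \<open>The germ at \<open>x\<close> of the denominator is not zero, so that \<open>\<alpha>\<close> is a fraction over the local ring at \<open>x\<close>.\<close>
  have Dx: "germ X x N D \<noteq> \<zero>\<^bsub>stalk X x\<^esub>"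
  proof
   assume z: "germ X x N D = \<zero>\<^bsub>stalk X x\<^esub>"
   then have "germ X x N D = germ X x N \<zero>\<^bsub>sections X N\<^esub>" by simp
   then obtain W where W: "is_open X W" "x \<in> W" "W \<subseteq> N" "restr X N W D = restr X N W \<zero>\<^bsub>sections X N\<^esub>"
    by (rule X.germ_eqD[OF _ N(1,2) SN.zero_closed]) blast
   interpret rr: ring_hom_ring "sections X N" "sections X W" "restr X N W"
    by (rule X.restr_ring_hom[OF N(1) W(1,3)])
   have "D = \<zero>\<^bsub>sections X N\<^esub>" using X.restr_generic_inj[OF N(1) W(3,1) _ cl(2)] W(2,4) rr.hom_zero by auto
   then show False using g\<xi>(2) b\<xi> g.hom_zero by simp
  qed
  obtain d where d: "d \<in> carrier (stalk X x)" "germ X x N A = germ X x N D \<otimes>\<^bsub>stalk X x\<^esub> d"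
   using normal_domain_root[OF normal[OF xp] gx.hom_closed[OF cl(1)] gx.hom_closed[OF cl(2)] Dx
     gx.hom_closed[OF cl(3)] n eqx] by blast
  obtain N1 t where N1: "is_open X N1" "x \<in> N1" "t \<in> \<Gamma> X N1" "d = germ X x N1 t"
   using X.stalk_cases[OF d(1)] .
  define N2 where "N2 = N \<inter> N1"
  have N2: "is_open X N2" "x \<in> N2" "N2 \<subseteq> N" "N2 \<subseteq> N1" using N N1 unfolding N2_def by auto
  define t2 where "t2 = restr X N1 N2 t"
  define D2 where "D2 = restr X N N2 D"
  have t2: "t2 \<in> \<Gamma> X N2" "germ X x N2 t2 = d" and D2: "D2 \<in> \<Gamma> X N2" "germ X x N2 D2 = germ X x N D"
   unfolding t2_def D2_def N1(4)
   using X.restr_closed[OF N1(1) N2(1,4) N1(3)] X.germ_restr[OF N1(1,3) N2(1,2,4)]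
    X.restr_closed[OF N(1) N2(1,3) cl(2)] X.germ_restr[OF N(1) cl(2) N2(1,2,3)] by auto
  interpret SN2: cring "sections X N2" by (rule X.sections_cring[OF N2(1)])
  have "germ X x N A = germ X x N2 (D2 \<otimes>\<^bsub>sections X N2\<^esub> t2)"
   using d(2) X.mult_germ[OF N2(1,2) D2(1) t2(1)] t2(2) D2(2) by simp
  then obtain W where W: "is_open X W" "x \<in> W" "W \<subseteq> N" "W \<subseteq> N2"
   "restr X N W A = restr X N2 W (D2 \<otimes>\<^bsub>sections X N2\<^esub> t2)"
   by (rule X.germ_eqD[OF _ N2(1,2) SN2.m_closed[OF D2(1) t2(1)]]) blast
  have \<xi>W: "\<xi> \<in> W" "\<xi> \<in> N2" using X.generic[OF W(1)] W(2,4) by auto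
  have "c.to_stalk a = germ X \<xi> N2 (D2 \<otimes>\<^bsub>sections X N2\<^esub> t2)"
   using X.germ_restr[OF N(1) cl(1) W(1) \<xi>W(1) W(3)] g\<xi>(1) W(5)
    X.germ_restr[OF N2(1) SN2.m_closed[OF D2(1) t2(1)] W(1) \<xi>W(1) W(4)] by simp
  also have "\<dots> = c.to_stalk b \<otimes>\<^bsub>F\<^esub> germ X \<xi> N2 t2"
   using X.mult_germ[OF N2(1) \<xi>W(2) D2(1) t2(1)] X.germ_restr[OF N(1) cl(2) N2(1) \<xi>W(2) N2(3)] g\<xi>(2)
   unfolding D2_def by simp
  finally have "germ X \<xi> N2 t2 = \<alpha>"
   using L.m_lcancel[OF b\<xi> tc(2) \<alpha> X.germ_closed[OF N2(1) \<xi>W(2) t2(1)]] ab(4) by simp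
  then show ?thesis using N2 N(5) t2(1) by blast
 qed
 obtain \<tau> where \<tau>: "\<tau> \<in> \<Gamma> X V'" "germ X \<xi> V' \<tau> = \<alpha>"
  using X.section_of_generic_germ[OF V'(1) _ loc] V'(2) by blast
 interpret SV': ring "sections X V'" using X.sections_cring[OF V'(1)] by (rule cring.axioms(1))
 interpret SV: ring "sections B V" using B.sections_cring[OF V(1)] by (rule cring.axioms(1))
 interpret g: ring_hom_ring "sections X V'" "F" "germ X \<xi> V'" by (rule X.germ_ring_hom[OF V'])
 have "germ X \<xi> V' (\<tau> [^]\<^bsub>sections X V'\<^esub> n) = germ X \<xi> V' \<sigma>"
  using \<tau> root\<sigma> by (simp add: g.hom_nat_pow)
 then have \<tau>n: "\<tau> [^]\<^bsub>sections X V'\<^esub> n = \<sigma>"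
  using inj_onD[OF X.germ_generic_inj[OF V'(1)]] V'(2) \<tau>(1) \<sigma> by blast
 note bij = push[OF V(1), folded V'_def]
 obtain r where r: "r \<in> \<Gamma> B V" "sec_map f V r = \<tau>"
  using \<tau>(1) bij by (metis bij_betw_imp_surj_on imageE)
 interpret sf: ring_hom_ring "sections B V" "sections X V'" "sec_map f V"
  by (rule ring_hom_ringI2[OF SV.ring_axioms SV'.ring_axioms sec_hom[OF V(1), folded V'_def]])
 have "sec_map f V (r [^]\<^bsub>sections B V\<^esub> n) = sec_map f V s"
  using r \<tau>n by (simp add: sf.hom_nat_pow \<sigma>_def)
 then have rn: "r [^]\<^bsub>sections B V\<^esub> n = s"
  using inj_onD[OF bij_betw_imp_inj_on[OF bij]] r(1) V(3) by blast
 interpret gB: ring_hom_ring "sections B V" "stalk B \<eta>" "germ B \<eta> V" by (rule B.germ_ring_hom[OF V(1,2)])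
 have "c = germ B \<eta> V r [^]\<^bsub>stalk B \<eta>\<^esub> n" unfolding V(4) rn[symmetric] using gB.hom_nat_pow[OF r(1)] .
 then show ?thesis using B.germ_closed[OF V(1,2) r(1)] by blast
qed

end

section \<open>The points of the generic fibre\<close>

lemma (in field) field_iso:
 assumes h: "h \<in> ring_iso R S" and S: "ring S"
 shows "field S"
proof -
 interpret h: ring_hom_ring R S h
  by (rule ring_hom_ringI2[OF ring_axioms S]) (use h in \<open>simp add: ring_iso_def\<close>)
 have "S\<lparr>zero := h \<zero>\<rparr> = S" using h.hom_zero by simp
 then show ?thesis using ring_iso_imp_img_field[OF h] by simp
qed

lemma max_ideal_field:
 fixes F :: "'r ring"
 assumes "field F"
 shows "max_ideal F = {\<zero>\<^bsub>F\<^esub>}"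
proof -
 interpret field F by fact
 show ?thesis
  by (rule max_ideal_eqI[OF cring_axioms zeroideal]) (use one_not_zero one_closed field_Units in auto)
qed

lemma (in field) hom_zero_imp_zero:
 assumes S: "ring S" "\<one>\<^bsub>S\<^esub> \<noteq> \<zero>\<^bsub>S\<^esub>" and h: "h \<in> ring_hom R S" and a: "a \<in> carrier R" "h a = \<zero>\<^bsub>S\<^esub>"
 shows "a = \<zero>"
proof (rule ccontr)
 assume "a \<noteq> \<zero>"
 then have u: "a \<in> Units R" using field_Units a(1) by blast
 interpret S: ring S by (rule S(1))
 have "\<one>\<^bsub>S\<^esub> = h (a \<otimes> inv a)" using ring_hom_memE(4)[OF h] Units_r_inv[OF u] by simp
 also have "\<dots> = h a \<otimes>\<^bsub>S\<^esub> h (inv a)" by (rule ring_hom_memE(2)[OF h a(1) Units_inv_closed[OF u]])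
 also have "\<dots> = \<zero>\<^bsub>S\<^esub>"
  unfolding a(2) by (rule S.l_null[OF ring_hom_memE(1)[OF h Units_inv_closed[OF u]]])
 finally show False using S(2) by simp
qed

context dominant_map
begin

abbreviation K where "K \<equiv> stalk B \<eta>"
abbreviation Y where "Y \<equiv> Spec K"
abbreviation g where "g \<equiv> generic_inclusion B \<eta>"
abbreviation y0 where "y0 \<equiv> {\<zero>\<^bsub>K\<^esub>}"
abbreviation \<psi> where "\<psi> \<equiv> stalk_map Y B g y0"

sublocale K: field K by (rule B.stalk_field)
sublocale SK: integral_affine_scheme K
 by (intro integral_affine_scheme.intro affine_scheme.intro K.cring_axioms K.domain_axioms)
sublocale Y: ring_presheaf Y by (rule SK.Spec_presheaf)

lemma points_Y: "points Y = {y0}"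
 unfolding SK.points_Spec K.primeideal_zero by simp

lemma y0_Y: "y0 \<in> points Y"
 unfolding points_Y by simp

lemma open_Y: "is_open Y V \<Longrightarrow> y0 \<in> V \<Longrightarrow> V = points Y"
 using openin_subset[of "space_top Y" V] unfolding points_Y by blast

lemma const_section_germ_hom: "(\<lambda>a. germ Y y0 (points Y) (const_section K a)) \<in> ring_hom K (stalk Y y0)"
 using ring_hom_trans[OF SK.const_section_hom Y.germ_hom[OF _ y0_Y, unfolded SK.points_Spec]]
 unfolding comp_def SK.points_Spec[symmetric] by simp

lemma \<psi>_eq:
 assumes a: "a \<in> carrier K"
 shows "\<psi> a = germ Y y0 (points Y) (const_section K a)"
proof -
 obtain V0 s0 where V0: "is_open B V0" "\<eta> \<in> V0" "s0 \<in> \<Gamma> B V0" "a = germ B \<eta> V0 s0"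
  using B.stalk_cases[OF a] .
 have *: "germ Y y0 (preimage Y g V) (sec_map g V s) = germ Y y0 (points Y) (const_section K a)"
  if "(V, s) \<in> a" for V s
 proof -
  note V = B.germ_memD[OF \<open>(V, s) \<in> a\<close>[unfolded V0(4)] V0(1,3)]
  have "preimage Y g V = points Y" unfolding preimage_def generic_inclusion_def using V(2) by simp
  moreover have "sec_map g V s = const_section K a"
   unfolding generic_inclusion_def const_section_def using V(2,4) V0(4) by simp
  ultimately show ?thesis by simp
 qed
 have "(V0, s0) \<in> a" unfolding V0(4) by (rule B.germ_memI[OF V0(1-3)])
 then show ?thesis unfolding stalk_map_def by (intro the_equality) (use * in blast)+
qed

text \<open>
 The spectrum of \<open>K\<close> has one point, and its local ring is \<open>K\<close>.
\<close>
lemma \<psi>_iso: "\<psi> \<in> ring_iso K (stalk Y y0)"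
proof -
 have hom: "\<psi> \<in> ring_hom K (stalk Y y0)"
  by (rule K.ring_hom_restrict[OF const_section_germ_hom]) (simp add: \<psi>_eq)
 interpret O: ring "stalk Y y0" using Y.stalk_cring[OF y0_Y] by (rule cring.axioms(1))
 interpret \<psi>: ring_hom_ring K "stalk Y y0" \<psi> by (rule ring_hom_ringI2[OF K.ring_axioms O.ring_axioms hom])
 have oY: "is_open Y (points Y)" by simp
 interpret SY: ring "sections Y (points Y)" using Y.sections_cring[OF oY] by (rule cring.axioms(1))
 have "a = \<zero>\<^bsub>K\<^esub>" if a: "a \<in> carrier K" "\<psi> a = \<zero>\<^bsub>stalk Y y0\<^esub>" for a
 proof (rule SK.const_section_zero[OF a(1)])
  have c: "const_section K a \<in> \<Gamma> Y (points Y)"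
   using SK.const_section_closed[OF a(1)] SK.points_Spec by simp
  have "germ Y y0 (points Y) (const_section K a) = germ Y y0 (points Y) \<zero>\<^bsub>sections Y (points Y)\<^esub>"
   using a \<psi>_eq[OF a(1)] Y.zero_stalk[OF oY y0_Y] by simp
  then obtain W where W: "is_open Y W" "y0 \<in> W"
   "restr Y (points Y) W (const_section K a) = restr Y (points Y) W \<zero>\<^bsub>sections Y (points Y)\<^esub>"
   by (rule Y.germ_eqD[OF _ oY y0_Y SY.zero_closed]) blast
  then have "const_section K a = \<zero>\<^bsub>sections Y (points Y)\<^esub>"
   using open_Y[OF W(1,2)] Y.restr_id[OF oY c] Y.restr_id[OF oY SY.zero_closed] by simp
  then show "const_section K a = \<zero>\<^bsub>sections Y SK.primes\<^esub>" using SK.points_Spec by simp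
 qed
 then have "a_kernel K (stalk Y y0) \<psi> = {\<zero>\<^bsub>K\<^esub>}"
  unfolding a_kernel_def' using \<psi>.hom_zero by auto
 then have inj: "inj_on \<psi> (carrier K)" by (rule \<psi>.trivial_ker_imp_inj)
 have "b \<in> \<psi> ` carrier K" if b: "b \<in> carrier (stalk Y y0)" for b
 proof -
  obtain V s where V: "is_open Y V" "y0 \<in> V" "s \<in> \<Gamma> Y V" "b = germ Y y0 V s"
   using Y.stalk_cases[OF b] .
  have "s \<in> carrier (sections Y SK.primes)" using V(3) open_Y[OF V(1,2)] SK.points_Spec by simp
  then obtain a where a: "a \<in> carrier K" "s = const_section K a" using SK.global_section_const by blast
  then have "b = \<psi> a" using V(4) open_Y[OF V(1,2)] \<psi>_eq by simp
  then show ?thesis using a(1) by blast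
 qed
 then show ?thesis unfolding ring_iso_def bij_betw_def using hom inj \<psi>.hom_closed by auto
qed

lemma \<psi>_hom: "\<psi> \<in> ring_hom K (stalk Y y0)"
 using \<psi>_iso unfolding ring_iso_def by blast

lemma \<psi>_surj: "b \<in> carrier (stalk Y y0) \<Longrightarrow> \<exists>c\<in>carrier K. b = \<psi> c"
 using \<psi>_iso unfolding ring_iso_def bij_betw_def by blast

sublocale O: field "stalk Y y0"
 by (rule K.field_iso[OF \<psi>_iso cring.axioms(1)[OF Y.stalk_cring[OF y0_Y]]])

definition fib where "fib = {x \<in> points X. pt_map f x = \<eta>}"

abbreviation FP where "FP x \<equiv> fp_ring X Y B f g x y0"
abbreviation FC where "FC x \<equiv> fp_class X Y B f g x y0"
abbreviation \<Lambda> where "\<Lambda> x a \<equiv> FC x (frag_of (a, \<one>\<^bsub>stalk Y y0\<^esub>))"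

abbreviation val where "val x U a \<equiv> \<Lambda> x (germ X x U a)"

lemma \<xi>_fib: "\<xi> \<in> fib"
 unfolding fib_def using X.\<xi>_point f_\<xi> by simp

lemma tensor_data_fib:
 assumes "x \<in> fib"
 shows "tensor_data (stalk X x) (stalk Y y0) K (\<phi> x) \<psi>"
 using assms ring_hom_memE(1)[OF \<phi>_hom] ring_hom_memE(1)[OF \<psi>_hom] X.stalk_cring O.cring_axioms
 unfolding fib_def by (intro tensor_data.intro two_rings.intro tensor_data_axioms.intro) auto

lemma FP_eq: "x \<in> fib \<Longrightarrow> FP x = tensor_ring K (stalk X x) (\<phi> x) (stalk Y y0) \<psi>"
 and FC_eq: "x \<in> fib \<Longrightarrow> FC x = tensor_class K (stalk X x) (\<phi> x) (stalk Y y0) \<psi>"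
 unfolding fib_def fp_ring_def fp_class_def by auto

context
 fixes x assumes x: "x \<in> fib"
begin

interpretation TD: tensor_data "stalk X x" "stalk Y y0" K "\<phi> x" \<psi>
 by (rule tensor_data_fib[OF x])

lemma FP_cring: "cring (FP x)"
 unfolding FP_eq[OF x] by (rule TD.M.cring_axioms)

lemma \<Lambda>_hom: "\<Lambda> x \<in> ring_hom (stalk X x) (FP x)"
 unfolding FP_eq[OF x] FC_eq[OF x] by (rule TD.left_hom)

lemma FC_diff:
 assumes "s \<in> carrier (free_product_ring (stalk X x) (stalk Y y0))" "t \<in> carrier (free_product_ring (stalk X x) (stalk Y y0))"
 shows "FC x (s - t) = FC x s \<ominus>\<^bsub>FP x\<^esub> FC x t"
 unfolding FP_eq[OF x] FC_eq[OF x] by (rule TD.cls_diff[OF assms])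

lemma FC_zero: "FC x 0 = \<zero>\<^bsub>FP x\<^esub>"
 unfolding FP_eq[OF x] FC_eq[OF x] using TD.cls.hom_zero by (simp add: TD.zero_F)

lemma tens_\<psi>:
 assumes a: "a \<in> carrier (stalk X x)" and c: "c \<in> carrier K"
 shows "FC x (frag_of (a, \<psi> c)) = \<Lambda> x (\<phi> x c \<otimes>\<^bsub>stalk X x\<^esub> a)"
 unfolding FC_eq[OF x] using TD.tens_balanced[OF c a O.one_closed] ring_hom_memE(1)[OF \<psi>_hom c] by simp

lemma \<phi>_closed: "c \<in> carrier K \<Longrightarrow> \<phi> x c \<in> carrier (stalk X x)"
 by (rule TD.\<phi>_closed)

text \<open>
 The second factor of the tensor product is \<open>K\<close>, and scalars can be moved to the first factor.
\<close>
lemma \<Lambda>_surj: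
 assumes "v \<in> carrier (FP x)"
 shows "\<exists>a\<in>carrier (stalk X x). v = \<Lambda> x a"
proof -
 interpret FP: ring "FP x" using FP_cring by (rule cring.axioms(1))
 interpret \<Lambda>: ring_hom_ring "stalk X x" "FP x" "\<Lambda> x"
  by (rule ring_hom_ringI2[OF TD.A.ring_axioms FP.ring_axioms \<Lambda>_hom])
 have "\<Lambda> x ` carrier (stalk X x) = carrier TD.M"
 proof (rule TD.M_in_subring)
  show "subring (\<Lambda> x ` carrier (stalk X x)) TD.M"
   using \<Lambda>.img_is_subring[OF TD.A.carrier_is_subring] FP_eq[OF x] by simp
  fix a b assume a: "a \<in> carrier (stalk X x)" and b: "b \<in> carrier (stalk Y y0)"
  obtain c where c: "c \<in> carrier K" "b = \<psi> c" using \<psi>_surj[OF b] by blast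
  have "TD.tens a b = \<Lambda> x (\<phi> x c \<otimes>\<^bsub>stalk X x\<^esub> a)" using tens_\<psi>[OF a c(1)] c(2) FC_eq[OF x] by simp
  then show "TD.tens a b \<in> \<Lambda> x ` carrier (stalk X x)" using \<phi>_closed[OF c(1)] a by blast
 qed
 then show ?thesis using assms FP_eq[OF x] by auto
qed

lemma right_FC_hom: "(\<lambda>b. FC x (frag_of (\<one>\<^bsub>stalk X x\<^esub>, b))) \<in> ring_hom (stalk Y y0) (FP x)"
 unfolding FP_eq[OF x] FC_eq[OF x] by (rule TD.right_hom)

end

sublocale L: field "F" by (rule X.stalk_field)

text \<open>
 The tensor product maps to the function field of \<open>X\<close>.
\<close>
lemma FP_\<xi>_nontrivial: "\<one>\<^bsub>FP \<xi>\<^esub> \<noteq> \<zero>\<^bsub>FP \<xi>\<^esub>"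
proof -
 interpret TD: tensor_data "F" "stalk Y y0" K "\<phi> \<xi>" \<psi>
  by (rule tensor_data_fib[OF \<xi>_fib])
 have inv: "inv_into (carrier K) \<psi> \<in> ring_hom (stalk Y y0) K"
  using ring_iso_set_sym[OF K.ring_axioms \<psi>_iso] unfolding ring_iso_def by blast
 have \<phi>: "\<phi> \<xi> \<in> ring_hom K F" by (rule \<phi>_hom[OF X.\<xi>_point f_\<xi>])
 have "inv_into (carrier K) \<psi> (\<psi> c) = c" if "c \<in> carrier K" for c
  using \<psi>_iso that unfolding ring_iso_def bij_betw_def by simp
 then have "\<one>\<^bsub>TD.M\<^esub> \<noteq> \<zero>\<^bsub>TD.M\<^esub>"
  using TD.nontrivial[OF L.cring_axioms L.one_not_zero _ ring_hom_trans[OF inv \<phi>], of "\<lambda>a. a"]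
  by (auto simp: ring_hom_def)
 then show ?thesis using FP_eq[OF \<xi>_fib] by simp
qed

lemma \<Lambda>_\<xi>_zero: "a \<in> carrier F \<Longrightarrow> \<Lambda> \<xi> a = \<zero>\<^bsub>FP \<xi>\<^esub> \<Longrightarrow> a = \<zero>\<^bsub>F\<^esub>"
 by (rule L.hom_zero_imp_zero[OF cring.axioms(1)[OF FP_cring[OF \<xi>_fib]] FP_\<xi>_nontrivial \<Lambda>_hom[OF \<xi>_fib]])

lemma \<Lambda>_\<xi>_iso: "\<Lambda> \<xi> \<in> ring_iso F (FP \<xi>)"
proof -
 interpret FP: ring "FP \<xi>" using FP_cring[OF \<xi>_fib] by (rule cring.axioms(1))
 interpret \<Lambda>: ring_hom_ring "F" "FP \<xi>" "\<Lambda> \<xi>"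
  by (rule ring_hom_ringI2[OF L.ring_axioms FP.ring_axioms \<Lambda>_hom[OF \<xi>_fib]])
 have "a_kernel F (FP \<xi>) (\<Lambda> \<xi>) = {\<zero>\<^bsub>F\<^esub>}"
  unfolding a_kernel_def' using \<Lambda>_\<xi>_zero \<Lambda>.hom_zero by auto
 then have "inj_on (\<Lambda> \<xi>) (carrier F)" by (rule \<Lambda>.trivial_ker_imp_inj)
 moreover have "\<Lambda> \<xi> ` carrier F = carrier (FP \<xi>)"
  using \<Lambda>.hom_closed \<Lambda>_surj[OF \<xi>_fib] by blast
 ultimately show ?thesis unfolding ring_iso_def bij_betw_def using \<Lambda>_hom[OF \<xi>_fib] by blast
qed

sublocale FP: field "FP \<xi>"
 by (rule L.field_iso[OF \<Lambda>_\<xi>_iso cring.axioms(1)[OF FP_cring[OF \<xi>_fib]]])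

abbreviation pts where "pts \<equiv> fp_points X Y B f g"

definition z0 where "z0 = (\<xi>, y0, {\<zero>\<^bsub>FP \<xi>\<^esub>})"

lemma pts_cases:
 assumes "z \<in> pts"
 obtains x P where "z = (x, y0, P)" "x \<in> fib" "primeideal P (FP x)"
proof -
 obtain x y P where z: "z = (x, y, P)" using prod_cases3 by blast
 then have m: "x \<in> points X" "y \<in> points Y" "pt_map f x = pt_map g y" "primeideal P (fp_ring X Y B f g x y)"
  using assms unfolding fp_points_def by auto
 have "y = y0" using m(2) points_Y by blast
 moreover have "pt_map g y = \<eta>" unfolding generic_inclusion_def by simp
 moreover have "x \<in> fib" unfolding fib_def using m(1,3) \<open>pt_map g y = \<eta>\<close> by simp
 ultimately show thesis using that[of x P] z m(4) by simp
qed

lemma pts_memD: "(x, y, P) \<in> pts \<Longrightarrow> y = y0 \<and> x \<in> fib \<and> primeideal P (FP x)"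
 using pts_cases by blast

lemma z0_pts: "z0 \<in> pts"
proof -
 have 1: "{a \<in> carrier F. \<Lambda> \<xi> a \<in> {\<zero>\<^bsub>FP \<xi>\<^esub>}} = {\<zero>\<^bsub>F\<^esub>}"
  using \<Lambda>_\<xi>_zero ring_hom_zero[OF \<Lambda>_hom[OF \<xi>_fib] L.ring_axioms FP.ring_axioms] by auto
 have 2: "{b \<in> carrier (stalk Y y0). FC \<xi> (frag_of (\<one>\<^bsub>F\<^esub>, b)) \<in> {\<zero>\<^bsub>FP \<xi>\<^esub>}} = {\<zero>\<^bsub>stalk Y y0\<^esub>}"
  using O.hom_zero_imp_zero[OF FP.ring_axioms FP_\<xi>_nontrivial right_FC_hom[OF \<xi>_fib]]
   ring_hom_zero[OF right_FC_hom[OF \<xi>_fib] O.ring_axioms FP.ring_axioms] by auto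
 show ?thesis unfolding fp_points_def z0_def mem_Collect_eq case_prod_conv
 proof (intro conjI)
  show "\<xi> \<in> points X" "y0 \<in> points Y" using X.\<xi>_point y0_Y by auto
  show "pt_map f \<xi> = pt_map g y0" using f_\<xi> unfolding generic_inclusion_def by simp
  show "primeideal {\<zero>\<^bsub>FP \<xi>\<^esub>} (FP \<xi>)" by (rule FP.zeroprimeideal)
  show "{a \<in> carrier F. \<Lambda> \<xi> a \<in> {\<zero>\<^bsub>FP \<xi>\<^esub>}} = max_ideal F"
   unfolding max_ideal_field[OF L.field_axioms] by (rule 1)
  show "{b \<in> carrier (stalk Y y0). FC \<xi> (frag_of (\<one>\<^bsub>F\<^esub>, b)) \<in> {\<zero>\<^bsub>FP \<xi>\<^esub>}} = max_ideal (stalk Y y0)"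
   unfolding max_ideal_field[OF O.field_axioms] by (rule 2)
 qed
qed

text \<open>
 Each element of \<open>\<kappa>(\<eta>)\<close> is the germ of a function near \<open>\<eta>\<close>. Hence a formal sum of pairs of sections
 is, on the fibre, given by a single section of \<open>X\<close>.
\<close>
lemma fp_germ_section:
 assumes U: "is_open X U" and V: "is_open Y V" "y0 \<in> V"
  and t: "t \<in> carrier (free_product_ring (sections X U) (sections Y V))"
 shows "\<exists>U' \<alpha>. is_open X U' \<and> U' \<subseteq> U \<and> \<alpha> \<in> \<Gamma> X U' \<and>
  (\<forall>x\<in>U \<inter> fib. x \<in> U' \<and> fp_germ X Y B f g U V t x y0 = val x U' \<alpha>)"
proof -
 interpret SU: cring "sections X U" by (rule X.sections_cring[OF U])
 interpret SV: cring "sections Y V" by (rule Y.sections_cring[OF V(1)])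
 interpret two: two_rings "sections X U" "sections Y V"
  by (intro two_rings.intro SU.cring_axioms SV.cring_axioms)
 let ?ext = "\<lambda>x t. frag_extend (\<lambda>(u, v). frag_of (germ X x U u, germ Y y0 V v)) t"
 have ext_closed: "?ext x s \<in> carrier (free_product_ring (stalk X x) (stalk Y y0))"
  if "x \<in> U \<inter> fib" "s \<in> carrier (free_product_ring (sections X U) (sections Y V))" for x s
 proof -
  interpret TD: tensor_data "stalk X x" "stalk Y y0" K "\<phi> x" \<psi> by (rule tensor_data_fib) (use that in blast)
  show ?thesis using that(2)
  proof (induction rule: two.F_induct)
   case (of a b)
   then show ?case using X.germ_closed[OF U _ of(1)] Y.germ_closed[OF V of(2)] that(1) by simp
  next
   case (diff s t)
   then show ?case by (simp add: frag_extend_diff)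
  qed simp
 qed
 show ?thesis using t
 proof (induction rule: two.F_induct)
  case zero
  have "fp_germ X Y B f g U V 0 x y0 = \<Lambda> x (germ X x U \<zero>\<^bsub>sections X U\<^esub>)" if x: "x \<in> U \<inter> fib" for x
   using that FC_zero[of x] ring_hom_zero[OF \<Lambda>_hom[of x] cring.axioms(1)[OF X.stalk_cring[of x]] cring.axioms(1)[OF FP_cring[of x]]]
    X.zero_stalk[OF U, of x] unfolding fp_germ_def fib_def by simp
  then show ?case using U SU.zero_closed by blast
 next
  case (of u v)
  have v: "v \<in> carrier (sections Y SK.primes)" using of(2) open_Y[OF V] SK.points_Spec by simp
  then obtain c where c: "c \<in> carrier K" "v = const_section K c" using SK.global_section_const by blast
  obtain W s where W: "is_open B W" "\<eta> \<in> W" "s \<in> \<Gamma> B W" "c = germ B \<eta> W s"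
   using B.stalk_cases[OF c(1)] .
  define U' where "U' = U \<inter> preimage X f W"
  have o: "is_open X U'" "U' \<subseteq> U" "U' \<subseteq> preimage X f W"
   using U open_preimage[OF W(1)] unfolding U'_def by auto
  define s' where "s' = restr X (preimage X f W) U' (sec_map f W s)"
  define u' where "u' = restr X U U' u"
  have cl: "s' \<in> \<Gamma> X U'" "u' \<in> \<Gamma> X U'"
   unfolding s'_def u'_def using X.restr_closed[OF open_preimage[OF W(1)] o(1,3) sec_closed[OF W(1,3)]]
    X.restr_closed[OF U o(1,2) of(1)] by auto
  interpret SU': cring "sections X U'" by (rule X.sections_cring[OF o(1)])
  have "x \<in> U' \<and> fp_germ X Y B f g U V (frag_of (u, v)) x y0 = val x U' (s' \<otimes>\<^bsub>sections X U'\<^esub> u')"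
   if x: "x \<in> U \<inter> fib" for x
  proof
   have xx: "x \<in> fib" "x \<in> points X" "pt_map f x = \<eta>" "x \<in> U" using x unfolding fib_def by auto
   show xU': "x \<in> U'" unfolding U'_def preimage_def using xx W(2) by simp
   have "\<phi> x c = germ X x U' s'"
    unfolding W(4) s'_def using stalk_map_germ[OF xx(2) W(1) _ W(3)] xx(3) W(2)
     X.germ_restr[OF open_preimage[OF W(1)] sec_closed[OF W(1,3)] o(1) xU' o(3)] by simp
   moreover have "germ X x U u = germ X x U' u'"
    unfolding u'_def using X.germ_restr[OF U of(1) o(1) xU' o(2)] by simp
   moreover have "germ Y y0 V v = \<psi> c" using c open_Y[OF V] \<psi>_eq by simp
   ultimately show "fp_germ X Y B f g U V (frag_of (u, v)) x y0 = val x U' (s' \<otimes>\<^bsub>sections X U'\<^esub> u')"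
    unfolding fp_germ_def using tens_\<psi>[OF xx(1) X.germ_closed[OF U xx(4) of(1)] c(1)]
     X.mult_germ[OF o(1) xU' cl] by simp
  qed
  then show ?case using o SU'.m_closed[OF cl] by blast
 next
  case (diff s t)
  obtain U1 \<alpha>1 where 1: "is_open X U1" "U1 \<subseteq> U" "\<alpha>1 \<in> \<Gamma> X U1"
   "\<And>x. x \<in> U \<inter> fib \<Longrightarrow> x \<in> U1 \<and> fp_germ X Y B f g U V s x y0 = val x U1 \<alpha>1"
   using diff.IH(1) by blast
  obtain U2 \<alpha>2 where 2: "is_open X U2" "U2 \<subseteq> U" "\<alpha>2 \<in> \<Gamma> X U2"
   "\<And>x. x \<in> U \<inter> fib \<Longrightarrow> x \<in> U2 \<and> fp_germ X Y B f g U V t x y0 = val x U2 \<alpha>2"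
   using diff.IH(2) by blast
  define U' where "U' = U1 \<inter> U2"
  have o: "is_open X U'" "U' \<subseteq> U1" "U' \<subseteq> U2" "U' \<subseteq> U" using 1 2 unfolding U'_def by auto
  define \<beta>1 where "\<beta>1 = restr X U1 U' \<alpha>1"
  define \<beta>2 where "\<beta>2 = restr X U2 U' \<alpha>2"
  have cl: "\<beta>1 \<in> \<Gamma> X U'" "\<beta>2 \<in> \<Gamma> X U'"
   unfolding \<beta>1_def \<beta>2_def using X.restr_closed[OF 1(1) o(1,2) 1(3)] X.restr_closed[OF 2(1) o(1,3) 2(3)] by auto
  interpret SU': cring "sections X U'" by (rule X.sections_cring[OF o(1)])
  have "x \<in> U' \<and> fp_germ X Y B f g U V (s - t) x y0 = val x U' (\<beta>1 \<ominus>\<^bsub>sections X U'\<^esub> \<beta>2)"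
   if x: "x \<in> U \<inter> fib" for x
  proof
   have xx: "x \<in> fib" using x by blast
   show xU': "x \<in> U'" unfolding U'_def using 1(4)[OF x] 2(4)[OF x] by simp
   interpret A: cring "stalk X x" using X.stalk_cring xx unfolding fib_def by blast
   interpret F: cring "FP x" by (rule FP_cring[OF xx])
   interpret \<Lambda>: ring_hom_ring "stalk X x" "FP x" "\<Lambda> x"
    by (rule ring_hom_ringI2[OF A.ring_axioms F.ring_axioms \<Lambda>_hom[OF xx]])
   interpret gx: ring_hom_ring "sections X U'" "stalk X x" "germ X x U'" by (rule X.germ_ring_hom[OF o(1) xU'])
   have "fp_germ X Y B f g U V (s - t) x y0 =
     fp_germ X Y B f g U V s x y0 \<ominus>\<^bsub>FP x\<^esub> fp_germ X Y B f g U V t x y0"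
    unfolding fp_germ_def frag_extend_diff by (rule FC_diff[OF xx ext_closed[OF x diff(1)] ext_closed[OF x diff(2)]])
   also have "\<dots> = val x U' \<beta>1 \<ominus>\<^bsub>FP x\<^esub> val x U' \<beta>2"
    unfolding \<beta>1_def \<beta>2_def using 1(4)[OF x] 2(4)[OF x] X.germ_restr[OF 1(1,3) o(1) xU' o(2)]
     X.germ_restr[OF 2(1,3) o(1) xU' o(3)] by simp
   also have "\<dots> = val x U' (\<beta>1 \<ominus>\<^bsub>sections X U'\<^esub> \<beta>2)"
    using cl by (simp add: a_minus_def)
   finally show "fp_germ X Y B f g U V (s - t) x y0 = val x U' (\<beta>1 \<ominus>\<^bsub>sections X U'\<^esub> \<beta>2)" .
  qed
  then show ?case using o SU'.minus_closed[OF cl] by blast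
 qed
qed

abbreviation fibre_top where "fibre_top \<equiv> fp_topology X Y B f g"

lemma \<Lambda>_germ_prime_one:
 assumes "(x, y0, P) \<in> pts"
 shows "\<Lambda> x \<one>\<^bsub>stalk X x\<^esub> = \<one>\<^bsub>FP x\<^esub>" "\<one>\<^bsub>FP x\<^esub> \<notin> P" "\<zero>\<^bsub>FP x\<^esub> \<in> P" "\<Lambda> x \<zero>\<^bsub>stalk X x\<^esub> = \<zero>\<^bsub>FP x\<^esub>"
proof -
 have x: "x \<in> fib" "primeideal P (FP x)" using pts_memD[OF assms] by auto
 interpret P: primeideal P "FP x" by (rule x(2))
 show "\<Lambda> x \<one>\<^bsub>stalk X x\<^esub> = \<one>\<^bsub>FP x\<^esub>" by (rule ring_hom_memE(4)[OF \<Lambda>_hom[OF x(1)]])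
 show "\<one>\<^bsub>FP x\<^esub> \<notin> P" using P.one_imp_carrier P.I_notcarr by auto
 show "\<zero>\<^bsub>FP x\<^esub> \<in> P" by simp
 show "\<Lambda> x \<zero>\<^bsub>stalk X x\<^esub> = \<zero>\<^bsub>FP x\<^esub>"
  using ring_hom_zero[OF \<Lambda>_hom[OF x(1)] cring.axioms(1)[OF X.stalk_cring] P.ring_axioms] x(1) unfolding fib_def by simp
qed

text \<open>
 The basic open subsets of the generic fibre that are given by a section of \<open>X\<close>.
\<close>
definition locus where
 "locus U \<beta> = {z \<in> pts. fst z \<in> U \<and> val (fst z) U \<beta> \<notin> snd (snd z)}"

lemma locus_open:
 assumes U: "is_open X U" and \<beta>: "\<beta> \<in> \<Gamma> X U"
 shows "openin fibre_top (locus U \<beta>)"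
proof -
 have oY: "is_open Y (points Y)" by simp
 interpret SY: cring "sections Y (points Y)" by (rule Y.sections_cring[OF oY])
 interpret SU: cring "sections X U" by (rule X.sections_cring[OF U])
 interpret two: two_rings "sections X U" "sections Y (points Y)"
  by (intro two_rings.intro SU.cring_axioms SY.cring_axioms)
 let ?t = "frag_of (\<beta>, \<one>\<^bsub>sections Y (points Y)\<^esub>)"
 have t: "?t \<in> carrier (free_product_ring (sections X U) (sections Y (points Y)))"
  using \<beta> SY.one_closed by simp
 have "fp_germ X Y B f g U (points Y) ?t x y0 = val x U \<beta>" for x
  unfolding fp_germ_def using Y.one_stalk[OF oY y0_Y] by simp
 then have "locus U \<beta> = {(x, y, P) \<in> pts. x \<in> U \<and> y \<in> points Y \<and> fp_germ X Y B f g U (points Y) ?t x y \<notin> P}"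
  unfolding locus_def using pts_memD y0_Y by fastforce
 then show ?thesis unfolding fp_topology_def using U oY t by (intro topology_generated_by_Basis) blast
qed

lemma locus_one:
 assumes U: "is_open X U"
 shows "locus U \<one>\<^bsub>sections X U\<^esub> = {z \<in> pts. fst z \<in> U}"
proof -
 have "\<Lambda> (fst z) (germ X (fst z) U \<one>\<^bsub>sections X U\<^esub>) \<notin> snd (snd z)" if z: "z \<in> pts" "fst z \<in> U" for z
 proof -
  obtain x P where x: "z = (x, y0, P)" by (rule pts_cases[OF z(1)])
  have xP: "(x, y0, P) \<in> pts" "x \<in> U" using z unfolding x by auto
  show ?thesis
   unfolding x fst_conv snd_conv X.one_stalk[OF U xP(2), symmetric] \<Lambda>_germ_prime_one(1)[OF xP(1)]
   by (rule \<Lambda>_germ_prime_one(2)[OF xP(1)])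
 qed
 then show ?thesis unfolding locus_def by blast
qed

lemma topspace_fibre: "topspace fibre_top = pts"
proof
 show "topspace fibre_top \<subseteq> pts" unfolding fp_topology_def topology_generated_by_topspace by blast
 have o: "is_open X (points X)" by simp
 have "pts = locus (points X) \<one>\<^bsub>sections X (points X)\<^esub>"
  unfolding locus_one[OF o] using pts_memD unfolding fib_def by fastforce
 then show "pts \<subseteq> topspace fibre_top"
  using openin_subset[OF locus_open[OF o ring.ring_simprules(6)[OF cring.axioms(1)[OF X.sections_cring[OF o]]]]] by simp
qed

text \<open>
 If \<open>\<beta>\<close> did not survive at \<open>\<xi>\<close>, then it would vanish, because its germ at \<open>\<xi>\<close> would.
\<close>
lemma locus_z0:
 assumes U: "is_open X U" and \<beta>: "\<beta> \<in> \<Gamma> X U" and ne: "locus U \<beta> \<noteq> {}"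
 shows "z0 \<in> locus U \<beta>"
proof -
 obtain z where "z \<in> locus U \<beta>" using ne by blast
 then have z': "z \<in> pts" "fst z \<in> U" "val (fst z) U \<beta> \<notin> snd (snd z)"
  unfolding locus_def by auto
 obtain x P where x: "z = (x, y0, P)" by (rule pts_cases[OF z'(1)])
 have z: "(x, y0, P) \<in> pts" "x \<in> U" "val x U \<beta> \<notin> P"
  using z' unfolding x fst_conv snd_conv .
 have "\<beta> \<noteq> \<zero>\<^bsub>sections X U\<^esub>" using z(3) \<Lambda>_germ_prime_one(3,4)[OF z(1)] X.zero_stalk[OF U z(2)] by auto
 then have "germ X \<xi> U \<beta> \<noteq> \<zero>\<^bsub>F\<^esub>" using X.germ_generic_zero[OF U _ \<beta>] z(2) by blast
 moreover have \<xi>: "\<xi> \<in> U" using X.generic[OF U] z(2) by blast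
 ultimately have "val \<xi> U \<beta> \<noteq> \<zero>\<^bsub>FP \<xi>\<^esub>" using \<Lambda>_\<xi>_zero[OF X.germ_closed[OF U \<xi> \<beta>]] by blast
 then show ?thesis unfolding locus_def using z0_pts \<xi> by (simp add: z0_def)
qed

lemma fibre_open_z0:
 assumes "openin fibre_top W" "W \<noteq> {}"
 shows "z0 \<in> W" using assms unfolding fp_topology_def openin_topology_generated_by_iff
proof (induction rule: generate_topology_on.induct)
 case (Int a b)
 then show ?case by blast
next
 case (Basis W)
 then obtain U V t where W: "W = {(x, y, P) \<in> pts. x \<in> U \<and> y \<in> V \<and> fp_germ X Y B f g U V t x y \<notin> P}"
  and U: "is_open X U" "is_open Y V" and t: "t \<in> carrier (free_product_ring (sections X U) (sections Y V))" by blast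
 obtain x P where z: "(x, y0, P) \<in> pts" "x \<in> U" "y0 \<in> V" "fp_germ X Y B f g U V t x y0 \<notin> P"
  using Basis(2) pts_memD unfolding W by blast
 obtain U' \<alpha> where U': "is_open X U'" "U' \<subseteq> U" "\<alpha> \<in> \<Gamma> X U'"
  "\<forall>x\<in>U \<inter> fib. x \<in> U' \<and> fp_germ X Y B f g U V t x y0 = val x U' \<alpha>"
  using fp_germ_section[OF U z(3) t] by blast
 have "x \<in> U \<inter> fib" using z pts_memD by blast
 then have "(x, y0, P) \<in> locus U' \<alpha>" unfolding locus_def using z U'(4) by simp
 then have "z0 \<in> locus U' \<alpha>" using locus_z0[OF U'(1,3)] by blast
 then show ?case unfolding W locus_def using U'(2,4) \<xi>_fib z(3) by (auto simp: z0_def)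
qed auto

lemma generic_pt_fibre: "generic_pt (generic_fibre X B f \<eta>) = z0"
proof -
 have top: "space_top (generic_fibre X B f \<eta>) = fibre_top" by (simp add: fibre_product_def function_space_def)
 show ?thesis unfolding generic_pt_def top is_generic_point_iff topspace_fibre
 proof (rule the_equality)
  show "z0 \<in> pts \<and> (\<forall>U. openin fibre_top U \<and> U \<noteq> {} \<longrightarrow> z0 \<in> U)" using z0_pts fibre_open_z0 by blast
  fix z assume z: "z \<in> pts \<and> (\<forall>U. openin fibre_top U \<and> U \<noteq> {} \<longrightarrow> z \<in> U)"
  then obtain x P where x: "z = (x, y0, P)" "x \<in> fib" "primeideal P (FP x)" using pts_cases by blast
  have "x \<in> U" if U: "is_open X U" "U \<noteq> {}" for U
  proof -
   have "z0 \<in> locus U \<one>\<^bsub>sections X U\<^esub>"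
    unfolding locus_one[OF U(1)] using z0_pts X.generic[OF U] by (simp add: z0_def)
   then have "z \<in> locus U \<one>\<^bsub>sections X U\<^esub>"
    using z locus_open[OF U(1) ring.ring_simprules(6)[OF cring.axioms(1)[OF X.sections_cring[OF U(1)]]]] by blast
   then show ?thesis unfolding locus_def x(1) by simp
  qed
  then have "x = \<xi>" using X.generic_unique x(2) unfolding fib_def by blast
  then show "z = z0" using x FP.primeideal_zero unfolding z0_def by blast
 qed
qed

end

section \<open>The local ring at the generic point of the generic fibre\<close>

lemma function_space_cong:
 assumes "\<And>V s. openin T V \<Longrightarrow> adm V s \<longleftrightarrow> adm' V s"
 shows "function_space T R adm = function_space T R adm'"
proof -
 have "(\<exists>V. openin T V \<and> x \<in> V \<and> V \<subseteq> U \<and> adm V s) \<longleftrightarrow> (\<exists>V. openin T V \<and> x \<in> V \<and> V \<subseteq> U \<and> adm' V s)" for x U s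
  using assms by blast
 then show ?thesis unfolding function_space_def by simp
qed

context dominant_map
begin

abbreviation gf where "gf \<equiv> generic_fibre X B f \<eta>"
abbreviation loc_ring where
 "loc_ring \<equiv> (\<lambda>(x, y, P). localization (fp_ring X Y B f g x y) (carrier (fp_ring X Y B f g x y) - P))"
abbreviation fr where "fr x P \<equiv> fraction (FP x) (carrier (FP x) - P)"

text \<open>
 By \<open>fp_germ_section\<close>, the sections of the generic fibre are locally fractions of sections of \<open>X\<close>.
\<close>
definition fib_adm where
 "fib_adm W s \<longleftrightarrow> (\<exists>U \<alpha> \<beta>. is_open X U \<and> \<alpha> \<in> \<Gamma> X U \<and> \<beta> \<in> \<Gamma> X U \<and>
   (\<forall>x P. (x, y0, P) \<in> W \<longrightarrow> x \<in> U \<and> val x U \<beta> \<notin> P \<and>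
    s (x, y0, P) = fr x P (val x U \<alpha>) (val x U \<beta>)))"

lemma fib_admI:
 assumes "is_open X U" "\<alpha> \<in> \<Gamma> X U" "\<beta> \<in> \<Gamma> X U"
  and "\<And>x P. (x, y0, P) \<in> W \<Longrightarrow> x \<in> U \<and> val x U \<beta> \<notin> P \<and>
    s (x, y0, P) = fr x P (val x U \<alpha>) (val x U \<beta>)"
 shows "fib_adm W s"
 unfolding fib_adm_def using assms(4) by (intro exI[of _ U] exI[of _ \<alpha>] exI[of _ \<beta>] conjI assms(1-3)) blast

lemma fp_germ_of:
 "fp_germ X Y B f g U (points Y) (frag_of (\<beta>, \<one>\<^bsub>sections Y (points Y)\<^esub>)) x y0 = val x U \<beta>"
 unfolding fp_germ_def using Y.one_stalk[OF _ y0_Y] by simp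

lemma gf_eq: "gf = function_space fibre_top loc_ring fib_adm"
 unfolding fibre_product_def
proof (rule function_space_cong)
 fix W s assume W: "openin fibre_top W"
 have Wp: "W \<subseteq> pts" using openin_subset[OF W] topspace_fibre by simp
 have oY: "is_open Y (points Y)" by simp
 interpret SY: cring "sections Y (points Y)" by (rule Y.sections_cring[OF oY])
 let ?C = "\<lambda>U V a b (x, y, P). x \<in> U \<and> y \<in> V \<and> fp_germ X Y B f g U V b x y \<notin> P \<and>
      s (x, y, P) = fraction (fp_ring X Y B f g x y) (carrier (fp_ring X Y B f g x y) - P)
       (fp_germ X Y B f g U V a x y) (fp_germ X Y B f g U V b x y)"
 show "(\<exists>U V a b. is_open X U \<and> is_open Y V \<and> a \<in> carrier (free_product_ring (sections X U) (sections Y V)) \<and>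
    b \<in> carrier (free_product_ring (sections X U) (sections Y V)) \<and> (\<forall>z\<in>W. ?C U V a b z)) \<longleftrightarrow> fib_adm W s"
  (is "?L \<longleftrightarrow> _")
 proof
  assume ?L
  then obtain U V a b where U: "is_open X U" "is_open Y V" and
   ab: "a \<in> carrier (free_product_ring (sections X U) (sections Y V))"
   "b \<in> carrier (free_product_ring (sections X U) (sections Y V))" and C: "\<forall>z\<in>W. ?C U V a b z" by blast
  show "fib_adm W s"
  proof (cases "W = {}")
   case True
   have o: "is_open X (points X)" by simp
   interpret SX: cring "sections X (points X)" by (rule X.sections_cring[OF o])
   show ?thesis by (rule fib_admI[OF o SX.one_closed SX.one_closed]) (use True in auto)
  next
   case False
   then obtain z where z: "z \<in> W" by blast
   then obtain x0 P0 where "z = (x0, y0, P0)" using pts_cases Wp by blast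
   then have y0V: "y0 \<in> V" using C z by auto
   obtain U1 \<alpha> where 1: "is_open X U1" "U1 \<subseteq> U" "\<alpha> \<in> \<Gamma> X U1"
    "\<forall>x\<in>U \<inter> fib. x \<in> U1 \<and> fp_germ X Y B f g U V a x y0 = val x U1 \<alpha>"
    using fp_germ_section[OF U y0V ab(1)] by blast
   obtain U2 \<beta> where 2: "is_open X U2" "U2 \<subseteq> U" "\<beta> \<in> \<Gamma> X U2"
    "\<forall>x\<in>U \<inter> fib. x \<in> U2 \<and> fp_germ X Y B f g U V b x y0 = val x U2 \<beta>"
    using fp_germ_section[OF U y0V ab(2)] by blast
   have o: "is_open X (U1 \<inter> U2)" using 1 2 by blast
   show ?thesis
   proof (rule fib_admI[OF o X.restr_closed[OF 1(1) o Int_lower1 1(3)] X.restr_closed[OF 2(1) o Int_lower2 2(3)]])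
    fix x P assume xP: "(x, y0, P) \<in> W"
    have x: "x \<in> U \<inter> fib" using bspec[OF C xP] pts_memD Wp xP by auto
    have xi: "x \<in> U1 \<inter> U2" using 1(4) 2(4) x by blast
    show "x \<in> U1 \<inter> U2 \<and> \<Lambda> x (germ X x (U1 \<inter> U2) (restr X U2 (U1 \<inter> U2) \<beta>)) \<notin> P \<and>
      s (x, y0, P) = fr x P (\<Lambda> x (germ X x (U1 \<inter> U2) (restr X U1 (U1 \<inter> U2) \<alpha>)))
       (\<Lambda> x (germ X x (U1 \<inter> U2) (restr X U2 (U1 \<inter> U2) \<beta>)))"
     using bspec[OF C xP] bspec[OF 1(4) x] bspec[OF 2(4) x] xi
      X.germ_restr[OF 1(1,3) o xi Int_lower1] X.germ_restr[OF 2(1,3) o xi Int_lower2] by simp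
   qed
  qed
 next
  assume "fib_adm W s"
  then obtain U \<alpha> \<beta> where U: "is_open X U" "\<alpha> \<in> \<Gamma> X U" "\<beta> \<in> \<Gamma> X U"
   and s: "\<forall>x P. (x, y0, P) \<in> W \<longrightarrow> x \<in> U \<and> val x U \<beta> \<notin> P \<and>
    s (x, y0, P) = fr x P (val x U \<alpha>) (val x U \<beta>)" unfolding fib_adm_def by blast
  interpret SU: cring "sections X U" by (rule X.sections_cring[OF U(1)])
  interpret two: two_rings "sections X U" "sections Y (points Y)"
   by (intro two_rings.intro SU.cring_axioms SY.cring_axioms)
  have t: "frag_of (r, \<one>\<^bsub>sections Y (points Y)\<^esub>) \<in> carrier (free_product_ring (sections X U) (sections Y (points Y)))"
   if "r \<in> \<Gamma> X U" for r using that SY.one_closed by simp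
  have "?C U (points Y) (frag_of (\<alpha>, \<one>\<^bsub>sections Y (points Y)\<^esub>)) (frag_of (\<beta>, \<one>\<^bsub>sections Y (points Y)\<^esub>)) z"
   if z: "z \<in> W" for z
  proof -
   obtain x P where x: "z = (x, y0, P)" by (rule pts_cases[of z]) (use z Wp in blast)+
   have xP: "(x, y0, P) \<in> W" using z unfolding x .
   show ?thesis unfolding x case_prod_conv fp_germ_of using s[rule_format, OF xP] y0_Y by blast
  qed
  then show ?L using U(1) oY t[OF U(2)] t[OF U(3)] by blast
 qed
qed

lemma fib_mult_set:
 assumes "(x, y0, P) \<in> pts"
 shows "multiplicative_set (FP x) (carrier (FP x) - P)"
 by (rule affine_scheme.prime_multiplicative_set[OF affine_scheme.intro[OF FP_cring]]) (use pts_memD[OF assms] in auto)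

lemma section_to_FP_hom:
 assumes "x \<in> fib" "is_open X U" "x \<in> U"
 shows "(\<lambda>a. val x U a) \<in> ring_hom (sections X U) (FP x)"
 using ring_hom_trans[OF X.germ_hom[OF assms(2,3)] \<Lambda>_hom[OF assms(1)]] unfolding comp_def .

lemma fib_adm_common:
 assumes "fib_adm W s" "fib_adm W t" and W: "W \<subseteq> pts"
 obtains U \<alpha> \<beta> \<gamma> \<delta> where "is_open X U" "\<alpha> \<in> \<Gamma> X U" "\<beta> \<in> \<Gamma> X U"
  "\<gamma> \<in> \<Gamma> X U" "\<delta> \<in> \<Gamma> X U"
  "\<And>x P. (x, y0, P) \<in> W \<Longrightarrow> x \<in> U \<and> val x U \<beta> \<notin> P \<and> val x U \<delta> \<notin> P \<and>
    s (x, y0, P) = fr x P (val x U \<alpha>) (val x U \<beta>) \<and>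
    t (x, y0, P) = fr x P (val x U \<gamma>) (val x U \<delta>)"
proof -
 obtain U1 \<alpha> \<beta> where 1: "is_open X U1" "\<alpha> \<in> \<Gamma> X U1" "\<beta> \<in> \<Gamma> X U1"
  "\<And>x P. (x, y0, P) \<in> W \<Longrightarrow> x \<in> U1 \<and> val x U1 \<beta> \<notin> P \<and>
    s (x, y0, P) = fr x P (val x U1 \<alpha>) (val x U1 \<beta>)"
  using assms(1) unfolding fib_adm_def by blast
 obtain U2 \<gamma> \<delta> where 2: "is_open X U2" "\<gamma> \<in> \<Gamma> X U2" "\<delta> \<in> \<Gamma> X U2"
  "\<And>x P. (x, y0, P) \<in> W \<Longrightarrow> x \<in> U2 \<and> val x U2 \<delta> \<notin> P \<and>
    t (x, y0, P) = fr x P (val x U2 \<gamma>) (val x U2 \<delta>)"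
  using assms(2) unfolding fib_adm_def by blast
 have o: "is_open X (U1 \<inter> U2)" using 1(1) 2(1) by blast
 note c1 = X.restr_closed[OF 1(1) o Int_lower1] and c2 = X.restr_closed[OF 2(1) o Int_lower2]
 show thesis
 proof (rule that[OF o c1[OF 1(2)] c1[OF 1(3)] c2[OF 2(2)] c2[OF 2(3)]])
  fix x P assume xP: "(x, y0, P) \<in> W"
  have xi: "x \<in> U1 \<inter> U2" using 1(4)[OF xP] 2(4)[OF xP] by blast
  show "x \<in> U1 \<inter> U2 \<and> \<Lambda> x (germ X x (U1 \<inter> U2) (restr X U1 (U1 \<inter> U2) \<beta>)) \<notin> P \<and>
    \<Lambda> x (germ X x (U1 \<inter> U2) (restr X U2 (U1 \<inter> U2) \<delta>)) \<notin> P \<and>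
    s (x, y0, P) = fr x P (\<Lambda> x (germ X x (U1 \<inter> U2) (restr X U1 (U1 \<inter> U2) \<alpha>)))
     (\<Lambda> x (germ X x (U1 \<inter> U2) (restr X U1 (U1 \<inter> U2) \<beta>))) \<and>
    t (x, y0, P) = fr x P (\<Lambda> x (germ X x (U1 \<inter> U2) (restr X U2 (U1 \<inter> U2) \<gamma>)))
     (\<Lambda> x (germ X x (U1 \<inter> U2) (restr X U2 (U1 \<inter> U2) \<delta>)))"
   using 1(4)[OF xP] 2(4)[OF xP] xi X.germ_restr[OF 1(1,2) o xi Int_lower1] X.germ_restr[OF 1(1,3) o xi Int_lower1]
    X.germ_restr[OF 2(1,2) o xi Int_lower2] X.germ_restr[OF 2(1,3) o xi Int_lower2] by simp
 qed
qed

lemma fib_adm_ops: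
 assumes s: "fib_adm W s" and t: "fib_adm W t" and W: "W \<subseteq> pts"
 shows "fib_adm W (\<lambda>z. s z \<oplus>\<^bsub>loc_ring z\<^esub> t z)" "fib_adm W (\<lambda>z. s z \<otimes>\<^bsub>loc_ring z\<^esub> t z)"
  "fib_adm W (\<lambda>z. \<ominus>\<^bsub>loc_ring z\<^esub> s z)"
proof -
 obtain U \<alpha> \<beta> \<gamma> \<delta> where U: "is_open X U" and c: "\<alpha> \<in> \<Gamma> X U" "\<beta> \<in> \<Gamma> X U"
  "\<gamma> \<in> \<Gamma> X U" "\<delta> \<in> \<Gamma> X U" and
  st: "\<And>x P. (x, y0, P) \<in> W \<Longrightarrow> x \<in> U \<and> val x U \<beta> \<notin> P \<and> val x U \<delta> \<notin> P \<and>
    s (x, y0, P) = fr x P (val x U \<alpha>) (val x U \<beta>) \<and>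
    t (x, y0, P) = fr x P (val x U \<gamma>) (val x U \<delta>)"
  by (rule fib_adm_common[OF s t W]) blast
 interpret SU: cring "sections X U" by (rule X.sections_cring[OF U])
 define G where "G x a = val x U a" for x a
 have calc: "G x (\<beta> \<otimes>\<^bsub>sections X U\<^esub> \<delta>) \<notin> P \<and>
   s (x, y0, P) \<oplus>\<^bsub>localization (FP x) (carrier (FP x) - P)\<^esub> t (x, y0, P) =
    fr x P (G x (\<delta> \<otimes>\<^bsub>sections X U\<^esub> \<alpha> \<oplus>\<^bsub>sections X U\<^esub> \<beta> \<otimes>\<^bsub>sections X U\<^esub> \<gamma>)) (G x (\<beta> \<otimes>\<^bsub>sections X U\<^esub> \<delta>)) \<and>
   s (x, y0, P) \<otimes>\<^bsub>localization (FP x) (carrier (FP x) - P)\<^esub> t (x, y0, P) =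
    fr x P (G x (\<alpha> \<otimes>\<^bsub>sections X U\<^esub> \<gamma>)) (G x (\<beta> \<otimes>\<^bsub>sections X U\<^esub> \<delta>)) \<and>
   \<ominus>\<^bsub>localization (FP x) (carrier (FP x) - P)\<^esub> s (x, y0, P) =
    fr x P (G x (\<ominus>\<^bsub>sections X U\<^esub> \<alpha>)) (G x \<beta>)"
  if xP: "(x, y0, P) \<in> W" for x P
 proof -
  have p: "(x, y0, P) \<in> pts" "x \<in> fib" "primeideal P (FP x)" using W xP pts_memD by auto
  note v = st[OF xP, folded G_def]
  then have xU: "x \<in> U" by blast
  interpret F: cring "FP x" by (rule FP_cring[OF p(2)])
  interpret AF: affine_scheme "FP x" by (rule affine_scheme.intro[OF F.cring_axioms])
  interpret h: ring_hom_ring "sections X U" "FP x" "G x"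
   by (rule ring_hom_ringI2[OF SU.ring_axioms F.ring_axioms]) (use section_to_FP_hom[OF p(2) U xU] in \<open>simp add: G_def[abs_def]\<close>)
  interpret M: multiplicative_set "FP x" "carrier (FP x) - P" by (rule fib_mult_set[OF p(1)])
  have m: "G x \<beta> \<in> carrier (FP x) - P" "G x \<delta> \<in> carrier (FP x) - P" using v c by auto
  have "G x \<beta> \<otimes>\<^bsub>FP x\<^esub> G x \<delta> \<in> carrier (FP x) - P" by (rule M.mult_S[OF m])
  then show ?thesis using v c m M.add_frac[OF h.hom_closed[OF c(1)] m(1) h.hom_closed[OF c(3)] m(2)]
    M.mult_frac[OF h.hom_closed[OF c(1)] m(1) h.hom_closed[OF c(3)] m(2)]
    AF.minus_frac[OF M.multiplicative_set_axioms h.hom_closed[OF c(1)] m(1)] by simp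
 qed
 show "fib_adm W (\<lambda>z. s z \<oplus>\<^bsub>loc_ring z\<^esub> t z)"
  by (rule fib_admI[OF U _ SU.m_closed[OF c(2,4)], of "\<delta> \<otimes>\<^bsub>sections X U\<^esub> \<alpha> \<oplus>\<^bsub>sections X U\<^esub> \<beta> \<otimes>\<^bsub>sections X U\<^esub> \<gamma>"])
   (use c calc[unfolded G_def] st in auto)
 show "fib_adm W (\<lambda>z. s z \<otimes>\<^bsub>loc_ring z\<^esub> t z)"
  by (rule fib_admI[OF U SU.m_closed[OF c(1,3)] SU.m_closed[OF c(2,4)]]) (use calc[unfolded G_def] st in auto)
 show "fib_adm W (\<lambda>z. \<ominus>\<^bsub>loc_ring z\<^esub> s z)"
  by (rule fib_admI[OF U SU.a_inv_closed[OF c(1)] c(2)]) (use calc[unfolded G_def] st in auto)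
qed

lemma fib_function_presheaf: "function_presheaf fibre_top loc_ring fib_adm"
proof (rule function_presheaf.intro)
 have top: "V \<subseteq> pts" if "openin fibre_top V" for V using openin_subset[OF that] topspace_fibre by simp
 have all: "openin fibre_top pts" using openin_topspace[of fibre_top] unfolding topspace_fibre .
 have o: "is_open X (points X)" by simp
 interpret SX: cring "sections X (points X)" by (rule X.sections_cring[OF o])
 have const: "x \<in> points X \<and> \<Lambda> x (germ X x (points X) \<one>\<^bsub>sections X (points X)\<^esub>) = \<one>\<^bsub>FP x\<^esub> \<and>
   \<Lambda> x (germ X x (points X) \<zero>\<^bsub>sections X (points X)\<^esub>) = \<zero>\<^bsub>FP x\<^esub> \<and> \<one>\<^bsub>FP x\<^esub> \<notin> P"
  if "(x, y0, P) \<in> pts" for x P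
 proof -
  have "x \<in> points X" using pts_memD[OF that] unfolding fib_def by blast
  then show ?thesis using \<Lambda>_germ_prime_one[OF that] X.one_stalk[OF o] X.zero_stalk[OF o] by metis
 qed
 show "cring (loc_ring z)" if "z \<in> topspace fibre_top" for z
 proof -
  obtain x P where x: "z = (x, y0, P)" by (rule pts_cases[of z]) (use \<open>z \<in> topspace fibre_top\<close> topspace_fibre in auto)
  have "(x, y0, P) \<in> pts" using \<open>z \<in> topspace fibre_top\<close> unfolding x topspace_fibre .
  then show ?thesis unfolding x using multiplicative_set.Loc_cring[OF fib_mult_set] by simp
 qed
 show "fib_adm W s'" if a: "fib_adm V s" "W \<subseteq> V" "\<And>z. z \<in> W \<Longrightarrow> s' z = s z" for V W s s'
 proof -
  obtain U \<alpha> \<beta> where U: "is_open X U" "\<alpha> \<in> \<Gamma> X U" "\<beta> \<in> \<Gamma> X U"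
   and s: "\<forall>x P. (x, y0, P) \<in> V \<longrightarrow> x \<in> U \<and> val x U \<beta> \<notin> P \<and>
    s (x, y0, P) = fr x P (val x U \<alpha>) (val x U \<beta>)" using a(1) unfolding fib_adm_def by blast
  show ?thesis by (rule fib_admI[OF U]) (use s a(2,3) in auto)
 qed
 have "fib_adm pts (\<lambda>z. \<zero>\<^bsub>loc_ring z\<^esub>)"
  by (rule fib_admI[OF o SX.zero_closed SX.one_closed])
   (use const multiplicative_set.zero_Loc[OF fib_mult_set] in auto)
 then show "\<exists>V. openin fibre_top V \<and> z \<in> V \<and> fib_adm V (\<lambda>z. \<zero>\<^bsub>loc_ring z\<^esub>)" if "z \<in> topspace fibre_top" for z
  using all that topspace_fibre by blast
 have "fib_adm pts (\<lambda>z. \<one>\<^bsub>loc_ring z\<^esub>)"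
  by (rule fib_admI[OF o SX.one_closed SX.one_closed])
   (use const multiplicative_set.one_Loc[OF fib_mult_set] in auto)
 then show "\<exists>V. openin fibre_top V \<and> z \<in> V \<and> fib_adm V (\<lambda>z. \<one>\<^bsub>loc_ring z\<^esub>)" if "z \<in> topspace fibre_top" for z
  using all that topspace_fibre by blast
 fix z V s assume V: "openin fibre_top V" "z \<in> V" "fib_adm V s"
 show "\<exists>W. openin fibre_top W \<and> z \<in> W \<and> W \<subseteq> V \<and> fib_adm W (\<lambda>z. \<ominus>\<^bsub>loc_ring z\<^esub> s z)"
  using fib_adm_ops(3)[OF V(3,3) top[OF V(1)]] V by blast
 fix t assume t: "fib_adm V t"
 show "\<exists>W. openin fibre_top W \<and> z \<in> W \<and> W \<subseteq> V \<and> fib_adm W (\<lambda>z. s z \<oplus>\<^bsub>loc_ring z\<^esub> t z)"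
  using fib_adm_ops(1)[OF V(3) t top[OF V(1)]] V by blast
 show "\<exists>W. openin fibre_top W \<and> z \<in> W \<and> W \<subseteq> V \<and> fib_adm W (\<lambda>z. s z \<otimes>\<^bsub>loc_ring z\<^esub> t z)"
  using fib_adm_ops(2)[OF V(3) t top[OF V(1)]] V by blast
qed

sublocale G: function_presheaf fibre_top loc_ring fib_adm by (rule fib_function_presheaf)

lemma gf_presheaf: "ring_presheaf gf"
 unfolding gf_eq by (rule G.Y.ring_presheaf_axioms)

sublocale gf: ring_presheaf gf by (rule gf_presheaf)

lemma top_gf: "space_top gf = fibre_top"
 unfolding gf_eq by (rule G.top_Y)

lemma restr_gf: "restr gf U V s = restrict s V"
 unfolding gf_eq by (rule G.restr_Y)

lemmas sec_gf = G.carrier_sec[folded gf_eq] and sec_ops_gf = G.sec_ops[folded gf_eq]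
 and sec_value_gf = G.sec_value[folded gf_eq] and sec_ext_gf = G.sec_ext[folded gf_eq]
 and sec_restrictI_gf = G.sec_restrictI[folded gf_eq]

abbreviation T where "T \<equiv> stalk gf z0"
abbreviation Q where "Q \<equiv> fraction_field (FP \<xi>)"

lemma loc_ring_z0: "loc_ring z0 = Q"
 by (simp add: z0_def fraction_field_def)

sublocale plainFP: plain_domain "FP \<xi>" ..
sublocale Q: field Q by (rule plainFP.fraction_field_field)

definition ev where "ev w = (THE v. \<exists>W s. (W, s) \<in> w \<and> v = s z0)"

lemma ev_germ:
 assumes W: "openin fibre_top W" "z0 \<in> W" "s \<in> \<Gamma> gf W"
 shows "ev (germ gf z0 W s) = s z0" unfolding ev_def
proof (rule the_equality)
 have W': "is_open gf W" using W(1) top_gf by simp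
 show "\<exists>W' s'. (W', s') \<in> germ gf z0 W s \<and> s z0 = s' z0" using gf.germ_memI[OF W' W(2,3)] by blast
 fix v assume "\<exists>W' s'. (W', s') \<in> germ gf z0 W s \<and> v = s' z0"
 then obtain W1 s1 where m: "(W1, s1) \<in> germ gf z0 W s" "v = s1 z0" by blast
 note m1 = gf.germ_memD[OF m(1) W' W(3)]
 obtain N where N: "is_open gf N" "z0 \<in> N" "N \<subseteq> W1" "N \<subseteq> W" "restr gf W1 N s1 = restr gf W N s"
  by (rule gf.germ_eqD[OF m1(4) W' W(2,3)]) blast
 have "restrict s1 N z0 = restrict s N z0" using N(5) unfolding restr_gf by simp
 then show "v = s z0" using N(2) m(2) by simp
qed

lemma T_cring: "cring T"
 by (rule gf.stalk_cring) (use z0_pts top_gf topspace_fibre in simp)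

lemma ev_hom: "ev \<in> ring_hom T Q"
proof (rule ring_hom_memI)
 fix a b assume a: "a \<in> carrier T" and b: "b \<in> carrier T"
 obtain W s t where W: "is_open gf W" "z0 \<in> W" "s \<in> \<Gamma> gf W" "t \<in> \<Gamma> gf W"
  "a = germ gf z0 W s" "b = germ gf z0 W t" using gf.stalk_cases2[OF a b] .
 have W': "openin fibre_top W" using W(1) top_gf by simp
 interpret SW: cring "sections gf W" by (rule gf.sections_cring[OF W(1)])
 note e = ev_germ[OF W' W(2)]
 show "ev a \<in> carrier Q"
  unfolding W(5) e[OF W(3)] using sec_value_gf[OF W(3,2)] loc_ring_z0 by simp
 show "ev (a \<otimes>\<^bsub>T\<^esub> b) = ev a \<otimes>\<^bsub>Q\<^esub> ev b"
  unfolding W(5,6) gf.mult_germ[OF W(1-4)] e[OF W(3)] e[OF W(4)] e[OF SW.m_closed[OF W(3,4)]]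
  using W(2) loc_ring_z0 by (simp add: sec_ops_gf)
 show "ev (a \<oplus>\<^bsub>T\<^esub> b) = ev a \<oplus>\<^bsub>Q\<^esub> ev b"
  unfolding W(5,6) gf.add_germ[OF W(1-4)] e[OF W(3)] e[OF W(4)] e[OF SW.a_closed[OF W(3,4)]]
  using W(2) loc_ring_z0 by (simp add: sec_ops_gf)
next
 have o: "is_open gf pts" "openin fibre_top pts"
  using openin_topspace[of fibre_top] unfolding topspace_fibre top_gf by auto
 interpret SW: cring "sections gf pts" by (rule gf.sections_cring[OF o(1)])
 show "ev \<one>\<^bsub>T\<^esub> = \<one>\<^bsub>Q\<^esub>"
  unfolding gf.one_stalk[OF o(1) z0_pts] ev_germ[OF o(2) z0_pts SW.one_closed]
  using z0_pts loc_ring_z0 by (simp add: sec_ops_gf)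
qed

text \<open>
 A section near \<open>z0\<close> is a fraction with a numerator \<open>\<alpha>\<close> that is a section of \<open>X\<close>. If the value at \<open>z0\<close>
 vanishes, then so does the germ of \<open>\<alpha>\<close> at \<open>\<xi>\<close>, and hence \<open>\<alpha>\<close>.
\<close>
lemma ev_zero:
 assumes w: "w \<in> carrier T" and z: "ev w = \<zero>\<^bsub>Q\<^esub>"
 shows "w = \<zero>\<^bsub>T\<^esub>"
proof -
 obtain W s where W: "is_open gf W" "z0 \<in> W" "s \<in> \<Gamma> gf W" "w = germ gf z0 W s"
  using gf.stalk_cases[OF w] .
 have W': "openin fibre_top W" using W(1) top_gf by simp
 have sz: "s z0 = \<zero>\<^bsub>Q\<^esub>" using z ev_germ[OF W' W(2,3)] W(4) by simp
 obtain V where V: "openin fibre_top V" "z0 \<in> V" "V \<subseteq> W" "fib_adm V s" using W(2,3) unfolding sec_gf by blast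
 obtain U \<alpha> \<beta> where U: "is_open X U" "\<alpha> \<in> \<Gamma> X U" "\<beta> \<in> \<Gamma> X U"
  and s: "\<And>x P. (x, y0, P) \<in> V \<Longrightarrow> x \<in> U \<and> val x U \<beta> \<notin> P \<and>
    s (x, y0, P) = fr x P (val x U \<alpha>) (val x U \<beta>)" using V(4) unfolding fib_adm_def by blast
 note s0 = s[OF V(2)[unfolded z0_def], folded z0_def]
 have \<xi>U: "\<xi> \<in> U" using s0 by blast
 interpret M: multiplicative_set "FP \<xi>" "carrier (FP \<xi>) - {\<zero>\<^bsub>FP \<xi>\<^esub>}" by (rule plainFP.nonzero_multiplicative_set)
 note Lc = ring_hom_memE(1)[OF \<Lambda>_hom[OF \<xi>_fib]]
 have ab: "val \<xi> U \<alpha> \<in> carrier (FP \<xi>)" "val \<xi> U \<beta> \<in> carrier (FP \<xi>) - {\<zero>\<^bsub>FP \<xi>\<^esub>}"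
  using Lc X.germ_closed[OF U(1) \<xi>U] U s0 by auto
 have "fr \<xi> {\<zero>\<^bsub>FP \<xi>\<^esub>} (val \<xi> U \<alpha>) (val \<xi> U \<beta>) = \<zero>\<^bsub>M.Loc\<^esub>"
  using s0 sz by (simp add: fraction_field_def)
 then obtain u where "u \<in> carrier (FP \<xi>) - {\<zero>\<^bsub>FP \<xi>\<^esub>}" "u \<otimes>\<^bsub>FP \<xi>\<^esub> val \<xi> U \<alpha> = \<zero>\<^bsub>FP \<xi>\<^esub>"
  using M.frac_eq_zero_iff[OF ab] by blast
 then have "val \<xi> U \<alpha> = \<zero>\<^bsub>FP \<xi>\<^esub>" using FP.integral ab(1) by blast
 then have "germ X \<xi> U \<alpha> = \<zero>\<^bsub>F\<^esub>" by (rule \<Lambda>_\<xi>_zero[OF X.germ_closed[OF U(1) \<xi>U U(2)]])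
 then have \<alpha>0: "\<alpha> = \<zero>\<^bsub>sections X U\<^esub>" using X.germ_generic_zero[OF U(1) _ U(2)] \<xi>U by blast
 have V': "is_open gf V" using V(1) top_gf by simp
 interpret SV: cring "sections gf V" by (rule gf.sections_cring[OF V'])
 have Vp: "V \<subseteq> pts" using openin_subset[OF V(1)] topspace_fibre by simp
 have "restr gf W V s = \<zero>\<^bsub>sections gf V\<^esub>"
 proof (rule sec_ext_gf[OF gf.restr_closed[OF W(1) V' V(3) W(3)] SV.zero_closed])
  fix z assume zV: "z \<in> V"
  then obtain x P where x: "z = (x, y0, P)" "x \<in> fib" "primeideal P (FP x)" using Vp pts_cases by blast
  have xp: "(x, y0, P) \<in> V" "(x, y0, P) \<in> pts" using zV Vp x(1) by auto
  note sx = s[OF xp(1)]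
  interpret N: multiplicative_set "FP x" "carrier (FP x) - P" by (rule fib_mult_set[OF xp(2)])
  have a0: "val x U \<alpha> = \<zero>\<^bsub>FP x\<^esub>"
   unfolding \<alpha>0 using \<Lambda>_germ_prime_one(4)[OF xp(2)] X.zero_stalk[OF U(1)] sx by simp
  have b: "val x U \<beta> \<in> carrier (FP x) - P"
   using ring_hom_memE(1)[OF \<Lambda>_hom[OF x(2)] X.germ_closed[OF U(1) _ U(3)]] sx by blast
  have "fr x P \<zero>\<^bsub>FP x\<^esub> (val x U \<beta>) = \<zero>\<^bsub>N.Loc\<^esub>"
   using N.frac_eq_zero_iff[OF N.zero_closed b] N.r_null b by blast
  then show "restr gf W V s z = \<zero>\<^bsub>sections gf V\<^esub> z"
   using zV sx a0 unfolding restr_gf sec_ops_gf x(1) by simp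
 qed
 then have "w = germ gf z0 V \<zero>\<^bsub>sections gf V\<^esub>" using gf.germ_restr[OF W(1,3) V' V(2,3)] W(4) by simp
 then show ?thesis using gf.zero_stalk[OF V' V(2)] by simp
qed

text \<open>
 Numerator and denominator of an element of \<open>Q\<close> are germs of sections of \<open>X\<close>, whose quotient is a
 section of the generic fibre near \<open>z0\<close>.
\<close>
lemma ev_iso: "ev \<in> ring_iso T Q"
proof -
 interpret T: cring T by (rule T_cring)
 interpret ev: ring_hom_ring T Q ev by (rule ring_hom_ringI2[OF T.ring_axioms Q.ring_axioms ev_hom])
 have "a_kernel T Q ev = {\<zero>\<^bsub>T\<^esub>}" unfolding a_kernel_def' using ev_zero ev.hom_zero by auto
 then have inj: "inj_on ev (carrier T)" by (rule ev.trivial_ker_imp_inj)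
 interpret M: multiplicative_set "FP \<xi>" "carrier (FP \<xi>) - {\<zero>\<^bsub>FP \<xi>\<^esub>}" by (rule plainFP.nonzero_multiplicative_set)
 have "v \<in> ev ` carrier T" if v: "v \<in> carrier Q" for v
 proof -
  obtain a b where ab: "a \<in> carrier (FP \<xi>)" "b \<in> carrier (FP \<xi>) - {\<zero>\<^bsub>FP \<xi>\<^esub>}" "v = M.frac a b"
   using v unfolding fraction_field_def by (rule M.Loc_cases)
  obtain a' b' where ab': "a' \<in> carrier F" "b' \<in> carrier F" "a = \<Lambda> \<xi> a'" "b = \<Lambda> \<xi> b'"
   using \<Lambda>_surj[OF \<xi>_fib] ab(1,2) by (metis DiffD1)
  obtain U \<alpha> \<beta> where U: "is_open X U" "\<xi> \<in> U" "\<alpha> \<in> \<Gamma> X U" "\<beta> \<in> \<Gamma> X U"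
   "a' = germ X \<xi> U \<alpha>" "b' = germ X \<xi> U \<beta>" using X.stalk_cases2[OF ab'(1,2)] .
  define W where "W = locus U \<beta>"
  have W: "openin fibre_top W" using locus_open[OF U(1,4)] unfolding W_def .
  have zW: "z0 \<in> W" unfolding W_def locus_def using z0_pts U(2) ab(2) ab'(4) U(6) by (simp add: z0_def)
  have mem: "z \<in> pts" "fst z \<in> U" "val (fst z) U \<beta> \<notin> snd (snd z)" if "z \<in> W" for z
   using that unfolding W_def locus_def by auto
  let ?s = "\<lambda>(x, y, P). fr x P (val x U \<alpha>) (val x U \<beta>)"
  have s: "restrict ?s W \<in> \<Gamma> gf W"
  proof (rule sec_restrictI_gf[OF W])
   have adm: "fib_adm W ?s"
   proof (rule fib_admI[OF U(1,3,4)])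
    fix x P assume "(x, y0, P) \<in> W"
    from mem(2,3)[OF this] show "x \<in> U \<and> val x U \<beta> \<notin> P \<and>
      ?s (x, y0, P) = fr x P (val x U \<alpha>) (val x U \<beta>)" by simp
   qed
   show "\<exists>V. openin fibre_top V \<and> z \<in> V \<and> fib_adm V ?s" if "z \<in> W" for z using adm W that by blast
   show "?s z \<in> carrier (loc_ring z)" if zW: "z \<in> W" for z
   proof -
    obtain x P where x: "z = (x, y0, P)" "x \<in> fib" using mem(1)[OF zW] pts_cases by blast
    interpret N: multiplicative_set "FP x" "carrier (FP x) - P" by (rule fib_mult_set) (use mem(1)[OF zW] x in simp)
    have xU: "x \<in> U" using mem(2)[OF zW] x by simp
    have "val x U \<alpha> \<in> carrier (FP x)" "val x U \<beta> \<in> carrier (FP x) - P"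
     using ring_hom_memE(1)[OF section_to_FP_hom[OF x(2) U(1) xU]] U(3,4) mem(3)[OF zW] x by auto
    then show ?thesis unfolding x(1) case_prod_conv by (rule N.frac_closed)
   qed
  qed
  have "ev (germ gf z0 W (restrict ?s W)) = v"
   unfolding ev_germ[OF W zW s] using zW ab(3) ab'(3,4) U(5,6) by (simp add: z0_def)
  moreover have "germ gf z0 W (restrict ?s W) \<in> carrier T"
   using gf.germ_closed[OF _ zW s] W top_gf by simp
  ultimately show ?thesis by blast
 qed
 then show ?thesis unfolding ring_iso_def bij_betw_def using ev_hom inj ev.hom_closed by auto
qed

lemma T_field: "field T"
proof -
 interpret T: cring T by (rule T_cring)
 show ?thesis by (rule Q.field_iso[OF ring_iso_set_sym[OF T.ring_axioms ev_iso] T.ring_axioms])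
qed

abbreviation \<theta> where "\<theta> \<equiv> field_to_stalk K gf (generic_fibre_mor X B f \<eta>) z0"

lemma ev_\<theta>:
 assumes c: "c \<in> carrier K"
 shows "\<theta> c \<in> carrier T" "ev (\<theta> c) = to_fraction_field (FP \<xi>) (\<Lambda> \<xi> (\<phi> \<xi> c))"
proof -
 let ?s = "\<lambda>(x, y, P). fr x P (\<Lambda> x (\<phi> x c)) \<one>\<^bsub>FP x\<^esub>"
 have o: "is_open gf pts" "openin fibre_top pts"
  using openin_topspace[of fibre_top] unfolding topspace_fibre top_gf by auto
 have snd_pts: "{(x, y, P) \<in> pts. y \<in> points Y} = pts" using pts_memD y0_Y by blast
 have pre: "preimage gf (generic_fibre_mor X B f \<eta>) (points Y) = pts"
  unfolding preimage_def top_gf topspace_fibre fp_snd_def using pts_memD y0_Y by auto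
 have sec: "sec_map (generic_fibre_mor X B f \<eta>) (points Y) (const_section K c) = restrict ?s pts"
 proof
  fix z
  show "sec_map (generic_fibre_mor X B f \<eta>) (points Y) (const_section K c) z = restrict ?s pts z"
  proof (cases "z \<in> pts")
   case True
   then obtain x P where x: "z = (x, y0, P)" "x \<in> fib" using pts_cases by blast
   interpret A: cring "stalk X x" using X.stalk_cring x(2) unfolding fib_def by blast
   have "FC x (frag_of (\<one>\<^bsub>stalk X x\<^esub>, germ Y y0 (points Y) (const_section K c))) = \<Lambda> x (\<phi> x c)"
    unfolding \<psi>_eq[OF c, symmetric] tens_\<psi>[OF x(2) A.one_closed c] using \<phi>_closed[OF x(2) c] by simp
   then show ?thesis unfolding fp_snd_def using True snd_pts x(1) by simp
  next
   case False
   then show ?thesis unfolding fp_snd_def using snd_pts by (auto simp: restrict_def)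
  qed
 qed
 obtain V s where V: "is_open B V" "\<eta> \<in> V" "s \<in> \<Gamma> B V" "c = germ B \<eta> V s"
  using B.stalk_cases[OF c] .
 define U where "U = preimage X f V"
 have U: "is_open X U" using open_preimage[OF V(1)] unfolding U_def .
 have \<sigma>: "sec_map f V s \<in> \<Gamma> X U" using sec_closed[OF V(1,3)] unfolding U_def .
 interpret SU: cring "sections X U" by (rule X.sections_cring[OF U])
 have x: "x \<in> U \<and> \<phi> x c = germ X x U (sec_map f V s)" if "x \<in> fib" for x
  using that stalk_map_germ[OF _ V(1) _ V(3), of x] V(2,4) unfolding fib_def U_def preimage_def by auto
 have s: "restrict ?s pts \<in> \<Gamma> gf pts"
 proof (rule sec_restrictI_gf[OF o(2)])
  have adm: "fib_adm pts ?s"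
  proof (rule fib_admI[OF U \<sigma> SU.one_closed])
   fix x P assume p: "(x, y0, P) \<in> pts"
   have xU: "x \<in> U" "\<phi> x c = germ X x U (sec_map f V s)" using x pts_memD[OF p] by auto
   have one: "\<Lambda> x (germ X x U \<one>\<^bsub>sections X U\<^esub>) = \<one>\<^bsub>FP x\<^esub>"
    using \<Lambda>_germ_prime_one(1)[OF p] X.one_stalk[OF U xU(1)] by simp
   show "x \<in> U \<and> \<Lambda> x (germ X x U \<one>\<^bsub>sections X U\<^esub>) \<notin> P \<and>
     ?s (x, y0, P) = fr x P (val x U (sec_map f V s)) (\<Lambda> x (germ X x U \<one>\<^bsub>sections X U\<^esub>))"
    unfolding one xU(2) case_prod_conv using xU(1) \<Lambda>_germ_prime_one(2)[OF p] by simp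
  qed
  show "\<exists>V. openin fibre_top V \<and> z \<in> V \<and> fib_adm V ?s" if "z \<in> pts" for z using adm o(2) that by blast
  show "?s z \<in> carrier (loc_ring z)" if zW: "z \<in> pts" for z
  proof -
   obtain x P where x: "z = (x, y0, P)" "x \<in> fib" using zW pts_cases by blast
   interpret M: multiplicative_set "FP x" "carrier (FP x) - P" by (rule fib_mult_set) (use zW x in simp)
   have "\<Lambda> x (\<phi> x c) \<in> carrier (FP x)" by (rule ring_hom_memE(1)[OF \<Lambda>_hom[OF x(2)] \<phi>_closed[OF x(2) c]])
   then show ?thesis unfolding x(1) case_prod_conv by (rule M.frac_closed[OF _ M.one_S])
  qed
 qed
 have \<theta>: "\<theta> c = germ gf z0 pts (restrict ?s pts)" unfolding field_to_stalk_def pre sec ..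
 show "\<theta> c \<in> carrier T" unfolding \<theta> by (rule gf.germ_closed[OF o(1) z0_pts s])
 show "ev (\<theta> c) = to_fraction_field (FP \<xi>) (\<Lambda> \<xi> (\<phi> \<xi> c))"
  unfolding \<theta> ev_germ[OF o(2) z0_pts s] using z0_pts by (simp add: z0_def to_fraction_field_def)
qed

lemma to_Q_hom: "(\<lambda>a. to_fraction_field (FP \<xi>) (\<Lambda> \<xi> a)) \<in> ring_hom F Q"
 using ring_hom_trans[OF \<Lambda>_hom[OF \<xi>_fib] plainFP.to_fraction_field_hom] unfolding comp_def .

lemma \<theta>_hom: "\<theta> \<in> ring_hom K T"
proof -
 interpret T: field T by (rule T_field)
 have hom: "(\<lambda>c. to_fraction_field (FP \<xi>) (\<Lambda> \<xi> (\<phi> \<xi> c))) \<in> ring_hom K Q"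
  using ring_hom_trans[OF \<phi>_hom[OF X.\<xi>_point f_\<xi>] to_Q_hom] unfolding comp_def .
 have inj: "inj_on ev (carrier T)" using ev_iso unfolding ring_iso_def bij_betw_def by blast
 note h = ring_hom_memE[OF hom] and e = ring_hom_memE[OF ev_hom] and t = ev_\<theta>
 show ?thesis
 proof (rule ring_hom_memI)
  fix a b assume a: "a \<in> carrier K" and b: "b \<in> carrier K"
  show "\<theta> a \<in> carrier T" by (rule t(1)[OF a])
  show "\<theta> (a \<otimes>\<^bsub>K\<^esub> b) = \<theta> a \<otimes>\<^bsub>T\<^esub> \<theta> b"
  proof (rule inj_onD[OF inj _ t(1) T.m_closed[OF t(1)[OF a] t(1)[OF b]]])
   show "ev (\<theta> (a \<otimes>\<^bsub>K\<^esub> b)) = ev (\<theta> a \<otimes>\<^bsub>T\<^esub> \<theta> b)"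
    unfolding e(2)[OF t(1)[OF a] t(1)[OF b]] t(2)[OF a] t(2)[OF b] t(2)[OF K.m_closed[OF a b]]
    by (rule h(2)[OF a b])
  qed (use a b in simp)
  show "\<theta> (a \<oplus>\<^bsub>K\<^esub> b) = \<theta> a \<oplus>\<^bsub>T\<^esub> \<theta> b"
  proof (rule inj_onD[OF inj _ t(1) T.a_closed[OF t(1)[OF a] t(1)[OF b]]])
   show "ev (\<theta> (a \<oplus>\<^bsub>K\<^esub> b)) = ev (\<theta> a \<oplus>\<^bsub>T\<^esub> \<theta> b)"
    unfolding e(3)[OF t(1)[OF a] t(1)[OF b]] t(2)[OF a] t(2)[OF b] t(2)[OF K.a_closed[OF a b]]
    by (rule h(3)[OF a b])
  qed (use a b in simp)
 next
  show "\<theta> \<one>\<^bsub>K\<^esub> = \<one>\<^bsub>T\<^esub>"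
   by (rule inj_onD[OF inj _ t(1)[OF K.one_closed] T.one_closed])
    (simp only: t(2)[OF K.one_closed] h(4) e(4))
 qed
qed

text \<open>
 By \<open>ev_iso\<close> and \<open>\<Lambda>_\<xi>_iso\<close>, the field \<open>T\<close> is the function field of \<open>X\<close>.
\<close>
lemma power_of_T:
 assumes w: "w \<in> carrier T" and c: "c \<in> carrier K" and eq: "w [^]\<^bsub>T\<^esub> (n::nat) = \<theta> c"
 shows "\<exists>\<alpha>\<in>carrier F. \<alpha> [^]\<^bsub>F\<^esub> n = \<phi> \<xi> c"
proof -
 interpret T: field T by (rule T_field)
 interpret ev: ring_hom_ring T Q ev by (rule ring_hom_ringI2[OF T.ring_axioms Q.ring_axioms ev_hom])
 interpret q: ring_hom_ring "F" Q "\<lambda>a. to_fraction_field (FP \<xi>) (\<Lambda> \<xi> a)"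
  by (rule ring_hom_ringI2[OF L.ring_axioms Q.ring_axioms to_Q_hom])
 interpret M: multiplicative_set "FP \<xi>" "carrier (FP \<xi>) - {\<zero>\<^bsub>FP \<xi>\<^esub>}" by (rule plainFP.nonzero_multiplicative_set)
 have "ev w \<in> carrier M.Loc" using ev.hom_closed[OF w] unfolding fraction_field_def .
 then obtain a b where ab: "a \<in> carrier (FP \<xi>)" "b \<in> carrier (FP \<xi>) - {\<zero>\<^bsub>FP \<xi>\<^esub>}" "ev w = M.frac a b"
  by (rule M.Loc_cases)
 have bu: "b \<in> Units (FP \<xi>)" using ab(2) FP.field_Units by simp
 have d: "a \<otimes>\<^bsub>FP \<xi>\<^esub> inv\<^bsub>FP \<xi>\<^esub> b \<in> carrier (FP \<xi>)" using ab(1) bu by simp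
 have "M.frac a b = M.frac (a \<otimes>\<^bsub>FP \<xi>\<^esub> inv\<^bsub>FP \<xi>\<^esub> b) \<one>\<^bsub>FP \<xi>\<^esub>"
 proof (rule M.frac_eqI[OF ab(1,2) d M.one_S])
  have "b \<otimes>\<^bsub>FP \<xi>\<^esub> (a \<otimes>\<^bsub>FP \<xi>\<^esub> inv\<^bsub>FP \<xi>\<^esub> b) = a \<otimes>\<^bsub>FP \<xi>\<^esub> (b \<otimes>\<^bsub>FP \<xi>\<^esub> inv\<^bsub>FP \<xi>\<^esub> b)"
   using ab(1) bu by (simp only: FP.m_lcomm FP.Units_closed FP.Units_inv_closed)
  then show "\<one>\<^bsub>FP \<xi>\<^esub> \<otimes>\<^bsub>FP \<xi>\<^esub> a = b \<otimes>\<^bsub>FP \<xi>\<^esub> (a \<otimes>\<^bsub>FP \<xi>\<^esub> inv\<^bsub>FP \<xi>\<^esub> b)"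
   using ab(1) bu by simp
 qed
 moreover obtain \<alpha> where \<alpha>: "\<alpha> \<in> carrier F" "a \<otimes>\<^bsub>FP \<xi>\<^esub> inv\<^bsub>FP \<xi>\<^esub> b = \<Lambda> \<xi> \<alpha>"
  using \<Lambda>_surj[OF \<xi>_fib d] by blast
 ultimately have ew: "ev w = to_fraction_field (FP \<xi>) (\<Lambda> \<xi> \<alpha>)" using ab(3) by (simp add: to_fraction_field_def)
 have \<phi>c: "\<phi> \<xi> c \<in> carrier F" by (rule \<phi>_closed[OF \<xi>_fib c])
 have "to_fraction_field (FP \<xi>) (\<Lambda> \<xi> (\<alpha> [^]\<^bsub>F\<^esub> n)) = ev w [^]\<^bsub>Q\<^esub> n"
  unfolding ew by (rule q.hom_nat_pow[OF \<alpha>(1)])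
 also have "\<dots> = ev (\<theta> c)" unfolding eq[symmetric] by (rule ev.hom_nat_pow[OF w, symmetric])
 also have "\<dots> = to_fraction_field (FP \<xi>) (\<Lambda> \<xi> (\<phi> \<xi> c))" by (rule ev_\<theta>(2)[OF c])
 finally have "\<Lambda> \<xi> (\<alpha> [^]\<^bsub>F\<^esub> n) = \<Lambda> \<xi> (\<phi> \<xi> c)"
  using inj_onD[OF plainFP.to_fraction_field_inj] ring_hom_memE(1)[OF \<Lambda>_hom[OF \<xi>_fib]] L.nat_pow_closed[OF \<alpha>(1)] \<phi>c
  by blast
 moreover have "inj_on (\<Lambda> \<xi>) (carrier F)" using \<Lambda>_\<xi>_iso unfolding ring_iso_def bij_betw_def by blast
 ultimately have "\<alpha> [^]\<^bsub>F\<^esub> n = \<phi> \<xi> c" using L.nat_pow_closed[OF \<alpha>(1)] \<phi>c by (blast dest: inj_onD)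
 then show ?thesis using \<alpha>(1) by blast
qed

end

section \<open>The geometric generic embedding dimension\<close>

theorem corollary2p4:
  fixes k :: "'k ring" and p :: nat
    and X :: "('a, 'b) ringed_space" and B :: "('c, 'd) ringed_space"
    and \<pi>X :: "('a, 'b, 'k set, 'k spec_section) lrs_map"
    and \<pi>B :: "('c, 'd, 'k set, 'k spec_section) lrs_map"
    and f :: "('a, 'b, 'c, 'd) lrs_map"
    and \<eta> :: 'c
  assumes "field k" and "Factorial_Ring.prime p" and "[p] \<cdot>\<^bsub>k\<^esub> \<one>\<^bsub>k\<^esub> = \<zero>\<^bsub>k\<^esub>"
    and perfect: "(\<lambda>a. a [^]\<^bsub>k\<^esub> p) ` carrier k = carrier k"
    and "integral_scheme X" and "normal_scheme X" and "finite_type X (Spec k) \<pi>X"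
    and "integral_scheme B" and "normal_scheme B" and "finite_type B (Spec k) \<pi>B"
    and "proper_morphism X B f" and "mor_eq X (Spec k) (comp_mor B \<pi>B f) \<pi>X"
    and pushforward: "\<And>V. is_open B V \<Longrightarrow>
      bij_betw (sec_map f V) (carrier (sections B V)) (carrier (sections X (preimage X f V)))"
    and "is_generic_point (space_top B) \<eta>"
    and "krull_dim (space_top B) > 0"
  shows "geometric_generic_edim p (stalk B \<eta>) (generic_fibre X B f \<eta>) (generic_fibre_mor X B f \<eta>)
    < krull_dim (space_top B)"
proof -
 obtain \<xi> where \<xi>: "generic_point X \<xi>" by (rule integral_scheme_generic_point[OF assms(5)])
 have \<eta>: "generic_point B \<eta>"
  by (rule generic_pointI[OF assms(8)]) (use assms(14) is_generic_point_iff[of "space_top B" \<eta>] in auto)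
 have f: "is_morphism X B f" using assms(11) unfolding proper_morphism_def finite_type_def by blast
 interpret dominant_map X \<xi> B \<eta> f by (rule dominant_mapI[OF \<xi> \<eta> f pushforward])
 obtain ts where K: "char_p_field K p" and ts: "set ts \<subseteq> carrier K"
  "ring.strict_tower K ((\<lambda>x. x [^]\<^bsub>K\<^esub> p) ` carrier K) ts"
  "ring.finite_extension K ((\<lambda>x. x [^]\<^bsub>K\<^esub> p) ` carrier K) ts = carrier K"
  and dim: "enat (length ts) \<le> krull_dim (space_top B)"
  by (rule p_basis_length_le_krull_dim[OF assms(1-4) \<eta> assms(10)])
 have p: "p > 0" using prime_gt_0_nat[OF assms(2)] .
 have normal: "normal_domain (stalk X x)" if "x \<in> points X" for x
  using assms(6) that unfolding normal_scheme_def by blast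
 have closed: "c \<in> (\<lambda>x. x [^]\<^bsub>K\<^esub> p) ` carrier K"
  if c: "c \<in> carrier K" and w: "w \<in> carrier T" "w [^]\<^bsub>T\<^esub> p = \<theta> c" for c w
 proof -
  obtain \<alpha> where "\<alpha> \<in> carrier (stalk X \<xi>)" "\<alpha> [^]\<^bsub>stalk X \<xi>\<^esub> p = \<phi> \<xi> c"
   using power_of_T[OF w(1) c w(2)] by blast
  then obtain d where "d \<in> carrier K" "c = d [^]\<^bsub>K\<^esub> p"
   using root_descends[OF normal pushforward c _ p] by blast
  then show ?thesis by blast
 qed
 have pc: "p_closed_extension K p T \<theta>"
 proof (rule p_closed_extension.intro)
  show "p_root_extension K p" by (rule p_root_extension.intro[OF K])
  show "field T" by (rule T_field)
  show "p_closed_extension_axioms K p T \<theta>"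
   by (rule p_closed_extension_axioms.intro[OF \<theta>_hom]) (rule closed)
 qed
 note bound = p_closed_extension.edim_tensor_p_root_field[OF pc ts]
 show ?thesis unfolding geometric_generic_edim_def generic_pt_fibre
 proof (cases "ts = []")
  case True
  \<comment> \<open>The field \<open>K\<close> is perfect here, and the bound is \<open>dim B > 0\<close>.\<close>
  have "enat 1 \<le> krull_dim (space_top B)"
   unfolding one_enat_def[symmetric] one_eSuc by (rule ileI1[OF assms(15)])
  then show "edim (tensor_ring K T \<theta> (p_root_field p K) (ring.indexed_const K)) < krull_dim (space_top B)"
   using bound[of 1] True by (auto intro: less_le_trans)
 next
  case False
  then show "edim (tensor_ring K T \<theta> (p_root_field p K) (ring.indexed_const K)) < krull_dim (space_top B)"
   using bound[of "length ts"] dim by (auto intro: less_le_trans)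
 qed
qed

end
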